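(* The morphism of Lawvere $\mathbf{sSet}$-theories $\mathbf{st}:\mathcal{NR}_{\Omega_{pic}}\to D(\mathbf A)$, where $\mathbf A$ is the Lawvere theory of abelian groups, is not a weak equivalence in the category $\mathbf{sSTh}$ of Lawvere $\mathbf{sSet}$-theories; i.e. it is not the case that $\mathcal{NR}_{\Omega_{pic}}(n,m)\to D(\mathbf A)(n,m)$ is a weak equivalence of simplicial sets for all $n,m\ge 0$.
   Context: A pro is a strict monoidal category whose monoid of objects is $(\mathbf N,+,0)$; maps of pros are strict monoidal functors sending $1$ to $1$. $\mathcal F$ is the opposite of the skeleton of finite sets. A Lawvere theory is a category $L$ with a bijective-on-objects finite-product-preserving functor $\mathcal F\to L$; each is a pro via its products. $\mathbf{Fr}(\mathcal G)$ is the free Lawvere theory and $\mathbf N[\mathcal G]$ the free pro on a reduced signature $\mathcal G:\mathbf N\to\mathbf{Set}$ (elements of $\mathcal G(n)$ give generators $n\to1$). A controlled theory $\Omega=\langle \mathcal G: P\xrightarrow{i}\mathbf{Fr}(\mathcal G)\xrightarrow{\mathbf{st}}L\rangle$ consists of a reduced signature $\mathcal G$, a pro $P$, a Lawvere theory $L$, a full map of Lawvere theories $\mathbf{st}$ and a faithful map of pros $i$. A morphism of controlled theories is a triple of a map of signatures $I$, a map of pros $P\to P'$ and a map of Lawvere theories $L\to L'$ making the evident two squares (with $\mathbf{Fr}(I)$ in the middle) commute. For $f\in P(n,k)$ put $[f]=\{g\in P(n,k):\mathbf{st}(i(g))=\mathbf{st}(i(f))\}$; the reduced pro $\overline\Omega$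 has $\overline\Omega(n,k)=\{[f]:f\in P(n,k)\}$. For a sub-pro $Q\subset\mathcal F$, $Q(\mathcal G)$ denotes the sub-pro of $\mathbf{Fr}(\mathcal G)$ generated by the image of $Q$ and the generating operations $\mathcal G$. $\Sigma=\coprod_n B\Sigma_n\subset\mathcal F$ is the pro of permutations; $\nabla\subset\mathcal F$ is the sub-pro generated by the diagonals $\Delta_k:1\to k$, $k\ge0$. Let $\mathcal M$ be the signature with one nullary and one binary operation, and $\mathcal G$ the signature with one nullary, one unary and one binary operation. Let $\mathbf M,\mathbf{CM},\mathbf G$ be the Lawvere theories of monoids, commutative monoids and groups. Then $\Omega_{mon}=\langle\mathcal M:\mathbf N[\mathcal M]\to\mathbf{Fr}(\mathcal M)\to\mathbf M\rangle$, $\Omega_{cm}=\langle\mathcal M:\Sigma(\mathcal M)\to\mathbf{Fr}(\mathcal M)\to\mathbf{CM}\rangle$, $\Omega_{grp}=\langle\mathcal G:\nabla(\mathcal G)\to\mathbf{Fr}(\mathcal G)\to\mathbf G\rangle$, with inclusions and the evident quotient maps. $\Omega_{pic}$ is the span of controlled theories $\Omega_{grp}\leftarrow\Omega_{mon}\to\Omega_{cm}$ given by the evident inclusions of signatures and control pros and the evident maps of Lawvere theories. Lawvere $\mathbf{sSet}$-theory: an $\mathbf{sSet}$-enriched category with a bijective-on-objects (enriched) product-preserving functor from $\mathcal F$ (viewed with discrete homs); maps are product-preserving enriched functors under $\mathcal F$. An $\mathbf{sSet}$-pro is the $\mathbf{sSet}$-enriched analogue of a pro; the forgetful functor from Lawvere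 $\mathbf{sSet}$-theories to $\mathbf{sSet}$-pros has a left adjoint $Q\mapsto L^{\mathbf{sSet}}_Q$. $D$ denotes regarding an ordinary pro or Lawvere theory as enriched with discrete homs. $L_P$ is the free Lawvere theory on a pro $P$. Nerve realization: let $E(S)$ be the category with object set $S$ and exactly one morphism between any two objects, $N$ the nerve. Let $Q_\Omega$ be the $\mathbf{sSet}$-pro with $Q_\Omega(n,k)=\coprod_{[f]\in\overline\Omega(n,k)}N E([f])$, with structure induced from $P$. Inclusion of vertices gives $D(P)\to Q_\Omega$, hence $D(L_P)\to L^{\mathbf{sSet}}_{Q_\Omega}$. $\mathcal{NR}_\Omega$ is the pushout of $D(\mathbf{Fr}(\mathcal G))\leftarrow D(L_P)\to L^{\mathbf{sSet}}_{Q_\Omega}$ (left map induced by $i$) in Lawvere $\mathbf{sSet}$-theories; it is functorial in $\Omega$. There is a canonical map $\mathcal{NR}_\Omega\to D(L)$, given by $D(\mathbf{st})$ on $D(\mathbf{Fr}(\mathcal G))$ and collapsing $N E([f])$ to $\mathbf{st}(i(f))$. For the span, $\mathcal{NR}_{\Omega_{pic}}$ is the pushout of $\mathcal{NR}_{\Omega_{grp}}\leftarrow\mathcal{NR}_{\Omega_{mon}}\to\mathcal{NR}_{\Omega_{cm}}$ in Lawvere $\mathbf{sSet}$-theories, and $\mathbf{st}:\mathcal{NR}_{\Omega_{pic}}\to D(\mathbf A)$ is the map induced by the universal property from the composites $\mathcal{NR}_{\Omega_{grp}}\to D(\mathbf G)\to D(\mathbf A)$ and $\mathcal{NR}_{\Omega_{cm}}\to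 D(\mathbf{CM})\to D(\mathbf A)$. A weak equivalence in $\mathbf{sSTh}$ is a map inducing weak equivalences of simplicial sets (Kan–Quillen) on all hom-objects. *)

theory Defs
  imports "HOL-Homology.Simplices"
begin

section \<open>Simplicial sets, geometric realization and weak equivalences\<close>

text \<open>A monotone map \<open>\<alpha> : [m] \<rightarrow> [n]\<close> is encoded as the list \<open>[\<alpha> 0, \<dots>, \<alpha> m]\<close>; the composite
  \<open>\<alpha> \<circ> \<beta>\<close> is \<open>map ((!) \<alpha>) \<beta>\<close>.\<close>

definition simp_ops :: "nat \<Rightarrow> nat \<Rightarrow> nat list set" where
  "simp_ops m n = {\<alpha>. length \<alpha> = Suc m \<and> sorted \<alpha> \<and> set \<alpha> \<subseteq> {..n}}"

text \<open>\<open>Act X n \<alpha>\<close> is the operator \<open>\<alpha>\<^sup>* : X\<^sub>n \<rightarrow> X\<^sub>m\<close> of \<open>\<alpha> : [m] \<rightarrow> [n]\<close>.\<close>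

record 'a sset =
  Simp :: "nat \<Rightarrow> 'a set"
  Act :: "nat \<Rightarrow> nat list \<Rightarrow> 'a \<Rightarrow> 'a"

definition simplicial_set :: "'a sset \<Rightarrow> bool" where
  "simplicial_set X \<longleftrightarrow>
     (\<forall>m n. \<forall>\<alpha>\<in>simp_ops m n. \<forall>x\<in>Simp X n. Act X n \<alpha> x \<in> Simp X m) \<and>
     (\<forall>n. \<forall>x\<in>Simp X n. Act X n [0..<Suc n] x = x) \<and>
     (\<forall>l m n. \<forall>\<beta>\<in>simp_ops l m. \<forall>\<alpha>\<in>simp_ops m n. \<forall>x\<in>Simp X n.
        Act X m \<beta> (Act X n \<alpha> x) = Act X n (map ((!) \<alpha>) \<beta>) x)"

text \<open>The geometric realization is the quotient of \<open>\<Coprod>\<^sub>n X\<^sub>n \<times> \<Delta>\<^sup>n\<close> by the equivalence relation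
  generated by \<open>(x, \<alpha>\<^sub>* t) \<sim> (\<alpha>\<^sup>* x, t)\<close>, with the quotient topology.\<close>

definition simplex_push :: "nat list \<Rightarrow> (nat \<Rightarrow> real) \<Rightarrow> nat \<Rightarrow> real" where
  "simplex_push \<alpha> t = (\<lambda>j. \<Sum>i | i < length \<alpha> \<and> \<alpha> ! i = j. t i)"

definition real_pts :: "'a sset \<Rightarrow> (nat \<times> 'a \<times> (nat \<Rightarrow> real)) set" where
  "real_pts X = {(n, x, t) | n x t. x \<in> Simp X n \<and> t \<in> standard_simplex n}"

definition real_step ::
  "'a sset \<Rightarrow> ((nat \<times> 'a \<times> (nat \<Rightarrow> real)) \<times> (nat \<times> 'a \<times> (nat \<Rightarrow> real))) set" where
  "real_step X = {((n, x, simplex_push \<alpha> t), (m, Act X n \<alpha> x, t)) | m n \<alpha> x t.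
     \<alpha> \<in> simp_ops m n \<and> x \<in> Simp X n \<and> t \<in> standard_simplex m}"

definition real_eq ::
  "'a sset \<Rightarrow> ((nat \<times> 'a \<times> (nat \<Rightarrow> real)) \<times> (nat \<times> 'a \<times> (nat \<Rightarrow> real))) set" where
  "real_eq X = (real_step X \<union> (real_step X)\<inverse>)\<^sup>*"

definition real_open :: "'a sset \<Rightarrow> (nat \<times> 'a \<times> (nat \<Rightarrow> real)) set set \<Rightarrow> bool" where
  "real_open X U \<longleftrightarrow> U \<subseteq> real_pts X // real_eq X \<and>
     (\<forall>n. \<forall>x\<in>Simp X n. openin (subtopology (powertop_real UNIV) (standard_simplex n))
        {t \<in> standard_simplex n. real_eq X `` {(n, x, t)} \<in> U})"

definition realization :: "'a sset \<Rightarrow> (nat \<times> 'a \<times> (nat \<Rightarrow> real)) set topology" where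
  "realization X = topology (real_open X)"

lemma openin_realization: "openin (realization X) U \<longleftrightarrow> real_open X U"
proof -
  have "istopology (real_open X)"
    unfolding istopology_def
  proof (intro conjI allI impI)
    fix S T assume S: "real_open X S" and T: "real_open X T"
    have "{t \<in> standard_simplex n. real_eq X `` {(n, x, t)} \<in> S \<inter> T} =
        {t \<in> standard_simplex n. real_eq X `` {(n, x, t)} \<in> S} \<inter>
        {t \<in> standard_simplex n. real_eq X `` {(n, x, t)} \<in> T}" for n x
      by auto
    then show "real_open X (S \<inter> T)"
      using S T unfolding real_open_def by (auto intro!: openin_Int)
  next
    fix \<K> assume K: "\<forall>K\<in>\<K>. real_open X K"
    have "{t \<in> standard_simplex n. real_eq X `` {(n, x, t)} \<in> \<Union>\<K>} =
        (\<Union>K\<in>\<K>. {t \<in> standard_simplex n. real_eq X `` {(n, x, t)} \<in> K})" for n x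
      by auto
    then show "real_open X (\<Union>\<K>)"
      using K unfolding real_open_def by (auto intro!: openin_Union)
  qed
  then show ?thesis unfolding realization_def by (simp add: topology_inverse')
qed

text \<open>The map of realizations \<open>[x, t] \<mapsto> [f x, t]\<close> induced by a simplicial map \<open>f : X \<rightarrow> Y\<close>.\<close>

definition real_map :: "'b sset \<Rightarrow> (nat \<Rightarrow> 'a \<Rightarrow> 'b) \<Rightarrow>
    (nat \<times> 'a \<times> (nat \<Rightarrow> real)) set \<Rightarrow> (nat \<times> 'b \<times> (nat \<Rightarrow> real)) set" where
  "real_map Y f c = real_eq Y `` ((\<lambda>(n, x, t). (n, f n x, t)) ` c)"

definition cube :: "nat \<Rightarrow> (nat \<Rightarrow> real) set" where
  "cube n = {s. (\<forall>i<n. 0 \<le> s i \<and> s i \<le> 1) \<and> (\<forall>i\<ge>n. s i = 0)}"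

definition cube_bd :: "nat \<Rightarrow> (nat \<Rightarrow> real) set" where
  "cube_bd n = {s \<in> cube n. \<exists>i<n. s i = 0 \<or> s i = 1}"

definition cube_top :: "nat \<Rightarrow> (nat \<Rightarrow> real) topology" where
  "cube_top n = subtopology (powertop_real UNIV) (cube n)"

text \<open>Representatives of elements of \<open>\<pi>\<^sub>n(Y, y)\<close>, and homotopy relative to the boundary. For
  \<open>n = 0\<close> the cube is a point with empty boundary, so these are the path components of \<open>Y\<close>.\<close>

definition spheroid :: "nat \<Rightarrow> 'b topology \<Rightarrow> 'b \<Rightarrow> ((nat \<Rightarrow> real) \<Rightarrow> 'b) set" where
  "spheroid n Y y = {f. continuous_map (cube_top n) Y f \<and> f ` cube_bd n \<subseteq> {y}}"

definition spheroid_homotopic ::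
  "nat \<Rightarrow> 'b topology \<Rightarrow> 'b \<Rightarrow> ((nat \<Rightarrow> real) \<Rightarrow> 'b) \<Rightarrow> ((nat \<Rightarrow> real) \<Rightarrow> 'b) \<Rightarrow> bool" where
  "spheroid_homotopic n Y y = homotopic_with (\<lambda>h. h ` cube_bd n \<subseteq> {y}) (cube_top n) Y"

text \<open>For a continuous map \<open>F\<close>: bijectivity on \<open>\<pi>\<^sub>0\<close> and on all \<open>\<pi>\<^sub>n\<close> at all base points. The first
  conjunct is needed only to exclude maps from the empty space to a nonempty one.\<close>

definition weak_homotopy_equivalence :: "'a topology \<Rightarrow> 'b topology \<Rightarrow> ('a \<Rightarrow> 'b) \<Rightarrow> bool" where
  "weak_homotopy_equivalence X Y F \<longleftrightarrow>
     (\<forall>y\<in>topspace Y. \<exists>x\<in>topspace X. path_component_of Y (F x) y) \<and>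
     (\<forall>n. \<forall>x\<in>topspace X.
        (\<forall>f\<in>spheroid n X x. \<forall>g\<in>spheroid n X x.
           spheroid_homotopic n Y (F x) (F \<circ> f) (F \<circ> g) \<longrightarrow> spheroid_homotopic n X x f g) \<and>
        (\<forall>g\<in>spheroid n Y (F x). \<exists>f\<in>spheroid n X x. spheroid_homotopic n Y (F x) (F \<circ> f) g))"

definition sset_weak_equivalence :: "'a sset \<Rightarrow> 'b sset \<Rightarrow> (nat \<Rightarrow> 'a \<Rightarrow> 'b) \<Rightarrow> bool" where
  "sset_weak_equivalence X Y f \<longleftrightarrow>
     weak_homotopy_equivalence (realization X) (realization Y) (real_map Y f)"


section \<open>Pros and Lawvere theories\<close>

text \<open>Categories with object set \<open>\<nat>\<close>. \<open>Comp C n m k g f\<close> is \<open>g \<circ> f\<close> for \<open>f : n \<rightarrow> m\<close>, \<open>g : m \<rightarrow> k\<close>.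
  Structure maps carry their objects, so hom-sets need not be disjoint.\<close>

record 'a cat =
  Hom :: "nat \<Rightarrow> nat \<Rightarrow> 'a set"
  Comp :: "nat \<Rightarrow> nat \<Rightarrow> nat \<Rightarrow> 'a \<Rightarrow> 'a \<Rightarrow> 'a"
  Idn :: "nat \<Rightarrow> 'a"

definition is_cat :: "('a, 'm) cat_scheme \<Rightarrow> bool" where
  "is_cat C \<longleftrightarrow>
     (\<forall>n. Idn C n \<in> Hom C n n) \<and>
     (\<forall>n m k. \<forall>f\<in>Hom C n m. \<forall>g\<in>Hom C m k. Comp C n m k g f \<in> Hom C n k) \<and>
     (\<forall>n k. \<forall>f\<in>Hom C n k. Comp C n n k f (Idn C n) = f \<and> Comp C n k k (Idn C k) f = f) \<and>
     (\<forall>n m k l. \<forall>f\<in>Hom C n m. \<forall>g\<in>Hom C m k. \<forall>h\<in>Hom C k l.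
        Comp C n k l h (Comp C n m k g f) = Comp C n m l (Comp C m k l h g) f)"

text \<open>\<open>Tens P n k n' k' f g : n + n' \<rightarrow> k + k'\<close> for \<open>f : n \<rightarrow> k\<close>, \<open>g : n' \<rightarrow> k'\<close>.\<close>

record 'a pro = "'a cat" +
  Tens :: "nat \<Rightarrow> nat \<Rightarrow> nat \<Rightarrow> nat \<Rightarrow> 'a \<Rightarrow> 'a \<Rightarrow> 'a"

definition is_pro :: "'a pro \<Rightarrow> bool" where
  "is_pro P \<longleftrightarrow> is_cat P \<and>
     (\<forall>n k n' k'. \<forall>f\<in>Hom P n k. \<forall>g\<in>Hom P n' k'. Tens P n k n' k' f g \<in> Hom P (n + n') (k + k')) \<and>
     (\<forall>n n'. Tens P n n n' n' (Idn P n) (Idn P n') = Idn P (n + n')) \<and>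
     (\<forall>n m k n' m' k'. \<forall>f\<in>Hom P n m. \<forall>g\<in>Hom P m k. \<forall>f'\<in>Hom P n' m'. \<forall>g'\<in>Hom P m' k'.
        Tens P n k n' k' (Comp P n m k g f) (Comp P n' m' k' g' f') =
        Comp P (n + n') (m + m') (k + k') (Tens P m k m' k' g g') (Tens P n m n' m' f f')) \<and>
     (\<forall>n k n' k' n'' k''. \<forall>f\<in>Hom P n k. \<forall>g\<in>Hom P n' k'. \<forall>h\<in>Hom P n'' k''.
        Tens P (n + n') (k + k') n'' k'' (Tens P n k n' k' f g) h =
        Tens P n k (n' + n'') (k' + k'') f (Tens P n' k' n'' k'' g h)) \<and>
     (\<forall>n k. \<forall>f\<in>Hom P n k. Tens P 0 0 n k (Idn P 0) f = f \<and> Tens P n k 0 0 f (Idn P 0) = f)"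

definition pro_map :: "'a pro \<Rightarrow> 'b pro \<Rightarrow> (nat \<Rightarrow> nat \<Rightarrow> 'a \<Rightarrow> 'b) \<Rightarrow> bool" where
  "pro_map P Q F \<longleftrightarrow>
     (\<forall>n k. \<forall>f\<in>Hom P n k. F n k f \<in> Hom Q n k) \<and>
     (\<forall>n. F n n (Idn P n) = Idn Q n) \<and>
     (\<forall>n m k. \<forall>f\<in>Hom P n m. \<forall>g\<in>Hom P m k.
        F n k (Comp P n m k g f) = Comp Q n m k (F m k g) (F n m f)) \<and>
     (\<forall>n k n' k'. \<forall>f\<in>Hom P n k. \<forall>g\<in>Hom P n' k'.
        F (n + n') (k + k') (Tens P n k n' k' f g) = Tens Q n k n' k' (F n k f) (F n' k' g))"

text \<open>The opposite of the skeleton of finite sets: a morphism \<open>n \<rightarrow> k\<close> is a function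
  \<open>{0..<k} \<rightarrow> {0..<n}\<close>, encoded as the list of its values.\<close>

definition fin_hom :: "nat \<Rightarrow> nat \<Rightarrow> nat list set" where
  "fin_hom n k = {xs. length xs = k \<and> set xs \<subseteq> {..<n}}"

definition fin_comp :: "nat list \<Rightarrow> nat list \<Rightarrow> nat list" where
  "fin_comp ys xs = map ((!) xs) ys"

text \<open>A Lawvere theory; \<open>Fin L n k\<close> is the action on \<open>fin_hom n k\<close> of the identity-on-objects
  functor from the opposite of finite sets. The product of \<open>k\<close> and \<open>l\<close> there is \<open>k + l\<close> with
  projections \<open>[0..<k]\<close> and \<open>[k..<k+l]\<close>, the terminal object is \<open>0\<close>, and these are to be preserved.\<close>

record 'a law = "'a cat" +
  Fin :: "nat \<Rightarrow> nat \<Rightarrow> nat list \<Rightarrow> 'a"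

abbreviation prj1 :: "'a law \<Rightarrow> nat \<Rightarrow> nat \<Rightarrow> 'a" where
  "prj1 L k l \<equiv> Fin L (k + l) k [0..<k]"

abbreviation prj2 :: "'a law \<Rightarrow> nat \<Rightarrow> nat \<Rightarrow> 'a" where
  "prj2 L k l \<equiv> Fin L (k + l) l [k..<k + l]"

definition is_law :: "'a law \<Rightarrow> bool" where
  "is_law L \<longleftrightarrow> is_cat L \<and>
     (\<forall>n k. \<forall>xs\<in>fin_hom n k. Fin L n k xs \<in> Hom L n k) \<and>
     (\<forall>n. Fin L n n [0..<n] = Idn L n) \<and>
     (\<forall>n m k. \<forall>xs\<in>fin_hom n m. \<forall>ys\<in>fin_hom m k.
        Comp L n m k (Fin L m k ys) (Fin L n m xs) = Fin L n k (fin_comp ys xs)) \<and>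
     (\<forall>n k l. \<forall>f\<in>Hom L n k. \<forall>g\<in>Hom L n l. \<exists>!h. h \<in> Hom L n (k + l) \<and>
        Comp L n (k + l) k (prj1 L k l) h = f \<and> Comp L n (k + l) l (prj2 L k l) h = g) \<and>
     (\<forall>n. \<exists>!h. h \<in> Hom L n 0)"

text \<open>Maps of Lawvere theories are functors under the opposite of finite sets; these preserve
  finite products automatically.\<close>

definition law_map :: "'a law \<Rightarrow> 'b law \<Rightarrow> (nat \<Rightarrow> nat \<Rightarrow> 'a \<Rightarrow> 'b) \<Rightarrow> bool" where
  "law_map L L' F \<longleftrightarrow>
     (\<forall>n k. \<forall>f\<in>Hom L n k. F n k f \<in> Hom L' n k) \<and>
     (\<forall>n m k. \<forall>f\<in>Hom L n m. \<forall>g\<in>Hom L m k.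
        F n k (Comp L n m k g f) = Comp L' n m k (F m k g) (F n m f)) \<and>
     (\<forall>n k. \<forall>xs\<in>fin_hom n k. F n k (Fin L n k xs) = Fin L' n k xs)"

definition pairing :: "'a law \<Rightarrow> nat \<Rightarrow> nat \<Rightarrow> nat \<Rightarrow> 'a \<Rightarrow> 'a \<Rightarrow> 'a" where
  "pairing L n k l f g = (THE h. h \<in> Hom L n (k + l) \<and>
     Comp L n (k + l) k (prj1 L k l) h = f \<and> Comp L n (k + l) l (prj2 L k l) h = g)"

text \<open>The underlying pro of a Lawvere theory: \<open>f \<otimes> g = \<langle>f \<circ> pr\<^sub>1, g \<circ> pr\<^sub>2\<rangle>\<close>.\<close>

definition law_pro :: "'a law \<Rightarrow> 'a pro" where
  "law_pro L = \<lparr>Hom = Hom L, Comp = Comp L, Idn = Idn L,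
     Tens = (\<lambda>n k n' k' f g. pairing L (n + n') k k'
       (Comp L (n + n') n k f (prj1 L n n')) (Comp L (n + n') n' k' g (prj2 L n n')))\<rparr>"

definition fin_law :: "nat list law" where
  "fin_law = \<lparr>Hom = fin_hom, Comp = (\<lambda>_ _ _. fin_comp), Idn = (\<lambda>n. [0..<n]), Fin = (\<lambda>_ _ xs. xs)\<rparr>"

inductive_set gen_hom :: "'a pro \<Rightarrow> (nat \<Rightarrow> nat \<Rightarrow> 'a set) \<Rightarrow> (nat \<times> nat \<times> 'a) set"
  for P :: "'a pro" and X :: "nat \<Rightarrow> nat \<Rightarrow> 'a set" where
  "f \<in> X n k \<Longrightarrow> (n, k, f) \<in> gen_hom P X"
| "(n, n, Idn P n) \<in> gen_hom P X"
| "(m, k, g) \<in> gen_hom P X \<Longrightarrow> (n, m, f) \<in> gen_hom P X \<Longrightarrow> (n, k, Comp P n m k g f) \<in> gen_hom P X"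
| "(n, k, f) \<in> gen_hom P X \<Longrightarrow> (n', k', g) \<in> gen_hom P X \<Longrightarrow>
     (n + n', k + k', Tens P n k n' k' f g) \<in> gen_hom P X"

definition gen_subpro :: "'a pro \<Rightarrow> (nat \<Rightarrow> nat \<Rightarrow> 'a set) \<Rightarrow> 'a pro" where
  "gen_subpro P X = P\<lparr>Hom := \<lambda>n k. {f. (n, k, f) \<in> gen_hom P X}\<rparr>"


section \<open>Lawvere theories presented by generators and relations\<close>

text \<open>Formal expressions in generating morphisms \<open>Gen n k g : n \<rightarrow> k\<close>, morphisms of finite sets,
  composition, and pairing \<open>PairE n k l e e' = \<langle>e, e'\<rangle> : n \<rightarrow> k + l\<close>.\<close>

datatype 'g expr =
    Gen nat nat 'g
  | FinE nat nat "nat list"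
  | CompE nat nat nat "'g expr" "'g expr"
  | PairE nat nat nat "'g expr" "'g expr"

text \<open>\<open>expr_eq G R n k e e'\<close>: both \<open>e\<close> and \<open>e'\<close> are well-formed expressions \<open>n \<rightarrow> k\<close> in the generators
  \<open>G\<close>, and they are identified by the relations \<open>R\<close> and the axioms of a Lawvere theory. In
  particular \<open>expr_eq G R n k e e\<close> says that \<open>e\<close> is well-formed.\<close>

inductive expr_eq :: "(nat \<Rightarrow> nat \<Rightarrow> 'g set) \<Rightarrow> (nat \<times> nat \<times> 'g expr \<times> 'g expr) set \<Rightarrow>
    nat \<Rightarrow> nat \<Rightarrow> 'g expr \<Rightarrow> 'g expr \<Rightarrow> bool"
  for G R where
  eGen: "g \<in> G n k \<Longrightarrow> expr_eq G R n k (Gen n k g) (Gen n k g)"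
| eFin: "xs \<in> fin_hom n k \<Longrightarrow> expr_eq G R n k (FinE n k xs) (FinE n k xs)"
| eComp: "expr_eq G R m k e e' \<Longrightarrow> expr_eq G R n m d d' \<Longrightarrow>
    expr_eq G R n k (CompE n m k e d) (CompE n m k e' d')"
| ePair: "expr_eq G R n k e e' \<Longrightarrow> expr_eq G R n l d d' \<Longrightarrow>
    expr_eq G R n (k + l) (PairE n k l e d) (PairE n k l e' d')"
| eSym: "expr_eq G R n k e e' \<Longrightarrow> expr_eq G R n k e' e"
| eTrans: "expr_eq G R n k e e' \<Longrightarrow> expr_eq G R n k e' e'' \<Longrightarrow> expr_eq G R n k e e''"
| eRel: "(n, k, e, e') \<in> R \<Longrightarrow> expr_eq G R n k e e \<Longrightarrow> expr_eq G R n k e' e' \<Longrightarrow> expr_eq G R n k e e'"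
| eIdR: "expr_eq G R n k e e \<Longrightarrow> expr_eq G R n k (CompE n n k e (FinE n n [0..<n])) e"
| eIdL: "expr_eq G R n k e e \<Longrightarrow> expr_eq G R n k (CompE n k k (FinE k k [0..<k]) e) e"
| eAssoc: "expr_eq G R k l e e \<Longrightarrow> expr_eq G R m k d d \<Longrightarrow> expr_eq G R n m c c \<Longrightarrow>
    expr_eq G R n l (CompE n k l e (CompE n m k d c)) (CompE n m l (CompE m k l e d) c)"
| eFinComp: "xs \<in> fin_hom n m \<Longrightarrow> ys \<in> fin_hom m k \<Longrightarrow>
    expr_eq G R n k (CompE n m k (FinE m k ys) (FinE n m xs)) (FinE n k (fin_comp ys xs))"
| eProj1: "expr_eq G R n k e e \<Longrightarrow> expr_eq G R n l d d \<Longrightarrow>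
    expr_eq G R n k (CompE n (k + l) k (FinE (k + l) k [0..<k]) (PairE n k l e d)) e"
| eProj2: "expr_eq G R n k e e \<Longrightarrow> expr_eq G R n l d d \<Longrightarrow>
    expr_eq G R n l (CompE n (k + l) l (FinE (k + l) l [k..<k + l]) (PairE n k l e d)) d"
| ePairEta: "expr_eq G R n (k + l) e e \<Longrightarrow>
    expr_eq G R n (k + l) (PairE n k l (CompE n (k + l) k (FinE (k + l) k [0..<k]) e)
      (CompE n (k + l) l (FinE (k + l) l [k..<k + l]) e)) e"
| eTerm: "expr_eq G R n 0 e e \<Longrightarrow> expr_eq G R n 0 e (FinE n 0 [])"

definition expr_class :: "(nat \<Rightarrow> nat \<Rightarrow> 'g set) \<Rightarrow> (nat \<times> nat \<times> 'g expr \<times> 'g expr) set \<Rightarrow>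
    nat \<Rightarrow> nat \<Rightarrow> 'g expr \<Rightarrow> 'g expr set" where
  "expr_class G R n k e = {e'. expr_eq G R n k e e'}"

definition pres :: "(nat \<Rightarrow> nat \<Rightarrow> 'g set) \<Rightarrow> (nat \<times> nat \<times> 'g expr \<times> 'g expr) set \<Rightarrow>
    'g expr set law" where
  "pres G R = \<lparr>
     Hom = (\<lambda>n k. {expr_class G R n k e | e. expr_eq G R n k e e}),
     Comp = (\<lambda>n m k c d. \<Union>e\<in>c. \<Union>e'\<in>d. expr_class G R n k (CompE n m k e e')),
     Idn = (\<lambda>n. expr_class G R n n (FinE n n [0..<n])),
     Fin = (\<lambda>n k xs. expr_class G R n k (FinE n k xs))\<rparr>"

definition pres_gen :: "(nat \<Rightarrow> nat \<Rightarrow> 'g set) \<Rightarrow> (nat \<times> nat \<times> 'g expr \<times> 'g expr) set \<Rightarrow>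
    nat \<Rightarrow> nat \<Rightarrow> 'g \<Rightarrow> 'g expr set" where
  "pres_gen G R n k g = expr_class G R n k (Gen n k g)"

primrec expr_eval :: "'a law \<Rightarrow> (nat \<Rightarrow> nat \<Rightarrow> 'g \<Rightarrow> 'a) \<Rightarrow> 'g expr \<Rightarrow> 'a" where
  "expr_eval L \<phi> (Gen n k g) = \<phi> n k g"
| "expr_eval L \<phi> (FinE n k xs) = Fin L n k xs"
| "expr_eval L \<phi> (CompE n m k e d) = Comp L n m k (expr_eval L \<phi> e) (expr_eval L \<phi> d)"
| "expr_eval L \<phi> (PairE n k l e d) = pairing L n k l (expr_eval L \<phi> e) (expr_eval L \<phi> d)"

text \<open>The map from a presented theory to \<open>L\<close> determined by its values \<open>\<phi>\<close> on generators.\<close>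

definition pres_lift :: "'a law \<Rightarrow> (nat \<Rightarrow> nat \<Rightarrow> 'g \<Rightarrow> 'a) \<Rightarrow> nat \<Rightarrow> nat \<Rightarrow> 'g expr set \<Rightarrow> 'a" where
  "pres_lift L \<phi> n k c = the_elem (expr_eval L \<phi> ` c)"

lemma expr_eq_refl: "expr_eq G R n k e e' \<Longrightarrow> expr_eq G R n k e e \<and> expr_eq G R n k e' e'"
  by (meson eSym eTrans)

lemma expr_class_eq:
  "expr_eq G R n k e e \<Longrightarrow> expr_class G R n k e = expr_class G R n k e' \<longleftrightarrow> expr_eq G R n k e e'"
  unfolding expr_class_def by (auto intro: eSym eTrans)

lemma expr_class_eqI: "expr_eq G R n k e e' \<Longrightarrow> expr_class G R n k e = expr_class G R n k e'"
  using expr_class_eq expr_eq_refl by metis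

lemma expr_class_self: "expr_eq G R n k e e \<Longrightarrow> e \<in> expr_class G R n k e"
  by (simp add: expr_class_def)

lemma pres_Hom: "c \<in> Hom (pres G R) n k \<longleftrightarrow> (\<exists>e. expr_eq G R n k e e \<and> c = expr_class G R n k e)"
  by (auto simp: pres_def)

lemma pres_HomI: "expr_eq G R n k e e \<Longrightarrow> expr_class G R n k e \<in> Hom (pres G R) n k"
  by (auto simp: pres_Hom)

lemma pres_HomE:
  assumes "c \<in> Hom (pres G R) n k"
  obtains e where "expr_eq G R n k e e" "c = expr_class G R n k e"
  using assms by (auto simp: pres_Hom)

lemma pres_Comp:
  assumes "expr_eq G R m k e e" "expr_eq G R n m d d"
  shows "Comp (pres G R) n m k (expr_class G R m k e) (expr_class G R n m d)
    = expr_class G R n k (CompE n m k e d)"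
proof -
  have c: "expr_class G R n k (CompE n m k e' d') = expr_class G R n k (CompE n m k e d)"
    if "e' \<in> expr_class G R m k e" "d' \<in> expr_class G R n m d" for e' d'
  proof (rule expr_class_eqI[symmetric], rule eComp)
    show "expr_eq G R m k e e'" "expr_eq G R n m d d'"
      using that by (simp_all add: expr_class_def)
  qed
  have "Comp (pres G R) n m k (expr_class G R m k e) (expr_class G R n m d)
     = (\<Union>e'\<in>expr_class G R m k e. \<Union>d'\<in>expr_class G R n m d. expr_class G R n k (CompE n m k e' d'))"
    by (simp add: pres_def)
  also have "\<dots> = (\<Union>e'\<in>expr_class G R m k e. \<Union>d'\<in>expr_class G R n m d. expr_class G R n k (CompE n m k e d))"
    by (intro SUP_cong refl) (rule c)
  also have "\<dots> = expr_class G R n k (CompE n m k e d)"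
    using expr_class_self[OF assms(1)] expr_class_self[OF assms(2)] by blast
  finally show ?thesis .
qed

lemma pres_Fin: "Fin (pres G R) n k xs = expr_class G R n k (FinE n k xs)"
  by (simp add: pres_def)

lemma pres_Idn: "Idn (pres G R) n = expr_class G R n n (FinE n n [0..<n])"
  by (simp add: pres_def)

lemma fin_hom_prj: "[0..<n] \<in> fin_hom n n" "[0..<k] \<in> fin_hom (k + l) k"
  "[k..<k + l] \<in> fin_hom (k + l) l" "[] \<in> fin_hom n 0"
  by (auto simp: fin_hom_def)

lemma pres_pairing_unique:
  assumes e: "expr_eq G R n k e e" and d: "expr_eq G R n l d d"
  shows "h \<in> Hom (pres G R) n (k + l) \<and>
     Comp (pres G R) n (k + l) k (prj1 (pres G R) k l) h = expr_class G R n k e \<and>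
     Comp (pres G R) n (k + l) l (prj2 (pres G R) k l) h = expr_class G R n l d \<longleftrightarrow>
     h = expr_class G R n (k + l) (PairE n k l e d)" (is "?A \<longleftrightarrow> h = ?p")
proof
  have ed: "expr_eq G R n (k + l) (PairE n k l e d) (PairE n k l e d)"
    using e d by (rule ePair)
  assume "h = ?p"
  then show ?A
    using e d ed fin_hom_prj[THEN eFin, of G R]
    by (simp add: pres_HomI pres_Fin pres_Comp expr_class_eqI[OF eProj1[OF e d]]
        expr_class_eqI[OF eProj2[OF e d]])
next
  assume A: ?A
  then obtain c where c: "expr_eq G R n (k + l) c c" and h: "h = expr_class G R n (k + l) c"
    by (auto simp: pres_Hom)
  have "expr_eq G R n k (CompE n (k + l) k (FinE (k + l) k [0..<k]) c) e"
    using A c e fin_hom_prj[THEN eFin, of G R] by (simp add: h pres_Fin pres_Comp expr_class_eq eComp)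
  moreover have "expr_eq G R n l (CompE n (k + l) l (FinE (k + l) l [k..<k + l]) c) d"
    using A c d fin_hom_prj[THEN eFin, of G R] by (simp add: h pres_Fin pres_Comp expr_class_eq eComp)
  ultimately have "expr_eq G R n (k + l) (PairE n k l (CompE n (k + l) k (FinE (k + l) k [0..<k]) c)
      (CompE n (k + l) l (FinE (k + l) l [k..<k + l]) c)) (PairE n k l e d)"
    by (rule ePair)
  then show "h = ?p"
    unfolding h by (rule expr_class_eqI[OF eTrans[OF eSym[OF ePairEta[OF c]]]])
qed

lemma pres_pairing:
  assumes "expr_eq G R n k e e" "expr_eq G R n l d d"
  shows "pairing (pres G R) n k l (expr_class G R n k e) (expr_class G R n l d)
    = expr_class G R n (k + l) (PairE n k l e d)"
  unfolding pairing_def pres_pairing_unique[OF assms] by simp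

lemma is_cat_pres: "is_cat (pres G R)"
proof -
  have id: "expr_eq G R n n (FinE n n [0..<n]) (FinE n n [0..<n])" for n
    by (rule eFin[OF fin_hom_prj(1)])
  have "Comp (pres G R) n k l h (Comp (pres G R) n m k g f)
      = Comp (pres G R) n m l (Comp (pres G R) m k l h g) f"
    if hom: "f \<in> Hom (pres G R) n m" "g \<in> Hom (pres G R) m k" "h \<in> Hom (pres G R) k l"
    for n m k l f g h
  proof -
    obtain e d c where "expr_eq G R k l e e" "expr_eq G R m k d d" "expr_eq G R n m c c"
      and "h = expr_class G R k l e" "g = expr_class G R m k d" "f = expr_class G R n m c"
      using hom by (auto simp: pres_Hom)
    then show ?thesis by (simp add: pres_Comp eComp expr_class_eqI[OF eAssoc])
  qed
  moreover have "Comp (pres G R) n m k g f \<in> Hom (pres G R) n k"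
    if hom: "f \<in> Hom (pres G R) n m" "g \<in> Hom (pres G R) m k" for n m k f g
  proof -
    obtain d c where "expr_eq G R m k d d" "expr_eq G R n m c c"
      and "g = expr_class G R m k d" "f = expr_class G R n m c"
      using hom by (auto simp: pres_Hom)
    then show ?thesis by (simp add: pres_Comp eComp pres_HomI)
  qed
  moreover have "Comp (pres G R) n n k f (Idn (pres G R) n) = f \<and>
      Comp (pres G R) n k k (Idn (pres G R) k) f = f" if hom: "f \<in> Hom (pres G R) n k" for n k f
  proof -
    obtain e where e: "expr_eq G R n k e e" and "f = expr_class G R n k e"
      using hom by (auto simp: pres_Hom)
    then show ?thesis
      by (simp add: pres_Comp pres_Idn id expr_class_eqI[OF eIdR] expr_class_eqI[OF eIdL])
  qed
  ultimately show ?thesis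
    unfolding is_cat_def by (simp add: pres_Idn pres_HomI id)
qed

theorem is_law_pres: "is_law (pres G R)"
proof -
  have pair: "\<exists>!h. h \<in> Hom (pres G R) n (k + l) \<and>
      Comp (pres G R) n (k + l) k (prj1 (pres G R) k l) h = f \<and>
      Comp (pres G R) n (k + l) l (prj2 (pres G R) k l) h = g"
    if "f \<in> Hom (pres G R) n k" "g \<in> Hom (pres G R) n l" for n k l f g
  proof -
    from that obtain e d where ed: "expr_eq G R n k e e" "expr_eq G R n l d d"
      and fg: "f = expr_class G R n k e" "g = expr_class G R n l d"
      by (auto simp: pres_Hom)
    show ?thesis unfolding fg pres_pairing_unique[OF ed] by simp
  qed
  have terminal: "\<exists>!h. h \<in> Hom (pres G R) n 0" for n
  proof (rule ex1I[of _ "expr_class G R n 0 (FinE n 0 [])"])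
    show "expr_class G R n 0 (FinE n 0 []) \<in> Hom (pres G R) n 0"
      by (intro pres_HomI eFin fin_hom_prj)
    show "h = expr_class G R n 0 (FinE n 0 [])" if "h \<in> Hom (pres G R) n 0" for h
      using that unfolding pres_Hom by (metis expr_class_eqI eTerm)
  qed
  have comp: "Comp (pres G R) n m k (Fin (pres G R) m k ys) (Fin (pres G R) n m xs)
      = Fin (pres G R) n k (fin_comp ys xs)"
    if "xs \<in> fin_hom n m" "ys \<in> fin_hom m k" for n m k xs ys
    using that by (simp add: pres_Fin pres_Comp eFin expr_class_eqI[OF eFinComp])
  show ?thesis
    unfolding is_law_def
    using is_cat_pres pair terminal comp by (simp add: pres_Fin pres_Idn pres_HomI eFin)
qed

lemma is_law_cat: "is_law L \<Longrightarrow> is_cat L"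
  by (simp add: is_law_def)

lemma cat_Comp: "is_cat C \<Longrightarrow> f \<in> Hom C n m \<Longrightarrow> g \<in> Hom C m k \<Longrightarrow> Comp C n m k g f \<in> Hom C n k"
  by (auto simp: is_cat_def)

lemma law_Fin: "is_law L \<Longrightarrow> xs \<in> fin_hom n k \<Longrightarrow> Fin L n k xs \<in> Hom L n k"
  by (auto simp: is_law_def)

lemma cat_idR: "is_cat C \<Longrightarrow> f \<in> Hom C n k \<Longrightarrow> Comp C n n k f (Idn C n) = f"
  and cat_idL: "is_cat C \<Longrightarrow> f \<in> Hom C n k \<Longrightarrow> Comp C n k k (Idn C k) f = f"
  by (auto simp: is_cat_def)

lemma cat_assoc: "is_cat C \<Longrightarrow> f \<in> Hom C n m \<Longrightarrow> g \<in> Hom C m k \<Longrightarrow> h \<in> Hom C k l \<Longrightarrow>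
    Comp C n k l h (Comp C n m k g f) = Comp C n m l (Comp C m k l h g) f"
  unfolding is_cat_def by blast

lemma law_Id: "is_law L \<Longrightarrow> Fin L n n [0..<n] = Idn L n"
  by (simp add: is_law_def)

lemma law_FinComp: "is_law L \<Longrightarrow> xs \<in> fin_hom n m \<Longrightarrow> ys \<in> fin_hom m k \<Longrightarrow>
    Comp L n m k (Fin L m k ys) (Fin L n m xs) = Fin L n k (fin_comp ys xs)"
  by (simp add: is_law_def)

lemma law_terminal: "is_law L \<Longrightarrow> f \<in> Hom L n 0 \<Longrightarrow> g \<in> Hom L n 0 \<Longrightarrow> f = g"
  unfolding is_law_def by blast

lemma fin_comp_hom: "xs \<in> fin_hom n m \<Longrightarrow> ys \<in> fin_hom m k \<Longrightarrow> fin_comp ys xs \<in> fin_hom n k"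
  unfolding fin_hom_def fin_comp_def by (auto simp: subset_iff)

lemma law_map_Hom: "law_map L L' F \<Longrightarrow> f \<in> Hom L n k \<Longrightarrow> F n k f \<in> Hom L' n k"
  and law_map_Comp: "law_map L L' F \<Longrightarrow> f \<in> Hom L n m \<Longrightarrow> g \<in> Hom L m k \<Longrightarrow>
    F n k (Comp L n m k g f) = Comp L' n m k (F m k g) (F n m f)"
  and law_map_Fin: "law_map L L' F \<Longrightarrow> xs \<in> fin_hom n k \<Longrightarrow> F n k (Fin L n k xs) = Fin L' n k xs"
  by (auto simp: law_map_def)

lemma law_pairing_ex1:
  assumes "is_law L" "f \<in> Hom L n k" "g \<in> Hom L n l"
  shows "\<exists>!h. h \<in> Hom L n (k + l) \<and>
     Comp L n (k + l) k (prj1 L k l) h = f \<and> Comp L n (k + l) l (prj2 L k l) h = g"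
proof -
  have "\<forall>n k l. \<forall>f\<in>Hom L n k. \<forall>g\<in>Hom L n l. \<exists>!h. h \<in> Hom L n (k + l) \<and>
     Comp L n (k + l) k (prj1 L k l) h = f \<and> Comp L n (k + l) l (prj2 L k l) h = g"
    using assms(1) unfolding is_law_def by (elim conjE)
  then show ?thesis using assms(2,3) by (elim allE ballE) auto
qed

lemma law_pairing:
  assumes "is_law L" "f \<in> Hom L n k" "g \<in> Hom L n l"
  shows "pairing L n k l f g \<in> Hom L n (k + l)"
    and "Comp L n (k + l) k (prj1 L k l) (pairing L n k l f g) = f"
    and "Comp L n (k + l) l (prj2 L k l) (pairing L n k l f g) = g"
  using theI'[OF law_pairing_ex1[OF assms]] unfolding pairing_def by simp_all

lemma law_pairing_unique:
  assumes L: "is_law L" and h: "h \<in> Hom L n (k + l)"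
    and fg: "Comp L n (k + l) k (prj1 L k l) h = f" "Comp L n (k + l) l (prj2 L k l) h = g"
  shows "pairing L n k l f g = h"
proof -
  have f: "f \<in> Hom L n k"
    unfolding fg(1)[symmetric] by (rule cat_Comp[OF is_law_cat[OF L] h law_Fin[OF L fin_hom_prj(2)]])
  have g: "g \<in> Hom L n l"
    unfolding fg(2)[symmetric] by (rule cat_Comp[OF is_law_cat[OF L] h law_Fin[OF L fin_hom_prj(3)]])
  show ?thesis
    unfolding pairing_def
    by (rule the1_equality[OF law_pairing_ex1[OF L f g]]) (intro conjI h fg)
qed

lemma law_map_pairing:
  assumes F: "law_map L L' F" and L: "is_law L" and L': "is_law L'"
    and f: "f \<in> Hom L n k" and g: "g \<in> Hom L n l"
  shows "F n (k + l) (pairing L n k l f g) = pairing L' n k l (F n k f) (F n l g)"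
proof (rule law_pairing_unique[symmetric, OF L'])
  note p = law_pairing[OF L f g]
  show "F n (k + l) (pairing L n k l f g) \<in> Hom L' n (k + l)"
    by (rule law_map_Hom[OF F p(1)])
  show "Comp L' n (k + l) k (prj1 L' k l) (F n (k + l) (pairing L n k l f g)) = F n k f"
    using law_map_Comp[OF F p(1) law_Fin[OF L fin_hom_prj(2)]]
    by (simp add: p(2) law_map_Fin[OF F fin_hom_prj(2)])
  show "Comp L' n (k + l) l (prj2 L' k l) (F n (k + l) (pairing L n k l f g)) = F n l g"
    using law_map_Comp[OF F p(1) law_Fin[OF L fin_hom_prj(3)]]
    by (simp add: p(3) law_map_Fin[OF F fin_hom_prj(3)])
qed

definition pres_model :: "(nat \<Rightarrow> nat \<Rightarrow> 'g set) \<Rightarrow> (nat \<times> nat \<times> 'g expr \<times> 'g expr) set \<Rightarrow>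
    'a law \<Rightarrow> (nat \<Rightarrow> nat \<Rightarrow> 'g \<Rightarrow> 'a) \<Rightarrow> bool" where
  "pres_model G R L \<phi> \<longleftrightarrow> (\<forall>n k. \<forall>g\<in>G n k. \<phi> n k g \<in> Hom L n k) \<and>
     (\<forall>n k e e'. (n, k, e, e') \<in> R \<longrightarrow> expr_eq G R n k e e \<longrightarrow> expr_eq G R n k e' e' \<longrightarrow>
        expr_eval L \<phi> e = expr_eval L \<phi> e')"

lemma expr_eval_sound:
  assumes L: "is_law L" and m: "pres_model G R L \<phi>" and "expr_eq G R n k e e'"
  shows "expr_eval L \<phi> e \<in> Hom L n k \<and> expr_eval L \<phi> e' = expr_eval L \<phi> e"
  using assms(3)
proof induction
  note C = is_law_cat[OF L]
  {
    case (eRel n k e e')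
    then show ?case using m unfolding pres_model_def by metis
  next
    case (eFinComp xs n m ys k)
    then show ?case by (simp add: law_FinComp[OF L] law_Fin[OF L] fin_comp_hom)
  next
    case (ePairEta n k l e)
    then have h: "expr_eval L \<phi> e \<in> Hom L n (k + l)" by simp
    show ?case using law_pairing_unique[OF L h refl refl] h by simp
  next
    case (eTerm n e)
    then show ?case using law_Fin[OF L fin_hom_prj(4)] law_terminal[OF L] by auto
  next
    case (eIdR n k e)
    then show ?case by (simp add: law_Id[OF L] cat_idR[OF C])
  next
    case (eIdL n k e)
    then show ?case by (simp add: law_Id[OF L] cat_idL[OF C])
  next
    case (eAssoc k l e m d n c)
    then have "expr_eval L \<phi> e \<in> Hom L k l" "expr_eval L \<phi> d \<in> Hom L m k"
      "expr_eval L \<phi> c \<in> Hom L n m" by auto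
    then show ?case by (simp add: cat_assoc[OF C] cat_Comp[OF C])
  next
    case (eProj1 n k e l d)
    then show ?case by (simp add: law_pairing[OF L])
  next
    case (eProj2 n k e l d)
    then show ?case by (simp add: law_pairing[OF L])
  next
    case (eGen g n k)
    then show ?case using m by (simp add: pres_model_def)
  next
    case (eFin xs n k)
    then show ?case by (simp add: law_Fin[OF L])
  next
    case (eComp m k e e' n d d')
    then show ?case by (simp add: cat_Comp[OF C])
  next
    case (ePair n k e e' l d d')
    then show ?case by (simp add: law_pairing[OF L])
  }
qed simp_all

lemma pres_lift_class:
  assumes "is_law L" "pres_model G R L \<phi>" "expr_eq G R n k e e"
  shows "pres_lift L \<phi> n k (expr_class G R n k e) = expr_eval L \<phi> e"
proof -
  have "expr_eval L \<phi> e' = expr_eval L \<phi> e" if "e' \<in> expr_class G R n k e" for e'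
    using expr_eval_sound[OF assms(1,2), of n k e e'] that by (simp add: expr_class_def)
  then have "expr_eval L \<phi> ` expr_class G R n k e = {expr_eval L \<phi> e}"
    using expr_class_self[OF assms(3)] by blast
  then show ?thesis by (simp add: pres_lift_def)
qed

theorem pres_lift_map:
  assumes "is_law L" "pres_model G R L \<phi>"
  shows "law_map (pres G R) L (pres_lift L \<phi>)"
    and "\<forall>n k. \<forall>g\<in>G n k. pres_lift L \<phi> n k (pres_gen G R n k g) = \<phi> n k g"
proof -
  note l = pres_lift_class[OF assms]
  have "pres_lift L \<phi> n k (Comp (pres G R) n m k g f)
      = Comp L n m k (pres_lift L \<phi> m k g) (pres_lift L \<phi> n m f)"
    if f: "f \<in> Hom (pres G R) n m" and g: "g \<in> Hom (pres G R) m k" for n m k f g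
  proof -
    obtain e where e: "expr_eq G R m k e e" "g = expr_class G R m k e"
      by (rule pres_HomE[OF g])
    obtain d where d: "expr_eq G R n m d d" "f = expr_class G R n m d"
      by (rule pres_HomE[OF f])
    show ?thesis using e(1) d(1) unfolding e(2) d(2) by (simp add: l pres_Comp eComp)
  qed
  moreover have "pres_lift L \<phi> n k f \<in> Hom L n k" if f: "f \<in> Hom (pres G R) n k" for n k f
  proof -
    obtain e where e: "expr_eq G R n k e e" "f = expr_class G R n k e"
      by (rule pres_HomE[OF f])
    show ?thesis using expr_eval_sound[OF assms e(1)] unfolding e(2) l[OF e(1)] by simp
  qed
  moreover have "pres_lift L \<phi> n k (Fin (pres G R) n k xs) = Fin L n k xs"
    if "xs \<in> fin_hom n k" for n k xs
    unfolding pres_Fin l[OF eFin[OF that]] by simp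
  ultimately show "law_map (pres G R) L (pres_lift L \<phi>)"
    unfolding law_map_def by (intro conjI allI ballI)
  show "\<forall>n k. \<forall>g\<in>G n k. pres_lift L \<phi> n k (pres_gen G R n k g) = \<phi> n k g"
  proof (intro allI ballI)
    fix n k g assume "g \<in> G n k"
    then have "expr_eq G R n k (Gen n k g) (Gen n k g)" by (rule eGen)
    from l[OF this] show "pres_lift L \<phi> n k (pres_gen G R n k g) = \<phi> n k g"
      unfolding pres_gen_def by simp
  qed
qed

theorem pres_map_unique:
  assumes L: "is_law L" and F: "law_map (pres G R) L F" and F': "law_map (pres G R) L F'"
    and gen: "\<And>n k g. g \<in> G n k \<Longrightarrow> F n k (pres_gen G R n k g) = F' n k (pres_gen G R n k g)"
    and c: "c \<in> Hom (pres G R) n k"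
  shows "F n k c = F' n k c"
proof -
  have comp: "H n k (expr_class G R n k (CompE n m k e d)) =
      Comp L n m k (H m k (expr_class G R m k e)) (H n m (expr_class G R n m d))"
    if "law_map (pres G R) L H" "expr_eq G R m k e e" "expr_eq G R n m d d" for H n m k e d
    unfolding pres_Comp[OF that(2,3), symmetric]
    by (rule law_map_Comp[OF that(1) pres_HomI[OF that(3)] pres_HomI[OF that(2)]])
  have pair: "H n (k + l) (expr_class G R n (k + l) (PairE n k l e d)) =
      pairing L n k l (H n k (expr_class G R n k e)) (H n l (expr_class G R n l d))"
    if "law_map (pres G R) L H" "expr_eq G R n k e e" "expr_eq G R n l d d" for H n k l e d
    unfolding pres_pairing[OF that(2,3), symmetric]
    by (rule law_map_pairing[OF that(1) is_law_pres L pres_HomI[OF that(2)] pres_HomI[OF that(3)]])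
  have fin: "H n k (expr_class G R n k (FinE n k xs)) = Fin L n k xs"
    if "law_map (pres G R) L H" "xs \<in> fin_hom n k" for H n k xs
    using law_map_Fin[OF that] by (simp add: pres_Fin)
  have main: "F n k (expr_class G R n k e) = F' n k (expr_class G R n k e)"
    if "expr_eq G R n k e e'" for n k e e'
    using that
  proof induction
    case (eGen g n k)
    show ?case using gen[OF eGen] unfolding pres_gen_def .
  next
    case (eFin xs n k)
    show ?case unfolding fin[OF F eFin] fin[OF F' eFin] ..
  next
    case (eComp m k e e' n d d')
    then have "expr_eq G R m k e e" "expr_eq G R n m d d" using expr_eq_refl by blast+
    from comp[OF F this] comp[OF F' this] eComp.IH show ?case by simp
  next
    case (ePair n k e e' l d d')
    then have "expr_eq G R n k e e" "expr_eq G R n l d d" using expr_eq_refl by blast+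
    from pair[OF F this] pair[OF F' this] ePair.IH show ?case by simp
  next
    case (eSym n k e e')
    then show ?case using expr_class_eqI[OF eSym.hyps] by simp
  next
    case (eTrans n k e e' e'')
    then show ?case by simp
  next
    case (eRel n k e e')
    then show ?case by simp
  next
    case (eIdR n k e)
    then show ?case using expr_class_eqI[OF expr_eq.eIdR[OF eIdR.hyps]] by simp
  next
    case (eIdL n k e)
    then show ?case using expr_class_eqI[OF expr_eq.eIdL[OF eIdL.hyps]] by simp
  next
    case (eAssoc k l e m d n c)
    have dc: "expr_eq G R n k (CompE n m k d c) (CompE n m k d c)"
      using eAssoc.hyps by (intro expr_eq.eComp)
    show ?case
      unfolding comp[OF F eAssoc.hyps(1) dc] comp[OF F' eAssoc.hyps(1) dc]
        comp[OF F eAssoc.hyps(2,3)] comp[OF F' eAssoc.hyps(2,3)] eAssoc.IH ..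
  next
    case (eFinComp xs n m ys k)
    show ?case
      unfolding expr_class_eqI[OF expr_eq.eFinComp[OF eFinComp.hyps]]
        fin[OF F fin_comp_hom[OF eFinComp.hyps]] fin[OF F' fin_comp_hom[OF eFinComp.hyps]] ..
  next
    case (eProj1 n k e l d)
    then show ?case using expr_class_eqI[OF expr_eq.eProj1[OF eProj1.hyps]] by simp
  next
    case (eProj2 n k e l d)
    then show ?case using expr_class_eqI[OF expr_eq.eProj2[OF eProj2.hyps]] by simp
  next
    case (ePairEta n k l e)
    then show ?case using expr_class_eqI[OF expr_eq.ePairEta[OF ePairEta.hyps]] by simp
  next
    case (eTerm n e)
    then show ?case by simp
  qed
  obtain e where e: "expr_eq G R n k e e" "c = expr_class G R n k e"
    by (rule pres_HomE[OF c])
  show ?thesis unfolding e(2) by (rule main[OF e(1)])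
qed


section \<open>Simplicially enriched pros and Lawvere theories\<close>

text \<open>A simplicially enriched category with object set \<open>\<nat>\<close>, written degreewise: \<open>Lev T d\<close> is the
  ordinary category formed by the \<open>d\<close>-simplices of the hom-objects, and the operators
  \<open>\<alpha>\<^sup>*\<close>, given by \<open>LAct T d \<alpha>\<close> for \<open>\<alpha> : [m] \<rightarrow> [d]\<close>, are identity-on-objects functors
  (this says that composition is simplicial).\<close>

record ('c, 'a) enr =
  Lev :: "nat \<Rightarrow> 'c"
  LAct :: "nat \<Rightarrow> nat list \<Rightarrow> nat \<Rightarrow> nat \<Rightarrow> 'a \<Rightarrow> 'a"

type_synonym 'a spro = "('a pro, 'a) enr"
type_synonym 'a slaw = "('a law, 'a) enr"

definition shom :: "(('a, 'm) cat_scheme, 'a) enr \<Rightarrow> nat \<Rightarrow> nat \<Rightarrow> 'a sset" where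
  "shom T n k = \<lparr>Simp = (\<lambda>d. Hom (Lev T d) n k), Act = (\<lambda>d \<alpha>. LAct T d \<alpha> n k)\<rparr>"

definition is_spro :: "'a spro \<Rightarrow> bool" where
  "is_spro Q \<longleftrightarrow> (\<forall>n k. simplicial_set (shom Q n k)) \<and> (\<forall>d. is_pro (Lev Q d)) \<and>
     (\<forall>m d. \<forall>\<alpha>\<in>simp_ops m d. pro_map (Lev Q d) (Lev Q m) (LAct Q d \<alpha>))"

definition spro_map :: "'a spro \<Rightarrow> 'b spro \<Rightarrow> (nat \<Rightarrow> nat \<Rightarrow> nat \<Rightarrow> 'a \<Rightarrow> 'b) \<Rightarrow> bool" where
  "spro_map Q Q' F \<longleftrightarrow> (\<forall>d. pro_map (Lev Q d) (Lev Q' d) (F d)) \<and>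
     (\<forall>m d. \<forall>\<alpha>\<in>simp_ops m d. \<forall>n k. \<forall>x\<in>Hom (Lev Q d) n k.
        F m n k (LAct Q d \<alpha> n k x) = LAct Q' d \<alpha> n k (F d n k x))"

text \<open>Lawvere \<open>sSet\<close>-theories. Preservation of the operators \<open>LAct\<close> by the degreewise functors from
  finite sets, which is part of \<open>law_map\<close>, says that these form an enriched functor from the
  opposite of finite sets with discrete homs.\<close>

definition is_slaw :: "'a slaw \<Rightarrow> bool" where
  "is_slaw T \<longleftrightarrow> (\<forall>n k. simplicial_set (shom T n k)) \<and> (\<forall>d. is_law (Lev T d)) \<and>
     (\<forall>m d. \<forall>\<alpha>\<in>simp_ops m d. law_map (Lev T d) (Lev T m) (LAct T d \<alpha>))"

definition slaw_map :: "'a slaw \<Rightarrow> 'b slaw \<Rightarrow> (nat \<Rightarrow> nat \<Rightarrow> nat \<Rightarrow> 'a \<Rightarrow> 'b) \<Rightarrow> bool" where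
  "slaw_map T T' F \<longleftrightarrow> (\<forall>d. law_map (Lev T d) (Lev T' d) (F d)) \<and>
     (\<forall>m d. \<forall>\<alpha>\<in>simp_ops m d. \<forall>n k. \<forall>x\<in>Hom (Lev T d) n k.
        F m n k (LAct T d \<alpha> n k x) = LAct T' d \<alpha> n k (F d n k x))"

definition slaw_pro :: "'a slaw \<Rightarrow> 'a spro" where
  "slaw_pro T = \<lparr>Lev = (\<lambda>d. law_pro (Lev T d)), LAct = LAct T\<rparr>"

definition disc :: "'c \<Rightarrow> ('c, 'a) enr" where
  "disc C = \<lparr>Lev = (\<lambda>_. C), LAct = (\<lambda>_ _ _ _ x. x)\<rparr>"

definition slaw_weak_equivalence ::
  "'a slaw \<Rightarrow> 'b slaw \<Rightarrow> (nat \<Rightarrow> nat \<Rightarrow> nat \<Rightarrow> 'a \<Rightarrow> 'b) \<Rightarrow> bool" where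
  "slaw_weak_equivalence T T' F \<longleftrightarrow>
     (\<forall>n m. sset_weak_equivalence (shom T n m) (shom T' n m) (\<lambda>d. F d n m))"

text \<open>Degreewise presentation: \<open>G d\<close> and \<open>R d\<close> are generators and relations in degree \<open>d\<close>, and
  \<open>\<gamma> d \<alpha> n k\<close> is the action of \<open>\<alpha>\<close> on generators \<open>n \<rightarrow> k\<close>.\<close>

definition spres :: "(nat \<Rightarrow> nat \<Rightarrow> nat \<Rightarrow> 'g set) \<Rightarrow>
    (nat \<Rightarrow> (nat \<times> nat \<times> 'g expr \<times> 'g expr) set) \<Rightarrow>
    (nat \<Rightarrow> nat list \<Rightarrow> nat \<Rightarrow> nat \<Rightarrow> 'g \<Rightarrow> 'g) \<Rightarrow> 'g expr set slaw" where
  "spres G R \<gamma> = \<lparr>Lev = (\<lambda>d. pres (G d) (R d)),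
     LAct = (\<lambda>d \<alpha>. let m = length \<alpha> - 1 in
       pres_lift (pres (G m) (R m)) (\<lambda>n k g. pres_gen (G m) (R m) n k (\<gamma> d \<alpha> n k g)))\<rparr>"


lemma slaw_Lev: "is_slaw T \<Longrightarrow> is_law (Lev T d)"
  and slaw_LAct: "is_slaw T \<Longrightarrow> \<alpha> \<in> simp_ops m d \<Longrightarrow> law_map (Lev T d) (Lev T m) (LAct T d \<alpha>)"
  by (auto simp: is_slaw_def)

lemma slaw_LAct_id: "is_slaw T \<Longrightarrow> x \<in> Hom (Lev T d) n k \<Longrightarrow> LAct T d [0..<Suc d] n k x = x"
  unfolding is_slaw_def simplicial_set_def shom_def by (elim conjE) simp

lemma slaw_LAct_comp: "is_slaw T \<Longrightarrow> \<beta> \<in> simp_ops l m \<Longrightarrow> \<alpha> \<in> simp_ops m d \<Longrightarrow>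
    x \<in> Hom (Lev T d) n k \<Longrightarrow>
    LAct T m \<beta> n k (LAct T d \<alpha> n k x) = LAct T d (map ((!) \<alpha>) \<beta>) n k x"
  unfolding is_slaw_def simplicial_set_def shom_def by (elim conjE) simp

lemma slawI:
  assumes "\<And>d. is_law (Lev T d)"
    and act: "\<And>m d \<alpha>. \<alpha> \<in> simp_ops m d \<Longrightarrow> law_map (Lev T d) (Lev T m) (LAct T d \<alpha>)"
    and "\<And>d n k x. x \<in> Hom (Lev T d) n k \<Longrightarrow> LAct T d [0..<Suc d] n k x = x"
    and "\<And>l m d \<alpha> \<beta> n k x. \<beta> \<in> simp_ops l m \<Longrightarrow> \<alpha> \<in> simp_ops m d \<Longrightarrow> x \<in> Hom (Lev T d) n k \<Longrightarrow>
      LAct T m \<beta> n k (LAct T d \<alpha> n k x) = LAct T d (map ((!) \<alpha>) \<beta>) n k x"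
  shows "is_slaw T"
  unfolding is_slaw_def simplicial_set_def shom_def
  using assms law_map_Hom[OF act] by simp

lemma simp_ops_comp: "\<beta> \<in> simp_ops l m \<Longrightarrow> \<alpha> \<in> simp_ops m d \<Longrightarrow> map ((!) \<alpha>) \<beta> \<in> simp_ops l d"
  unfolding simp_ops_def
  by (auto simp: sorted_iff_nth_mono subset_iff less_Suc_eq_le intro!: nth_mem)

lemma simp_ops_id: "[0..<Suc d] \<in> simp_ops d d"
  unfolding simp_ops_def by (auto simp del: upt_Suc)

lemma simp_ops_length: "\<alpha> \<in> simp_ops m d \<Longrightarrow> length \<alpha> = Suc m"
  by (simp add: simp_ops_def)

lemma law_map_id: "law_map L L (\<lambda>n k x. x)"
  by (simp add: law_map_def)

lemma law_map_compose:
  assumes F: "law_map L L' F" and F': "law_map L' L'' F'"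
  shows "law_map L L'' (\<lambda>n k x. F' n k (F n k x))"
  unfolding law_map_def
  using law_map_Hom[OF F] law_map_Hom[OF F'] law_map_Comp[OF F] law_map_Comp[OF F']
    law_map_Fin[OF F] law_map_Fin[OF F'] by simp

lemma disc_sel: "Lev (disc C) d = C" "LAct (disc C) d \<alpha> n k x = x"
  by (simp_all add: disc_def)

lemma is_slaw_disc: "is_law L \<Longrightarrow> is_slaw (disc L)"
  by (rule slawI) (simp_all add: disc_def law_map_id)

lemma slaw_mapI:
  assumes "\<And>d. law_map (Lev T d) (Lev T' d) (F d)"
    and "\<And>m d \<alpha> n k x. \<alpha> \<in> simp_ops m d \<Longrightarrow> x \<in> Hom (Lev T d) n k \<Longrightarrow>
      F m n k (LAct T d \<alpha> n k x) = LAct T' d \<alpha> n k (F d n k x)"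
  shows "slaw_map T T' F"
  using assms by (simp add: slaw_map_def)

lemma slaw_map_law: "slaw_map T T' F \<Longrightarrow> law_map (Lev T d) (Lev T' d) (F d)"
  and slaw_map_act: "slaw_map T T' F \<Longrightarrow> \<alpha> \<in> simp_ops m d \<Longrightarrow> x \<in> Hom (Lev T d) n k \<Longrightarrow>
      F m n k (LAct T d \<alpha> n k x) = LAct T' d \<alpha> n k (F d n k x)"
  by (auto simp: slaw_map_def)

lemma slaw_map_compose:
  assumes F: "slaw_map T T' F" and F': "slaw_map T' T'' F'"
  shows "slaw_map T T'' (\<lambda>d n k x. F' d n k (F d n k x))"
proof (rule slaw_mapI)
  show "law_map (Lev T d) (Lev T'' d) (\<lambda>n k x. F' d n k (F d n k x))" for d
    by (rule law_map_compose[OF slaw_map_law[OF F] slaw_map_law[OF F']])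
  fix m d \<alpha> n k x assume a: "\<alpha> \<in> simp_ops m d" and x: "x \<in> Hom (Lev T d) n k"
  have "F d n k x \<in> Hom (Lev T' d) n k" by (rule law_map_Hom[OF slaw_map_law[OF F] x])
  then show "F' m n k (F m n k (LAct T d \<alpha> n k x)) = LAct T'' d \<alpha> n k (F' d n k (F d n k x))"
    by (simp add: slaw_map_act[OF F a x] slaw_map_act[OF F' a])
qed

lemma pres_gen_Hom: "g \<in> G n k \<Longrightarrow> pres_gen G R n k g \<in> Hom (pres G R) n k"
  unfolding pres_gen_def by (rule pres_HomI, rule eGen)

lemma pres_lift_gen:
  "is_law L \<Longrightarrow> pres_model G R L \<phi> \<Longrightarrow> g \<in> G n k \<Longrightarrow> pres_lift L \<phi> n k (pres_gen G R n k g) = \<phi> n k g"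
  using pres_lift_map(2) by blast

lemma rel_class: "(n, k, e, e') \<in> R \<Longrightarrow> expr_eq G R n k e e \<Longrightarrow> expr_eq G R n k e' e' \<Longrightarrow>
    expr_class G R n k e = expr_class G R n k e'"
  by (rule expr_class_eqI, rule eRel)

lemma spres_Lev: "Lev (spres G R \<gamma>) d = pres (G d) (R d)"
  by (simp add: spres_def)

lemma spres_LAct: "\<alpha> \<in> simp_ops m d \<Longrightarrow> LAct (spres G R \<gamma>) d \<alpha> =
    pres_lift (pres (G m) (R m)) (\<lambda>n k g. pres_gen (G m) (R m) n k (\<gamma> d \<alpha> n k g))"
  by (simp add: spres_def simp_ops_length)

locale simplicial_presentation =
  fixes G :: "nat \<Rightarrow> nat \<Rightarrow> nat \<Rightarrow> 'g set" and R \<gamma>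
  assumes gen: "\<And>m d \<alpha> n k g. \<alpha> \<in> simp_ops m d \<Longrightarrow> g \<in> G d n k \<Longrightarrow> \<gamma> d \<alpha> n k g \<in> G m n k"
    and gen_id: "\<And>d n k g. g \<in> G d n k \<Longrightarrow> \<gamma> d [0..<Suc d] n k g = g"
    and gen_comp: "\<And>l m d \<alpha> \<beta> n k g. \<beta> \<in> simp_ops l m \<Longrightarrow> \<alpha> \<in> simp_ops m d \<Longrightarrow> g \<in> G d n k \<Longrightarrow>
      \<gamma> m \<beta> n k (\<gamma> d \<alpha> n k g) = \<gamma> d (map ((!) \<alpha>) \<beta>) n k g"
    and rel: "\<And>m d \<alpha>. \<alpha> \<in> simp_ops m d \<Longrightarrow> pres_model (G d) (R d) (pres (G m) (R m))
      (\<lambda>n k g. pres_gen (G m) (R m) n k (\<gamma> d \<alpha> n k g))"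
begin

lemma act_gen:
  assumes a: "\<alpha> \<in> simp_ops m d" and g: "g \<in> G d n k"
  shows "LAct (spres G R \<gamma>) d \<alpha> n k (pres_gen (G d) (R d) n k g)
    = pres_gen (G m) (R m) n k (\<gamma> d \<alpha> n k g)"
  unfolding spres_LAct[OF a] by (rule pres_lift_gen[OF is_law_pres rel[OF a], of g n k, OF g])

lemma act_map:
  assumes a: "\<alpha> \<in> simp_ops m d"
  shows "law_map (pres (G d) (R d)) (pres (G m) (R m)) (LAct (spres G R \<gamma>) d \<alpha>)"
  unfolding spres_LAct[OF a] by (rule pres_lift_map[OF is_law_pres rel[OF a]])

lemma is_slaw_spres: "is_slaw (spres G R \<gamma>)"
proof (rule slawI; (unfold spres_Lev)?)
  show "is_law (pres (G d) (R d))" for d by (rule is_law_pres)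
  show "law_map (pres (G d) (R d)) (pres (G m) (R m)) (LAct (spres G R \<gamma>) d \<alpha>)"
    if "\<alpha> \<in> simp_ops m d" for m d \<alpha> by (rule act_map[OF that])
  show "LAct (spres G R \<gamma>) d [0..<Suc d] n k x = x" if x: "x \<in> Hom (pres (G d) (R d)) n k" for d n k x
  proof (rule pres_map_unique[OF is_law_pres act_map[OF simp_ops_id] law_map_id _ x])
    fix n k g assume g: "g \<in> G d n k"
    show "LAct (spres G R \<gamma>) d [0..<Suc d] n k (pres_gen (G d) (R d) n k g) = pres_gen (G d) (R d) n k g"
      unfolding act_gen[OF simp_ops_id, of g d n k, OF g] gen_id[of g d n k, OF g] ..
  qed
  fix l m d \<alpha> \<beta> n k x
  assume b: "\<beta> \<in> simp_ops l m" and a: "\<alpha> \<in> simp_ops m d" and x: "x \<in> Hom (pres (G d) (R d)) n k"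
  show "LAct (spres G R \<gamma>) m \<beta> n k (LAct (spres G R \<gamma>) d \<alpha> n k x)
      = LAct (spres G R \<gamma>) d (map ((!) \<alpha>) \<beta>) n k x"
  proof (rule pres_map_unique[OF is_law_pres law_map_compose[OF act_map[OF a] act_map[OF b]]
        act_map[OF simp_ops_comp[OF b a]] _ x])
    fix n k g assume g: "g \<in> G d n k"
    show "LAct (spres G R \<gamma>) m \<beta> n k (LAct (spres G R \<gamma>) d \<alpha> n k (pres_gen (G d) (R d) n k g))
      = LAct (spres G R \<gamma>) d (map ((!) \<alpha>) \<beta>) n k (pres_gen (G d) (R d) n k g)"
      unfolding act_gen[OF a, of g n k, OF g] act_gen[OF b, of "\<gamma> d \<alpha> n k g" n k, OF gen[OF a g]]
        act_gen[OF simp_ops_comp[OF b a], of g n k, OF g] gen_comp[OF b a g] ..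
  qed
qed

lemma lift_slaw_map:
  assumes T: "is_slaw T" and m: "\<And>d. pres_model (G d) (R d) (Lev T d) (\<phi> d)"
    and nat: "\<And>m d \<alpha> n k g. \<alpha> \<in> simp_ops m d \<Longrightarrow> g \<in> G d n k \<Longrightarrow>
      \<phi> m n k (\<gamma> d \<alpha> n k g) = LAct T d \<alpha> n k (\<phi> d n k g)"
  shows "slaw_map (spres G R \<gamma>) T (\<lambda>d. pres_lift (Lev T d) (\<phi> d))"
proof (rule slaw_mapI; unfold spres_Lev)
  show l: "law_map (pres (G d) (R d)) (Lev T d) (pres_lift (Lev T d) (\<phi> d))" for d
    by (rule pres_lift_map[OF slaw_Lev[OF T] m])
  fix m d \<alpha> n k x
  assume a: "\<alpha> \<in> simp_ops m d" and x: "x \<in> Hom (pres (G d) (R d)) n k"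
  show "pres_lift (Lev T m) (\<phi> m) n k (LAct (spres G R \<gamma>) d \<alpha> n k x)
      = LAct T d \<alpha> n k (pres_lift (Lev T d) (\<phi> d) n k x)"
  proof (rule pres_map_unique[OF slaw_Lev[OF T] law_map_compose[OF act_map[OF a] l]
        law_map_compose[OF l slaw_LAct[OF T a]] _ x])
    fix n k g assume g: "g \<in> G d n k"
    show "pres_lift (Lev T m) (\<phi> m) n k (LAct (spres G R \<gamma>) d \<alpha> n k (pres_gen (G d) (R d) n k g))
      = LAct T d \<alpha> n k (pres_lift (Lev T d) (\<phi> d) n k (pres_gen (G d) (R d) n k g))"
      unfolding act_gen[OF a, of g n k, OF g]
        pres_lift_gen[OF slaw_Lev[OF T] m, of g d n k, OF g]
        pres_lift_gen[OF slaw_Lev[OF T] m, of "\<gamma> d \<alpha> n k g" m n k, OF gen[OF a g]]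
      by (rule nat[OF a g])
  qed
qed

end


section \<open>Free Lawvere theories on pros, and pushouts\<close>

text \<open>The free Lawvere theory on a pro \<open>P\<close> is generated by the morphisms of \<open>P\<close>, subject to the
  relations making \<open>P \<rightarrow> L\<^sub>P\<close> a map of pros.\<close>

definition tensE :: "nat \<Rightarrow> nat \<Rightarrow> nat \<Rightarrow> nat \<Rightarrow> 'g expr \<Rightarrow> 'g expr \<Rightarrow> 'g expr" where
  "tensE n k n' k' e e' = PairE (n + n') k k'
     (CompE (n + n') n k e (FinE (n + n') n [0..<n]))
     (CompE (n + n') n' k' e' (FinE (n + n') n' [n..<n + n']))"

definition free_rel :: "'a pro \<Rightarrow> (nat \<times> nat \<times> 'a expr \<times> 'a expr) set" where
  "free_rel P =
     {(n, k, CompE n m k (Gen m k g) (Gen n m f), Gen n k (Comp P n m k g f)) | n m k f g.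
        f \<in> Hom P n m \<and> g \<in> Hom P m k} \<union>
     {(n, n, FinE n n [0..<n], Gen n n (Idn P n)) | n. True} \<union>
     {(n + n', k + k', tensE n k n' k' (Gen n k f) (Gen n' k' g),
         Gen (n + n') (k + k') (Tens P n k n' k' f g)) | n k n' k' f g.
        f \<in> Hom P n k \<and> g \<in> Hom P n' k'}"

definition free_law :: "'a pro \<Rightarrow> 'a expr set law" where
  "free_law P = pres (Hom P) (free_rel P)"

definition free_unit :: "'a pro \<Rightarrow> nat \<Rightarrow> nat \<Rightarrow> 'a \<Rightarrow> 'a expr set" where
  "free_unit P = pres_gen (Hom P) (free_rel P)"

definition sfree_law :: "'a spro \<Rightarrow> 'a expr set slaw" where
  "sfree_law Q = spres (\<lambda>d. Hom (Lev Q d)) (\<lambda>d. free_rel (Lev Q d)) (LAct Q)"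

definition sfree_unit :: "'a spro \<Rightarrow> nat \<Rightarrow> nat \<Rightarrow> nat \<Rightarrow> 'a \<Rightarrow> 'a expr set" where
  "sfree_unit Q d = free_unit (Lev Q d)"

text \<open>The pushout of \<open>T1 \<leftarrow> T0 \<rightarrow> T2\<close> along \<open>F1\<close>, \<open>F2\<close>, presented degreewise by the morphisms of
  \<open>T1\<close> and \<open>T2\<close>. Its universal property is given by \<open>po_in_slaw_map\<close>, \<open>po_square\<close>, \<open>po_lift_map\<close>
  and \<open>po_unique\<close>.\<close>

definition po_gens :: "'b law \<Rightarrow> 'c law \<Rightarrow> nat \<Rightarrow> nat \<Rightarrow> ('b + 'c) set" where
  "po_gens L1 L2 n k = Hom L1 n k <+> Hom L2 n k"

definition po_rel :: "'a law \<Rightarrow> 'b law \<Rightarrow> 'c law \<Rightarrow> (nat \<Rightarrow> nat \<Rightarrow> 'a \<Rightarrow> 'b) \<Rightarrow>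
    (nat \<Rightarrow> nat \<Rightarrow> 'a \<Rightarrow> 'c) \<Rightarrow> (nat \<times> nat \<times> ('b + 'c) expr \<times> ('b + 'c) expr) set" where
  "po_rel L0 L1 L2 F1 F2 =
     {(n, k, CompE n m k (Gen m k (Inl g)) (Gen n m (Inl f)), Gen n k (Inl (Comp L1 n m k g f)))
        | n m k f g. f \<in> Hom L1 n m \<and> g \<in> Hom L1 m k} \<union>
     {(n, k, FinE n k xs, Gen n k (Inl (Fin L1 n k xs))) | n k xs. xs \<in> fin_hom n k} \<union>
     {(n, k, CompE n m k (Gen m k (Inr g)) (Gen n m (Inr f)), Gen n k (Inr (Comp L2 n m k g f)))
        | n m k f g. f \<in> Hom L2 n m \<and> g \<in> Hom L2 m k} \<union>
     {(n, k, FinE n k xs, Gen n k (Inr (Fin L2 n k xs))) | n k xs. xs \<in> fin_hom n k} \<union>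
     {(n, k, Gen n k (Inl (F1 n k f)), Gen n k (Inr (F2 n k f))) | n k f. f \<in> Hom L0 n k}"

definition spushout :: "'a slaw \<Rightarrow> 'b slaw \<Rightarrow> 'c slaw \<Rightarrow> (nat \<Rightarrow> nat \<Rightarrow> nat \<Rightarrow> 'a \<Rightarrow> 'b) \<Rightarrow>
    (nat \<Rightarrow> nat \<Rightarrow> nat \<Rightarrow> 'a \<Rightarrow> 'c) \<Rightarrow> ('b + 'c) expr set slaw" where
  "spushout T0 T1 T2 F1 F2 = spres (\<lambda>d. po_gens (Lev T1 d) (Lev T2 d))
     (\<lambda>d. po_rel (Lev T0 d) (Lev T1 d) (Lev T2 d) (F1 d) (F2 d))
     (\<lambda>d \<alpha> n k. map_sum (LAct T1 d \<alpha> n k) (LAct T2 d \<alpha> n k))"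

definition po_in1 :: "'a slaw \<Rightarrow> 'b slaw \<Rightarrow> 'c slaw \<Rightarrow> (nat \<Rightarrow> nat \<Rightarrow> nat \<Rightarrow> 'a \<Rightarrow> 'b) \<Rightarrow>
    (nat \<Rightarrow> nat \<Rightarrow> nat \<Rightarrow> 'a \<Rightarrow> 'c) \<Rightarrow> nat \<Rightarrow> nat \<Rightarrow> nat \<Rightarrow> 'b \<Rightarrow> ('b + 'c) expr set" where
  "po_in1 T0 T1 T2 F1 F2 d n k x = pres_gen (po_gens (Lev T1 d) (Lev T2 d))
     (po_rel (Lev T0 d) (Lev T1 d) (Lev T2 d) (F1 d) (F2 d)) n k (Inl x)"

definition po_in2 :: "'a slaw \<Rightarrow> 'b slaw \<Rightarrow> 'c slaw \<Rightarrow> (nat \<Rightarrow> nat \<Rightarrow> nat \<Rightarrow> 'a \<Rightarrow> 'b) \<Rightarrow>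
    (nat \<Rightarrow> nat \<Rightarrow> nat \<Rightarrow> 'a \<Rightarrow> 'c) \<Rightarrow> nat \<Rightarrow> nat \<Rightarrow> nat \<Rightarrow> 'c \<Rightarrow> ('b + 'c) expr set" where
  "po_in2 T0 T1 T2 F1 F2 d n k x = pres_gen (po_gens (Lev T1 d) (Lev T2 d))
     (po_rel (Lev T0 d) (Lev T1 d) (Lev T2 d) (F1 d) (F2 d)) n k (Inr x)"

definition po_lift :: "'d slaw \<Rightarrow> (nat \<Rightarrow> nat \<Rightarrow> nat \<Rightarrow> 'b \<Rightarrow> 'd) \<Rightarrow>
    (nat \<Rightarrow> nat \<Rightarrow> nat \<Rightarrow> 'c \<Rightarrow> 'd) \<Rightarrow> nat \<Rightarrow> nat \<Rightarrow> nat \<Rightarrow> ('b + 'c) expr set \<Rightarrow> 'd" where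
  "po_lift T H1 H2 d = pres_lift (Lev T d) (\<lambda>n k. case_sum (H1 d n k) (H2 d n k))"


lemma law_pro_sel: "Hom (law_pro L) = Hom L" "Comp (law_pro L) = Comp L" "Idn (law_pro L) = Idn L"
  by (simp_all add: law_pro_def)

lemma law_pro_Tens: "Tens (law_pro L) n k n' k' f g = pairing L (n + n') k k'
    (Comp L (n + n') n k f (prj1 L n n')) (Comp L (n + n') n' k' g (prj2 L n n'))"
  by (simp add: law_pro_def)

lemma pro_cat: "is_pro P \<Longrightarrow> is_cat P"
  and pro_Id: "is_pro P \<Longrightarrow> Idn P n \<in> Hom P n n"
  and pro_Tens: "is_pro P \<Longrightarrow> f \<in> Hom P n k \<Longrightarrow> g \<in> Hom P n' k' \<Longrightarrow>
    Tens P n k n' k' f g \<in> Hom P (n + n') (k + k')"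
  by (auto simp: is_pro_def is_cat_def)

lemma pro_map_Hom: "pro_map P Q F \<Longrightarrow> f \<in> Hom P n k \<Longrightarrow> F n k f \<in> Hom Q n k"
  and pro_map_Id: "pro_map P Q F \<Longrightarrow> F n n (Idn P n) = Idn Q n"
  and pro_map_Comp: "pro_map P Q F \<Longrightarrow> f \<in> Hom P n m \<Longrightarrow> g \<in> Hom P m k \<Longrightarrow>
    F n k (Comp P n m k g f) = Comp Q n m k (F m k g) (F n m f)"
  and pro_map_Tens: "pro_map P Q F \<Longrightarrow> f \<in> Hom P n k \<Longrightarrow> g \<in> Hom P n' k' \<Longrightarrow>
    F (n + n') (k + k') (Tens P n k n' k' f g) = Tens Q n k n' k' (F n k f) (F n' k' g)"
  by (auto simp: pro_map_def)

lemma pro_map_compose: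
  assumes F: "pro_map P Q F" and F': "pro_map Q S F'"
  shows "pro_map P S (\<lambda>n k x. F' n k (F n k x))"
  unfolding pro_map_def
  using pro_map_Hom[OF F] pro_map_Hom[OF F'] pro_map_Comp[OF F] pro_map_Comp[OF F']
    pro_map_Id[OF F] pro_map_Id[OF F'] pro_map_Tens[OF F] pro_map_Tens[OF F'] by simp

lemma pairing_precomp_closed:
  assumes L: "is_law L" and f: "f \<in> Hom L n k" and g: "g \<in> Hom L n' k'"
  shows "Comp L (n + n') n k f (prj1 L n n') \<in> Hom L (n + n') k"
    and "Comp L (n + n') n' k' g (prj2 L n n') \<in> Hom L (n + n') k'"
  using cat_Comp[OF is_law_cat[OF L] law_Fin[OF L fin_hom_prj(2)] f]
    cat_Comp[OF is_law_cat[OF L] law_Fin[OF L fin_hom_prj(3)] g] by simp_all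

lemma law_map_pro_map:
  assumes F: "law_map L L' F" and L: "is_law L" and L': "is_law L'"
  shows "pro_map (law_pro L) (law_pro L') F"
  unfolding pro_map_def law_pro_sel law_pro_Tens
proof (intro conjI allI ballI)
  show "F n k f \<in> Hom L' n k" if "f \<in> Hom L n k" for n k f by (rule law_map_Hom[OF F that])
  show "F n n (Idn L n) = Idn L' n" for n
    using law_map_Fin[OF F fin_hom_prj(1)] by (simp add: law_Id[OF L] law_Id[OF L'])
  show "F n k (Comp L n m k g f) = Comp L' n m k (F m k g) (F n m f)"
    if "f \<in> Hom L n m" "g \<in> Hom L m k" for n m k f g by (rule law_map_Comp[OF F that])
  fix n k n' k' f g assume f: "f \<in> Hom L n k" and g: "g \<in> Hom L n' k'"
  note c = pairing_precomp_closed[OF L f g]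
  show "F (n + n') (k + k') (pairing L (n + n') k k'
        (Comp L (n + n') n k f (prj1 L n n')) (Comp L (n + n') n' k' g (prj2 L n n'))) =
      pairing L' (n + n') k k' (Comp L' (n + n') n k (F n k f) (prj1 L' n n'))
        (Comp L' (n + n') n' k' (F n' k' g) (prj2 L' n n'))"
    unfolding law_map_pairing[OF F L L' c] law_map_Comp[OF F law_Fin[OF L fin_hom_prj(2)] f]
      law_map_Comp[OF F law_Fin[OF L fin_hom_prj(3)] g] law_map_Fin[OF F fin_hom_prj(2)]
      law_map_Fin[OF F fin_hom_prj(3)] ..
qed

lemma free_model:
  assumes F: "pro_map P (law_pro L) F" and L: "is_law L"
  shows "pres_model (Hom P) (free_rel P) L F"
  unfolding pres_model_def
proof (intro conjI allI ballI impI)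
  show "F n k g \<in> Hom L n k" if "g \<in> Hom P n k" for n k g
    using pro_map_Hom[OF F that] by (simp add: law_pro_sel)
  fix n k e e' assume "(n, k, e, e') \<in> free_rel P"
  then show "expr_eval L F e = expr_eval L F e'"
    using pro_map_Comp[OF F] pro_map_Id[OF F] pro_map_Tens[OF F]
    by (auto simp: free_rel_def tensE_def law_pro_sel law_pro_Tens law_Id[OF L])
qed

lemma is_law_free_law: "is_law (free_law P)"
  unfolding free_law_def by (rule is_law_pres)

lemma free_unit_map:
  assumes P: "is_pro P"
  shows "pro_map P (law_pro (free_law P)) (free_unit P)"
  unfolding pro_map_def law_pro_sel
proof (intro conjI allI ballI)
  let ?cl = "expr_class (Hom P) (free_rel P)"
  show "free_unit P n k f \<in> Hom (free_law P) n k" if "f \<in> Hom P n k" for n k f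
    unfolding free_unit_def free_law_def by (rule pres_gen_Hom[of f "Hom P" n k, OF that])
  have G: "expr_eq (Hom P) (free_rel P) n k (Gen n k f) (Gen n k f)" if "f \<in> Hom P n k" for n k f
    using that by (rule eGen)
  note N = eFin[OF fin_hom_prj(1)] eFin[OF fin_hom_prj(2)] eFin[OF fin_hom_prj(3)]
  show "free_unit P n n (Idn P n) = Idn (free_law P) n" for n
    unfolding free_unit_def free_law_def pres_gen_def pres_Idn
  proof (rule rel_class[symmetric])
    show "(n, n, FinE n n [0..<n], Gen n n (Idn P n)) \<in> free_rel P"
      unfolding free_rel_def by blast
  qed (intro N G pro_Id[OF P])+
  show "free_unit P n k (Comp P n m k g f) = Comp (free_law P) n m k (free_unit P m k g) (free_unit P n m f)"
    if f: "f \<in> Hom P n m" and g: "g \<in> Hom P m k" for n m k f g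
    unfolding free_unit_def free_law_def pres_gen_def pres_Comp[OF G[OF g] G[OF f]]
  proof (rule rel_class[symmetric])
    show "(n, k, CompE n m k (Gen m k g) (Gen n m f), Gen n k (Comp P n m k g f)) \<in> free_rel P"
      using f g unfolding free_rel_def by blast
    show "expr_eq (Hom P) (free_rel P) n k (CompE n m k (Gen m k g) (Gen n m f))
      (CompE n m k (Gen m k g) (Gen n m f))" by (intro eComp G f g)
    show "expr_eq (Hom P) (free_rel P) n k (Gen n k (Comp P n m k g f)) (Gen n k (Comp P n m k g f))"
      by (intro G cat_Comp[OF pro_cat[OF P]] f g)
  qed
  fix n k n' k' f g assume f: "f \<in> Hom P n k" and g: "g \<in> Hom P n' k'"
  note e = eComp[OF G[OF f] N(2)] eComp[OF G[OF g] N(3)]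
  show "free_unit P (n + n') (k + k') (Tens P n k n' k' f g) =
      Tens (law_pro (free_law P)) n k n' k' (free_unit P n k f) (free_unit P n' k' g)"
    unfolding free_unit_def free_law_def pres_gen_def law_pro_Tens pres_Fin
      pres_Comp[OF G[OF f] N(2)] pres_Comp[OF G[OF g] N(3)] pres_pairing[OF e]
  proof (rule rel_class[symmetric], fold tensE_def)
    show "(n + n', k + k', tensE n k n' k' (Gen n k f) (Gen n' k' g),
        Gen (n + n') (k + k') (Tens P n k n' k' f g)) \<in> free_rel P"
      using f g unfolding free_rel_def by blast
    show "expr_eq (Hom P) (free_rel P) (n + n') (k + k') (tensE n k n' k' (Gen n k f) (Gen n' k' g))
        (tensE n k n' k' (Gen n k f) (Gen n' k' g))"
      unfolding tensE_def by (rule ePair[OF e])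
    show "expr_eq (Hom P) (free_rel P) (n + n') (k + k')
        (Gen (n + n') (k + k') (Tens P n k n' k' f g)) (Gen (n + n') (k + k') (Tens P n k n' k' f g))"
      by (rule G[OF pro_Tens[OF P f g]])
  qed
qed

lemma spro_Lev: "is_spro Q \<Longrightarrow> is_pro (Lev Q d)"
  and spro_LAct: "is_spro Q \<Longrightarrow> \<alpha> \<in> simp_ops m d \<Longrightarrow> pro_map (Lev Q d) (Lev Q m) (LAct Q d \<alpha>)"
  by (auto simp: is_spro_def)

lemma sfree_presentation:
  assumes Q: "is_spro Q"
  shows "simplicial_presentation (\<lambda>d. Hom (Lev Q d)) (\<lambda>d. free_rel (Lev Q d)) (LAct Q)"
proof
  fix m d \<alpha> assume a: "\<alpha> \<in> simp_ops m d"
  show "LAct Q d \<alpha> n k g \<in> Hom (Lev Q m) n k" if "g \<in> Hom (Lev Q d) n k" for n k g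
    by (rule pro_map_Hom[OF spro_LAct[OF Q a] that])
  show "LAct Q m \<beta> n k (LAct Q d \<alpha> n k g) = LAct Q d (map ((!) \<alpha>) \<beta>) n k g"
    if "\<beta> \<in> simp_ops l m" "g \<in> Hom (Lev Q d) n k" for l \<beta> n k g
    using Q a that unfolding is_spro_def simplicial_set_def shom_def by (elim conjE) simp
  have "pro_map (Lev Q d) (law_pro (free_law (Lev Q m))) (\<lambda>n k g. free_unit (Lev Q m) n k (LAct Q d \<alpha> n k g))"
    by (rule pro_map_compose[OF spro_LAct[OF Q a] free_unit_map[OF spro_Lev[OF Q]]])
  from free_model[OF this is_law_free_law]
  show "pres_model (Hom (Lev Q d)) (free_rel (Lev Q d)) (pres (Hom (Lev Q m)) (free_rel (Lev Q m)))
     (\<lambda>n k g. pres_gen (Hom (Lev Q m)) (free_rel (Lev Q m)) n k (LAct Q d \<alpha> n k g))"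
    unfolding free_law_def free_unit_def .
next
  show "LAct Q d [0..<Suc d] n k g = g" if "g \<in> Hom (Lev Q d) n k" for d n k g
    using Q that unfolding is_spro_def simplicial_set_def shom_def by (elim conjE) simp
qed

lemma sfree_Lev: "Lev (sfree_law Q) d = free_law (Lev Q d)"
  by (simp add: sfree_law_def spres_Lev free_law_def)

text \<open>The universal property of \<open>sfree_law Q\<close>: the unit is a map of \<open>sSet\<close>-pros, and every map of
  \<open>sSet\<close>-pros to (the underlying pro of) a Lawvere \<open>sSet\<close>-theory factors uniquely through it.\<close>

theorem is_slaw_sfree: "is_spro Q \<Longrightarrow> is_slaw (sfree_law Q)"
  unfolding sfree_law_def by (rule simplicial_presentation.is_slaw_spres[OF sfree_presentation])

theorem sfree_unit_map:
  assumes Q: "is_spro Q"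
  shows "spro_map Q (slaw_pro (sfree_law Q)) (sfree_unit Q)"
  unfolding spro_map_def slaw_pro_def sfree_unit_def
proof (simp add: sfree_Lev free_unit_map[OF spro_Lev[OF Q]], intro allI ballI)
  fix m d \<alpha> n k x assume a: "\<alpha> \<in> simp_ops m d" and x: "x \<in> Hom (Lev Q d) n k"
  show "free_unit (Lev Q m) n k (LAct Q d \<alpha> n k x) = LAct (sfree_law Q) d \<alpha> n k (free_unit (Lev Q d) n k x)"
    using simplicial_presentation.act_gen[OF sfree_presentation[OF Q] a x]
    by (simp add: sfree_law_def free_unit_def)
qed

theorem sfree_lift:
  assumes Q: "is_spro Q" and T: "is_slaw T" and F: "spro_map Q (slaw_pro T) F"
  defines "F' \<equiv> \<lambda>d. pres_lift (Lev T d) (F d)"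
  shows "slaw_map (sfree_law Q) T F'"
    and "x \<in> Hom (Lev Q d) n k \<Longrightarrow> F' d n k (sfree_unit Q d n k x) = F d n k x"
proof -
  have F1: "pro_map (Lev Q d) (law_pro (Lev T d)) (F d)" for d
    using F by (simp add: spro_map_def slaw_pro_def)
  have F2: "F m n k (LAct Q d \<alpha> n k x) = LAct T d \<alpha> n k (F d n k x)"
    if "\<alpha> \<in> simp_ops m d" "x \<in> Hom (Lev Q d) n k" for m d \<alpha> n k x
    using F that by (simp add: spro_map_def slaw_pro_def)
  show "slaw_map (sfree_law Q) T F'"
    unfolding F'_def sfree_law_def
    by (rule simplicial_presentation.lift_slaw_map[OF sfree_presentation[OF Q] T
          free_model[OF F1 slaw_Lev[OF T]] F2])
  show "F' d n k (sfree_unit Q d n k x) = F d n k x" if "x \<in> Hom (Lev Q d) n k"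
    unfolding F'_def sfree_unit_def free_unit_def
    by (rule pres_lift_gen[of _ "Hom (Lev Q d)" _ _ x n k,
          OF slaw_Lev[OF T] free_model[OF F1 slaw_Lev[OF T]] that])
qed

theorem sfree_unique:
  assumes T: "is_slaw T" and F: "slaw_map (sfree_law Q) T F" and F': "slaw_map (sfree_law Q) T F'"
    and eq: "\<And>d n k x. x \<in> Hom (Lev Q d) n k \<Longrightarrow>
      F d n k (sfree_unit Q d n k x) = F' d n k (sfree_unit Q d n k x)"
    and y: "y \<in> Hom (Lev (sfree_law Q) d) n k"
  shows "F d n k y = F' d n k y"
proof (rule pres_map_unique[OF slaw_Lev[OF T, of d]])
  show "law_map (pres (Hom (Lev Q d)) (free_rel (Lev Q d))) (Lev T d) (F d)"
    using slaw_map_law[OF F, of d] by (simp add: sfree_Lev free_law_def)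
  show "law_map (pres (Hom (Lev Q d)) (free_rel (Lev Q d))) (Lev T d) (F' d)"
    using slaw_map_law[OF F', of d] by (simp add: sfree_Lev free_law_def)
  show "y \<in> Hom (pres (Hom (Lev Q d)) (free_rel (Lev Q d))) n k"
    using y by (simp add: sfree_Lev free_law_def)
  fix n k g assume "g \<in> Hom (Lev Q d) n k"
  from eq[OF this] show "F d n k (pres_gen (Hom (Lev Q d)) (free_rel (Lev Q d)) n k g) =
      F' d n k (pres_gen (Hom (Lev Q d)) (free_rel (Lev Q d)) n k g)"
    by (simp add: sfree_unit_def free_unit_def)
qed

text \<open>The universal property of the pushout.\<close>

lemma po_model:
  assumes H1: "law_map L1 L H1" and H2: "law_map L2 L H2"
    and eq: "\<And>n k f. f \<in> Hom L0 n k \<Longrightarrow> H1 n k (F1 n k f) = H2 n k (F2 n k f)"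
  shows "pres_model (po_gens L1 L2) (po_rel L0 L1 L2 F1 F2) L (\<lambda>n k. case_sum (H1 n k) (H2 n k))"
  unfolding pres_model_def
proof (intro conjI allI ballI impI)
  show "case_sum (H1 n k) (H2 n k) g \<in> Hom L n k" if "g \<in> po_gens L1 L2 n k" for n k g
    using that law_map_Hom[OF H1] law_map_Hom[OF H2] by (auto simp: po_gens_def)
  fix n k e e' assume "(n, k, e, e') \<in> po_rel L0 L1 L2 F1 F2"
  then show "expr_eval L (\<lambda>n k. case_sum (H1 n k) (H2 n k)) e = expr_eval L (\<lambda>n k. case_sum (H1 n k) (H2 n k)) e'"
    using law_map_Comp[OF H1] law_map_Comp[OF H2] law_map_Fin[OF H1] law_map_Fin[OF H2] eq
    by (auto simp: po_rel_def)
qed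

lemma po_gensI:
  "f \<in> Hom L1 n k \<Longrightarrow> Inl f \<in> po_gens L1 L2 n k"
  "f' \<in> Hom L2 n k \<Longrightarrow> Inr f' \<in> po_gens L1 L2 n k"
  unfolding po_gens_def by (rule InlI InrI, assumption)+

lemma po_gens_eq:
  "f \<in> Hom L1 n k \<Longrightarrow> expr_eq (po_gens L1 L2) R n k (Gen n k (Inl f)) (Gen n k (Inl f))"
  "f' \<in> Hom L2 n k \<Longrightarrow> expr_eq (po_gens L1 L2) R n k (Gen n k (Inr f')) (Gen n k (Inr f'))"
  by (rule eGen, erule po_gensI)+

lemma po_incl_map:
  fixes L0 L1 L2 F1 F2
  assumes L1: "is_law L1" and L2: "is_law L2"
  defines "G \<equiv> po_gens L1 L2" and "R \<equiv> po_rel L0 L1 L2 F1 F2"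
  shows "law_map L1 (pres G R) (\<lambda>n k x. pres_gen G R n k (Inl x))"
    and "law_map L2 (pres G R) (\<lambda>n k x. pres_gen G R n k (Inr x))"
proof -

  have g1: "expr_eq G R n k (Gen n k (Inl f)) (Gen n k (Inl f))" if "f \<in> Hom L1 n k" for n k f
    unfolding G_def by (rule po_gens_eq(1)[OF that])
  have g2: "expr_eq G R n k (Gen n k (Inr f)) (Gen n k (Inr f))" if "f \<in> Hom L2 n k" for n k f
    unfolding G_def by (rule po_gens_eq(2)[OF that])
  have c1: "expr_class G R n k (Gen n k (Inl (Comp L1 n m k g f))) =
      expr_class G R n k (CompE n m k (Gen m k (Inl g)) (Gen n m (Inl f)))"
    if "f \<in> Hom L1 n m" "g \<in> Hom L1 m k" for n m k f g
  proof (rule rel_class[symmetric])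
    show "(n, k, CompE n m k (Gen m k (Inl g)) (Gen n m (Inl f)), Gen n k (Inl (Comp L1 n m k g f))) \<in> R"
      using that unfolding R_def po_rel_def by blast
  qed (intro eComp g1 that cat_Comp[OF is_law_cat[OF L1]])+
  have c2: "expr_class G R n k (Gen n k (Inr (Comp L2 n m k g f))) =
      expr_class G R n k (CompE n m k (Gen m k (Inr g)) (Gen n m (Inr f)))"
    if "f \<in> Hom L2 n m" "g \<in> Hom L2 m k" for n m k f g
  proof (rule rel_class[symmetric])
    show "(n, k, CompE n m k (Gen m k (Inr g)) (Gen n m (Inr f)), Gen n k (Inr (Comp L2 n m k g f))) \<in> R"
      using that unfolding R_def po_rel_def by blast
  qed (intro eComp g2 that cat_Comp[OF is_law_cat[OF L2]])+
  have f1: "expr_class G R n k (Gen n k (Inl (Fin L1 n k xs))) = expr_class G R n k (FinE n k xs)"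
    if "xs \<in> fin_hom n k" for n k xs
  proof (rule rel_class[symmetric])
    show "(n, k, FinE n k xs, Gen n k (Inl (Fin L1 n k xs))) \<in> R"
      using that unfolding R_def po_rel_def by blast
  qed (intro eFin g1 that law_Fin[OF L1])+
  have f2: "expr_class G R n k (Gen n k (Inr (Fin L2 n k xs))) = expr_class G R n k (FinE n k xs)"
    if "xs \<in> fin_hom n k" for n k xs
  proof (rule rel_class[symmetric])
    show "(n, k, FinE n k xs, Gen n k (Inr (Fin L2 n k xs))) \<in> R"
      using that unfolding R_def po_rel_def by blast
  qed (intro eFin g2 that law_Fin[OF L2])+
  show "law_map L1 (pres G R) (\<lambda>n k x. pres_gen G R n k (Inl x))"
    unfolding law_map_def pres_gen_def pres_Fin
    using c1 f1 g1 by (simp add: pres_HomI pres_Comp)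
  show "law_map L2 (pres G R) (\<lambda>n k x. pres_gen G R n k (Inr x))"
    unfolding law_map_def pres_gen_def pres_Fin
    using c2 f2 g2 by (simp add: pres_HomI pres_Comp)
qed

context
  fixes T0 :: "'a slaw" and T1 :: "'b slaw" and T2 :: "'c slaw" and F1 F2
  assumes T0: "is_slaw T0" and T1: "is_slaw T1" and T2: "is_slaw T2"
    and F1: "slaw_map T0 T1 F1" and F2: "slaw_map T0 T2 F2"
begin

lemma po_in_law_map:
  "law_map (Lev T1 d) (Lev (spushout T0 T1 T2 F1 F2) d) (po_in1 T0 T1 T2 F1 F2 d)"
  "law_map (Lev T2 d) (Lev (spushout T0 T1 T2 F1 F2) d) (po_in2 T0 T1 T2 F1 F2 d)"
  unfolding spushout_def spres_Lev po_in1_def po_in2_def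
  by (rule po_incl_map[OF slaw_Lev[OF T1] slaw_Lev[OF T2]])+

lemma po_square:
  assumes x: "x \<in> Hom (Lev T0 d) n k"
  shows "po_in1 T0 T1 T2 F1 F2 d n k (F1 d n k x) = po_in2 T0 T1 T2 F1 F2 d n k (F2 d n k x)"
  unfolding po_in1_def po_in2_def pres_gen_def
proof (rule rel_class)
  show "(n, k, Gen n k (Inl (F1 d n k x)), Gen n k (Inr (F2 d n k x)))
      \<in> po_rel (Lev T0 d) (Lev T1 d) (Lev T2 d) (F1 d) (F2 d)"
    using x unfolding po_rel_def by blast
qed (intro po_gens_eq law_map_Hom[OF slaw_map_law[OF F1] x] law_map_Hom[OF slaw_map_law[OF F2] x])+

lemma po_presentation:
  "simplicial_presentation (\<lambda>d. po_gens (Lev T1 d) (Lev T2 d))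
     (\<lambda>d. po_rel (Lev T0 d) (Lev T1 d) (Lev T2 d) (F1 d) (F2 d))
     (\<lambda>d \<alpha> n k. map_sum (LAct T1 d \<alpha> n k) (LAct T2 d \<alpha> n k))"
proof
  fix m d \<alpha> assume a: "\<alpha> \<in> simp_ops m d"
  show "map_sum (LAct T1 d \<alpha> n k) (LAct T2 d \<alpha> n k) g \<in> po_gens (Lev T1 m) (Lev T2 m) n k"
    if "g \<in> po_gens (Lev T1 d) (Lev T2 d) n k" for n k g
    using that law_map_Hom[OF slaw_LAct[OF T1 a]] law_map_Hom[OF slaw_LAct[OF T2 a]]
    by (auto simp: po_gens_def)
  show "map_sum (LAct T1 m \<beta> n k) (LAct T2 m \<beta> n k) (map_sum (LAct T1 d \<alpha> n k) (LAct T2 d \<alpha> n k) g) =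
      map_sum (LAct T1 d (map ((!) \<alpha>) \<beta>) n k) (LAct T2 d (map ((!) \<alpha>) \<beta>) n k) g"
    if "\<beta> \<in> simp_ops l m" "g \<in> po_gens (Lev T1 d) (Lev T2 d) n k" for l \<beta> n k g
    using that slaw_LAct_comp[OF T1 that(1) a] slaw_LAct_comp[OF T2 that(1) a]
    by (auto simp: po_gens_def)
  let ?S = "spushout T0 T1 T2 F1 F2"
  let ?i1 = "po_in1 T0 T1 T2 F1 F2 m" and ?i2 = "po_in2 T0 T1 T2 F1 F2 m"
  have "pres_model (po_gens (Lev T1 d) (Lev T2 d))
      (po_rel (Lev T0 d) (Lev T1 d) (Lev T2 d) (F1 d) (F2 d)) (Lev ?S m)
      (\<lambda>n k. case_sum (\<lambda>x. ?i1 n k (LAct T1 d \<alpha> n k x)) (\<lambda>x. ?i2 n k (LAct T2 d \<alpha> n k x)))"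
  proof (rule po_model[OF law_map_compose[OF slaw_LAct[OF T1 a] po_in_law_map(1)]
        law_map_compose[OF slaw_LAct[OF T2 a] po_in_law_map(2)]])
    fix n k f assume f: "f \<in> Hom (Lev T0 d) n k"
    show "?i1 n k (LAct T1 d \<alpha> n k (F1 d n k f)) = ?i2 n k (LAct T2 d \<alpha> n k (F2 d n k f))"
      unfolding slaw_map_act[OF F1 a f, symmetric] slaw_map_act[OF F2 a f, symmetric]
      by (rule po_square[OF law_map_Hom[OF slaw_LAct[OF T0 a] f]])
  qed
  moreover have "(\<lambda>n k. case_sum (\<lambda>x. ?i1 n k (LAct T1 d \<alpha> n k x)) (\<lambda>x. ?i2 n k (LAct T2 d \<alpha> n k x)))
      = (\<lambda>n k g. pres_gen (po_gens (Lev T1 m) (Lev T2 m))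
          (po_rel (Lev T0 m) (Lev T1 m) (Lev T2 m) (F1 m) (F2 m)) n k
          (map_sum (LAct T1 d \<alpha> n k) (LAct T2 d \<alpha> n k) g))"
    unfolding po_in1_def po_in2_def by (intro ext) (simp split: sum.split)
  ultimately show "pres_model (po_gens (Lev T1 d) (Lev T2 d))
      (po_rel (Lev T0 d) (Lev T1 d) (Lev T2 d) (F1 d) (F2 d))
      (pres (po_gens (Lev T1 m) (Lev T2 m)) (po_rel (Lev T0 m) (Lev T1 m) (Lev T2 m) (F1 m) (F2 m)))
      (\<lambda>n k g. pres_gen (po_gens (Lev T1 m) (Lev T2 m))
          (po_rel (Lev T0 m) (Lev T1 m) (Lev T2 m) (F1 m) (F2 m)) n k
          (map_sum (LAct T1 d \<alpha> n k) (LAct T2 d \<alpha> n k) g))"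
    by (simp add: spushout_def spres_Lev)
next
  show "map_sum (LAct T1 d [0..<Suc d] n k) (LAct T2 d [0..<Suc d] n k) g = g"
    if "g \<in> po_gens (Lev T1 d) (Lev T2 d) n k" for d n k g
    using that slaw_LAct_id[OF T1] slaw_LAct_id[OF T2] by (auto simp: po_gens_def simp del: upt_Suc)
qed

theorem is_slaw_spushout: "is_slaw (spushout T0 T1 T2 F1 F2)"
  unfolding spushout_def by (rule simplicial_presentation.is_slaw_spres[OF po_presentation])

theorem po_in_slaw_map:
  "slaw_map T1 (spushout T0 T1 T2 F1 F2) (po_in1 T0 T1 T2 F1 F2)"
  "slaw_map T2 (spushout T0 T1 T2 F1 F2) (po_in2 T0 T1 T2 F1 F2)"
proof -
  show "slaw_map T1 (spushout T0 T1 T2 F1 F2) (po_in1 T0 T1 T2 F1 F2)"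
  proof (rule slaw_mapI[OF po_in_law_map(1)])
    fix m d \<alpha> n k x assume a: "\<alpha> \<in> simp_ops m d" and x: "x \<in> Hom (Lev T1 d) n k"
    have "Inl x \<in> po_gens (Lev T1 d) (Lev T2 d) n k" using x by (rule po_gensI)
    from simplicial_presentation.act_gen[OF po_presentation a this]
    show "po_in1 T0 T1 T2 F1 F2 m n k (LAct T1 d \<alpha> n k x) =
        LAct (spushout T0 T1 T2 F1 F2) d \<alpha> n k (po_in1 T0 T1 T2 F1 F2 d n k x)"
      by (simp add: spushout_def po_in1_def)
  qed
  show "slaw_map T2 (spushout T0 T1 T2 F1 F2) (po_in2 T0 T1 T2 F1 F2)"
  proof (rule slaw_mapI[OF po_in_law_map(2)])
    fix m d \<alpha> n k x assume a: "\<alpha> \<in> simp_ops m d" and x: "x \<in> Hom (Lev T2 d) n k"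
    have "Inr x \<in> po_gens (Lev T1 d) (Lev T2 d) n k" using x by (rule po_gensI)
    from simplicial_presentation.act_gen[OF po_presentation a this]
    show "po_in2 T0 T1 T2 F1 F2 m n k (LAct T2 d \<alpha> n k x) =
        LAct (spushout T0 T1 T2 F1 F2) d \<alpha> n k (po_in2 T0 T1 T2 F1 F2 d n k x)"
      by (simp add: spushout_def po_in2_def)
  qed
qed

theorem po_lift_map:
  assumes T: "is_slaw T" and H1: "slaw_map T1 T H1" and H2: "slaw_map T2 T H2"
    and eq: "\<And>d n k x. x \<in> Hom (Lev T0 d) n k \<Longrightarrow> H1 d n k (F1 d n k x) = H2 d n k (F2 d n k x)"
  shows "slaw_map (spushout T0 T1 T2 F1 F2) T (po_lift T H1 H2)"
    and "x \<in> Hom (Lev T1 d) n k \<Longrightarrow> po_lift T H1 H2 d n k (po_in1 T0 T1 T2 F1 F2 d n k x) = H1 d n k x"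
    and "y \<in> Hom (Lev T2 d) n k \<Longrightarrow> po_lift T H1 H2 d n k (po_in2 T0 T1 T2 F1 F2 d n k y) = H2 d n k y"
proof -
  have m: "pres_model (po_gens (Lev T1 d) (Lev T2 d))
      (po_rel (Lev T0 d) (Lev T1 d) (Lev T2 d) (F1 d) (F2 d)) (Lev T d)
      (\<lambda>n k. case_sum (H1 d n k) (H2 d n k))" for d
    by (rule po_model[OF slaw_map_law[OF H1] slaw_map_law[OF H2] eq])
  show "slaw_map (spushout T0 T1 T2 F1 F2) T (po_lift T H1 H2)"
    unfolding spushout_def po_lift_def
  proof (rule simplicial_presentation.lift_slaw_map[OF po_presentation T m])
    fix m d \<alpha> n k g assume a: "\<alpha> \<in> simp_ops m d" and g: "g \<in> po_gens (Lev T1 d) (Lev T2 d) n k"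
    show "case_sum (H1 m n k) (H2 m n k) (map_sum (LAct T1 d \<alpha> n k) (LAct T2 d \<alpha> n k) g) =
        LAct T d \<alpha> n k (case_sum (H1 d n k) (H2 d n k) g)"
      using g slaw_map_act[OF H1 a] slaw_map_act[OF H2 a] by (auto simp: po_gens_def)
  qed
  show "po_lift T H1 H2 d n k (po_in1 T0 T1 T2 F1 F2 d n k x) = H1 d n k x"
    if "x \<in> Hom (Lev T1 d) n k"
  proof -
    have "Inl x \<in> po_gens (Lev T1 d) (Lev T2 d) n k" using that by (rule po_gensI)
    from pres_lift_gen[OF slaw_Lev[OF T] m this] show ?thesis
      by (simp add: po_lift_def po_in1_def)
  qed
  show "po_lift T H1 H2 d n k (po_in2 T0 T1 T2 F1 F2 d n k y) = H2 d n k y"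
    if "y \<in> Hom (Lev T2 d) n k"
  proof -
    have "Inr y \<in> po_gens (Lev T1 d) (Lev T2 d) n k" using that by (rule po_gensI)
    from pres_lift_gen[OF slaw_Lev[OF T] m this] show ?thesis
      by (simp add: po_lift_def po_in2_def)
  qed
qed

theorem po_unique:
  assumes T: "is_slaw T" and H: "slaw_map (spushout T0 T1 T2 F1 F2) T H"
    and H': "slaw_map (spushout T0 T1 T2 F1 F2) T H'"
    and eq1: "\<And>d n k x. x \<in> Hom (Lev T1 d) n k \<Longrightarrow>
      H d n k (po_in1 T0 T1 T2 F1 F2 d n k x) = H' d n k (po_in1 T0 T1 T2 F1 F2 d n k x)"
    and eq2: "\<And>d n k x. x \<in> Hom (Lev T2 d) n k \<Longrightarrow>
      H d n k (po_in2 T0 T1 T2 F1 F2 d n k x) = H' d n k (po_in2 T0 T1 T2 F1 F2 d n k x)"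
    and y: "y \<in> Hom (Lev (spushout T0 T1 T2 F1 F2) d) n k"
  shows "H d n k y = H' d n k y"
proof (rule pres_map_unique[OF slaw_Lev[OF T, of d] slaw_map_law[OF H, of d, unfolded spushout_def spres_Lev]
      slaw_map_law[OF H', of d, unfolded spushout_def spres_Lev] _
      y[unfolded spushout_def spres_Lev]])
  fix n k g assume "g \<in> po_gens (Lev T1 d) (Lev T2 d) n k"
  then show "H d n k (pres_gen (po_gens (Lev T1 d) (Lev T2 d))
        (po_rel (Lev T0 d) (Lev T1 d) (Lev T2 d) (F1 d) (F2 d)) n k g) =
      H' d n k (pres_gen (po_gens (Lev T1 d) (Lev T2 d))
        (po_rel (Lev T0 d) (Lev T1 d) (Lev T2 d) (F1 d) (F2 d)) n k g)"
    using eq1 eq2 by (auto simp: po_gens_def po_in1_def po_in2_def)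
qed

end


lemma law_ext:
  assumes L: "is_law L" and h: "h \<in> Hom L n (k + l)" and h': "h' \<in> Hom L n (k + l)"
    and "Comp L n (k + l) k (prj1 L k l) h = Comp L n (k + l) k (prj1 L k l) h'"
    and "Comp L n (k + l) l (prj2 L k l) h = Comp L n (k + l) l (prj2 L k l) h'"
  shows "h = h'"
  using law_pairing_unique[OF L h assms(4,5)] law_pairing_unique[OF L h' refl refl] by simp

lemma law_tens:
  assumes L: "is_law L" and f: "f \<in> Hom L n k" and g: "g \<in> Hom L n' k'"
  shows "Tens (law_pro L) n k n' k' f g \<in> Hom L (n + n') (k + k')"
    and "Comp L (n + n') (k + k') k (prj1 L k k') (Tens (law_pro L) n k n' k' f g)
      = Comp L (n + n') n k f (prj1 L n n')"
    and "Comp L (n + n') (k + k') k' (prj2 L k k') (Tens (law_pro L) n k n' k' f g)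
      = Comp L (n + n') n' k' g (prj2 L n n')"
  unfolding law_pro_Tens using law_pairing[OF L pairing_precomp_closed[OF L f g]] by simp_all

theorem is_pro_law_pro:
  assumes L: "is_law L"
  shows "is_pro (law_pro L)"
proof -
  note C = is_law_cat[OF L]
  note F1 = law_Fin[OF L fin_hom_prj(2)] and F2 = law_Fin[OF L fin_hom_prj(3)]
  note I = law_Fin[OF L fin_hom_prj(1), unfolded law_Id[OF L]]
  let ?T = "Tens (law_pro L)"
  have idn: "?T n n n' n' (Idn L n) (Idn L n') = Idn L (n + n')" for n n'
    by (rule law_ext[OF L law_tens(1)[OF L I I] I])
      (simp_all add: law_tens[OF L I I] cat_idL[OF C F1] cat_idL[OF C F2] cat_idR[OF C F1] cat_idR[OF C F2])
  have inter: "?T n k n' k' (Comp L n m k g f) (Comp L n' m' k' g' f') =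
      Comp L (n + n') (m + m') (k + k') (?T m k m' k' g g') (?T n m n' m' f f')"
    if f: "f \<in> Hom L n m" and g: "g \<in> Hom L m k" and f': "f' \<in> Hom L n' m'" and g': "g' \<in> Hom L m' k'"
    for n m k n' m' k' f g f' g'
  proof -
    note gf = cat_Comp[OF C f g] and gf' = cat_Comp[OF C f' g']
    note Tf = law_tens[OF L f f'] and Tg = law_tens[OF L g g']
    show ?thesis
    proof (rule law_ext[OF L law_tens(1)[OF L gf gf'] cat_Comp[OF C Tf(1) Tg(1)]])
      show "Comp L (n + n') (k + k') k (prj1 L k k') (?T n k n' k' (Comp L n m k g f) (Comp L n' m' k' g' f'))
        = Comp L (n + n') (k + k') k (prj1 L k k')
            (Comp L (n + n') (m + m') (k + k') (?T m k m' k' g g') (?T n m n' m' f f'))"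
        unfolding law_tens(2)[OF L gf gf'] cat_assoc[OF C Tf(1) Tg(1) F1] Tg(2)
          cat_assoc[OF C Tf(1) F1 g, symmetric] Tf(2) cat_assoc[OF C F1 f g] ..
      show "Comp L (n + n') (k + k') k' (prj2 L k k') (?T n k n' k' (Comp L n m k g f) (Comp L n' m' k' g' f'))
        = Comp L (n + n') (k + k') k' (prj2 L k k')
            (Comp L (n + n') (m + m') (k + k') (?T m k m' k' g g') (?T n m n' m' f f'))"
        unfolding law_tens(3)[OF L gf gf'] cat_assoc[OF C Tf(1) Tg(1) F2] Tg(3)
          cat_assoc[OF C Tf(1) F2 g', symmetric] Tf(3) cat_assoc[OF C F2 f' g'] ..
    qed
  qed
  have pp: "Comp L (a + b + c) (a + b) a (prj1 L a b) (prj1 L (a + b) c) = prj1 L a (b + c)"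
    "Comp L (a + b + c) (a + b) b (prj2 L a b) (prj1 L (a + b) c)
      = Comp L (a + b + c) (b + c) b (prj1 L b c) (prj2 L a (b + c))"
    "Comp L (a + b + c) (b + c) c (prj2 L b c) (prj2 L a (b + c)) = prj2 L (a + b) c" for a b c
  proof -
    have 1: "[0..<a + b] \<in> fin_hom (a + b + c) (a + b)" by (rule fin_hom_prj)
    have 2: "[a..<a + (b + c)] \<in> fin_hom (a + b + c) (b + c)"
      using fin_hom_prj(3)[where k = a and l = "b + c"] by (simp only: add.assoc)
    have l: "fin_comp [0..<a] [0..<a + b] = [0..<a]" "fin_comp [a..<a + b] [0..<a + b] = [a..<a + b]"
      "fin_comp [0..<b] [a..<a + (b + c)] = [a..<a + b]"
      "fin_comp [b..<b + c] [a..<a + (b + c)] = [a + b..<a + b + c]"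
      unfolding fin_comp_def by (intro nth_equalityI; simp)+
    show "Comp L (a + b + c) (a + b) a (prj1 L a b) (prj1 L (a + b) c) = prj1 L a (b + c)"
      using law_FinComp[OF L 1 fin_hom_prj(2)] by (simp add: l add.assoc)
    show "Comp L (a + b + c) (a + b) b (prj2 L a b) (prj1 L (a + b) c)
      = Comp L (a + b + c) (b + c) b (prj1 L b c) (prj2 L a (b + c))"
      using law_FinComp[OF L 1 fin_hom_prj(3)] law_FinComp[OF L 2 fin_hom_prj(2)] by (simp add: l add.assoc)
    show "Comp L (a + b + c) (b + c) c (prj2 L b c) (prj2 L a (b + c)) = prj2 L (a + b) c"
      using law_FinComp[OF L 2 fin_hom_prj(3)] by (simp add: l add.assoc)
  qed
  have assoc: "?T (n + n') (k + k') n'' k'' (?T n k n' k' f g) h =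
      ?T n k (n' + n'') (k' + k'') f (?T n' k' n'' k'' g h)"
    if f: "f \<in> Hom L n k" and g: "g \<in> Hom L n' k'" and h: "h \<in> Hom L n'' k''"
    for n k n' k' n'' k'' f g h
  proof -
    note fg = law_tens[OF L f g] and gh = law_tens[OF L g h]
    note l = law_tens[OF L fg(1) h] and r = law_tens[OF L f gh(1)]
    let ?N = "n + n' + n''" and ?K = "k + k' + k''"
    let ?l = "?T (n + n') (k + k') n'' k'' (?T n k n' k' f g) h"
    let ?r = "?T n k (n' + n'') (k' + k'') f (?T n' k' n'' k'' g h)"
    have lh: "?l \<in> Hom L ?N (k + (k' + k''))" using l(1) by (simp only: add.assoc)
    have rh: "?r \<in> Hom L ?N (k + (k' + k''))" using r(1) by (simp only: add.assoc)
    have Fa: "prj1 L a (b + c) \<in> Hom L (a + b + c) a" "prj2 L a (b + c) \<in> Hom L (a + b + c) (b + c)" for a b c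
      using law_Fin[OF L fin_hom_prj(2)[where k = a and l = "b + c"]]
        law_Fin[OF L fin_hom_prj(3)[where k = a and l = "b + c"]] by (simp_all only: add.assoc)
    have lh': "?l \<in> Hom L ?N ?K" by (rule l(1))
    have r2: "Comp L ?N ?K k (prj1 L k (k' + k'')) ?r = Comp L ?N n k f (prj1 L n (n' + n''))"
      using r(2) by (simp only: add.assoc)
    have r3: "Comp L ?N ?K (k' + k'') (prj2 L k (k' + k'')) ?r
        = Comp L ?N (n' + n'') (k' + k'') (?T n' k' n'' k'' g h) (prj2 L n (n' + n''))"
      using r(3) by (simp only: add.assoc)
    have 1: "Comp L ?N ?K k (prj1 L k (k' + k'')) ?l = Comp L ?N n k f (prj1 L n (n' + n''))"
      unfolding pp(1)[symmetric] cat_assoc[OF C lh' F1 F1, symmetric] l(2)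
      unfolding cat_assoc[OF C F1 fg(1) F1] fg(2) cat_assoc[OF C F1 F1 f] ..
    note lp = cat_Comp[OF C lh' Fa(2)]
    note rp = cat_Comp[OF C Fa(2) gh(1)]
    have 2: "Comp L ?N ?K (k' + k'') (prj2 L k (k' + k'')) ?l
        = Comp L ?N (n' + n'') (k' + k'') (?T n' k' n'' k'' g h) (prj2 L n (n' + n''))"
    proof (rule law_ext[OF L lp rp])
      show "Comp L ?N (k' + k'') k' (prj1 L k' k'') (Comp L ?N ?K (k' + k'') (prj2 L k (k' + k'')) ?l) =
        Comp L ?N (k' + k'') k' (prj1 L k' k'')
          (Comp L ?N (n' + n'') (k' + k'') (?T n' k' n'' k'' g h) (prj2 L n (n' + n'')))"
        unfolding cat_assoc[OF C lh' Fa(2) F1] pp(2)[symmetric] cat_assoc[OF C lh' F1 F2, symmetric] l(2)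
        unfolding cat_assoc[OF C F1 fg(1) F2] fg(3)
        unfolding cat_assoc[OF C Fa(2) gh(1) F1] gh(2)
        unfolding cat_assoc[OF C F1 F2 g, symmetric] cat_assoc[OF C Fa(2) F1 g, symmetric] pp(2) ..
      show "Comp L ?N (k' + k'') k'' (prj2 L k' k'') (Comp L ?N ?K (k' + k'') (prj2 L k (k' + k'')) ?l) =
        Comp L ?N (k' + k'') k'' (prj2 L k' k'')
          (Comp L ?N (n' + n'') (k' + k'') (?T n' k' n'' k'' g h) (prj2 L n (n' + n'')))"
        unfolding cat_assoc[OF C lh' Fa(2) F2] pp(3) l(3)
        unfolding cat_assoc[OF C Fa(2) gh(1) F2] gh(3)
        unfolding cat_assoc[OF C Fa(2) F2 h, symmetric] pp(3) ..
    qed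
    show ?thesis
      by (rule law_ext[OF L lh rh]) (use 1 2 r2 r3 in \<open>simp_all only: add.assoc\<close>)
  qed
  have unitL: "?T 0 0 n k (Idn L 0) f = f" if f: "f \<in> Hom L n k" for n k f
    using law_tens(1,3)[OF L I[of 0] f]
    by (simp add: law_Id[OF L] cat_idL[OF C] cat_idR[OF C f])
  have unitR: "?T n k 0 0 f (Idn L 0) = f" if f: "f \<in> Hom L n k" for n k f
    using law_tens(1,2)[OF L f I[of 0]]
    by (simp add: law_Id[OF L] cat_idL[OF C] cat_idR[OF C f])
  have "is_cat (law_pro L)" using C unfolding is_cat_def law_pro_sel .
  then show ?thesis
    unfolding is_pro_def law_pro_sel
    using law_tens(1)[OF L] idn inter assoc unitL unitR by (intro conjI allI ballI) auto
qed


section \<open>Free pros\<close>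

datatype 'g pexpr =
    PGen nat nat 'g
  | PId nat
  | PComp nat nat nat "'g pexpr" "'g pexpr"
  | PTens nat nat nat nat "'g pexpr" "'g pexpr"

inductive pexpr_eq :: "(nat \<Rightarrow> nat \<Rightarrow> 'g set) \<Rightarrow> nat \<Rightarrow> nat \<Rightarrow> 'g pexpr \<Rightarrow> 'g pexpr \<Rightarrow> bool"
  for G where
  pGen: "g \<in> G n k \<Longrightarrow> pexpr_eq G n k (PGen n k g) (PGen n k g)"
| pId: "pexpr_eq G n n (PId n) (PId n)"
| pComp: "pexpr_eq G m k e e' \<Longrightarrow> pexpr_eq G n m d d' \<Longrightarrow>
    pexpr_eq G n k (PComp n m k e d) (PComp n m k e' d')"
| pTens: "pexpr_eq G n k e e' \<Longrightarrow> pexpr_eq G n' k' d d' \<Longrightarrow>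
    pexpr_eq G (n + n') (k + k') (PTens n k n' k' e d) (PTens n k n' k' e' d')"
| pSym: "pexpr_eq G n k e e' \<Longrightarrow> pexpr_eq G n k e' e"
| pTrans: "pexpr_eq G n k e e' \<Longrightarrow> pexpr_eq G n k e' e'' \<Longrightarrow> pexpr_eq G n k e e''"
| pIdR: "pexpr_eq G n k e e \<Longrightarrow> pexpr_eq G n k (PComp n n k e (PId n)) e"
| pIdL: "pexpr_eq G n k e e \<Longrightarrow> pexpr_eq G n k (PComp n k k (PId k) e) e"
| pAssoc: "pexpr_eq G k l e e \<Longrightarrow> pexpr_eq G m k d d \<Longrightarrow> pexpr_eq G n m c c \<Longrightarrow>
    pexpr_eq G n l (PComp n k l e (PComp n m k d c)) (PComp n m l (PComp m k l e d) c)"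
| pTensId: "pexpr_eq G (n + n') (n + n') (PTens n n n' n' (PId n) (PId n')) (PId (n + n'))"
| pInterchange: "pexpr_eq G m k e e \<Longrightarrow> pexpr_eq G n m d d \<Longrightarrow> pexpr_eq G m' k' e' e' \<Longrightarrow>
    pexpr_eq G n' m' d' d' \<Longrightarrow> pexpr_eq G (n + n') (k + k')
      (PTens n k n' k' (PComp n m k e d) (PComp n' m' k' e' d'))
      (PComp (n + n') (m + m') (k + k') (PTens m k m' k' e e') (PTens n m n' m' d d'))"
| pTensAssoc: "pexpr_eq G n k e e \<Longrightarrow> pexpr_eq G n' k' e' e' \<Longrightarrow> pexpr_eq G n'' k'' e'' e'' \<Longrightarrow>
    pexpr_eq G (n + (n' + n'')) (k + (k' + k''))
      (PTens (n + n') (k + k') n'' k'' (PTens n k n' k' e e') e'')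
      (PTens n k (n' + n'') (k' + k'') e (PTens n' k' n'' k'' e' e''))"
| pUnitL: "pexpr_eq G n k e e \<Longrightarrow> pexpr_eq G n k (PTens 0 0 n k (PId 0) e) e"
| pUnitR: "pexpr_eq G n k e e \<Longrightarrow> pexpr_eq G n k (PTens n k 0 0 e (PId 0)) e"

definition pexpr_class :: "(nat \<Rightarrow> nat \<Rightarrow> 'g set) \<Rightarrow> nat \<Rightarrow> nat \<Rightarrow> 'g pexpr \<Rightarrow> 'g pexpr set" where
  "pexpr_class G n k e = {e'. pexpr_eq G n k e e'}"

definition free_pro :: "(nat \<Rightarrow> nat \<Rightarrow> 'g set) \<Rightarrow> 'g pexpr set pro" where
  "free_pro G = \<lparr>
     Hom = (\<lambda>n k. {pexpr_class G n k e | e. pexpr_eq G n k e e}),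
     Comp = (\<lambda>n m k c d. \<Union>e\<in>c. \<Union>e'\<in>d. pexpr_class G n k (PComp n m k e e')),
     Idn = (\<lambda>n. pexpr_class G n n (PId n)),
     Tens = (\<lambda>n k n' k' c d. \<Union>e\<in>c. \<Union>e'\<in>d. pexpr_class G (n + n') (k + k') (PTens n k n' k' e e'))\<rparr>"

primrec pexpr_eval :: "'a pro \<Rightarrow> (nat \<Rightarrow> nat \<Rightarrow> 'g \<Rightarrow> 'a) \<Rightarrow> 'g pexpr \<Rightarrow> 'a" where
  "pexpr_eval P \<phi> (PGen n k g) = \<phi> n k g"
| "pexpr_eval P \<phi> (PId n) = Idn P n"
| "pexpr_eval P \<phi> (PComp n m k e d) = Comp P n m k (pexpr_eval P \<phi> e) (pexpr_eval P \<phi> d)"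
| "pexpr_eval P \<phi> (PTens n k n' k' e d) = Tens P n k n' k' (pexpr_eval P \<phi> e) (pexpr_eval P \<phi> d)"

definition free_pro_lift :: "'a pro \<Rightarrow> (nat \<Rightarrow> nat \<Rightarrow> 'g \<Rightarrow> 'a) \<Rightarrow> nat \<Rightarrow> nat \<Rightarrow> 'g pexpr set \<Rightarrow> 'a" where
  "free_pro_lift P \<phi> n k c = the_elem (pexpr_eval P \<phi> ` c)"


definition free_pro_gen :: "(nat \<Rightarrow> nat \<Rightarrow> 'g set) \<Rightarrow> nat \<Rightarrow> nat \<Rightarrow> 'g \<Rightarrow> 'g pexpr set" where
  "free_pro_gen G n k g = pexpr_class G n k (PGen n k g)"

lemma pexpr_eq_refl: "pexpr_eq G n k e e' \<Longrightarrow> pexpr_eq G n k e e \<and> pexpr_eq G n k e' e'"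
  by (meson pSym pTrans)

lemma pexpr_class_eqI: "pexpr_eq G n k e e' \<Longrightarrow> pexpr_class G n k e = pexpr_class G n k e'"
  unfolding pexpr_class_def by (auto intro: pSym pTrans)

lemma pexpr_class_self: "pexpr_eq G n k e e \<Longrightarrow> e \<in> pexpr_class G n k e"
  by (simp add: pexpr_class_def)

lemma free_pro_HomI: "pexpr_eq G n k e e \<Longrightarrow> pexpr_class G n k e \<in> Hom (free_pro G) n k"
  by (auto simp: free_pro_def)

lemma free_pro_HomE:
  assumes "c \<in> Hom (free_pro G) n k"
  obtains e where "pexpr_eq G n k e e" "c = pexpr_class G n k e"
  using assms by (auto simp: free_pro_def)

lemma free_pro_Comp:
  assumes "pexpr_eq G m k e e" "pexpr_eq G n m d d"
  shows "Comp (free_pro G) n m k (pexpr_class G m k e) (pexpr_class G n m d)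
    = pexpr_class G n k (PComp n m k e d)"
proof -
  have c: "pexpr_class G n k (PComp n m k e' d') = pexpr_class G n k (PComp n m k e d)"
    if "e' \<in> pexpr_class G m k e" "d' \<in> pexpr_class G n m d" for e' d'
  proof (rule pexpr_class_eqI[symmetric], rule pComp)
    show "pexpr_eq G m k e e'" "pexpr_eq G n m d d'"
      using that by (simp_all add: pexpr_class_def)
  qed
  have "Comp (free_pro G) n m k (pexpr_class G m k e) (pexpr_class G n m d)
     = (\<Union>e'\<in>pexpr_class G m k e. \<Union>d'\<in>pexpr_class G n m d. pexpr_class G n k (PComp n m k e' d'))"
    by (simp add: free_pro_def)
  also have "\<dots> = (\<Union>e'\<in>pexpr_class G m k e. \<Union>d'\<in>pexpr_class G n m d. pexpr_class G n k (PComp n m k e d))"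
    by (intro SUP_cong refl) (rule c)
  also have "\<dots> = pexpr_class G n k (PComp n m k e d)"
    using pexpr_class_self[OF assms(1)] pexpr_class_self[OF assms(2)] by blast
  finally show ?thesis .
qed

lemma free_pro_Tens:
  assumes "pexpr_eq G n k e e" "pexpr_eq G n' k' d d"
  shows "Tens (free_pro G) n k n' k' (pexpr_class G n k e) (pexpr_class G n' k' d)
    = pexpr_class G (n + n') (k + k') (PTens n k n' k' e d)"
proof -
  have c: "pexpr_class G (n + n') (k + k') (PTens n k n' k' e' d')
      = pexpr_class G (n + n') (k + k') (PTens n k n' k' e d)"
    if "e' \<in> pexpr_class G n k e" "d' \<in> pexpr_class G n' k' d" for e' d'
  proof (rule pexpr_class_eqI[symmetric], rule pTens)
    show "pexpr_eq G n k e e'" "pexpr_eq G n' k' d d'"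
      using that by (simp_all add: pexpr_class_def)
  qed
  have "Tens (free_pro G) n k n' k' (pexpr_class G n k e) (pexpr_class G n' k' d)
     = (\<Union>e'\<in>pexpr_class G n k e. \<Union>d'\<in>pexpr_class G n' k' d.
          pexpr_class G (n + n') (k + k') (PTens n k n' k' e' d'))"
    by (simp add: free_pro_def)
  also have "\<dots> = (\<Union>e'\<in>pexpr_class G n k e. \<Union>d'\<in>pexpr_class G n' k' d.
          pexpr_class G (n + n') (k + k') (PTens n k n' k' e d))"
    by (intro SUP_cong refl) (rule c)
  also have "\<dots> = pexpr_class G (n + n') (k + k') (PTens n k n' k' e d)"
    using pexpr_class_self[OF assms(1)] pexpr_class_self[OF assms(2)] by blast
  finally show ?thesis .
qed

lemma free_pro_Idn: "Idn (free_pro G) n = pexpr_class G n n (PId n)"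
  by (simp add: free_pro_def)

text \<open>The universal property of the free pro.\<close>

theorem is_pro_free_pro: "is_pro (free_pro G)"
  unfolding is_pro_def is_cat_def
proof (intro conjI allI ballI)
  let ?P = "free_pro G"
  show "Idn ?P n \<in> Hom ?P n n" for n unfolding free_pro_Idn by (rule free_pro_HomI[OF pId])
  show "Comp ?P n m k g f \<in> Hom ?P n k" if f: "f \<in> Hom ?P n m" and g: "g \<in> Hom ?P m k" for n m k f g
  proof -
    obtain e where e: "pexpr_eq G m k e e" "g = pexpr_class G m k e" by (rule free_pro_HomE[OF g])
    obtain d where d: "pexpr_eq G n m d d" "f = pexpr_class G n m d" by (rule free_pro_HomE[OF f])
    show ?thesis unfolding e(2) d(2) free_pro_Comp[OF e(1) d(1)]
      by (rule free_pro_HomI[OF pComp[OF e(1) d(1)]])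
  qed
  show "Comp ?P n n k f (Idn ?P n) = f" if f: "f \<in> Hom ?P n k" for n k f
  proof -
    obtain e where e: "pexpr_eq G n k e e" "f = pexpr_class G n k e" by (rule free_pro_HomE[OF f])
    show ?thesis unfolding e(2) free_pro_Idn free_pro_Comp[OF e(1) pId]
      by (rule pexpr_class_eqI[OF pIdR[OF e(1)]])
  qed
  show "Comp ?P n k k (Idn ?P k) f = f" if f: "f \<in> Hom ?P n k" for n k f
  proof -
    obtain e where e: "pexpr_eq G n k e e" "f = pexpr_class G n k e" by (rule free_pro_HomE[OF f])
    show ?thesis unfolding e(2) free_pro_Idn free_pro_Comp[OF pId e(1)]
      by (rule pexpr_class_eqI[OF pIdL[OF e(1)]])
  qed
  show "Comp ?P n k l h (Comp ?P n m k g f) = Comp ?P n m l (Comp ?P m k l h g) f"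
    if f: "f \<in> Hom ?P n m" and g: "g \<in> Hom ?P m k" and h: "h \<in> Hom ?P k l" for n m k l f g h
  proof -
    obtain e where e: "pexpr_eq G k l e e" "h = pexpr_class G k l e" by (rule free_pro_HomE[OF h])
    obtain d where d: "pexpr_eq G m k d d" "g = pexpr_class G m k d" by (rule free_pro_HomE[OF g])
    obtain c where c: "pexpr_eq G n m c c" "f = pexpr_class G n m c" by (rule free_pro_HomE[OF f])
    show ?thesis unfolding e(2) d(2) c(2) free_pro_Comp[OF d(1) c(1)] free_pro_Comp[OF e(1) d(1)]
        free_pro_Comp[OF e(1) pComp[OF d(1) c(1)]] free_pro_Comp[OF pComp[OF e(1) d(1)] c(1)]
      by (rule pexpr_class_eqI[OF pAssoc[OF e(1) d(1) c(1)]])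
  qed
  show "Tens ?P n k n' k' f g \<in> Hom ?P (n + n') (k + k')"
    if f: "f \<in> Hom ?P n k" and g: "g \<in> Hom ?P n' k'" for n k n' k' f g
  proof -
    obtain e where e: "pexpr_eq G n k e e" "f = pexpr_class G n k e" by (rule free_pro_HomE[OF f])
    obtain d where d: "pexpr_eq G n' k' d d" "g = pexpr_class G n' k' d" by (rule free_pro_HomE[OF g])
    show ?thesis unfolding e(2) d(2) free_pro_Tens[OF e(1) d(1)]
      by (rule free_pro_HomI[OF pTens[OF e(1) d(1)]])
  qed
  show "Tens ?P n n n' n' (Idn ?P n) (Idn ?P n') = Idn ?P (n + n')" for n n'
    unfolding free_pro_Idn free_pro_Tens[OF pId pId] by (rule pexpr_class_eqI[OF pTensId])
  show "Tens ?P n k n' k' (Comp ?P n m k g f) (Comp ?P n' m' k' g' f') =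
      Comp ?P (n + n') (m + m') (k + k') (Tens ?P m k m' k' g g') (Tens ?P n m n' m' f f')"
    if f: "f \<in> Hom ?P n m" and g: "g \<in> Hom ?P m k"
      and f': "f' \<in> Hom ?P n' m'" and g': "g' \<in> Hom ?P m' k'" for n m k n' m' k' f g f' g'
  proof -
    obtain e where e: "pexpr_eq G m k e e" "g = pexpr_class G m k e" by (rule free_pro_HomE[OF g])
    obtain d where d: "pexpr_eq G n m d d" "f = pexpr_class G n m d" by (rule free_pro_HomE[OF f])
    obtain e' where e': "pexpr_eq G m' k' e' e'" "g' = pexpr_class G m' k' e'" by (rule free_pro_HomE[OF g'])
    obtain d' where d': "pexpr_eq G n' m' d' d'" "f' = pexpr_class G n' m' d'" by (rule free_pro_HomE[OF f'])
    show ?thesis unfolding e(2) d(2) e'(2) d'(2) free_pro_Comp[OF e(1) d(1)] free_pro_Comp[OF e'(1) d'(1)]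
        free_pro_Tens[OF e(1) e'(1)] free_pro_Tens[OF d(1) d'(1)]
        free_pro_Tens[OF pComp[OF e(1) d(1)] pComp[OF e'(1) d'(1)]]
        free_pro_Comp[OF pTens[OF e(1) e'(1)] pTens[OF d(1) d'(1)]]
      by (rule pexpr_class_eqI[OF pInterchange[OF e(1) d(1) e'(1) d'(1)]])
  qed
  show "Tens ?P (n + n') (k + k') n'' k'' (Tens ?P n k n' k' f g) h =
      Tens ?P n k (n' + n'') (k' + k'') f (Tens ?P n' k' n'' k'' g h)"
    if f: "f \<in> Hom ?P n k" and g: "g \<in> Hom ?P n' k'" and h: "h \<in> Hom ?P n'' k''"
    for n k n' k' n'' k'' f g h
  proof -
    obtain e where e: "pexpr_eq G n k e e" "f = pexpr_class G n k e" by (rule free_pro_HomE[OF f])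
    obtain d where d: "pexpr_eq G n' k' d d" "g = pexpr_class G n' k' d" by (rule free_pro_HomE[OF g])
    obtain c where c: "pexpr_eq G n'' k'' c c" "h = pexpr_class G n'' k'' c" by (rule free_pro_HomE[OF h])
    show ?thesis unfolding e(2) d(2) c(2) free_pro_Tens[OF e(1) d(1)] free_pro_Tens[OF d(1) c(1)]
        free_pro_Tens[OF pTens[OF e(1) d(1)] c(1)] free_pro_Tens[OF e(1) pTens[OF d(1) c(1)]] add.assoc
      by (rule pexpr_class_eqI[OF pTensAssoc[OF e(1) d(1) c(1)]])
  qed
  show "Tens ?P 0 0 n k (Idn ?P 0) f = f" if f: "f \<in> Hom ?P n k" for n k f
  proof -
    obtain e where e: "pexpr_eq G n k e e" "f = pexpr_class G n k e" by (rule free_pro_HomE[OF f])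
    show ?thesis unfolding e(2) free_pro_Idn free_pro_Tens[OF pId e(1)] add_0
      by (rule pexpr_class_eqI[OF pUnitL[OF e(1)]])
  qed
  show "Tens ?P n k 0 0 f (Idn ?P 0) = f" if f: "f \<in> Hom ?P n k" for n k f
  proof -
    obtain e where e: "pexpr_eq G n k e e" "f = pexpr_class G n k e" by (rule free_pro_HomE[OF f])
    show ?thesis unfolding e(2) free_pro_Idn free_pro_Tens[OF e(1) pId] add_0_right
      by (rule pexpr_class_eqI[OF pUnitR[OF e(1)]])
  qed
qed

lemma pexpr_eval_sound:
  assumes P: "is_pro P" and \<phi>: "\<And>n k g. g \<in> G n k \<Longrightarrow> \<phi> n k g \<in> Hom P n k"
    and "pexpr_eq G n k e e'"
  shows "pexpr_eval P \<phi> e \<in> Hom P n k \<and> pexpr_eval P \<phi> e' = pexpr_eval P \<phi> e"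
  using assms(3)
proof induction
  note C = pro_cat[OF P]
  {
    case (pGen g n k)
    then show ?case by (simp add: \<phi>)
  next
    case (pId n)
    then show ?case by (simp add: pro_Id[OF P])
  next
    case (pComp m k e e' n d d')
    then show ?case by (simp add: cat_Comp[OF C])
  next
    case (pTens n k e e' n' k' d d')
    then show ?case by (simp add: pro_Tens[OF P])
  next
    case (pIdR n k e)
    then show ?case by (simp add: cat_idR[OF C])
  next
    case (pIdL n k e)
    then show ?case by (simp add: cat_idL[OF C])
  next
    case (pAssoc k l e m d n c)
    then show ?case by (simp add: cat_assoc[OF C] cat_Comp[OF C])
  next
    case (pTensId n n')
    then show ?case using P by (simp add: is_pro_def is_cat_def)
  next
    case (pInterchange m k e n d m' k' e' n' d')
    then have h: "pexpr_eval P \<phi> d \<in> Hom P n m" "pexpr_eval P \<phi> e \<in> Hom P m k"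
      "pexpr_eval P \<phi> d' \<in> Hom P n' m'" "pexpr_eval P \<phi> e' \<in> Hom P m' k'" by auto
    have "\<forall>n m k n' m' k'. \<forall>f\<in>Hom P n m. \<forall>g\<in>Hom P m k. \<forall>f'\<in>Hom P n' m'. \<forall>g'\<in>Hom P m' k'.
        Tens P n k n' k' (Comp P n m k g f) (Comp P n' m' k' g' f') =
        Comp P (n + n') (m + m') (k + k') (Tens P m k m' k' g g') (Tens P n m n' m' f f')"
      using P unfolding is_pro_def by (elim conjE)
    with h show ?case by (simp add: cat_Comp[OF C] pro_Tens[OF P])
  next
    case (pTensAssoc n k e n' k' e' n'' k'' e'')
    then have h: "pexpr_eval P \<phi> e \<in> Hom P n k" "pexpr_eval P \<phi> e' \<in> Hom P n' k'"
      "pexpr_eval P \<phi> e'' \<in> Hom P n'' k''" by auto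
    have "\<forall>n k n' k' n'' k''. \<forall>f\<in>Hom P n k. \<forall>g\<in>Hom P n' k'. \<forall>h\<in>Hom P n'' k''.
        Tens P (n + n') (k + k') n'' k'' (Tens P n k n' k' f g) h =
        Tens P n k (n' + n'') (k' + k'') f (Tens P n' k' n'' k'' g h)"
      using P unfolding is_pro_def by (elim conjE)
    with h show ?case by (simp add: pro_Tens[OF P])
  next
    case (pUnitL n k e)
    then show ?case using P by (simp add: is_pro_def)
  next
    case (pUnitR n k e)
    then show ?case using P by (simp add: is_pro_def)
  }
qed simp_all

lemma free_pro_lift_class:
  assumes "is_pro P" "\<And>n k g. g \<in> G n k \<Longrightarrow> \<phi> n k g \<in> Hom P n k" "pexpr_eq G n k e e"
  shows "free_pro_lift P \<phi> n k (pexpr_class G n k e) = pexpr_eval P \<phi> e"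
proof -
  have "pexpr_eval P \<phi> e' = pexpr_eval P \<phi> e" if "e' \<in> pexpr_class G n k e" for e'
    using pexpr_eval_sound[of P G \<phi> n k e e', OF assms(1,2)] that by (simp add: pexpr_class_def)
  then have "pexpr_eval P \<phi> ` pexpr_class G n k e = {pexpr_eval P \<phi> e}"
    using pexpr_class_self[OF assms(3)] by blast
  then show ?thesis by (simp add: free_pro_lift_def)
qed

theorem free_pro_lift_map:
  assumes P: "is_pro P" and \<phi>: "\<And>n k g. g \<in> G n k \<Longrightarrow> \<phi> n k g \<in> Hom P n k"
  shows "pro_map (free_pro G) P (free_pro_lift P \<phi>)"
    and "g \<in> G n k \<Longrightarrow> free_pro_lift P \<phi> n k (free_pro_gen G n k g) = \<phi> n k g"
proof -
  have l: "free_pro_lift P \<phi> n k (pexpr_class G n k e) = pexpr_eval P \<phi> e"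
    if "pexpr_eq G n k e e" for n k e
    by (rule free_pro_lift_class[of P G \<phi>, OF P \<phi> that])
  have s: "pexpr_eval P \<phi> e \<in> Hom P n k" if "pexpr_eq G n k e e" for n k e
    using pexpr_eval_sound[of P G \<phi> n k e e, OF P \<phi> that] ..
  show "free_pro_lift P \<phi> n k (free_pro_gen G n k g) = \<phi> n k g" if "g \<in> G n k"
    unfolding free_pro_gen_def using l[of n k "PGen n k g"] pGen[of g G n k, OF that] by simp
  show "pro_map (free_pro G) P (free_pro_lift P \<phi>)"
    unfolding pro_map_def
  proof (intro conjI allI ballI)
    show "free_pro_lift P \<phi> n k f \<in> Hom P n k" if f: "f \<in> Hom (free_pro G) n k" for n k f
    proof -
      obtain e where e: "pexpr_eq G n k e e" "f = pexpr_class G n k e" by (rule free_pro_HomE[OF f])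
      show ?thesis unfolding e(2) l[OF e(1)] by (rule s[OF e(1)])
    qed
    show "free_pro_lift P \<phi> n n (Idn (free_pro G) n) = Idn P n" for n
      unfolding free_pro_Idn l[OF pId] by simp
    show "free_pro_lift P \<phi> n k (Comp (free_pro G) n m k g f) =
        Comp P n m k (free_pro_lift P \<phi> m k g) (free_pro_lift P \<phi> n m f)"
      if f: "f \<in> Hom (free_pro G) n m" and g: "g \<in> Hom (free_pro G) m k" for n m k f g
    proof -
      obtain e where e: "pexpr_eq G m k e e" "g = pexpr_class G m k e" by (rule free_pro_HomE[OF g])
      obtain d where d: "pexpr_eq G n m d d" "f = pexpr_class G n m d" by (rule free_pro_HomE[OF f])
      show ?thesis unfolding e(2) d(2) free_pro_Comp[OF e(1) d(1)] l[OF e(1)] l[OF d(1)]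
          l[OF pComp[OF e(1) d(1)]] by simp
    qed
    show "free_pro_lift P \<phi> (n + n') (k + k') (Tens (free_pro G) n k n' k' f g) =
        Tens P n k n' k' (free_pro_lift P \<phi> n k f) (free_pro_lift P \<phi> n' k' g)"
      if f: "f \<in> Hom (free_pro G) n k" and g: "g \<in> Hom (free_pro G) n' k'" for n k n' k' f g
    proof -
      obtain e where e: "pexpr_eq G n k e e" "f = pexpr_class G n k e" by (rule free_pro_HomE[OF f])
      obtain d where d: "pexpr_eq G n' k' d d" "g = pexpr_class G n' k' d" by (rule free_pro_HomE[OF g])
      show ?thesis unfolding e(2) d(2) free_pro_Tens[OF e(1) d(1)] l[OF e(1)] l[OF d(1)]
          l[OF pTens[OF e(1) d(1)]] by simp
    qed
  qed
qed

theorem free_pro_unique: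
  assumes F: "pro_map (free_pro G) P F" and F': "pro_map (free_pro G) P F'"
    and gen: "\<And>n k g. g \<in> G n k \<Longrightarrow> F n k (free_pro_gen G n k g) = F' n k (free_pro_gen G n k g)"
    and c: "c \<in> Hom (free_pro G) n k"
  shows "F n k c = F' n k c"
proof -
  have comp: "H n k (pexpr_class G n k (PComp n m k e d)) =
      Comp P n m k (H m k (pexpr_class G m k e)) (H n m (pexpr_class G n m d))"
    if "pro_map (free_pro G) P H" "pexpr_eq G m k e e" "pexpr_eq G n m d d" for H n m k e d
    unfolding free_pro_Comp[OF that(2,3), symmetric]
    by (rule pro_map_Comp[OF that(1) free_pro_HomI[OF that(3)] free_pro_HomI[OF that(2)]])
  have tens: "H (n + n') (k + k') (pexpr_class G (n + n') (k + k') (PTens n k n' k' e d)) =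
      Tens P n k n' k' (H n k (pexpr_class G n k e)) (H n' k' (pexpr_class G n' k' d))"
    if "pro_map (free_pro G) P H" "pexpr_eq G n k e e" "pexpr_eq G n' k' d d" for H n k n' k' e d
    unfolding free_pro_Tens[OF that(2,3), symmetric]
    by (rule pro_map_Tens[OF that(1) free_pro_HomI[OF that(2)] free_pro_HomI[OF that(3)]])
  have id: "H n n (pexpr_class G n n (PId n)) = Idn P n" if "pro_map (free_pro G) P H" for H n
    using pro_map_Id[OF that, of n] by (simp add: free_pro_Idn)
  have main: "F n k (pexpr_class G n k e) = F' n k (pexpr_class G n k e)"
    if "pexpr_eq G n k e e'" for n k e e'
    using that
  proof induction
    case (pGen g n k)
    show ?case using gen[OF pGen] unfolding free_pro_gen_def .
  next
    case (pId n)
    show ?case unfolding id[OF F] id[OF F'] ..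
  next
    case (pComp m k e e' n d d')
    then have "pexpr_eq G m k e e" "pexpr_eq G n m d d" using pexpr_eq_refl by blast+
    from comp[OF F this] comp[OF F' this] pComp.IH show ?case by simp
  next
    case (pTens n k e e' n' k' d d')
    then have "pexpr_eq G n k e e" "pexpr_eq G n' k' d d" using pexpr_eq_refl by blast+
    from tens[OF F this] tens[OF F' this] pTens.IH show ?case by simp
  next
    case (pSym n k e e')
    then show ?case using pexpr_class_eqI[OF pSym.hyps] by simp
  next
    case (pTrans n k e e' e'')
    then show ?case by simp
  next
    case (pIdR n k e)
    then show ?case using pexpr_class_eqI[OF pexpr_eq.pIdR[OF pIdR.hyps]] by simp
  next
    case (pIdL n k e)
    then show ?case using pexpr_class_eqI[OF pexpr_eq.pIdL[OF pIdL.hyps]] by simp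
  next
    case (pAssoc k l e m d n c)
    note dc = pexpr_eq.pComp[OF pAssoc.hyps(2,3)]
    show ?case
      unfolding comp[OF F pAssoc.hyps(1) dc] comp[OF F' pAssoc.hyps(1) dc]
        comp[OF F pAssoc.hyps(2,3)] comp[OF F' pAssoc.hyps(2,3)] pAssoc.IH ..
  next
    case (pTensId n n')
    show ?case unfolding pexpr_class_eqI[OF pexpr_eq.pTensId] id[OF F] id[OF F'] ..
  next
    case (pInterchange m k e n d m' k' e' n' d')
    note c1 = pexpr_eq.pComp[OF pInterchange.hyps(1,2)] and c2 = pexpr_eq.pComp[OF pInterchange.hyps(3,4)]
    show ?case
      unfolding tens[OF F c1 c2] tens[OF F' c1 c2] comp[OF F pInterchange.hyps(1,2)]
        comp[OF F pInterchange.hyps(3,4)] comp[OF F' pInterchange.hyps(1,2)]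
        comp[OF F' pInterchange.hyps(3,4)] pInterchange.IH ..
  next
    case (pTensAssoc n k e n' k' e' n'' k'' e'')
    note t = pexpr_eq.pTens[OF pTensAssoc.hyps(1,2)]
    show ?case
      unfolding add.assoc[symmetric] tens[OF F t pTensAssoc.hyps(3)] tens[OF F' t pTensAssoc.hyps(3)]
        tens[OF F pTensAssoc.hyps(1,2)] tens[OF F' pTensAssoc.hyps(1,2)] pTensAssoc.IH ..
  next
    case (pUnitL n k e)
    then show ?case using pexpr_class_eqI[OF pexpr_eq.pUnitL[OF pUnitL.hyps]] by simp
  next
    case (pUnitR n k e)
    then show ?case using pexpr_class_eqI[OF pexpr_eq.pUnitR[OF pUnitR.hyps]] by simp
  qed
  obtain e where e: "pexpr_eq G n k e e" "c = pexpr_class G n k e"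
    by (rule free_pro_HomE[OF c])
  show ?thesis unfolding e(2) by (rule main[OF e(1)])
qed


section \<open>Controlled theories and their nerve realizations\<close>

text \<open>Elements of \<open>G n\<close> are generating operations \<open>n \<rightarrow> 1\<close>.\<close>

definition sig_gens :: "(nat \<Rightarrow> 'g set) \<Rightarrow> nat \<Rightarrow> nat \<Rightarrow> 'g set" where
  "sig_gens G n k = (if k = 1 then G n else {})"

definition Fr :: "(nat \<Rightarrow> 'g set) \<Rightarrow> 'g expr set law" where
  "Fr G = pres (sig_gens G) {}"

definition Fr_gen :: "(nat \<Rightarrow> 'g set) \<Rightarrow> nat \<Rightarrow> nat \<Rightarrow> 'g \<Rightarrow> 'g expr set" where
  "Fr_gen G = pres_gen (sig_gens G) {}"

record ('g, 'p, 'l) ctrl =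
  CSig :: "nat \<Rightarrow> 'g set"
  CPro :: "'p pro"
  CLaw :: "'l law"
  cinc :: "nat \<Rightarrow> nat \<Rightarrow> 'p \<Rightarrow> 'g expr set"
  cst :: "nat \<Rightarrow> nat \<Rightarrow> 'g expr set \<Rightarrow> 'l"

definition controlled_theory :: "('g, 'p, 'l) ctrl \<Rightarrow> bool" where
  "controlled_theory \<Omega> \<longleftrightarrow> is_pro (CPro \<Omega>) \<and> is_law (CLaw \<Omega>) \<and>
     pro_map (CPro \<Omega>) (law_pro (Fr (CSig \<Omega>))) (cinc \<Omega>) \<and>
     (\<forall>n k. inj_on (cinc \<Omega> n k) (Hom (CPro \<Omega>) n k)) \<and>
     law_map (Fr (CSig \<Omega>)) (CLaw \<Omega>) (cst \<Omega>) \<and>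
     (\<forall>n k. cst \<Omega> n k ` Hom (Fr (CSig \<Omega>)) n k = Hom (CLaw \<Omega>) n k)"

definition ctrl_class :: "('g, 'p, 'l) ctrl \<Rightarrow> nat \<Rightarrow> nat \<Rightarrow> 'p \<Rightarrow> 'p set" where
  "ctrl_class \<Omega> n k f =
     {g \<in> Hom (CPro \<Omega>) n k. cst \<Omega> n k (cinc \<Omega> n k g) = cst \<Omega> n k (cinc \<Omega> n k f)}"

text \<open>The nerve of the category \<open>E S\<close> with object set \<open>S\<close> and exactly one morphism between any two
  objects: a functor \<open>[d] \<rightarrow> E S\<close> is a \<open>(d+1)\<close>-tuple of objects.\<close>

definition nerve_E :: "'a set \<Rightarrow> 'a list sset" where
  "nerve_E S = \<lparr>Simp = (\<lambda>d. {xs. length xs = Suc d \<and> set xs \<subseteq> S}), Act = (\<lambda>d \<alpha> xs. map ((!) xs) \<alpha>)\<rparr>"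

text \<open>The \<open>sSet\<close>-pro \<open>Q\<^sub>\<Omega>\<close>. The coproduct of the \<open>N E [f]\<close> is formed as a union: distinct classes are
  disjoint, so distinct \<open>N E [f]\<close> have no simplex in common.\<close>

definition ctrl_spro :: "('g, 'p, 'l) ctrl \<Rightarrow> 'p list spro" where
  "ctrl_spro \<Omega> = \<lparr>
     Lev = (\<lambda>d. \<lparr>
       Hom = (\<lambda>n k. \<Union>f\<in>Hom (CPro \<Omega>) n k. Simp (nerve_E (ctrl_class \<Omega> n k f)) d),
       Comp = (\<lambda>n m k. map2 (Comp (CPro \<Omega>) n m k)),
       Idn = (\<lambda>n. replicate (Suc d) (Idn (CPro \<Omega>) n)),
       Tens = (\<lambda>n k n' k'. map2 (Tens (CPro \<Omega>) n k n' k'))\<rparr>),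
     LAct = (\<lambda>d \<alpha> n k. Act (nerve_E UNIV) d \<alpha>)\<rparr>"

definition NR_left :: "('g, 'p, 'l) ctrl \<Rightarrow> nat \<Rightarrow> nat \<Rightarrow> nat \<Rightarrow> 'p expr set \<Rightarrow> 'g expr set" where
  "NR_left \<Omega> d = pres_lift (Fr (CSig \<Omega>)) (cinc \<Omega>)"

definition NR_right :: "('g, 'p, 'l) ctrl \<Rightarrow> nat \<Rightarrow> nat \<Rightarrow> nat \<Rightarrow> 'p expr set \<Rightarrow> 'p list expr set" where
  "NR_right \<Omega> d = pres_lift (Lev (sfree_law (ctrl_spro \<Omega>)) d)
     (\<lambda>n k f. sfree_unit (ctrl_spro \<Omega>) d n k (replicate (Suc d) f))"

definition NR :: "('g, 'p, 'l) ctrl \<Rightarrow> ('g expr set + 'p list expr set) expr set slaw" where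
  "NR \<Omega> = spushout (disc (free_law (CPro \<Omega>))) (disc (Fr (CSig \<Omega>))) (sfree_law (ctrl_spro \<Omega>))
     (NR_left \<Omega>) (NR_right \<Omega>)"

abbreviation NR_in1 where
  "NR_in1 \<Omega> \<equiv> po_in1 (disc (free_law (CPro \<Omega>))) (disc (Fr (CSig \<Omega>))) (sfree_law (ctrl_spro \<Omega>))
     (NR_left \<Omega>) (NR_right \<Omega>)"

abbreviation NR_in2 where
  "NR_in2 \<Omega> \<equiv> po_in2 (disc (free_law (CPro \<Omega>))) (disc (Fr (CSig \<Omega>))) (sfree_law (ctrl_spro \<Omega>))
     (NR_left \<Omega>) (NR_right \<Omega>)"

text \<open>The map \<open>NR \<Omega> \<rightarrow> D(L)\<close>; all entries of a simplex of \<open>Q\<^sub>\<Omega>\<close> have the same image in \<open>L\<close>.\<close>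

definition NR_st :: "('g, 'p, 'l) ctrl \<Rightarrow>
    nat \<Rightarrow> nat \<Rightarrow> nat \<Rightarrow> ('g expr set + 'p list expr set) expr set \<Rightarrow> 'l" where
  "NR_st \<Omega> = po_lift (disc (CLaw \<Omega>)) (\<lambda>d. cst \<Omega>)
     (\<lambda>d. pres_lift (CLaw \<Omega>) (\<lambda>n k xs. cst \<Omega> n k (cinc \<Omega> n k (hd xs))))"

text \<open>A morphism of controlled theories consists of a map of signatures \<open>I\<close>, a map of pros \<open>p\<close> and a
  map of Lawvere theories \<open>l\<close>; its effect on nerve realizations depends only on \<open>I\<close> and \<open>p\<close>.\<close>

definition Fr_map :: "(nat \<Rightarrow> 'h set) \<Rightarrow> (nat \<Rightarrow> 'g \<Rightarrow> 'h) \<Rightarrow>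
    nat \<Rightarrow> nat \<Rightarrow> 'g expr set \<Rightarrow> 'h expr set" where
  "Fr_map G' I = pres_lift (Fr G') (\<lambda>n k g. Fr_gen G' n k (I n g))"

definition ctrl_map :: "('g, 'p, 'l) ctrl \<Rightarrow> ('h, 'q, 'r) ctrl \<Rightarrow> (nat \<Rightarrow> 'g \<Rightarrow> 'h) \<Rightarrow>
    (nat \<Rightarrow> nat \<Rightarrow> 'p \<Rightarrow> 'q) \<Rightarrow> (nat \<Rightarrow> nat \<Rightarrow> 'l \<Rightarrow> 'r) \<Rightarrow> bool" where
  "ctrl_map \<Omega> \<Omega>' I p l \<longleftrightarrow>
     (\<forall>n. \<forall>g\<in>CSig \<Omega> n. I n g \<in> CSig \<Omega>' n) \<and> pro_map (CPro \<Omega>) (CPro \<Omega>') p \<and>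
     law_map (CLaw \<Omega>) (CLaw \<Omega>') l \<and>
     (\<forall>n k. \<forall>f\<in>Hom (CPro \<Omega>) n k. Fr_map (CSig \<Omega>') I n k (cinc \<Omega> n k f) = cinc \<Omega>' n k (p n k f)) \<and>
     (\<forall>n k. \<forall>f\<in>Hom (Fr (CSig \<Omega>)) n k.
        l n k (cst \<Omega> n k f) = cst \<Omega>' n k (Fr_map (CSig \<Omega>') I n k f))"

definition NR_map :: "('h, 'q, 'r) ctrl \<Rightarrow> (nat \<Rightarrow> 'g \<Rightarrow> 'h) \<Rightarrow> (nat \<Rightarrow> nat \<Rightarrow> 'p \<Rightarrow> 'q) \<Rightarrow>
    nat \<Rightarrow> nat \<Rightarrow> nat \<Rightarrow> ('g expr set + 'p list expr set) expr set \<Rightarrow>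
    ('h expr set + 'q list expr set) expr set" where
  "NR_map \<Omega>' I p = po_lift (NR \<Omega>')
     (\<lambda>d n k x. NR_in1 \<Omega>' d n k (Fr_map (CSig \<Omega>') I n k x))
     (\<lambda>d n k y. NR_in2 \<Omega>' d n k (pres_lift (Lev (sfree_law (ctrl_spro \<Omega>')) d)
        (\<lambda>n k xs. sfree_unit (ctrl_spro \<Omega>') d n k (map (p n k) xs)) n k y))"


lemma pro_TensId: "is_pro P \<Longrightarrow> Tens P n n n' n' (Idn P n) (Idn P n') = Idn P (n + n')"
  and pro_interchange: "is_pro P \<Longrightarrow> f \<in> Hom P n m \<Longrightarrow> g \<in> Hom P m k \<Longrightarrow> f' \<in> Hom P n' m' \<Longrightarrow>
    g' \<in> Hom P m' k' \<Longrightarrow> Tens P n k n' k' (Comp P n m k g f) (Comp P n' m' k' g' f') =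
      Comp P (n + n') (m + m') (k + k') (Tens P m k m' k' g g') (Tens P n m n' m' f f')"
  and pro_TensAssoc: "is_pro P \<Longrightarrow> f \<in> Hom P n k \<Longrightarrow> g \<in> Hom P n' k' \<Longrightarrow> h \<in> Hom P n'' k'' \<Longrightarrow>
    Tens P (n + n') (k + k') n'' k'' (Tens P n k n' k' f g) h =
    Tens P n k (n' + n'') (k' + k'') f (Tens P n' k' n'' k'' g h)"
  and pro_unitL: "is_pro P \<Longrightarrow> f \<in> Hom P n k \<Longrightarrow> Tens P 0 0 n k (Idn P 0) f = f"
  and pro_unitR: "is_pro P \<Longrightarrow> f \<in> Hom P n k \<Longrightarrow> Tens P n k 0 0 f (Idn P 0) = f"
  unfolding is_pro_def by (elim conjE; simp)+

lemma proI:
  assumes "\<And>n. Idn P n \<in> Hom P n n"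
    and "\<And>n m k f g. f \<in> Hom P n m \<Longrightarrow> g \<in> Hom P m k \<Longrightarrow> Comp P n m k g f \<in> Hom P n k"
    and "\<And>n k f. f \<in> Hom P n k \<Longrightarrow> Comp P n n k f (Idn P n) = f"
    and "\<And>n k f. f \<in> Hom P n k \<Longrightarrow> Comp P n k k (Idn P k) f = f"
    and "\<And>n m k l f g h. f \<in> Hom P n m \<Longrightarrow> g \<in> Hom P m k \<Longrightarrow> h \<in> Hom P k l \<Longrightarrow>
      Comp P n k l h (Comp P n m k g f) = Comp P n m l (Comp P m k l h g) f"
    and "\<And>n k n' k' f g. f \<in> Hom P n k \<Longrightarrow> g \<in> Hom P n' k' \<Longrightarrow>
      Tens P n k n' k' f g \<in> Hom P (n + n') (k + k')"
    and "\<And>n n'. Tens P n n n' n' (Idn P n) (Idn P n') = Idn P (n + n')"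
    and "\<And>n m k n' m' k' f g f' g'. f \<in> Hom P n m \<Longrightarrow> g \<in> Hom P m k \<Longrightarrow> f' \<in> Hom P n' m' \<Longrightarrow>
      g' \<in> Hom P m' k' \<Longrightarrow> Tens P n k n' k' (Comp P n m k g f) (Comp P n' m' k' g' f') =
      Comp P (n + n') (m + m') (k + k') (Tens P m k m' k' g g') (Tens P n m n' m' f f')"
    and "\<And>n k n' k' n'' k'' f g h. f \<in> Hom P n k \<Longrightarrow> g \<in> Hom P n' k' \<Longrightarrow> h \<in> Hom P n'' k'' \<Longrightarrow>
      Tens P (n + n') (k + k') n'' k'' (Tens P n k n' k' f g) h =
      Tens P n k (n' + n'') (k' + k'') f (Tens P n' k' n'' k'' g h)"
    and "\<And>n k f. f \<in> Hom P n k \<Longrightarrow> Tens P 0 0 n k (Idn P 0) f = f"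
    and "\<And>n k f. f \<in> Hom P n k \<Longrightarrow> Tens P n k 0 0 f (Idn P 0) = f"
  shows "is_pro P"
  unfolding is_pro_def is_cat_def using assms by (intro conjI allI ballI) auto

lemma is_law_Fr: "is_law (Fr G)"
  unfolding Fr_def by (rule is_law_pres)

lemma Fr_gen_Hom: "g \<in> G n \<Longrightarrow> Fr_gen G n 1 g \<in> Hom (Fr G) n 1"
  unfolding Fr_gen_def Fr_def by (rule pres_gen_Hom) (simp add: sig_gens_def)

lemma simp_ops_nth: "\<alpha> \<in> simp_ops m d \<Longrightarrow> i \<le> m \<Longrightarrow> \<alpha> ! i \<le> d"
  unfolding simp_ops_def by (auto simp: subset_iff)

locale ctrl_data =
  fixes \<Omega> :: "('g, 'p, 'l) ctrl"
  assumes P: "is_pro (CPro \<Omega>)" and L: "is_law (CLaw \<Omega>)"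
    and i: "pro_map (CPro \<Omega>) (law_pro (Fr (CSig \<Omega>))) (cinc \<Omega>)"
    and st: "law_map (Fr (CSig \<Omega>)) (CLaw \<Omega>) (cst \<Omega>)"
begin

definition sg where "sg n k f = cst \<Omega> n k (cinc \<Omega> n k f)"

lemma sg_map: "pro_map (CPro \<Omega>) (law_pro (CLaw \<Omega>)) sg"
  unfolding sg_def[abs_def] by (rule pro_map_compose[OF i law_map_pro_map[OF st is_law_Fr L]])

abbreviation "Q \<equiv> ctrl_spro \<Omega>"

lemma Q_Hom: "xs \<in> Hom (Lev Q d) n k \<longleftrightarrow> length xs = Suc d \<and>
    (\<forall>i\<le>d. xs ! i \<in> Hom (CPro \<Omega>) n k) \<and> (\<exists>c. \<forall>i\<le>d. sg n k (xs ! i) = c)"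
proof -
  have sub: "set xs \<subseteq> A \<longleftrightarrow> (\<forall>i<length xs. xs ! i \<in> A)" for A
    by (auto simp: set_conv_nth)
  have "xs \<in> Hom (Lev Q d) n k \<longleftrightarrow>
      (\<exists>f\<in>Hom (CPro \<Omega>) n k. length xs = Suc d \<and> set xs \<subseteq> ctrl_class \<Omega> n k f)"
    by (simp add: ctrl_spro_def nerve_E_def)
  also have "\<dots> \<longleftrightarrow> (\<exists>f\<in>Hom (CPro \<Omega>) n k. length xs = Suc d \<and>
      (\<forall>i\<le>d. xs ! i \<in> Hom (CPro \<Omega>) n k \<and> sg n k (xs ! i) = sg n k f))"
    by (intro bex_cong refl conj_cong) (simp add: sub ctrl_class_def sg_def less_Suc_eq_le)
  also have "\<dots> \<longleftrightarrow> length xs = Suc d \<and>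
      (\<forall>i\<le>d. xs ! i \<in> Hom (CPro \<Omega>) n k) \<and> (\<exists>c. \<forall>i\<le>d. sg n k (xs ! i) = c)"
  proof (intro iffI conjI)
    assume "length xs = Suc d \<and> (\<forall>i\<le>d. xs ! i \<in> Hom (CPro \<Omega>) n k) \<and> (\<exists>c. \<forall>i\<le>d. sg n k (xs ! i) = c)"
    then obtain c where c: "length xs = Suc d" "\<forall>i\<le>d. xs ! i \<in> Hom (CPro \<Omega>) n k"
      "\<forall>i\<le>d. sg n k (xs ! i) = c" by blast
    then show "\<exists>f\<in>Hom (CPro \<Omega>) n k. length xs = Suc d \<and>
        (\<forall>i\<le>d. xs ! i \<in> Hom (CPro \<Omega>) n k \<and> sg n k (xs ! i) = sg n k f)"
      by (intro bexI[of _ "xs ! 0"]) simp_all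
  qed blast+
  finally show ?thesis .
qed

lemma Q_HomI: "length xs = Suc d \<Longrightarrow> (\<And>i. i \<le> d \<Longrightarrow> xs ! i \<in> Hom (CPro \<Omega>) n k) \<Longrightarrow>
    (\<And>i. i \<le> d \<Longrightarrow> sg n k (xs ! i) = c) \<Longrightarrow> xs \<in> Hom (Lev Q d) n k"
  unfolding Q_Hom by blast

lemma Q_HomE:
  assumes "xs \<in> Hom (Lev Q d) n k"
  obtains c where "length xs = Suc d" "\<And>i. i \<le> d \<Longrightarrow> xs ! i \<in> Hom (CPro \<Omega>) n k"
    "\<And>i. i \<le> d \<Longrightarrow> sg n k (xs ! i) = c"
  using assms unfolding Q_Hom by blast

lemma Q_ops:
  "Comp (Lev Q d) n m k = map2 (Comp (CPro \<Omega>) n m k)"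
  "Idn (Lev Q d) n = replicate (Suc d) (Idn (CPro \<Omega>) n)"
  "Tens (Lev Q d) n k n' k' = map2 (Tens (CPro \<Omega>) n k n' k')"
  "LAct Q d \<alpha> n k xs = map ((!) xs) \<alpha>"
  by (simp_all add: ctrl_spro_def nerve_E_def)

lemma Q_pro: "is_pro (Lev Q d)"
proof (rule proI)
  note C = pro_cat[OF P]
  show "Idn (Lev Q d) n \<in> Hom (Lev Q d) n n" for n
    by (rule Q_HomI[where c = "sg n n (Idn (CPro \<Omega>) n)"])
      (simp_all add: Q_ops pro_Id[OF P] del: replicate_Suc)
  show "Comp (Lev Q d) n m k g f \<in> Hom (Lev Q d) n k"
    if f: "f \<in> Hom (Lev Q d) n m" and g: "g \<in> Hom (Lev Q d) m k" for n m k f g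
  proof -
    obtain a where a: "length f = Suc d" "\<And>i. i \<le> d \<Longrightarrow> f ! i \<in> Hom (CPro \<Omega>) n m"
      "\<And>i. i \<le> d \<Longrightarrow> sg n m (f ! i) = a" using f unfolding Q_Hom by blast
    obtain b where b: "length g = Suc d" "\<And>i. i \<le> d \<Longrightarrow> g ! i \<in> Hom (CPro \<Omega>) m k"
      "\<And>i. i \<le> d \<Longrightarrow> sg m k (g ! i) = b" using g unfolding Q_Hom by blast
    show ?thesis
      by (rule Q_HomI[where c = "Comp (law_pro (CLaw \<Omega>)) n m k b a"])
        (use a b in \<open>simp_all add: Q_ops less_Suc_eq_le cat_Comp[OF C] pro_map_Comp[OF sg_map]\<close>)
  qed
  show "Comp (Lev Q d) n n k f (Idn (Lev Q d) n) = f" if "f \<in> Hom (Lev Q d) n k" for n k f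
    using that unfolding Q_Hom Q_ops
    by (intro nth_equalityI) (simp_all add: less_Suc_eq_le cat_idR[OF C] del: replicate_Suc)
  show "Comp (Lev Q d) n k k (Idn (Lev Q d) k) f = f" if "f \<in> Hom (Lev Q d) n k" for n k f
    using that unfolding Q_Hom Q_ops
    by (intro nth_equalityI) (simp_all add: less_Suc_eq_le cat_idL[OF C] del: replicate_Suc)
  show "Comp (Lev Q d) n k l h (Comp (Lev Q d) n m k g f) = Comp (Lev Q d) n m l (Comp (Lev Q d) m k l h g) f"
    if "f \<in> Hom (Lev Q d) n m" "g \<in> Hom (Lev Q d) m k" "h \<in> Hom (Lev Q d) k l" for n m k l f g h
    using that unfolding Q_Hom Q_ops
    by (intro nth_equalityI) (simp_all add: less_Suc_eq_le cat_assoc[OF C])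
  show "Tens (Lev Q d) n k n' k' f g \<in> Hom (Lev Q d) (n + n') (k + k')"
    if f: "f \<in> Hom (Lev Q d) n k" and g: "g \<in> Hom (Lev Q d) n' k'" for n k n' k' f g
  proof -
    obtain a where a: "length f = Suc d" "\<And>i. i \<le> d \<Longrightarrow> f ! i \<in> Hom (CPro \<Omega>) n k"
      "\<And>i. i \<le> d \<Longrightarrow> sg n k (f ! i) = a" using f unfolding Q_Hom by blast
    obtain b where b: "length g = Suc d" "\<And>i. i \<le> d \<Longrightarrow> g ! i \<in> Hom (CPro \<Omega>) n' k'"
      "\<And>i. i \<le> d \<Longrightarrow> sg n' k' (g ! i) = b" using g unfolding Q_Hom by blast
    show ?thesis
      by (rule Q_HomI[where c = "Tens (law_pro (CLaw \<Omega>)) n k n' k' a b"])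
        (use a b in \<open>simp_all add: Q_ops less_Suc_eq_le pro_Tens[OF P] pro_map_Tens[OF sg_map]\<close>)
  qed
  show "Tens (Lev Q d) n n n' n' (Idn (Lev Q d) n) (Idn (Lev Q d) n') = Idn (Lev Q d) (n + n')" for n n'
    unfolding Q_ops by (intro nth_equalityI) (simp_all add: pro_TensId[OF P] del: replicate_Suc)
  show "Tens (Lev Q d) n k n' k' (Comp (Lev Q d) n m k g f) (Comp (Lev Q d) n' m' k' g' f') =
      Comp (Lev Q d) (n + n') (m + m') (k + k') (Tens (Lev Q d) m k m' k' g g') (Tens (Lev Q d) n m n' m' f f')"
    if "f \<in> Hom (Lev Q d) n m" "g \<in> Hom (Lev Q d) m k" "f' \<in> Hom (Lev Q d) n' m'"
      "g' \<in> Hom (Lev Q d) m' k'" for n m k n' m' k' f g f' g'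
    using that unfolding Q_Hom Q_ops
    by (intro nth_equalityI) (simp_all add: less_Suc_eq_le pro_interchange[OF P])
  show "Tens (Lev Q d) (n + n') (k + k') n'' k'' (Tens (Lev Q d) n k n' k' f g) h =
      Tens (Lev Q d) n k (n' + n'') (k' + k'') f (Tens (Lev Q d) n' k' n'' k'' g h)"
    if "f \<in> Hom (Lev Q d) n k" "g \<in> Hom (Lev Q d) n' k'" "h \<in> Hom (Lev Q d) n'' k''"
    for n k n' k' n'' k'' f g h
    using that unfolding Q_Hom Q_ops
    by (intro nth_equalityI) (simp_all add: less_Suc_eq_le pro_TensAssoc[OF P])
  show "Tens (Lev Q d) 0 0 n k (Idn (Lev Q d) 0) f = f" if "f \<in> Hom (Lev Q d) n k" for n k f
    using that unfolding Q_Hom Q_ops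
    by (intro nth_equalityI) (simp_all add: less_Suc_eq_le pro_unitL[OF P] del: replicate_Suc)
  show "Tens (Lev Q d) n k 0 0 f (Idn (Lev Q d) 0) = f" if "f \<in> Hom (Lev Q d) n k" for n k f
    using that unfolding Q_Hom Q_ops
    by (intro nth_equalityI) (simp_all add: less_Suc_eq_le pro_unitR[OF P] del: replicate_Suc)
qed

lemma Q_act_Hom:
  assumes a: "\<alpha> \<in> simp_ops m d" and xs: "xs \<in> Hom (Lev Q d) n k"
  shows "LAct Q d \<alpha> n k xs \<in> Hom (Lev Q m) n k"
proof -
  obtain c where c: "length xs = Suc d" "\<And>i. i \<le> d \<Longrightarrow> xs ! i \<in> Hom (CPro \<Omega>) n k"
    "\<And>i. i \<le> d \<Longrightarrow> sg n k (xs ! i) = c" using xs unfolding Q_Hom by blast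
  show ?thesis
    by (rule Q_HomI[where c = c])
      (use c simp_ops_nth[OF a] simp_ops_length[OF a] in \<open>simp_all add: Q_ops less_Suc_eq_le\<close>)
qed

lemma Q_act: "\<alpha> \<in> simp_ops m d \<Longrightarrow> pro_map (Lev Q d) (Lev Q m) (LAct Q d \<alpha>)"
  unfolding pro_map_def
proof (intro conjI allI ballI)
  assume a: "\<alpha> \<in> simp_ops m d"
  note A = simp_ops_nth[OF a] simp_ops_length[OF a]
  show "LAct Q d \<alpha> n k f \<in> Hom (Lev Q m) n k" if "f \<in> Hom (Lev Q d) n k" for n k f
    by (rule Q_act_Hom[OF a that])
  show "LAct Q d \<alpha> n n (Idn (Lev Q d) n) = Idn (Lev Q m) n" for n
    unfolding Q_ops using A
    by (intro nth_equalityI) (simp_all add: less_Suc_eq_le del: replicate_Suc)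
  show "LAct Q d \<alpha> n k (Comp (Lev Q d) n m' k g f) =
      Comp (Lev Q m) n m' k (LAct Q d \<alpha> m' k g) (LAct Q d \<alpha> n m' f)"
    if "f \<in> Hom (Lev Q d) n m'" "g \<in> Hom (Lev Q d) m' k" for n m' k f g
    using that A unfolding Q_ops Q_Hom
    by (intro nth_equalityI) (simp_all add: less_Suc_eq_le)
  show "LAct Q d \<alpha> (n + n') (k + k') (Tens (Lev Q d) n k n' k' f g) =
      Tens (Lev Q m) n k n' k' (LAct Q d \<alpha> n k f) (LAct Q d \<alpha> n' k' g)"
    if "f \<in> Hom (Lev Q d) n k" "g \<in> Hom (Lev Q d) n' k'" for n k n' k' f g
    using that A unfolding Q_ops Q_Hom
    by (intro nth_equalityI) (simp_all add: less_Suc_eq_le)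
qed

theorem is_spro_Q: "is_spro Q"
  unfolding is_spro_def
proof (intro conjI allI ballI)
  show "is_pro (Lev Q d)" for d by (rule Q_pro)
  show "pro_map (Lev Q d) (Lev Q m) (LAct Q d \<alpha>)" if "\<alpha> \<in> simp_ops m d" for m d \<alpha> by (rule Q_act[OF that])
  fix n k
  show "simplicial_set (shom Q n k)"
    unfolding simplicial_set_def
  proof (intro conjI allI ballI)
    show "Act (shom Q n k) d \<alpha> xs \<in> Simp (shom Q n k) m"
      if "\<alpha> \<in> simp_ops m d" "xs \<in> Simp (shom Q n k) d" for m d \<alpha> xs
      using Q_act_Hom[OF that(1)] that(2) by (simp add: shom_def)
    show "Act (shom Q n k) d [0..<Suc d] xs = xs" if "xs \<in> Simp (shom Q n k) d" for d xs
      using that unfolding shom_def by (simp add: Q_Hom Q_ops del: upt_Suc) (metis map_nth)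
    show "Act (shom Q n k) m \<beta> (Act (shom Q n k) d \<alpha> xs) = Act (shom Q n k) d (map ((!) \<alpha>) \<beta>) xs"
      if "\<beta> \<in> simp_ops l m" "\<alpha> \<in> simp_ops m d" "xs \<in> Simp (shom Q n k) d" for l m d \<alpha> \<beta> xs
      unfolding shom_def
      using that(1) simp_ops_length[OF that(2)]
      by (auto simp: Q_ops simp_ops_def intro!: nth_map)
  qed
qed

lemma vertex_map: "pro_map (CPro \<Omega>) (Lev Q d) (\<lambda>n k f. replicate (Suc d) f)"
  unfolding pro_map_def
proof (intro conjI allI ballI)
  show "replicate (Suc d) f \<in> Hom (Lev Q d) n k" if "f \<in> Hom (CPro \<Omega>) n k" for n k f
    by (rule Q_HomI[where c = "sg n k f"]) (simp_all add: that del: replicate_Suc)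
qed (simp_all add: Q_ops zip_replicate del: replicate_Suc)

lemma NR_right_pro_map:
  "pro_map (CPro \<Omega>) (law_pro (Lev (sfree_law Q) d)) (\<lambda>n k f. sfree_unit Q d n k (replicate (Suc d) f))"
  unfolding sfree_Lev sfree_unit_def by (rule pro_map_compose[OF vertex_map free_unit_map[OF Q_pro]])

lemma free_law_lift:
  assumes F: "pro_map (CPro \<Omega>) (law_pro T) F" and T: "is_law T"
  shows "law_map (free_law (CPro \<Omega>)) T (pres_lift T F)"
    and "f \<in> Hom (CPro \<Omega>) n k \<Longrightarrow> pres_lift T F n k (free_unit (CPro \<Omega>) n k f) = F n k f"
  unfolding free_law_def free_unit_def
  by (rule pres_lift_map[OF T free_model[OF F T]])
    (rule pres_lift_gen[OF T free_model[OF F T], of f n k])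

lemma free_law_unique:
  assumes "is_law T" "law_map (free_law (CPro \<Omega>)) T F" "law_map (free_law (CPro \<Omega>)) T F'"
    and "\<And>n k f. f \<in> Hom (CPro \<Omega>) n k \<Longrightarrow>
      F n k (free_unit (CPro \<Omega>) n k f) = F' n k (free_unit (CPro \<Omega>) n k f)"
    and "x \<in> Hom (free_law (CPro \<Omega>)) n k"
  shows "F n k x = F' n k x"
  using pres_map_unique[of T "Hom (CPro \<Omega>)" "free_rel (CPro \<Omega>)" F F' x n k] assms
  unfolding free_law_def free_unit_def by blast

lemma NR_right_unit: "f \<in> Hom (CPro \<Omega>) n k \<Longrightarrow>
    NR_right \<Omega> d n k (free_unit (CPro \<Omega>) n k f) = sfree_unit Q d n k (replicate (Suc d) f)"
  unfolding NR_right_def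
  by (rule free_law_lift(2)[OF NR_right_pro_map slaw_Lev[OF is_slaw_sfree[OF is_spro_Q]]])

theorem NR_right_map: "slaw_map (disc (free_law (CPro \<Omega>))) (sfree_law Q) (NR_right \<Omega>)"
proof (rule slaw_mapI; unfold disc_sel)
  note S = is_slaw_sfree[OF is_spro_Q]
  show l: "law_map (free_law (CPro \<Omega>)) (Lev (sfree_law Q) d) (NR_right \<Omega> d)" for d
    unfolding NR_right_def by (rule free_law_lift(1)[OF NR_right_pro_map slaw_Lev[OF S]])
  fix m d \<alpha> n k x assume a: "\<alpha> \<in> simp_ops m d" and x: "x \<in> Hom (free_law (CPro \<Omega>)) n k"
  show "NR_right \<Omega> m n k x = LAct (sfree_law Q) d \<alpha> n k (NR_right \<Omega> d n k x)"
  proof (rule free_law_unique[OF slaw_Lev[OF S] l law_map_compose[OF l slaw_LAct[OF S a]] _ x])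
    fix n k f assume f: "f \<in> Hom (CPro \<Omega>) n k"
    have v: "replicate (Suc d) f \<in> Hom (Lev Q d) n k" by (rule pro_map_Hom[OF vertex_map f])
    have "LAct Q d \<alpha> n k (replicate (Suc d) f) = replicate (Suc m) f"
      unfolding Q_ops using simp_ops_nth[OF a] simp_ops_length[OF a]
      by (intro nth_equalityI) (simp_all add: less_Suc_eq_le del: replicate_Suc)
    with sfree_unit_map[OF is_spro_Q] a v
    have "sfree_unit Q m n k (replicate (Suc m) f) =
        LAct (sfree_law Q) d \<alpha> n k (sfree_unit Q d n k (replicate (Suc d) f))"
      unfolding spro_map_def slaw_pro_def by (metis enr.select_convs(2))
    then show "NR_right \<Omega> m n k (free_unit (CPro \<Omega>) n k f) =
        LAct (sfree_law Q) d \<alpha> n k (NR_right \<Omega> d n k (free_unit (CPro \<Omega>) n k f))"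
      by (simp only: NR_right_unit[OF f])
  qed
qed

lemma NR_left_unit: "f \<in> Hom (CPro \<Omega>) n k \<Longrightarrow> NR_left \<Omega> d n k (free_unit (CPro \<Omega>) n k f) = cinc \<Omega> n k f"
  unfolding NR_left_def by (rule free_law_lift(2)[OF i is_law_Fr])

theorem NR_left_map: "slaw_map (disc (free_law (CPro \<Omega>))) (disc (Fr (CSig \<Omega>))) (NR_left \<Omega>)"
proof (rule slaw_mapI; unfold disc_sel)
  show "law_map (free_law (CPro \<Omega>)) (Fr (CSig \<Omega>)) (NR_left \<Omega> d)" for d
    unfolding NR_left_def by (rule free_law_lift(1)[OF i is_law_Fr])
qed (simp add: NR_left_def)

lemmas NR_po = is_slaw_disc[OF is_law_free_law] is_slaw_disc[OF is_law_Fr] is_slaw_sfree[OF is_spro_Q]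
  NR_left_map NR_right_map

theorem is_slaw_NR: "is_slaw (NR \<Omega>)"
  unfolding NR_def by (rule is_slaw_spushout[OF NR_po])

lemma NR_in_map: "slaw_map (disc (Fr (CSig \<Omega>))) (NR \<Omega>) (NR_in1 \<Omega>)" "slaw_map (sfree_law Q) (NR \<Omega>) (NR_in2 \<Omega>)"
  unfolding NR_def by (rule po_in_slaw_map[OF NR_po])+

lemma NR_square: "x \<in> Hom (free_law (CPro \<Omega>)) n k \<Longrightarrow>
    NR_in1 \<Omega> d n k (NR_left \<Omega> d n k x) = NR_in2 \<Omega> d n k (NR_right \<Omega> d n k x)"
  using po_square[OF NR_po, of x d n k] by (simp add: disc_sel)

definition st_Q where "st_Q = (\<lambda>d. pres_lift (CLaw \<Omega>) (\<lambda>n k xs. cst \<Omega> n k (cinc \<Omega> n k (hd xs))))"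

lemma Q_hd: "xs \<in> Hom (Lev Q d) n k \<Longrightarrow> hd xs = xs ! 0"
  unfolding Q_Hom by (cases xs) auto

lemma st_Q_spro_map: "spro_map Q (slaw_pro (disc (CLaw \<Omega>))) (\<lambda>d n k xs. cst \<Omega> n k (cinc \<Omega> n k (hd xs)))"
  unfolding spro_map_def slaw_pro_def sg_def[symmetric]
proof (simp add: disc_sel, intro conjI allI ballI)
  show "pro_map (Lev Q d) (law_pro (CLaw \<Omega>)) (\<lambda>n k xs. sg n k (hd xs))" for d
    unfolding pro_map_def
  proof (intro conjI allI ballI)
    show "sg n k (hd f) \<in> Hom (law_pro (CLaw \<Omega>)) n k" if "f \<in> Hom (Lev Q d) n k" for n k f
      using that pro_map_Hom[OF sg_map] unfolding Q_hd[OF that] by (simp add: Q_Hom)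
    show "sg n n (hd (Idn (Lev Q d) n)) = Idn (law_pro (CLaw \<Omega>)) n" for n
      by (simp add: Q_ops pro_map_Id[OF sg_map])
    show "sg n k (hd (Comp (Lev Q d) n m k g f)) = Comp (law_pro (CLaw \<Omega>)) n m k (sg m k (hd g)) (sg n m (hd f))"
      if f: "f \<in> Hom (Lev Q d) n m" and g: "g \<in> Hom (Lev Q d) m k" for n m k f g
      using f g unfolding Q_hd[OF f] Q_hd[OF g] Q_hd[OF cat_Comp[OF pro_cat[OF Q_pro] f g]]
      by (simp add: Q_Hom Q_ops pro_map_Comp[OF sg_map])
    show "sg (n + n') (k + k') (hd (Tens (Lev Q d) n k n' k' f g)) =
        Tens (law_pro (CLaw \<Omega>)) n k n' k' (sg n k (hd f)) (sg n' k' (hd g))"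
      if f: "f \<in> Hom (Lev Q d) n k" and g: "g \<in> Hom (Lev Q d) n' k'" for n k n' k' f g
      using f g unfolding Q_hd[OF f] Q_hd[OF g] Q_hd[OF pro_Tens[OF Q_pro f g]]
      by (simp add: Q_Hom Q_ops pro_map_Tens[OF sg_map])
  qed
  fix m d \<alpha> n k xs assume a: "\<alpha> \<in> simp_ops m d" and x: "xs \<in> Hom (Lev Q d) n k"
  show "sg n k (hd (LAct Q d \<alpha> n k xs)) = sg n k (hd xs)"
  proof -
    obtain c where c: "length xs = Suc d" "\<And>i. i \<le> d \<Longrightarrow> sg n k (xs ! i) = c" using x unfolding Q_Hom by blast
    show ?thesis
      using c simp_ops_nth[OF a, of 0] simp_ops_length[OF a]
      unfolding Q_hd[OF x] Q_hd[OF Q_act_Hom[OF a x]] by (simp add: Q_ops)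
  qed
qed

lemma st_Q_map: "slaw_map (sfree_law Q) (disc (CLaw \<Omega>)) st_Q"
  and st_Q_unit: "xs \<in> Hom (Lev Q d) n k \<Longrightarrow>
    st_Q d n k (sfree_unit Q d n k xs) = cst \<Omega> n k (cinc \<Omega> n k (hd xs))"
  using sfree_lift[OF is_spro_Q is_slaw_disc[OF L] st_Q_spro_map] by (simp_all add: st_Q_def disc_sel)

lemma cst_disc: "slaw_map (disc (Fr (CSig \<Omega>))) (disc (CLaw \<Omega>)) (\<lambda>d. cst \<Omega>)"
  by (rule slaw_mapI) (simp_all add: disc_sel st)

lemma NR_st_square:
  assumes x: "x \<in> Hom (Lev (disc (free_law (CPro \<Omega>))) d) n k"
  shows "cst \<Omega> n k (NR_left \<Omega> d n k x) = st_Q d n k (NR_right \<Omega> d n k x)"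
proof (rule free_law_unique[OF L _ _ _ x[unfolded disc_sel]])
  show "law_map (free_law (CPro \<Omega>)) (CLaw \<Omega>) (\<lambda>n k x. cst \<Omega> n k (NR_left \<Omega> d n k x))"
    using slaw_map_law[OF slaw_map_compose[OF NR_left_map cst_disc], of d] by (simp add: disc_sel)
  show "law_map (free_law (CPro \<Omega>)) (CLaw \<Omega>) (\<lambda>n k x. st_Q d n k (NR_right \<Omega> d n k x))"
    using slaw_map_law[OF slaw_map_compose[OF NR_right_map st_Q_map], of d] by (simp add: disc_sel)
  fix n k f assume f: "f \<in> Hom (CPro \<Omega>) n k"
  show "cst \<Omega> n k (NR_left \<Omega> d n k (free_unit (CPro \<Omega>) n k f)) =
      st_Q d n k (NR_right \<Omega> d n k (free_unit (CPro \<Omega>) n k f))"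
    unfolding NR_left_unit[OF f] NR_right_unit[OF f] st_Q_unit[OF pro_map_Hom[OF vertex_map f]] by simp
qed

theorem NR_st_map: "slaw_map (NR \<Omega>) (disc (CLaw \<Omega>)) (NR_st \<Omega>)"
  and NR_st_in1: "x \<in> Hom (Fr (CSig \<Omega>)) n k \<Longrightarrow> NR_st \<Omega> d n k (NR_in1 \<Omega> d n k x) = cst \<Omega> n k x"
  and NR_st_in2: "y \<in> Hom (Lev (sfree_law Q) d) n k \<Longrightarrow> NR_st \<Omega> d n k (NR_in2 \<Omega> d n k y) = st_Q d n k y"
proof -
  have e: "NR_st \<Omega> = po_lift (disc (CLaw \<Omega>)) (\<lambda>d. cst \<Omega>) st_Q"
    by (simp add: NR_st_def st_Q_def)
  note l = po_lift_map[OF NR_po is_slaw_disc[OF L] cst_disc st_Q_map NR_st_square]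
  show "slaw_map (NR \<Omega>) (disc (CLaw \<Omega>)) (NR_st \<Omega>)" unfolding e NR_def by (rule l(1))
  show "NR_st \<Omega> d n k (NR_in1 \<Omega> d n k x) = cst \<Omega> n k x" if "x \<in> Hom (Fr (CSig \<Omega>)) n k"
    unfolding e by (rule l(2)) (simp_all add: disc_sel that)
  show "NR_st \<Omega> d n k (NR_in2 \<Omega> d n k y) = st_Q d n k y" if "y \<in> Hom (Lev (sfree_law Q) d) n k"
    unfolding e by (rule l(3)) (simp_all add: that)
qed

end

lemma controlled_theory_data: "controlled_theory \<Omega> \<Longrightarrow> ctrl_data \<Omega>"
  by (simp add: controlled_theory_def ctrl_data_def)

lemma Fr_map_law:
  assumes I: "\<And>n g. g \<in> G n \<Longrightarrow> I n g \<in> G' n"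
  shows "law_map (Fr G) (Fr G') (Fr_map G' I)"
    and "g \<in> G n \<Longrightarrow> Fr_map G' I n 1 (Fr_gen G n 1 g) = Fr_gen G' n 1 (I n g)"
proof -
  have m: "pres_model (sig_gens G) {} (Fr G') (\<lambda>n k g. Fr_gen G' n k (I n g))"
    unfolding pres_model_def sig_gens_def using I by (auto intro: Fr_gen_Hom[unfolded One_nat_def])
  show "law_map (Fr G) (Fr G') (Fr_map G' I)"
    unfolding Fr_map_def by (subst Fr_def) (rule pres_lift_map(1)[OF is_law_Fr m])
  show "Fr_map G' I n 1 (Fr_gen G n 1 g) = Fr_gen G' n 1 (I n g)" if "g \<in> G n"
    unfolding Fr_map_def Fr_gen_def[of G]
    by (rule pres_lift_gen[OF is_law_Fr m, of g n 1]) (simp add: sig_gens_def that)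
qed

locale ctrl_morphism = A: ctrl_data \<Omega> + B: ctrl_data \<Omega>'
  for \<Omega> :: "('g, 'p, 'l) ctrl" and \<Omega>' :: "('h, 'q, 'r) ctrl" +
  fixes I p l
  assumes mor: "ctrl_map \<Omega> \<Omega>' I p l"
begin

lemma sig: "g \<in> CSig \<Omega> n \<Longrightarrow> I n g \<in> CSig \<Omega>' n"
  and p: "pro_map (CPro \<Omega>) (CPro \<Omega>') p"
  and sq1: "f \<in> Hom (CPro \<Omega>) n k \<Longrightarrow> Fr_map (CSig \<Omega>') I n k (cinc \<Omega> n k f) = cinc \<Omega>' n k (p n k f)"
  and sq2: "x \<in> Hom (Fr (CSig \<Omega>)) n k \<Longrightarrow> l n k (cst \<Omega> n k x) = cst \<Omega>' n k (Fr_map (CSig \<Omega>') I n k x)"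
  using mor unfolding ctrl_map_def by blast+

lemma sg_p:
  assumes f: "f \<in> Hom (CPro \<Omega>) n k"
  shows "B.sg n k (p n k f) = l n k (A.sg n k f)"
proof -
  have "cinc \<Omega> n k f \<in> Hom (Fr (CSig \<Omega>)) n k"
    using pro_map_Hom[OF A.i f] by (simp add: law_pro_sel)
  from sq2[OF this] show ?thesis by (simp add: A.sg_def B.sg_def sq1[OF f])
qed

lemma Q_p: "spro_map A.Q B.Q (\<lambda>d n k. map (p n k))"
  unfolding spro_map_def
proof (intro conjI allI ballI)
  show "pro_map (Lev A.Q d) (Lev B.Q d) (\<lambda>n k. map (p n k))" for d
    unfolding pro_map_def
  proof (intro conjI allI ballI)
    show "map (p n k) f \<in> Hom (Lev B.Q d) n k" if f: "f \<in> Hom (Lev A.Q d) n k" for n k f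
    proof -
      obtain c where c: "length f = Suc d" "\<And>i. i \<le> d \<Longrightarrow> f ! i \<in> Hom (CPro \<Omega>) n k"
        "\<And>i. i \<le> d \<Longrightarrow> A.sg n k (f ! i) = c" using f unfolding A.Q_Hom by blast
      show ?thesis
        by (rule B.Q_HomI[where c = "l n k c"])
          (use c in \<open>simp_all add: less_Suc_eq_le pro_map_Hom[OF p] sg_p\<close>)
    qed
    show "map (p n n) (Idn (Lev A.Q d) n) = Idn (Lev B.Q d) n" for n
      by (simp add: A.Q_ops B.Q_ops pro_map_Id[OF p])
    show "map (p n k) (Comp (Lev A.Q d) n m k g f) = Comp (Lev B.Q d) n m k (map (p m k) g) (map (p n m) f)"
      if "f \<in> Hom (Lev A.Q d) n m" "g \<in> Hom (Lev A.Q d) m k" for n m k f g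
      using that unfolding A.Q_Hom A.Q_ops B.Q_ops
      by (intro nth_equalityI) (simp_all add: less_Suc_eq_le pro_map_Comp[OF p])
    show "map (p (n + n') (k + k')) (Tens (Lev A.Q d) n k n' k' f g) =
        Tens (Lev B.Q d) n k n' k' (map (p n k) f) (map (p n' k') g)"
      if "f \<in> Hom (Lev A.Q d) n k" "g \<in> Hom (Lev A.Q d) n' k'" for n k n' k' f g
      using that unfolding A.Q_Hom A.Q_ops B.Q_ops
      by (intro nth_equalityI) (simp_all add: less_Suc_eq_le pro_map_Tens[OF p])
  qed
  show "map (p n k) (LAct A.Q d \<alpha> n k xs) = LAct B.Q d \<alpha> n k (map (p n k) xs)"
    if "\<alpha> \<in> simp_ops m d" "xs \<in> Hom (Lev A.Q d) n k" for m d \<alpha> n k xs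
    using that(2) simp_ops_nth[OF that(1)] simp_ops_length[OF that(1)]
    unfolding A.Q_ops B.Q_ops A.Q_Hom by (intro nth_equalityI) (simp_all add: less_Suc_eq_le)
qed

definition free_Q_p where "free_Q_p = (\<lambda>d. pres_lift (Lev (sfree_law B.Q) d)
    (\<lambda>n k xs. sfree_unit B.Q d n k (map (p n k) xs)))"

lemma Q_p_unit: "spro_map A.Q (slaw_pro (sfree_law B.Q)) (\<lambda>d n k xs. sfree_unit B.Q d n k (map (p n k) xs))"
  unfolding spro_map_def
proof (intro conjI allI ballI)
  have u: "pro_map (Lev B.Q d) (Lev (slaw_pro (sfree_law B.Q)) d) (sfree_unit B.Q d)" for d
    using sfree_unit_map[OF B.is_spro_Q] by (simp add: spro_map_def)
  have q: "pro_map (Lev A.Q d) (Lev B.Q d) (\<lambda>n k. map (p n k))" for d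
    using Q_p by (simp add: spro_map_def)
  show "pro_map (Lev A.Q d) (Lev (slaw_pro (sfree_law B.Q)) d) (\<lambda>n k xs. sfree_unit B.Q d n k (map (p n k) xs))" for d
    by (rule pro_map_compose[OF q u])
  fix m d \<alpha> n k xs assume a: "\<alpha> \<in> simp_ops m d" and x: "xs \<in> Hom (Lev A.Q d) n k"
  have "map (p n k) (LAct A.Q d \<alpha> n k xs) = LAct B.Q d \<alpha> n k (map (p n k) xs)"
    using Q_p a x unfolding spro_map_def by blast
  moreover have "sfree_unit B.Q m n k (LAct B.Q d \<alpha> n k (map (p n k) xs)) =
      LAct (slaw_pro (sfree_law B.Q)) d \<alpha> n k (sfree_unit B.Q d n k (map (p n k) xs))"
    using sfree_unit_map[OF B.is_spro_Q] a pro_map_Hom[OF q x] unfolding spro_map_def by blast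
  ultimately show "sfree_unit B.Q m n k (map (p n k) (LAct A.Q d \<alpha> n k xs)) =
      LAct (slaw_pro (sfree_law B.Q)) d \<alpha> n k (sfree_unit B.Q d n k (map (p n k) xs))"
    by simp
qed

lemma free_Q_p_map: "slaw_map (sfree_law A.Q) (sfree_law B.Q) free_Q_p"
  and free_Q_p_unit: "xs \<in> Hom (Lev A.Q d) n k \<Longrightarrow>
    free_Q_p d n k (sfree_unit A.Q d n k xs) = sfree_unit B.Q d n k (map (p n k) xs)"
  unfolding free_Q_p_def
  by (rule sfree_lift[OF A.is_spro_Q is_slaw_sfree[OF B.is_spro_Q] Q_p_unit])+

lemma Fr_map_disc: "slaw_map (disc (Fr (CSig \<Omega>))) (disc (Fr (CSig \<Omega>'))) (\<lambda>d. Fr_map (CSig \<Omega>') I)"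
  by (rule slaw_mapI) (simp_all add: disc_sel Fr_map_law(1)[OF sig])

lemmas NR_map1 = slaw_map_compose[OF Fr_map_disc B.NR_in_map(1)]
lemmas NR_map2 = slaw_map_compose[OF free_Q_p_map B.NR_in_map(2)]

lemma NR_map_square:
  assumes x: "x \<in> Hom (Lev (disc (free_law (CPro \<Omega>))) d) n k"
  shows "NR_in1 \<Omega>' d n k (Fr_map (CSig \<Omega>') I n k (NR_left \<Omega> d n k x)) =
    NR_in2 \<Omega>' d n k (free_Q_p d n k (NR_right \<Omega> d n k x))"
proof (rule A.free_law_unique[OF slaw_Lev[OF B.is_slaw_NR] _ _ _ x[unfolded disc_sel]])
  show "law_map (free_law (CPro \<Omega>)) (Lev (NR \<Omega>') d)
      (\<lambda>n k x. NR_in1 \<Omega>' d n k (Fr_map (CSig \<Omega>') I n k (NR_left \<Omega> d n k x)))"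
    using slaw_map_law[OF slaw_map_compose[OF A.NR_left_map NR_map1], of d] by (simp add: disc_sel)
  show "law_map (free_law (CPro \<Omega>)) (Lev (NR \<Omega>') d)
      (\<lambda>n k x. NR_in2 \<Omega>' d n k (free_Q_p d n k (NR_right \<Omega> d n k x)))"
    using slaw_map_law[OF slaw_map_compose[OF A.NR_right_map NR_map2], of d] by (simp add: disc_sel)
  fix n k f assume f: "f \<in> Hom (CPro \<Omega>) n k"
  note pf = pro_map_Hom[OF p f]
  have u: "free_unit (CPro \<Omega>') n k (p n k f) \<in> Hom (free_law (CPro \<Omega>')) n k"
    using pro_map_Hom[OF free_unit_map[OF B.P] pf] by (simp add: law_pro_sel)
  show "NR_in1 \<Omega>' d n k (Fr_map (CSig \<Omega>') I n k (NR_left \<Omega> d n k (free_unit (CPro \<Omega>) n k f))) =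
      NR_in2 \<Omega>' d n k (free_Q_p d n k (NR_right \<Omega> d n k (free_unit (CPro \<Omega>) n k f)))"
    unfolding A.NR_left_unit[OF f] A.NR_right_unit[OF f] sq1[OF f]
      free_Q_p_unit[OF pro_map_Hom[OF A.vertex_map f]] map_replicate
    using B.NR_square[OF u, of d] unfolding B.NR_left_unit[OF pf] B.NR_right_unit[OF pf] .
qed

theorem NR_map_map: "slaw_map (NR \<Omega>) (NR \<Omega>') (NR_map \<Omega>' I p)"
  and NR_map_in1: "x \<in> Hom (Fr (CSig \<Omega>)) n k \<Longrightarrow>
    NR_map \<Omega>' I p d n k (NR_in1 \<Omega> d n k x) = NR_in1 \<Omega>' d n k (Fr_map (CSig \<Omega>') I n k x)"
  and NR_map_in2: "y \<in> Hom (Lev (sfree_law A.Q) d) n k \<Longrightarrow>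
    NR_map \<Omega>' I p d n k (NR_in2 \<Omega> d n k y) = NR_in2 \<Omega>' d n k (free_Q_p d n k y)"
proof -
  have e: "NR_map \<Omega>' I p = po_lift (NR \<Omega>')
      (\<lambda>d n k x. NR_in1 \<Omega>' d n k (Fr_map (CSig \<Omega>') I n k x))
      (\<lambda>d n k y. NR_in2 \<Omega>' d n k (free_Q_p d n k y))"
    by (simp add: NR_map_def free_Q_p_def)
  note l = po_lift_map[OF A.NR_po B.is_slaw_NR NR_map1 NR_map2 NR_map_square]
  show "slaw_map (NR \<Omega>) (NR \<Omega>') (NR_map \<Omega>' I p)" unfolding e NR_def[of \<Omega>] by (rule l(1))
  show "NR_map \<Omega>' I p d n k (NR_in1 \<Omega> d n k x) = NR_in1 \<Omega>' d n k (Fr_map (CSig \<Omega>') I n k x)"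
    if "x \<in> Hom (Fr (CSig \<Omega>)) n k"
    unfolding e by (rule l(2)) (simp_all add: disc_sel that)
  show "NR_map \<Omega>' I p d n k (NR_in2 \<Omega> d n k y) = NR_in2 \<Omega>' d n k (free_Q_p d n k y)"
    if "y \<in> Hom (Lev (sfree_law A.Q) d) n k"
    unfolding e by (rule l(3)) (simp_all add: that)
qed

end


section \<open>The controlled theories of monoids, commutative monoids and groups\<close>

datatype opsym = UnitOp | MultOp | InvOp

definition mon_sig :: "nat \<Rightarrow> opsym set" where
  "mon_sig n = (if n = 0 then {UnitOp} else if n = 2 then {MultOp} else {})"

definition grp_sig :: "nat \<Rightarrow> opsym set" where
  "grp_sig n = (if n = 0 then {UnitOp} else if n = 1 then {InvOp} else if n = 2 then {MultOp} else {})"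

text \<open>Terms in \<open>n\<close> variables, as expressions \<open>n \<rightarrow> 1\<close>.\<close>

abbreviation varE :: "nat \<Rightarrow> nat \<Rightarrow> opsym expr" where
  "varE n i \<equiv> FinE n 1 [i]"
abbreviation unitE :: "nat \<Rightarrow> opsym expr" where
  "unitE n \<equiv> CompE n 0 1 (Gen 0 1 UnitOp) (FinE n 0 [])"
abbreviation multE :: "nat \<Rightarrow> opsym expr \<Rightarrow> opsym expr \<Rightarrow> opsym expr" where
  "multE n s t \<equiv> CompE n 2 1 (Gen 2 1 MultOp) (PairE n 1 1 s t)"
abbreviation invE :: "nat \<Rightarrow> opsym expr \<Rightarrow> opsym expr" where
  "invE n s \<equiv> CompE n 1 1 (Gen 1 1 InvOp) s"

definition mon_eqs :: "(nat \<times> nat \<times> opsym expr \<times> opsym expr) set" where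
  "mon_eqs = {
     (3, 1, multE 3 (multE 3 (varE 3 0) (varE 3 1)) (varE 3 2),
            multE 3 (varE 3 0) (multE 3 (varE 3 1) (varE 3 2))),
     (1, 1, multE 1 (unitE 1) (varE 1 0), varE 1 0),
     (1, 1, multE 1 (varE 1 0) (unitE 1), varE 1 0)}"

definition inv_eqs :: "(nat \<times> nat \<times> opsym expr \<times> opsym expr) set" where
  "inv_eqs = {
     (1, 1, multE 1 (invE 1 (varE 1 0)) (varE 1 0), unitE 1),
     (1, 1, multE 1 (varE 1 0) (invE 1 (varE 1 0)), unitE 1)}"

definition comm_eqs :: "(nat \<times> nat \<times> opsym expr \<times> opsym expr) set" where
  "comm_eqs = {(2, 1, multE 2 (varE 2 0) (varE 2 1), multE 2 (varE 2 1) (varE 2 0))}"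

definition Th :: "(nat \<Rightarrow> opsym set) \<Rightarrow> (nat \<times> nat \<times> opsym expr \<times> opsym expr) set \<Rightarrow> opsym expr set law" where
  "Th G R = pres (sig_gens G) R"

abbreviation "Th_mon \<equiv> Th mon_sig mon_eqs"
abbreviation "Th_cm \<equiv> Th mon_sig (mon_eqs \<union> comm_eqs)"
abbreviation "Th_grp \<equiv> Th grp_sig (mon_eqs \<union> inv_eqs)"
abbreviation "Th_ab \<equiv> Th grp_sig (mon_eqs \<union> inv_eqs \<union> comm_eqs)"

text \<open>The map to \<open>Th G R\<close>, from any theory presented by operations in \<open>G\<close> and relations that hold in
  \<open>Th G R\<close>, that sends each operation to itself.\<close>

definition Th_map :: "(nat \<Rightarrow> opsym set) \<Rightarrow> (nat \<times> nat \<times> opsym expr \<times> opsym expr) set \<Rightarrow>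
    nat \<Rightarrow> nat \<Rightarrow> opsym expr set \<Rightarrow> opsym expr set" where
  "Th_map G R = pres_lift (Th G R) (pres_gen (sig_gens G) R)"

text \<open>The sub-pro \<open>Q(G)\<close> of \<open>Fr(G)\<close> generated by the image of a sub-pro \<open>Q\<close> of the opposite of finite
  sets and the generating operations.\<close>

definition sub_Fr :: "(nat \<Rightarrow> nat \<Rightarrow> nat list set) \<Rightarrow> (nat \<Rightarrow> 'g set) \<Rightarrow> 'g expr set pro" where
  "sub_Fr Q G = gen_subpro (law_pro (Fr G))
     (\<lambda>n k. Fin (Fr G) n k ` Q n k \<union> Fr_gen G n k ` sig_gens G n k)"

definition perms :: "nat \<Rightarrow> nat \<Rightarrow> nat list set" where
  "perms n k = {xs \<in> fin_hom n k. n = k \<and> distinct xs}"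

text \<open>The diagonal \<open>\<Delta>\<^sub>k : 1 \<rightarrow> k\<close> corresponds to the function \<open>{0..<k} \<rightarrow> {0}\<close>.\<close>

definition nabla :: "nat \<Rightarrow> nat \<Rightarrow> nat list set" where
  "nabla = Hom (gen_subpro (law_pro fin_law) (\<lambda>n k. if n = 1 then {replicate k 0} else {}))"

definition \<Omega>_mon :: "(opsym, opsym pexpr set, opsym expr set) ctrl" where
  "\<Omega>_mon = \<lparr>CSig = mon_sig, CPro = free_pro (sig_gens mon_sig), CLaw = Th_mon,
     cinc = free_pro_lift (law_pro (Fr mon_sig)) (Fr_gen mon_sig),
     cst = Th_map mon_sig mon_eqs\<rparr>"

definition \<Omega>_cm :: "(opsym, opsym expr set, opsym expr set) ctrl" where
  "\<Omega>_cm = \<lparr>CSig = mon_sig, CPro = sub_Fr perms mon_sig, CLaw = Th_cm,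
     cinc = (\<lambda>n k f. f), cst = Th_map mon_sig (mon_eqs \<union> comm_eqs)\<rparr>"

definition \<Omega>_grp :: "(opsym, opsym expr set, opsym expr set) ctrl" where
  "\<Omega>_grp = \<lparr>CSig = grp_sig, CPro = sub_Fr nabla grp_sig, CLaw = Th_grp,
     cinc = (\<lambda>n k f. f), cst = Th_map grp_sig (mon_eqs \<union> inv_eqs)\<rparr>"


lemma is_law_Th: "is_law (Th G R)"
  unfolding Th_def by (rule is_law_pres)

lemma expr_eq_mono:
  assumes "expr_eq G R n k e e'" and G: "\<And>n k. G n k \<subseteq> G' n k" and R: "R \<subseteq> R'"
  shows "expr_eq G' R' n k e e'"
  using assms(1)
proof induction
  case (eGen g n k)
  have "g \<in> G' n k" by (rule subsetD[OF G eGen.hyps])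
  then show ?case by (rule expr_eq.eGen)
next
  case (eRel n k e e')
  show ?case by (rule expr_eq.eRel[OF subsetD[OF R eRel.hyps(1)] eRel.IH])
next
  case (eSym n k e e')
  show ?case by (rule expr_eq.eSym[OF eSym.IH])
next
  case (eTrans n k e e' e'')
  show ?case by (rule expr_eq.eTrans[OF eTrans.IH])
qed (rule expr_eq.intros; assumption)+

lemma expr_eval_pres:
  "expr_eq G R n k e e' \<Longrightarrow> expr_eval (pres G R) (pres_gen G R) e = expr_class G R n k e \<and>
    expr_eval (pres G R) (pres_gen G R) e' = expr_class G R n k e'"
proof (induction rule: expr_eq.induct)
  case (eComp m k e e' n d d')
  then have "expr_eq G R m k e e" "expr_eq G R n m d d" "expr_eq G R m k e' e'" "expr_eq G R n m d' d'"
    using expr_eq_refl by blast+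
  with eComp.IH show ?case by (simp add: pres_Comp)
next
  case (ePair n k e e' l d d')
  then have "expr_eq G R n k e e" "expr_eq G R n l d d" "expr_eq G R n k e' e'" "expr_eq G R n l d' d'"
    using expr_eq_refl by blast+
  with ePair.IH show ?case by (simp add: pres_pairing)
qed (simp_all add: pres_gen_def pres_Fin pres_Comp pres_pairing eFin fin_hom_prj
      expr_eq.eComp expr_eq.ePair)

lemma sig_gens_mono: "(\<And>n. G n \<subseteq> G' n) \<Longrightarrow> sig_gens G n k \<subseteq> sig_gens G' n k"
  by (simp add: sig_gens_def)

lemma Th_model:
  assumes G: "\<And>n. G n \<subseteq> G' n" and R: "R \<subseteq> R'"
  shows "pres_model (sig_gens G) R (Th G' R') (pres_gen (sig_gens G') R')"
  unfolding pres_model_def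
proof (intro conjI allI ballI impI)
  have GG: "sig_gens G n k \<subseteq> sig_gens G' n k" for n k using G by (simp add: sig_gens_def)
  show "pres_gen (sig_gens G') R' n k g \<in> Hom (Th G' R') n k" if "g \<in> sig_gens G n k" for n k g
    unfolding Th_def by (rule pres_gen_Hom[of g "sig_gens G'" n k]) (use that GG in blast)
  fix n k e e'
  assume r: "(n, k, e, e') \<in> R" and e: "expr_eq (sig_gens G) R n k e e" "expr_eq (sig_gens G) R n k e' e'"
  have q: "expr_eq (sig_gens G') R' n k e e'"
    by (rule expr_eq_mono[OF eRel[OF r e] GG R])
  note v = expr_eval_pres[OF q, THEN conjunct1] expr_eval_pres[OF q, THEN conjunct2]
  show "expr_eval (Th G' R') (pres_gen (sig_gens G') R') e = expr_eval (Th G' R') (pres_gen (sig_gens G') R') e'"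
    unfolding Th_def v by (rule expr_class_eqI[OF q])
qed

lemma Th_map_law:
  assumes G: "\<And>n. G n \<subseteq> G' n" and R: "R \<subseteq> R'"
  shows "law_map (Th G R) (Th G' R') (Th_map G' R')"
    and "g \<in> sig_gens G n k \<Longrightarrow>
      Th_map G' R' n k (pres_gen (sig_gens G) R n k g) = pres_gen (sig_gens G') R' n k g"
proof -
  have m: "pres_model (sig_gens G) R (Th G' R') (pres_gen (sig_gens G') R')"
    by (rule Th_model[OF G R])
  show "law_map (Th G R) (Th G' R') (Th_map G' R')"
    unfolding Th_map_def Th_def[of G R] by (rule pres_lift_map(1)[OF is_law_Th m])
  show "Th_map G' R' n k (pres_gen (sig_gens G) R n k g) = pres_gen (sig_gens G') R' n k g"
    if "g \<in> sig_gens G n k"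
    unfolding Th_map_def by (rule pres_lift_gen[of _ "sig_gens G" _ _ g n k, OF is_law_Th m that])
qed

lemma Fr_Th: "Fr G = Th G {}" "Fr_gen G = pres_gen (sig_gens G) {}"
  by (simp_all add: Fr_def Th_def Fr_gen_def)

lemma Fr_map_eq_Th_map: "Fr_map G' (\<lambda>n g. g) = Th_map G' {}"
  by (simp add: Fr_map_def Th_map_def Fr_Th)

lemma Th_map_unique:
  assumes "is_law T" "law_map (Th G R) T F" "law_map (Th G R) T F'"
    and "\<And>n k g. g \<in> sig_gens G n k \<Longrightarrow>
      F n k (pres_gen (sig_gens G) R n k g) = F' n k (pres_gen (sig_gens G) R n k g)"
    and "x \<in> Hom (Th G R) n k"
  shows "F n k x = F' n k x"
  by (rule pres_map_unique[OF assms(1) assms(2,3)[unfolded Th_def] assms(4) assms(5)[unfolded Th_def]])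

lemma Th_map_comp:
  assumes G: "\<And>n. G n \<subseteq> G' n" and R: "R \<subseteq> R'" and G': "\<And>n. G' n \<subseteq> G'' n" and R': "R' \<subseteq> R''"
    and x: "x \<in> Hom (Th G R) n k"
  shows "Th_map G'' R'' n k (Th_map G' R' n k x) = Th_map G'' R'' n k x"
proof (rule Th_map_unique[OF is_law_Th _ _ _ x])
  have GG: "G n \<subseteq> G'' n" for n using G G' by blast
  have RR: "R \<subseteq> R''" using R R' by blast
  show "law_map (Th G R) (Th G'' R'') (\<lambda>n k x. Th_map G'' R'' n k (Th_map G' R' n k x))"
    by (rule law_map_compose[OF Th_map_law(1)[of G G', OF G R] Th_map_law(1)[of G' G'', OF G' R']])
  show "law_map (Th G R) (Th G'' R'') (Th_map G'' R'')"
    by (rule Th_map_law(1)[of G G'', OF GG RR])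
  fix n k g assume g: "g \<in> sig_gens G n k"
  have g': "g \<in> sig_gens G' n k" by (rule subsetD[OF sig_gens_mono[OF G] g])
  show "Th_map G'' R'' n k (Th_map G' R' n k (pres_gen (sig_gens G) R n k g)) =
      Th_map G'' R'' n k (pres_gen (sig_gens G) R n k g)"
    unfolding Th_map_law(2)[of G G', OF G R g] Th_map_law(2)[of G' G'', OF G' R' g']
      Th_map_law(2)[of G G'', OF GG RR g] ..
qed

lemma is_law_fin: "is_law fin_law"
proof -
  have sel: "Hom fin_law = fin_hom" "Comp fin_law n m k = fin_comp" "Idn fin_law n = [0..<n]"
    "Fin fin_law n k xs = xs" for n m k xs
    by (simp_all add: fin_law_def)
  have C: "is_cat fin_law"
    unfolding is_cat_def sel
  proof (intro conjI allI ballI)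
    show "[0..<n] \<in> fin_hom n n" for n by (rule fin_hom_prj)
    show "fin_comp g f \<in> fin_hom n k" if "f \<in> fin_hom n m" "g \<in> fin_hom m k" for n m k f g
      by (rule fin_comp_hom[OF that])
    show "fin_comp f [0..<n] = f" if "f \<in> fin_hom n k" for n k f
      using that by (auto simp: fin_hom_def fin_comp_def subset_iff intro!: map_idI)
    show "fin_comp [0..<k] f = f" if "f \<in> fin_hom n k" for n k f
      using that by (auto simp: fin_hom_def fin_comp_def map_nth)
    show "fin_comp h (fin_comp g f) = fin_comp (fin_comp h g) f"
      if "f \<in> fin_hom n m" "g \<in> fin_hom m k" "h \<in> fin_hom k l" for n m k l f g h
      using that by (auto simp: fin_hom_def fin_comp_def subset_iff)
  qed
  have P: "\<exists>!h. h \<in> fin_hom n (k + l) \<and> fin_comp [0..<k] h = f \<and> fin_comp [k..<k + l] h = g"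
    if f: "f \<in> fin_hom n k" and g: "g \<in> fin_hom n l" for n k l f g
  proof (rule ex1I[of _ "f @ g"])
    have lf: "length f = k" "length g = l" using f g by (auto simp: fin_hom_def)
    have "fin_comp [0..<k] (f @ g) = f" unfolding fin_comp_def
      by (rule nth_equalityI) (simp_all add: lf nth_append)
    moreover have "fin_comp [k..<k + l] (f @ g) = g" unfolding fin_comp_def
      by (rule nth_equalityI) (simp_all add: lf nth_append)
    ultimately show "f @ g \<in> fin_hom n (k + l) \<and> fin_comp [0..<k] (f @ g) = f \<and> fin_comp [k..<k + l] (f @ g) = g"
      using f g by (auto simp: fin_hom_def)
    fix h assume h: "h \<in> fin_hom n (k + l) \<and> fin_comp [0..<k] h = f \<and> fin_comp [k..<k + l] h = g"
    then have "length h = k + l" by (simp add: fin_hom_def)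
    then have "h = map ((!) h) ([0..<k] @ [k..<k + l])"
      by (metis map_nth upt_add_eq_append zero_le)
    with h show "h = f @ g" by (simp add: fin_comp_def)
  qed
  show ?thesis
    unfolding is_law_def sel
  proof (intro conjI allI ballI)
    show "\<exists>!h. h \<in> fin_hom n 0" for n by (auto simp: fin_hom_def)
    show "is_cat fin_law" by (rule C)
    show "\<exists>!h. h \<in> fin_hom n (k + l) \<and> fin_comp [0..<k] h = f \<and> fin_comp [k..<k + l] h = g"
      if "f \<in> fin_hom n k" "g \<in> fin_hom n l" for n k l f g by (rule P[OF that])
  qed simp_all
qed

lemma gen_subpro_sel: "Hom (gen_subpro P X) n k = {f. (n, k, f) \<in> gen_hom P X}"
  "Comp (gen_subpro P X) = Comp P" "Idn (gen_subpro P X) = Idn P" "Tens (gen_subpro P X) = Tens P"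
  by (simp_all add: gen_subpro_def)

lemma gen_hom_Hom:
  assumes P: "is_pro P" and X: "\<And>n k. X n k \<subseteq> Hom P n k" and f: "(n, k, f) \<in> gen_hom P X"
  shows "f \<in> Hom P n k"
  using f by induction (use X in \<open>auto intro: pro_Id[OF P] cat_Comp[OF pro_cat[OF P]] pro_Tens[OF P]\<close>)

lemma gen_subpro_pro:
  assumes P: "is_pro P" and X: "\<And>n k. X n k \<subseteq> Hom P n k"
  shows "is_pro (gen_subpro P X)" and "pro_map (gen_subpro P X) P (\<lambda>n k f. f)"
proof -
  note h = gen_hom_Hom[of P X, OF P X]
  note C = pro_cat[OF P]
  show "is_pro (gen_subpro P X)"
    by (rule proI; unfold gen_subpro_sel mem_Collect_eq)
      (simp_all add: h gen_hom.intros(2-4) cat_idL[OF C] cat_idR[OF C] cat_assoc[OF C]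
        pro_TensId[OF P] pro_interchange[OF P] pro_TensAssoc[OF P] pro_unitL[OF P] pro_unitR[OF P])
  show "pro_map (gen_subpro P X) P (\<lambda>n k f. f)"
    unfolding pro_map_def gen_subpro_sel using h by auto
qed

lemma Fr_gen_sig: "g \<in> sig_gens G n k \<Longrightarrow> Fr_gen G n k g \<in> Hom (law_pro (Fr G)) n k"
  unfolding law_pro_sel Fr_gen_def Fr_def by (rule pres_gen_Hom)

lemma sub_Fr_gens:
  assumes "\<And>n k. Q n k \<subseteq> fin_hom n k"
  shows "Fin (Fr G) n k ` Q n k \<union> Fr_gen G n k ` sig_gens G n k \<subseteq> Hom (law_pro (Fr G)) n k"
proof (intro Un_least image_subsetI)
  show "Fr_gen G n k g \<in> Hom (law_pro (Fr G)) n k" if "g \<in> sig_gens G n k" for g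
    by (rule Fr_gen_sig[OF that])
  show "Fin (Fr G) n k xs \<in> Hom (law_pro (Fr G)) n k" if "xs \<in> Q n k" for xs
    unfolding law_pro_sel by (rule law_Fin[OF is_law_Fr subsetD[OF assms that]])
qed

lemma sub_Fr_pro:
  assumes "\<And>n k. Q n k \<subseteq> fin_hom n k"
  shows "is_pro (sub_Fr Q G)" and "pro_map (sub_Fr Q G) (law_pro (Fr G)) (\<lambda>n k f. f)"
  unfolding sub_Fr_def
  by (rule gen_subpro_pro[OF is_pro_law_pro[OF is_law_Fr] sub_Fr_gens[of Q, OF assms]])+

lemma perms_sub: "perms n k \<subseteq> fin_hom n k"
  by (auto simp: perms_def)

lemma nabla_sub: "nabla n k \<subseteq> fin_hom n k"
proof -
  have "is_pro (law_pro fin_law)" by (rule is_pro_law_pro[OF is_law_fin])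
  moreover have "(if n = 1 then {replicate k 0} else {}) \<subseteq> Hom (law_pro fin_law) n k" for n k :: nat
    by (auto simp: law_pro_sel fin_law_def fin_hom_def)
  ultimately have "f \<in> Hom (law_pro fin_law) n k" if "f \<in> nabla n k" for f
    by (rule gen_hom_Hom) (use that in \<open>simp add: nabla_def gen_subpro_sel\<close>)
  then show ?thesis by (auto simp: law_pro_sel fin_law_def)
qed

lemma cst_Th: "law_map (Fr G) (Th G R) (Th_map G R)"
  unfolding Fr_Th by (rule Th_map_law(1)) auto

lemma mon_data: "ctrl_data \<Omega>_mon"
  unfolding ctrl_data_def \<Omega>_mon_def
  by (simp add: is_pro_free_pro is_law_Th cst_Th
      free_pro_lift_map(1)[OF is_pro_law_pro[OF is_law_Fr] Fr_gen_sig])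

lemma cm_data: "ctrl_data \<Omega>_cm"
  unfolding ctrl_data_def \<Omega>_cm_def by (simp add: sub_Fr_pro perms_sub is_law_Th cst_Th)

lemma grp_data: "ctrl_data \<Omega>_grp"
  unfolding ctrl_data_def \<Omega>_grp_def by (simp add: sub_Fr_pro nabla_sub is_law_Th cst_Th)

text \<open>The span \<open>\<Omega>_grp \<leftarrow> \<Omega>_mon \<rightarrow> \<Omega>_cm\<close> is the identity on operation symbols; on control pros it sends
  generators to generators.\<close>

definition pic_left where
  "pic_left = NR_map \<Omega>_grp (\<lambda>n g. g) (free_pro_lift (law_pro (Fr grp_sig)) (Fr_gen grp_sig))"

definition pic_right where
  "pic_right = NR_map \<Omega>_cm (\<lambda>n g. g) (free_pro_lift (law_pro (Fr mon_sig)) (Fr_gen mon_sig))"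

definition NR_pic where
  "NR_pic = spushout (NR \<Omega>_mon) (NR \<Omega>_grp) (NR \<Omega>_cm) pic_left pic_right"

definition st_pic where
  "st_pic = po_lift (disc Th_ab)
     (\<lambda>d n k x. Th_map grp_sig (mon_eqs \<union> inv_eqs \<union> comm_eqs) n k (NR_st \<Omega>_grp d n k x))
     (\<lambda>d n k x. Th_map grp_sig (mon_eqs \<union> inv_eqs \<union> comm_eqs) n k (NR_st \<Omega>_cm d n k x))"


lemma mon_map:
  fixes \<Omega>' :: "(opsym, opsym expr set, opsym expr set) ctrl"
  assumes sig: "CSig \<Omega>' = G'" "\<And>n. mon_sig n \<subseteq> G' n"
    and P: "CPro \<Omega>' = sub_Fr Q G'" "\<And>n k. Q n k \<subseteq> fin_hom n k"
    and L: "CLaw \<Omega>' = Th G' R'" "cst \<Omega>' = Th_map G' R'" "mon_eqs \<subseteq> R'"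
    and i: "cinc \<Omega>' = (\<lambda>n k f. f)"
  shows "ctrl_map \<Omega>_mon \<Omega>' (\<lambda>n g. g) (free_pro_lift (law_pro (Fr G')) (Fr_gen G')) (Th_map G' R')"
proof -
  have gens: "Fr_gen G' n k g \<in> Hom (law_pro (Fr G')) n k" if "g \<in> sig_gens mon_sig n k" for n k g
    using that sig(2) by (intro Fr_gen_sig) (auto simp: sig_gens_def split: if_splits)
  have F': "is_pro (law_pro (Fr G'))" by (rule is_pro_law_pro[OF is_law_Fr])
  have p: "pro_map (free_pro (sig_gens mon_sig)) (law_pro (Fr G')) (free_pro_lift (law_pro (Fr G')) (Fr_gen G'))"
    by (rule free_pro_lift_map(1)[OF F' gens])
  have pg: "free_pro_lift (law_pro (Fr G')) (Fr_gen G') n k (free_pro_gen (sig_gens mon_sig) n k g) = Fr_gen G' n k g"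
    if "g \<in> sig_gens mon_sig n k" for n k g
    by (rule free_pro_lift_map(2)[of "law_pro (Fr G')" "sig_gens mon_sig"]) (use F' gens that in auto)
  have "pexpr_eval (sub_Fr Q G') \<phi> e = pexpr_eval (law_pro (Fr G')) \<phi> e" for \<phi> and e :: "opsym pexpr"
    by (induction e) (simp_all add: sub_Fr_def gen_subpro_sel)
  then have "pexpr_eval (sub_Fr Q G') = (pexpr_eval (law_pro (Fr G')) :: _ \<Rightarrow> opsym pexpr \<Rightarrow> _)"
    by (intro ext)
  then have lift: "free_pro_lift (law_pro (Fr G')) (Fr_gen G') = free_pro_lift (sub_Fr Q G') (Fr_gen G')"
    by (intro ext) (simp add: free_pro_lift_def)
  have gens': "Fr_gen G' n k g \<in> Hom (sub_Fr Q G') n k" if "g \<in> sig_gens mon_sig n k" for n k g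
  proof -
    have "g \<in> sig_gens G' n k" by (rule subsetD[OF sig_gens_mono[OF sig(2)] that])
    then show ?thesis unfolding sub_Fr_def gen_subpro_sel by (intro CollectI gen_hom.intros(1)) blast
  qed
  have p': "pro_map (free_pro (sig_gens mon_sig)) (sub_Fr Q G') (free_pro_lift (law_pro (Fr G')) (Fr_gen G'))"
    unfolding lift by (rule free_pro_lift_map(1)[OF sub_Fr_pro(1)[OF P(2)] gens'])
  have I: "g \<in> mon_sig n \<Longrightarrow> g \<in> G' n" for n g using sig(2) by blast
  have F0: "is_pro (law_pro (Fr mon_sig))" by (rule is_pro_law_pro[OF is_law_Fr])
  have p0: "pro_map (free_pro (sig_gens mon_sig)) (law_pro (Fr mon_sig))
      (free_pro_lift (law_pro (Fr mon_sig)) (Fr_gen mon_sig))"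
    by (rule free_pro_lift_map(1)[OF F0 Fr_gen_sig])
  have p0g: "free_pro_lift (law_pro (Fr mon_sig)) (Fr_gen mon_sig) n k (free_pro_gen (sig_gens mon_sig) n k g)
      = Fr_gen mon_sig n k g" if "g \<in> sig_gens mon_sig n k" for n k g
    by (rule free_pro_lift_map(2)[of "law_pro (Fr mon_sig)" "sig_gens mon_sig"])
      (use F0 Fr_gen_sig that in auto)
  have sq: "Fr_map G' (\<lambda>n g. g) n k (free_pro_lift (law_pro (Fr mon_sig)) (Fr_gen mon_sig) n k f) =
      free_pro_lift (law_pro (Fr G')) (Fr_gen G') n k f"
    if f: "f \<in> Hom (free_pro (sig_gens mon_sig)) n k" for n k f
  proof (rule free_pro_unique[OF _ p _ f])
    show "pro_map (free_pro (sig_gens mon_sig)) (law_pro (Fr G'))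
        (\<lambda>n k f. Fr_map G' (\<lambda>n g. g) n k (free_pro_lift (law_pro (Fr mon_sig)) (Fr_gen mon_sig) n k f))"
      by (rule pro_map_compose[OF p0 law_map_pro_map[OF Fr_map_law(1) is_law_Fr is_law_Fr]]) (assumption | rule I)+
    fix n k g assume g: "g \<in> sig_gens mon_sig n k"
    then have k: "k = 1" and g1: "g \<in> mon_sig n" by (auto simp: sig_gens_def split: if_splits)
    show "Fr_map G' (\<lambda>n g. g) n k (free_pro_lift (law_pro (Fr mon_sig)) (Fr_gen mon_sig) n k
          (free_pro_gen (sig_gens mon_sig) n k g)) =
        free_pro_lift (law_pro (Fr G')) (Fr_gen G') n k (free_pro_gen (sig_gens mon_sig) n k g)"
      unfolding p0g[OF g] pg[OF g] unfolding k
      by (rule Fr_map_law(2)[of mon_sig "\<lambda>n g. g" G', OF I g1])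
  qed
  have st: "Th_map G' R' n k (Th_map mon_sig mon_eqs n k x) = Th_map G' R' n k (Fr_map G' (\<lambda>n g. g) n k x)"
    if "x \<in> Hom (Fr mon_sig) n k" for n k x
    using that unfolding Fr_map_eq_Th_map Fr_Th
    by (simp add: Th_map_comp[of mon_sig mon_sig "{}" mon_eqs G' R'] Th_map_comp[of mon_sig G' "{}" "{}" G' R']
        sig(2) L(3))
  show ?thesis
    unfolding ctrl_map_def
    by (simp add: \<Omega>_mon_def sig P(1) L(1,2) i I p' sq st Th_map_law(1)[OF sig(2) L(3)])
qed

lemma mon_grp_sig: "mon_sig n \<subseteq> grp_sig n"
  by (auto simp: mon_sig_def grp_sig_def)

lemma mon_grp: "ctrl_morphism \<Omega>_mon \<Omega>_grp (\<lambda>n g. g)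
    (free_pro_lift (law_pro (Fr grp_sig)) (Fr_gen grp_sig)) (Th_map grp_sig (mon_eqs \<union> inv_eqs))"
  by (intro ctrl_morphism.intro ctrl_morphism_axioms.intro mon_data grp_data mon_map[where Q = nabla])
    (simp_all add: \<Omega>_grp_def mon_grp_sig nabla_sub)

lemma mon_cm: "ctrl_morphism \<Omega>_mon \<Omega>_cm (\<lambda>n g. g)
    (free_pro_lift (law_pro (Fr mon_sig)) (Fr_gen mon_sig)) (Th_map mon_sig (mon_eqs \<union> comm_eqs))"
  by (intro ctrl_morphism.intro ctrl_morphism_axioms.intro mon_data cm_data mon_map[where Q = perms])
    (simp_all add: \<Omega>_cm_def perms_sub)

lemmas pic_po = ctrl_data.is_slaw_NR[OF mon_data] ctrl_data.is_slaw_NR[OF grp_data]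
  ctrl_data.is_slaw_NR[OF cm_data] ctrl_morphism.NR_map_map[OF mon_grp, folded pic_left_def]
  ctrl_morphism.NR_map_map[OF mon_cm, folded pic_right_def]

theorem is_slaw_NR_pic: "is_slaw NR_pic"
  unfolding NR_pic_def by (rule is_slaw_spushout[OF pic_po])

abbreviation "ab_map \<equiv> Th_map grp_sig (mon_eqs \<union> inv_eqs \<union> comm_eqs)"

lemma st_grp_ab: "slaw_map (NR \<Omega>_grp) (disc Th_ab) (\<lambda>d n k x. ab_map n k (NR_st \<Omega>_grp d n k x))"
proof (rule slaw_map_compose[OF ctrl_data.NR_st_map[OF grp_data]])
  show "slaw_map (disc (CLaw \<Omega>_grp)) (disc Th_ab) (\<lambda>d. ab_map)"
    by (rule slaw_mapI) (simp_all add: disc_sel \<Omega>_grp_def Th_map_law(1))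
qed

lemma st_cm_ab: "slaw_map (NR \<Omega>_cm) (disc Th_ab) (\<lambda>d n k x. ab_map n k (NR_st \<Omega>_cm d n k x))"
proof (rule slaw_map_compose[OF ctrl_data.NR_st_map[OF cm_data]])
  have "law_map Th_cm Th_ab ab_map" by (rule Th_map_law(1)) (use mon_grp_sig in auto)
  then show "slaw_map (disc (CLaw \<Omega>_cm)) (disc Th_ab) (\<lambda>d. ab_map)"
    by (intro slaw_mapI) (simp_all add: disc_sel \<Omega>_cm_def)
qed

lemma st_pic_Fr:
  assumes x: "x \<in> Hom (Fr mon_sig) n k"
  shows "ab_map n k (cst \<Omega>_grp n k (Fr_map grp_sig (\<lambda>n g. g) n k x)) =
    ab_map n k (cst \<Omega>_cm n k (Fr_map mon_sig (\<lambda>n g. g) n k x))"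
proof -
  have G: "Th_map grp_sig {} n k x \<in> Hom (Th grp_sig {}) n k"
    by (rule law_map_Hom[OF Th_map_law(1)[of mon_sig grp_sig "{}"]])
      (use x mon_grp_sig in \<open>auto simp: Fr_Th\<close>)
  have M: "Th_map mon_sig {} n k x \<in> Hom (Th mon_sig {}) n k"
    by (rule law_map_Hom[OF Th_map_law(1)[of mon_sig mon_sig "{}"]]) (use x in \<open>auto simp: Fr_Th\<close>)
  have x': "x \<in> Hom (Th mon_sig {}) n k" using x by (simp add: Fr_Th)
  have "ab_map n k (Th_map grp_sig (mon_eqs \<union> inv_eqs) n k (Th_map grp_sig {} n k x)) = ab_map n k x"
    by (simp add: Th_map_comp[OF _ _ _ _ G] Th_map_comp[OF _ _ _ _ x'] mon_grp_sig)
  moreover have "ab_map n k (Th_map mon_sig (mon_eqs \<union> comm_eqs) n k (Th_map mon_sig {} n k x)) = ab_map n k x"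
    using Th_map_comp[of mon_sig mon_sig "{}" "mon_eqs \<union> comm_eqs" grp_sig "mon_eqs \<union> inv_eqs \<union> comm_eqs", OF _ _ _ _ M]
      Th_map_comp[of mon_sig mon_sig "{}" "{}" grp_sig "mon_eqs \<union> inv_eqs \<union> comm_eqs", OF _ _ _ _ x']
    by (auto simp: mon_grp_sig)
  ultimately show ?thesis by (simp add: \<Omega>_grp_def \<Omega>_cm_def Fr_map_eq_Th_map)
qed

theorem st_pic_square:
  assumes x: "x \<in> Hom (Lev (NR \<Omega>_mon) d) n k"
  shows "ab_map n k (NR_st \<Omega>_grp d n k (pic_left d n k x)) = ab_map n k (NR_st \<Omega>_cm d n k (pic_right d n k x))"
proof -
  interpret A: ctrl_morphism \<Omega>_mon \<Omega>_grp "\<lambda>n g. g" "free_pro_lift (law_pro (Fr grp_sig)) (Fr_gen grp_sig)"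
    "Th_map grp_sig (mon_eqs \<union> inv_eqs)" by (rule mon_grp)
  interpret B: ctrl_morphism \<Omega>_mon \<Omega>_cm "\<lambda>n g. g" "free_pro_lift (law_pro (Fr mon_sig)) (Fr_gen mon_sig)"
    "Th_map mon_sig (mon_eqs \<union> comm_eqs)" by (rule mon_cm)
  let ?l = "\<lambda>d n k x. ab_map n k (NR_st \<Omega>_grp d n k (pic_left d n k x))"
  let ?r = "\<lambda>d n k x. ab_map n k (NR_st \<Omega>_cm d n k (pic_right d n k x))"
  have l: "slaw_map (NR \<Omega>_mon) (disc Th_ab) ?l" by (rule slaw_map_compose[OF pic_po(4) st_grp_ab])
  have r: "slaw_map (NR \<Omega>_mon) (disc Th_ab) ?r" by (rule slaw_map_compose[OF pic_po(5) st_cm_ab])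
  have sig: "CSig \<Omega>_mon = mon_sig" "CSig \<Omega>_grp = grp_sig" "CSig \<Omega>_cm = mon_sig"
    by (simp_all add: \<Omega>_mon_def \<Omega>_grp_def \<Omega>_cm_def)
  have 1: "?l d n k (NR_in1 \<Omega>_mon d n k y) = ?r d n k (NR_in1 \<Omega>_mon d n k y)"
    if "y \<in> Hom (Lev (disc (Fr (CSig \<Omega>_mon))) d) n k" for d n k y
  proof -
    have y: "y \<in> Hom (Fr (CSig \<Omega>_mon)) n k" using that by (simp add: disc_sel)
    have yg: "Fr_map grp_sig (\<lambda>n g. g) n k y \<in> Hom (Fr (CSig \<Omega>_grp)) n k"
      using law_map_Hom[OF Fr_map_law(1)[OF A.sig] y] by (simp add: sig)
    have yc: "Fr_map mon_sig (\<lambda>n g. g) n k y \<in> Hom (Fr (CSig \<Omega>_cm)) n k"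
      using law_map_Hom[OF Fr_map_law(1)[OF B.sig] y] by (simp add: sig)
    show ?thesis
      unfolding pic_left_def pic_right_def A.NR_map_in1[OF y] B.NR_map_in1[OF y] unfolding sig
        A.B.NR_st_in1[OF yg, unfolded sig] B.B.NR_st_in1[OF yc, unfolded sig]
      by (rule st_pic_Fr) (use y in \<open>simp add: sig\<close>)
  qed
  have 2: "?l d n k (NR_in2 \<Omega>_mon d n k y) = ?r d n k (NR_in2 \<Omega>_mon d n k y)"
    if y: "y \<in> Hom (Lev (sfree_law (ctrl_spro \<Omega>_mon)) d) n k" for d n k y
  proof (rule sfree_unique[OF is_slaw_disc[OF is_law_Th] slaw_map_compose[OF A.A.NR_in_map(2) l]
        slaw_map_compose[OF A.A.NR_in_map(2) r] _ y])
    fix d n k xs assume xs: "xs \<in> Hom (Lev (ctrl_spro \<Omega>_mon) d) n k"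
    have ne: "xs \<noteq> []" and hd: "hd xs \<in> Hom (CPro \<Omega>_mon) n k"
      using xs A.A.Q_hd[OF xs] unfolding A.A.Q_Hom by auto
    have u: "sfree_unit (ctrl_spro \<Omega>_mon) d n k xs \<in> Hom (Lev (sfree_law (ctrl_spro \<Omega>_mon)) d) n k"
      using pro_map_Hom[OF free_unit_map[OF A.A.Q_pro] xs] by (simp add: sfree_unit_def sfree_Lev law_pro_sel)
    have mg: "map (free_pro_lift (law_pro (Fr grp_sig)) (Fr_gen grp_sig) n k) xs \<in> Hom (Lev (ctrl_spro \<Omega>_grp) d) n k"
      using A.Q_p xs unfolding spro_map_def pro_map_def by blast
    have mc: "map (free_pro_lift (law_pro (Fr mon_sig)) (Fr_gen mon_sig) n k) xs \<in> Hom (Lev (ctrl_spro \<Omega>_cm) d) n k"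
      using B.Q_p xs unfolding spro_map_def pro_map_def by blast
    have ug: "sfree_unit (ctrl_spro \<Omega>_grp) d n k (map (free_pro_lift (law_pro (Fr grp_sig)) (Fr_gen grp_sig) n k) xs)
        \<in> Hom (Lev (sfree_law (ctrl_spro \<Omega>_grp)) d) n k"
      using pro_map_Hom[OF free_unit_map[OF A.B.Q_pro] mg] by (simp add: sfree_unit_def sfree_Lev law_pro_sel)
    have uc: "sfree_unit (ctrl_spro \<Omega>_cm) d n k (map (free_pro_lift (law_pro (Fr mon_sig)) (Fr_gen mon_sig) n k) xs)
        \<in> Hom (Lev (sfree_law (ctrl_spro \<Omega>_cm)) d) n k"
      using pro_map_Hom[OF free_unit_map[OF B.B.Q_pro] mc] by (simp add: sfree_unit_def sfree_Lev law_pro_sel)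
    have c: "cinc \<Omega>_mon n k (hd xs) \<in> Hom (Fr mon_sig) n k"
      using pro_map_Hom[OF A.A.i hd] by (simp add: law_pro_sel sig)
    show "?l d n k (NR_in2 \<Omega>_mon d n k (sfree_unit (ctrl_spro \<Omega>_mon) d n k xs)) =
        ?r d n k (NR_in2 \<Omega>_mon d n k (sfree_unit (ctrl_spro \<Omega>_mon) d n k xs))"
      unfolding pic_left_def pic_right_def A.NR_map_in2[OF u] B.NR_map_in2[OF u]
        A.free_Q_p_unit[OF xs] B.free_Q_p_unit[OF xs] A.B.NR_st_in2[OF ug] B.B.NR_st_in2[OF uc]
        A.B.st_Q_unit[OF mg] B.B.st_Q_unit[OF mc] hd_map[OF ne]
        A.sq1[OF hd, symmetric] B.sq1[OF hd, symmetric]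
      unfolding sig by (rule st_pic_Fr[OF c])
  qed
  show ?thesis
    by (rule po_unique[OF A.A.NR_po is_slaw_disc[OF is_law_Th] l[unfolded NR_def[of \<Omega>_mon]]
          r[unfolded NR_def[of \<Omega>_mon]] 1 2 x[unfolded NR_def]])
qed

theorem st_pic_map: "slaw_map NR_pic (disc Th_ab) st_pic"
  unfolding NR_pic_def st_pic_def
  by (rule po_lift_map(1)[OF pic_po is_slaw_disc[OF is_law_Th] st_grp_ab st_cm_ab st_pic_square])

end

theory Submission
  imports Defs "HOL-Library.Z2" "HOL-Library.Multiset" "HOL-Analysis.Analysis"
begin

text \<open>
  An abelian group in homotopy theory carries the self-symmetry \<open>x x \<rightarrow> x x\<close> of each of its points, and
  nothing in the control pros of groups and commutative monoids trivializes it; in the theory of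
  abelian groups it is trivial. In \<open>\<Omega>_cm\<close> the operations \<open>x y\<close> and \<open>y x\<close> are joined by an edge of the
  nerve realization. Restricting this edge along the diagonal \<open>1 \<rightarrow> 2\<close>, which is available in every
  Lawvere theory, makes both of its ends equal to \<open>x x\<close>: the result is a loop \<open>symmetry_loop\<close> in
  \<open>NR_pic(1, 1)\<close>. A weak equivalence to a discrete theory would make it null-homotopic
  (\<open>weak_equivalence_degenerate_edge\<close>).

  That the loop is essential is seen in a single Picard groupoid: the strictly associative one
  with objects \<open>\<int>/2\<close> and all automorphism groups \<open>\<int>/2\<close>, with symmetry \<open>c\<^sub>x\<^sub>,\<^sub>y = (-1)\<^sup>x\<^sup>y\<close>. It is a strict
  group, so \<open>NR \<Omega>_grp\<close> acts on it through the theory of groups, and it is a symmetric monoidal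
  category, so \<open>NR \<Omega>_cm\<close> acts on it with \<open>c\<close> as the symmetry; on \<open>NR \<Omega>_mon\<close> both actions are strict and
  agree. The simplicial theory of additive operations on this groupoid is \<open>sop_slaw\<close>, the
  resulting action is \<open>pic_sop\<close>, and it sends the loop to \<open>c\<^sub>1\<^sub>,\<^sub>1 = -1\<close> (\<open>symmetry_loop_sign\<close>). The coherence
  isomorphism between two arrangements of the same variables is the sign that counts the
  inverted pairs of letters; that these signs are compatible with substitution is
  \<open>inversions_concat_mset\<close>, and here it matters that the operations in the control pro of
  \<open>\<Omega>_cm\<close> use no variable twice (\<open>perm_terms_linear\<close>).

  Evaluating automorphisms at the object \<open>1\<close> turns the action into a \<open>\<int>/2\<close>-valued cocycle on the
  simplicial set \<open>NR_pic(1, 1)\<close>, a \<open>sign_system\<close>, whose value on the loop is nontrivial. It remains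
  to see that such a loop is not null-homotopic in the geometric realization
  (\<open>edge_loop_essential\<close>). A cocycle is a map to \<open>B(\<int>/2)\<close>, and \<open>E(\<int>/2)\<close> can be realized by
  step functions on \<open>[0, 1)\<close> with values \<open>\<plusminus>1\<close>: a point of a simplex with barycentric coordinates \<open>t\<close>
  divides the interval into pieces of lengths \<open>t\<^sub>0, t\<^sub>1, \<dots>\<close>, and the cocycle gives a sign on each
  piece, up to a common sign. Thus every point of the realization has a step function up to sign,
  and it varies continuously for the measure of the set where two functions
  differ. Along a homotopy of loops the signs can be followed on a fine grid, so the sign
  picked up around a null-homotopic loop is \<open>1\<close> (\<open>sign_monodromy_trivial\<close>), whereas the
  loop in question turns the constant function \<open>1\<close> into \<open>-1\<close>.
\<close>


section \<open>Monodromy of functions defined up to sign\<close>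

definition sign_fun :: "(real \<Rightarrow> real) \<Rightarrow> bool" where
  "sign_fun f \<longleftrightarrow> f \<in> borel_measurable borel \<and> (\<forall>u. f u = 1 \<or> f u = -1)"

text \<open>Half the \<open>L\<^sup>1\<close>-distance of two functions with values \<open>\<plusminus>1\<close> on \<open>[0, 1)\<close>. A function and its negative
  are at distance \<open>1\<close>, the largest possible.\<close>
definition disagreement :: "(real \<Rightarrow> real) \<Rightarrow> (real \<Rightarrow> real) \<Rightarrow> real" where
  "disagreement f g = measure lborel {u \<in> {0..<1}. f u \<noteq> g u}"

lemma disagreement_fmeasurable:
  assumes "sign_fun f" "sign_fun g"
  shows "{u \<in> {0..<1}. f u \<noteq> g u} \<in> fmeasurable lborel"
proof (rule fmeasurableI2)
  show "{0..<1::real} \<in> fmeasurable lborel" by (auto simp: fmeasurable_def)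
  have [measurable]: "f \<in> borel_measurable borel" "g \<in> borel_measurable borel"
    using assms by (auto simp: sign_fun_def)
  show "{u \<in> {0..<1}. f u \<noteq> g u} \<in> sets lborel" by measurable
qed auto

lemma disagreement_self: "disagreement f f = 0"
  by (simp add: disagreement_def)

lemma disagreement_commute: "disagreement f g = disagreement g f"
  unfolding disagreement_def by (rule arg_cong[where f = "measure lborel"]) auto

lemma disagreement_triangle:
  assumes "sign_fun f" "sign_fun g" "sign_fun h"
  shows "disagreement f h \<le> disagreement f g + disagreement g h"
proof -
  have "disagreement f h \<le> measure lborel ({u \<in> {0..<1}. f u \<noteq> g u} \<union> {u \<in> {0..<1}. g u \<noteq> h u})"
    unfolding disagreement_def
    by (intro measure_mono_fmeasurable fmeasurable.Un fmeasurableD disagreement_fmeasurable assms) auto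
  also have "\<dots> \<le> disagreement f g + disagreement g h"
    unfolding disagreement_def by (intro measure_Un_le fmeasurableD disagreement_fmeasurable assms)
  finally show ?thesis .
qed

lemma sign_fun_uminus: "sign_fun f \<Longrightarrow> sign_fun (\<lambda>u. - f u)"
  by (auto simp: sign_fun_def)

text \<open>At each point a sign function agrees with exactly one of \<open>g\<close> and \<open>-g\<close>. Hence at most one
  choice of sign brings \<open>\<plusminus>g\<close> closer than \<open>1/2\<close>.\<close>
lemma disagreement_uminus:
  assumes "sign_fun f" "sign_fun g"
  shows "disagreement f (\<lambda>u. - g u) = 1 - disagreement f g"
proof -
  have pm: "f u = 1 \<or> f u = -1" "g u = 1 \<or> g u = -1" for u
    using assms by (auto simp: sign_fun_def)
  have e: "f u \<noteq> - g u \<longleftrightarrow> f u = g u" for u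
    using pm[of u] by auto
  have "measure lborel ({u \<in> {0..<1}. f u \<noteq> g u} \<union> {u \<in> {0..<1}. f u \<noteq> - g u}) = disagreement f g + disagreement f (\<lambda>u. - g u)"
    unfolding disagreement_def
    by (intro measure_Un_AE disagreement_fmeasurable assms sign_fun_uminus) (simp add: e)
  moreover have "{u \<in> {0..<1}. f u \<noteq> g u} \<union> {u \<in> {0..<1}. f u \<noteq> - g u} = {0..<1}"
    unfolding e by auto
  ultimately show ?thesis by simp
qed

text \<open>Closeness of functions up to sign. The bound \<open>1/4\<close> is chosen so that two functions near a
  third one are, with the right sign, closer than \<open>1/2\<close> to each other.\<close>
definition near :: "(real \<Rightarrow> real) \<Rightarrow> (real \<Rightarrow> real) \<Rightarrow> bool" where
  "near f g \<longleftrightarrow> (\<exists>s. (s = 1 \<or> s = -1) \<and> disagreement f (\<lambda>u. s * g u) < 1/4)"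

definition relative_sign :: "(real \<Rightarrow> real) \<Rightarrow> (real \<Rightarrow> real) \<Rightarrow> real" where
  "relative_sign f g = (if disagreement f g < 1/2 then 1 else -1)"

lemma relative_sign_self: "relative_sign f f = 1"
  by (simp add: relative_sign_def disagreement_self)

lemma relative_sign_common:
  assumes f: "sign_fun f" and g: "sign_fun g" and h: "sign_fun h"
    and s: "s = 1 \<or> s = -1" "s' = 1 \<or> s' = -1"
    and d: "disagreement f (\<lambda>u. s * h u) < 1/4" "disagreement g (\<lambda>u. s' * h u) < 1/4"
  shows "relative_sign f g = s * s'"
proof -
  have sh: "sign_fun (\<lambda>u. s * h u)"
    using s(1) h sign_fun_uminus[OF h] by auto
  show ?thesis
  proof (cases "s = s'")
    case True
    have "disagreement f g \<le> disagreement f (\<lambda>u. s * h u) + disagreement (\<lambda>u. s * h u) g" by (rule disagreement_triangle[OF f sh g])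
    then have "disagreement f g < 1/2" using d True by (simp add: disagreement_commute[of _ g])
    then show ?thesis using True s by (auto simp: relative_sign_def)
  next
    case False
    then have s': "s' = - s" using s by auto
    have "disagreement g (\<lambda>u. s * h u) = 1 - disagreement g (\<lambda>u. s' * h u)"
      using disagreement_uminus[OF g sh] unfolding s' by simp
    moreover have "disagreement g (\<lambda>u. s * h u) \<le> disagreement g f + disagreement f (\<lambda>u. s * h u)"
      by (rule disagreement_triangle[OF g f sh])
    ultimately have "\<not> disagreement f g < 1/2" using d by (simp add: disagreement_commute[of g f])
    then show ?thesis using s s' by (auto simp: relative_sign_def)
  qed
qed

text \<open>Four functions near a common one get signs relative to it, and these trivialize the
  relative signs among the four: the local triviality of the double cover.\<close>
lemma relative_sign_square:
  assumes "sign_fun h" and "\<And>f. f \<in> {p, q, r, s} \<Longrightarrow> sign_fun f \<and> near f h"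
  shows "relative_sign p q * relative_sign q s = relative_sign p r * relative_sign r s"
proof -
  have "\<exists>\<sigma>. (\<sigma> = 1 \<or> \<sigma> = -1) \<and> disagreement f (\<lambda>u. \<sigma> * h u) < 1/4" if "f \<in> {p, q, r, s}" for f
    using assms(2)[OF that] by (simp add: near_def)
  then obtain \<sigma> where \<sigma>: "\<And>f. f \<in> {p, q, r, s} \<Longrightarrow> (\<sigma> f = 1 \<or> \<sigma> f = -1) \<and> disagreement f (\<lambda>u. \<sigma> f * h u) < 1/4"
    by metis
  have c: "relative_sign f g = \<sigma> f * \<sigma> g" if "f \<in> {p, q, r, s}" "g \<in> {p, q, r, s}" for f g
    using relative_sign_common[of f g h "\<sigma> f" "\<sigma> g"] assms \<sigma>[OF that(1)] \<sigma>[OF that(2)] that by blast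
  have "\<sigma> q * \<sigma> q = 1" "\<sigma> r * \<sigma> r = 1" using \<sigma>[of q] \<sigma>[of r] by auto
  then show ?thesis by (simp add: c algebra_simps)
qed

text \<open>Discrete Stokes theorem for signs on the edges of an \<open>N \<times> N\<close> grid, with \<open>H\<close> on
  horizontal and \<open>V\<close> on vertical edges: sweeping upwards one square at a time does not change
  the product along a row.\<close>
lemma row_products:
  fixes H V :: "nat \<Rightarrow> nat \<Rightarrow> real"
  assumes sq: "\<And>i j. i < N \<Longrightarrow> j < N \<Longrightarrow> H i j * V (Suc i) j = V i j * H i (Suc j)"
    and V: "\<And>j. j < N \<Longrightarrow> V 0 j = 1" "\<And>j. j < N \<Longrightarrow> V N j = 1"
    and top: "\<And>i. i < N \<Longrightarrow> H i N = 1"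
  shows "(\<Prod>i<N. H i 0) = 1"
proof -
  have row: "(\<Prod>k<i. H k j) * V i j = V 0 j * (\<Prod>k<i. H k (Suc j))" if "i \<le> N" "j < N" for i j
    using that(1)
  proof (induction i)
    case (Suc i)
    have "(\<Prod>k<Suc i. H k j) * V (Suc i) j = (\<Prod>k<i. H k j) * (H i j * V (Suc i) j)" by simp
    also have "\<dots> = ((\<Prod>k<i. H k j) * V i j) * H i (Suc j)" using Suc.prems that(2) by (simp add: sq)
    also have "\<dots> = V 0 j * (\<Prod>k<Suc i. H k (Suc j))" using Suc by simp
    finally show ?case .
  qed simp
  have step: "(\<Prod>k<N. H k j) = (\<Prod>k<N. H k (Suc j))" if "j < N" for j
    using row[of N j] V that by simp
  have "(\<Prod>k<N. H k 0) = (\<Prod>k<N. H k j)" if "j \<le> N" for j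
    using that by (induction j) (simp_all add: step)
  from this[of N] show ?thesis by (simp add: top)
qed

text \<open>The homotopy lifting property of the double cover whose fibre over \<open>y\<close> is \<open>{rep y, - rep y}\<close>,
  in the form in which it is needed: by compactness the square can be cut into so small
  squares that the relative signs around each of them multiply to \<open>1\<close>; the three sides on
  which the homotopy is constant contribute nothing. The bound on \<open>N\<close> makes consecutive points of an
  edge, \<open>1/N\<close> apart, near each other in \<open>edge_loop_essential\<close>.\<close>
lemma sign_monodromy_trivial:
  fixes h :: "real \<times> real \<Rightarrow> 'b"
  assumes h: "continuous_map (top_of_set ({0..1} \<times> {0..1})) Y h"
    and rep: "\<And>y. sign_fun (rep y)"
    and op: "\<And>y. y \<in> topspace Y \<Longrightarrow> openin Y {z \<in> topspace Y. near (rep z) (rep y)}"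
    and bd: "\<And>b. b \<in> {0..1} \<Longrightarrow> h (0, b) = x" "\<And>b. b \<in> {0..1} \<Longrightarrow> h (1, b) = x"
      "\<And>a. a \<in> {0..1} \<Longrightarrow> h (a, 1) = x"
  shows "\<exists>N>4. (\<Prod>i<N. relative_sign (rep (h (real i / real N, 0))) (rep (h (real (Suc i) / real N, 0)))) = 1"
proof -
  let ?S = "{0..1::real} \<times> {0..1::real}"
  have hS: "h w \<in> topspace Y" if "w \<in> ?S" for w
    using continuous_map_image_subset_topspace[OF h] that by auto
  have "\<forall>z\<in>?S. \<exists>T. open T \<and> {w \<in> ?S. near (rep (h w)) (rep (h z))} = ?S \<inter> T"
  proof
    fix z assume "z \<in> ?S"
    note that = this
    have "openin (top_of_set ?S) {w \<in> topspace (top_of_set ?S). h w \<in> {y \<in> topspace Y. near (rep y) (rep (h z))}}"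
      by (rule openin_continuous_map_preimage[OF h op[OF hS[OF that]]])
    moreover have "{w \<in> topspace (top_of_set ?S). h w \<in> {y \<in> topspace Y. near (rep y) (rep (h z))}} =
        {w \<in> ?S. near (rep (h w)) (rep (h z))}" using hS by auto
    ultimately have "openin (top_of_set ?S) {w \<in> ?S. near (rep (h w)) (rep (h z))}" by simp
    then show "\<exists>T. open T \<and> {w \<in> ?S. near (rep (h w)) (rep (h z))} = ?S \<inter> T"
      unfolding openin_open by blast
  qed
  from bchoice[OF this] obtain T where
    "\<forall>z\<in>?S. open (T z) \<and> {w \<in> ?S. near (rep (h w)) (rep (h z))} = ?S \<inter> T z" ..
  note T = bspec[OF this, THEN conjunct1] bspec[OF this, THEN conjunct2]
  have self: "near f f" for f unfolding near_def by (rule exI[of _ 1]) (simp add: disagreement_self)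
  have cS: "compact ?S" by (intro compact_Times) auto
  have cov: "?S \<subseteq> \<Union>(T ` ?S)"
  proof
    fix z assume z: "z \<in> ?S"
    have "z \<in> ?S \<inter> T z" unfolding T(2)[OF z, symmetric] by (intro CollectI conjI z self)
    then show "z \<in> \<Union>(T ` ?S)" by (intro UN_I[OF z]) (rule IntD2)
  qed
  have opT: "open G" if "G \<in> T ` ?S" for G using that by (elim imageE) (simp only: T(1))
  obtain e where e: "e > 0" "\<And>z. z \<in> ?S \<Longrightarrow> \<exists>G\<in>T ` ?S. ball z e \<subseteq> G"
    using Heine_Borel_lemma[OF cS cov opT] by metis
  obtain N :: nat where N: "max 4 (2 / e) < real N" using reals_Archimedean2 by blast
  then have N2: "N > 4" "2 / real N < e" using e(1) by (auto simp: field_simps)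
  define c where "c i j = rep (h (real i / real N, real j / real N))" for i j
  have "relative_sign (c i j) (c (Suc i) j) * relative_sign (c (Suc i) j) (c (Suc i) (Suc j)) =
      relative_sign (c i j) (c i (Suc j)) * relative_sign (c i (Suc j)) (c (Suc i) (Suc j))" if "i < N" "j < N" for i j
  proof -
    let ?p = "\<lambda>i j. (real i / real N, real j / real N)"
    have pS: "?p a b \<in> ?S" if "a \<le> N" "b \<le> N" for a b using that N2(1) by (auto simp: divide_le_eq_1)
    obtain z where z: "z \<in> ?S" "ball (?p i j) e \<subseteq> T z" using e(2)[OF pS[of i j]] \<open>i < N\<close> \<open>j < N\<close> by auto
    have nr: "near (c a b) (rep (h z))" if "a \<in> {i, Suc i}" "b \<in> {j, Suc j}" for a b
    proof -
      have "dist (?p i j) (?p a b) \<le> \<bar>real i / real N - real a / real N\<bar> + \<bar>real j / real N - real b / real N\<bar>"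
        unfolding dist_Pair_Pair dist_real_def by (rule order_trans[OF sqrt_sum_squares_le_sum_abs]) simp
      also have "\<dots> \<le> 1 / real N + 1 / real N"
        using that N2(1) by (auto simp: field_simps)
      also have "\<dots> < e" using N2(2) by simp
      finally have "?p a b \<in> T z" using z(2) by (auto simp: subset_iff)
      moreover have "?p a b \<in> ?S" by (rule pS) (use that \<open>i < N\<close> \<open>j < N\<close> in auto)
      ultimately show ?thesis unfolding c_def by (intro CollectD[of "?p a b", OF subsetD[OF equalityD2[OF T(2)[OF z(1)]]], THEN conjunct2] IntI)
    qed
    have sf: "sign_fun (c a b)" for a b by (simp add: c_def rep)
    show ?thesis
      by (rule relative_sign_square[of "rep (h z)"]) (use nr sf in \<open>auto simp: rep\<close>)
  qed
  note sq = this
  have "(\<Prod>i<N. relative_sign (c i 0) (c (Suc i) 0)) = 1"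
  proof (rule row_products[where V = "\<lambda>i j. relative_sign (c i j) (c i (Suc j))"])
    fix j assume j: "j < N"
    have "real j / real N \<in> {0..1}" "real (Suc j) / real N \<in> {0..1}" using j by (auto simp: field_simps)
    then show "relative_sign (c 0 j) (c 0 (Suc j)) = 1" "relative_sign (c N j) (c N (Suc j)) = 1"
      using j by (simp_all add: c_def bd relative_sign_self del: of_nat_Suc)
  next
    fix i assume i: "i < N"
    have "real i / real N \<in> {0..1}" "real (Suc i) / real N \<in> {0..1}" using i by (auto simp: field_simps)
    then show "relative_sign (c i N) (c (Suc i) N) = 1"
      using i by (simp add: c_def bd relative_sign_self del: of_nat_Suc)
  qed (rule sq)
  then show ?thesis using N2(1) unfolding c_def by auto
qed

section \<open>Step functions attached to points of a simplex\<close>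

text \<open>Cut \<open>[0, 1)\<close> into consecutive half-open intervals of lengths \<open>t 0, t 1, \<dots>\<close>; this is the
  number of the interval that contains \<open>u\<close>. Intervals of length zero contain no \<open>u\<close>, which makes
  the construction compatible with face maps.\<close>
definition step_index :: "(nat \<Rightarrow> real) \<Rightarrow> real \<Rightarrow> nat" where
  "step_index t u = (LEAST i. u < (\<Sum>k\<le>i. t k))"

lemma step_index_simplex:
  assumes t: "t \<in> standard_simplex n" and u: "u \<in> {0..<1}"
  shows "step_index t u \<le> n" "u < (\<Sum>k\<le>step_index t u. t k)" "(\<Sum>k<step_index t u. t k) \<le> u"
proof -
  have n: "u < (\<Sum>k\<le>n. t k)" using t u by (auto simp: standard_simplex_def)
  show "step_index t u \<le> n" unfolding step_index_def by (rule Least_le) (rule n)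
  show "u < (\<Sum>k\<le>step_index t u. t k)"
    unfolding step_index_def by (rule LeastI[of "\<lambda>i. u < (\<Sum>k\<le>i. t k)", OF n])
  show "(\<Sum>k<step_index t u. t k) \<le> u"
  proof (cases "step_index t u")
    case (Suc i)
    have "\<not> u < (\<Sum>k\<le>i. t k)"
      by (rule not_less_Least) (use Suc in \<open>simp add: step_index_def[symmetric]\<close>)
    then show ?thesis by (simp add: Suc lessThan_Suc_atMost)
  qed (use u in auto)
qed

lemma step_index_eqI:
  assumes "t \<in> standard_simplex n" and "u < (\<Sum>k\<le>i. t k)" and "(\<Sum>k<i. t k) \<le> u"
  shows "step_index t u = i"
  unfolding step_index_def
proof (rule Least_equality)
  fix j assume j: "u < (\<Sum>k\<le>j. t k)"
  show "i \<le> j"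
  proof (rule ccontr)
    assume "\<not> i \<le> j"
    then have "(\<Sum>k\<le>j. t k) \<le> (\<Sum>k<i. t k)"
      using assms(1) by (intro sum_mono2) (auto simp: standard_simplex_def)
    then show False using j assms(3) by simp
  qed
qed (rule assms(2))

lemma simplex_push_simplex:
  assumes a: "\<alpha> \<in> simp_ops m n" and t: "t \<in> standard_simplex m"
  shows "simplex_push \<alpha> t \<in> standard_simplex n"
    and "finite J \<Longrightarrow> (\<Sum>j\<in>J. simplex_push \<alpha> t j) = (\<Sum>i | i \<le> m \<and> \<alpha> ! i \<in> J. t i)"
proof -
  have len: "length \<alpha> = Suc m" and le: "\<And>i. i \<le> m \<Longrightarrow> \<alpha> ! i \<le> n"
    using simp_ops_length[OF a] simp_ops_nth[OF a] by auto
  have t0: "0 \<le> t i" for i using t by (auto simp: standard_simplex_def)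
  have t1: "(\<Sum>i\<le>m. t i) = 1" using t by (auto simp: standard_simplex_def)
  have eq: "(\<Sum>j\<in>J. simplex_push \<alpha> t j) = (\<Sum>i | i \<le> m \<and> \<alpha> ! i \<in> J. t i)" if "finite J" for J
  proof -
    have "(\<Sum>i | i \<le> m \<and> \<alpha> ! i \<in> J. t i) = (\<Sum>j\<in>J. \<Sum>i\<in>{i \<in> {i. i \<le> m \<and> \<alpha> ! i \<in> J}. \<alpha> ! i = j}. t i)"
      by (rule sum.group[symmetric]) (use that in auto)
    also have "\<dots> = (\<Sum>j\<in>J. simplex_push \<alpha> t j)"
      unfolding simplex_push_def len by (intro sum.cong) (auto simp: less_Suc_eq_le)
    finally show ?thesis by simp
  qed
  then show "finite J \<Longrightarrow> (\<Sum>j\<in>J. simplex_push \<alpha> t j) = (\<Sum>i | i \<le> m \<and> \<alpha> ! i \<in> J. t i)" .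
  have nn: "0 \<le> simplex_push \<alpha> t j" for j unfolding simplex_push_def by (intro sum_nonneg t0)
  have all: "{i. i \<le> m \<and> \<alpha> ! i \<in> {..n}} = {..m}" using le by auto
  have s1: "(\<Sum>j\<le>n. simplex_push \<alpha> t j) = 1" using eq[of "{..n}"] unfolding all by (simp add: t1)
  have z: "simplex_push \<alpha> t j = 0" if "j > n" for j
    unfolding simplex_push_def
    by (rule sum.neutral) (use le that len in \<open>force simp: less_Suc_eq_le\<close>)
  have "simplex_push \<alpha> t j \<le> 1" for j
  proof (cases "j \<le> n")
    case True
    then have "simplex_push \<alpha> t j \<le> (\<Sum>j\<le>n. simplex_push \<alpha> t j)"
      by (intro member_le_sum) (auto simp: nn)
    then show ?thesis by (simp add: s1)
  qed (simp add: z)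
  then show "simplex_push \<alpha> t \<in> standard_simplex n"
    using nn z s1 by (auto simp: standard_simplex_def)
qed

text \<open>A simplicial operator merges consecutive intervals, because it is monotone, and inserts
  empty ones.\<close>
lemma step_index_push:
  assumes a: "\<alpha> \<in> simp_ops m n" and t: "t \<in> standard_simplex m" and u: "u \<in> {0..<1}"
  shows "step_index (simplex_push \<alpha> t) u = \<alpha> ! step_index t u"
proof (rule step_index_eqI[OF simplex_push_simplex(1)[OF a t]])
  let ?i = "step_index t u"
  note i = step_index_simplex[OF t u]
  have t0: "0 \<le> t i" for i using t by (auto simp: standard_simplex_def)
  have mono: "\<alpha> ! j \<le> \<alpha> ! k" if "j \<le> k" "k \<le> m" for j k
    using a that unfolding simp_ops_def by (auto simp: sorted_iff_nth_mono)
  have "(\<Sum>k\<le>?i. t k) \<le> (\<Sum>k | k \<le> m \<and> \<alpha> ! k \<in> {..\<alpha> ! ?i}. t k)"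
    by (rule sum_mono2) (use i(1) mono t0 in auto)
  also have "\<dots> = (\<Sum>j\<le>\<alpha> ! ?i. simplex_push \<alpha> t j)"
    by (rule simplex_push_simplex(2)[OF a t, symmetric]) simp
  finally show "u < (\<Sum>j\<le>\<alpha> ! ?i. simplex_push \<alpha> t j)" using i(2) by simp
  have "(\<Sum>j<\<alpha> ! ?i. simplex_push \<alpha> t j) = (\<Sum>k | k \<le> m \<and> \<alpha> ! k \<in> {..<\<alpha> ! ?i}. t k)"
    by (rule simplex_push_simplex(2)[OF a t]) simp
  also have "\<dots> \<le> (\<Sum>k<?i. t k)"
  proof (rule sum_mono2)
    show "{k. k \<le> m \<and> \<alpha> ! k \<in> {..<\<alpha> ! ?i}} \<subseteq> {..<?i}"
    proof
      fix k assume "k \<in> {k. k \<le> m \<and> \<alpha> ! k \<in> {..<\<alpha> ! ?i}}"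
      then show "k \<in> {..<?i}" using mono[of ?i k] by (cases "?i \<le> k") auto
    qed
  qed (use t0 in auto)
  also have "\<dots> \<le> u" by (rule i(3))
  finally show "(\<Sum>j<\<alpha> ! ?i. simplex_push \<alpha> t j) \<le> u" .
qed

definition sign_step :: "(nat \<Rightarrow> real) \<Rightarrow> (nat \<Rightarrow> real) \<Rightarrow> real \<Rightarrow> real" where
  "sign_step s t u = s (step_index t u)"

lemma sign_step_sign_fun:
  assumes "\<And>i. s i = 1 \<or> s i = -1"
  shows "sign_fun (sign_step s t)"
proof -
  have "step_index t \<in> measurable borel (count_space UNIV)"
    unfolding step_index_def[abs_def] by measurable
  then have "(\<lambda>u. s (step_index t u)) \<in> borel_measurable borel"
    by (rule measurable_compose) simp
  then show ?thesis using assms by (simp add: sign_fun_def sign_step_def[abs_def])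
qed

text \<open>The two step functions can differ only between corresponding end points of the intervals.\<close>
lemma disagreement_sign_step:
  assumes t: "t \<in> standard_simplex n" and t': "t' \<in> standard_simplex n"
    and s: "\<And>i. s i = 1 \<or> s i = -1"
  shows "disagreement (sign_step s t) (sign_step s t') \<le> (\<Sum>i\<le>n. \<bar>(\<Sum>k\<le>i. t k) - (\<Sum>k\<le>i. t' k)\<bar>)"
proof -
  \<comment> \<open>The right end points of the intervals.\<close>
  define A where "A t i = (\<Sum>k\<le>i. t k)" for t :: "nat \<Rightarrow> real" and i
  define I where "I i = {min (A t i) (A t' i)..max (A t i) (A t' i)}" for i
  have I: "I i \<in> fmeasurable lborel" for i by (auto simp: I_def fmeasurable_def emeasure_lborel_Icc_eq)
  have "{u \<in> {0..<1}. sign_step s t u \<noteq> sign_step s t' u} \<subseteq> (\<Union>i\<le>n. I i)"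
  proof
    fix u assume u: "u \<in> {u \<in> {0..<1}. sign_step s t u \<noteq> sign_step s t' u}"
    show "u \<in> (\<Union>i\<le>n. I i)"
    proof (rule ccontr)
      assume out: "u \<notin> (\<Union>i\<le>n. I i)"
      have iff: "u < A t i \<longleftrightarrow> u < A t' i" if "i \<le> n" for i
      proof -
        have "u \<notin> I i" using out that by blast
        then show ?thesis by (auto simp: I_def min_def max_def split: if_splits)
      qed
      have u': "u \<in> {0..<1}" using u by blast
      note i = step_index_simplex[OF t u'] and i' = step_index_simplex[OF t' u']
      have "step_index t' u \<le> step_index t u"
        unfolding step_index_def[of t'] by (rule Least_le) (use i iff[of "step_index t u"] in \<open>simp add: A_def\<close>)
      moreover have "step_index t u \<le> step_index t' u"
        unfolding step_index_def[of t] by (rule Least_le) (use i' iff[of "step_index t' u"] in \<open>simp add: A_def\<close>)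
      ultimately show False using u by (simp add: sign_step_def)
    qed
  qed
  then have "disagreement (sign_step s t) (sign_step s t') \<le> measure lborel (\<Union>i\<le>n. I i)"
    unfolding disagreement_def
    by (rule measure_mono_fmeasurable)
      (intro fmeasurableD disagreement_fmeasurable sign_step_sign_fun s fmeasurable.finite_UN finite_atMost I)+
  also have "\<dots> \<le> (\<Sum>i\<le>n. measure lborel (I i))"
    by (intro measure_UNION_le fmeasurableD I finite_atMost)
  also have "\<dots> = (\<Sum>i\<le>n. \<bar>A t i - A t' i\<bar>)"
    by (intro sum.cong refl) (auto simp: I_def min_def max_def)
  finally show ?thesis by (simp add: A_def)
qed

lemma openin_near_sign_step:
  assumes s: "\<And>i. s i = 1 \<or> s i = -1" and g: "sign_fun g"
  shows "openin (subtopology (powertop_real UNIV) (standard_simplex n))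
    {t \<in> standard_simplex n. near (sign_step s t) g}"
proof (subst openin_subopen, intro ballI)
  fix t assume t: "t \<in> {t \<in> standard_simplex n. near (sign_step s t) g}"
  then obtain \<epsilon> where e: "\<epsilon> = 1 \<or> \<epsilon> = -1" "disagreement (sign_step s t) (\<lambda>u. \<epsilon> * g u) < 1/4"
    by (auto simp: near_def)
  have eg: "sign_fun (\<lambda>u. \<epsilon> * g u)" using e(1) g sign_fun_uminus[OF g] by auto
  define r where "r = 1/4 - disagreement (sign_step s t) (\<lambda>u. \<epsilon> * g u)"
  let ?F = "\<lambda>t'. \<Sum>i\<le>n. \<bar>(\<Sum>k\<le>i. t' k) - (\<Sum>k\<le>i. t k)\<bar>"
  let ?T = "{t' \<in> topspace (subtopology (powertop_real UNIV) (standard_simplex n)). ?F t' \<in> {..<r}}"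
  have cont: "continuous_map (subtopology (powertop_real UNIV) (standard_simplex n)) euclideanreal ?F"
    by (intro continuous_map_from_subtopology continuous_map_sum continuous_map_real_abs continuous_map_diff
        continuous_map_product_projection finite_atMost continuous_map_canonical_const) auto
  show "\<exists>T. openin (subtopology (powertop_real UNIV) (standard_simplex n)) T \<and> t \<in> T \<and>
      T \<subseteq> {t \<in> standard_simplex n. near (sign_step s t) g}"
  proof (intro exI conjI)
    show "openin (subtopology (powertop_real UNIV) (standard_simplex n)) ?T"
      by (rule openin_continuous_map_preimage[OF cont]) (simp add: open_openin[symmetric])
    show "t \<in> ?T" using t e(2) by (simp add: r_def)
    show "?T \<subseteq> {t \<in> standard_simplex n. near (sign_step s t) g}"
    proof
      fix t' assume "t' \<in> ?T"
      then have t': "t' \<in> standard_simplex n" and F: "?F t' < r" by auto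
      have "disagreement (sign_step s t') (\<lambda>u. \<epsilon> * g u) \<le> disagreement (sign_step s t') (sign_step s t) + disagreement (sign_step s t) (\<lambda>u. \<epsilon> * g u)"
        by (intro disagreement_triangle sign_step_sign_fun s eg)
      also have "disagreement (sign_step s t') (sign_step s t) \<le> ?F t'"
        by (rule disagreement_sign_step) (use t t' s in auto)
      finally have "disagreement (sign_step s t') (\<lambda>u. \<epsilon> * g u) < 1/4" using F by (simp add: r_def)
      then show "t' \<in> {t \<in> standard_simplex n. near (sign_step s t) g}"
        using t' e(1) by (auto simp: near_def)
    qed
  qed
qed

section \<open>Sign systems and essential loops in the realization\<close>
lemma real_eq_sym: "(p, q) \<in> real_eq X \<Longrightarrow> (q, p) \<in> real_eq X"
  unfolding real_eq_def by (rule symD[OF sym_rtrancl]) (auto simp: sym_def)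

lemma real_eq_trans: "(p, q) \<in> real_eq X \<Longrightarrow> (q, r) \<in> real_eq X \<Longrightarrow> (p, r) \<in> real_eq X"
  unfolding real_eq_def by (rule rtrancl_trans)

lemma real_eq_class:
  assumes "(p, q) \<in> real_eq X"
  shows "real_eq X `` {p} = real_eq X `` {q}"
  using real_eq_trans[OF assms] real_eq_trans[OF real_eq_sym[OF assms]] by blast

lemma real_eq_step_class: "(p, q) \<in> real_step X \<Longrightarrow> real_eq X `` {p} = real_eq X `` {q}"
  unfolding real_eq_def by (rule real_eq_class[unfolded real_eq_def], rule r_into_rtrancl) blast

lemma topspace_realization: "topspace (realization X) = real_pts X // real_eq X"
proof -
  have "real_open X (real_pts X // real_eq X)"
    unfolding real_open_def
  proof (intro conjI allI ballI)
    fix n x assume "x \<in> Simp X n"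
    then have "{t \<in> standard_simplex n. real_eq X `` {(n, x, t)} \<in> real_pts X // real_eq X} =
        topspace (subtopology (powertop_real UNIV) (standard_simplex n))"
      by (auto simp: real_pts_def intro!: quotientI)
    then show "openin (subtopology (powertop_real UNIV) (standard_simplex n))
        {t \<in> standard_simplex n. real_eq X `` {(n, x, t)} \<in> real_pts X // real_eq X}"
      by (metis openin_topspace)
  qed simp
  then have "real_pts X // real_eq X \<subseteq> topspace (realization X)"
    by (intro openin_subset) (simp add: openin_realization)
  moreover have "topspace (realization X) \<subseteq> real_pts X // real_eq X"
    using openin_topspace[of "realization X"] unfolding openin_realization real_open_def by blast
  ultimately show ?thesis by blast
qed

definition agree_up_to_sign :: "(real \<Rightarrow> real) \<Rightarrow> (real \<Rightarrow> real) \<Rightarrow> bool" where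
  "agree_up_to_sign f g \<longleftrightarrow> (\<exists>s. (s = 1 \<or> s = -1) \<and> (\<forall>u\<in>{0..<1}. f u = s * g u))"

lemma agree_refl: "agree_up_to_sign f f"
  unfolding agree_up_to_sign_def by (rule exI[of _ 1]) simp

lemma agree_sym: "agree_up_to_sign f g \<Longrightarrow> agree_up_to_sign g f"
  unfolding agree_up_to_sign_def
proof (elim exE conjE)
  fix s :: real
  assume "s = 1 \<or> s = -1" "\<forall>u\<in>{0..<1}. f u = s * g u"
  then show "\<exists>s. (s = 1 \<or> s = -1) \<and> (\<forall>u\<in>{0..<1}. g u = s * f u)"
    by (intro exI[of _ s]) auto
qed

lemma agree_trans: "agree_up_to_sign f g \<Longrightarrow> agree_up_to_sign g h \<Longrightarrow> agree_up_to_sign f h"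
  unfolding agree_up_to_sign_def
proof (elim exE conjE)
  fix s s' :: real
  assume "s = 1 \<or> s = -1" "s' = 1 \<or> s' = -1" "\<forall>u\<in>{0..<1}. f u = s * g u" "\<forall>u\<in>{0..<1}. g u = s' * h u"
  then show "\<exists>s. (s = 1 \<or> s = -1) \<and> (\<forall>u\<in>{0..<1}. f u = s * h u)"
    by (intro exI[of _ "s * s'"]) auto
qed

lemma disagreement_cong: "(\<And>u. u \<in> {0..<1} \<Longrightarrow> f u = f' u) \<Longrightarrow> (\<And>u. u \<in> {0..<1} \<Longrightarrow> g u = g' u) \<Longrightarrow> disagreement f g = disagreement f' g'"
  unfolding disagreement_def by (rule arg_cong[where f = "measure lborel"]) auto

text \<open>The sign in \<open>near\<close> is free, so it is a notion for functions up to sign.\<close>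
lemma near_agree:
  assumes "agree_up_to_sign f f'" "near f g"
  shows "near f' g"
proof -
  obtain s s' where s: "s = 1 \<or> s = -1" "\<And>u. u \<in> {0..<1} \<Longrightarrow> f u = s * f' u"
    and s': "s' = 1 \<or> s' = -1" "disagreement f (\<lambda>u. s' * g u) < 1/4"
    using assms unfolding agree_up_to_sign_def near_def by blast
  have "disagreement f' (\<lambda>u. s * s' * g u) = disagreement f (\<lambda>u. s' * g u)"
    unfolding disagreement_def using s(1)
    by (intro arg_cong[where f = "measure lborel"]) (auto simp: s(2))
  then show ?thesis unfolding near_def using s(1) s' by (intro exI[of _ "s * s'"]) auto
qed

text \<open>The point with parameter \<open>r\<close> on the standard edge; at \<open>r = 0\<close> it is the first vertex, and it is also
  the only point of the standard \<open>0\<close>-simplex.\<close>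
definition edge_pt :: "real \<Rightarrow> nat \<Rightarrow> real" where
  "edge_pt r = (\<lambda>j. if j = 0 then 1 - r else if j = 1 then r else 0)"

lemma edge_pt_simplex: "r \<in> {0..1} \<Longrightarrow> edge_pt r \<in> standard_simplex 1" "edge_pt 0 \<in> standard_simplex 0"
  by (auto simp: edge_pt_def standard_simplex_def)

text \<open>A simplicial map to the nerve of \<open>\<int>/2\<close>, that is, a \<open>\<int>/2\<close>-valued \<open>1\<close>-cocycle, in a symmetric
  form: \<open>sg n x i * sg n x j\<close> is the value of the cocycle on the edge of \<open>x\<close> from vertex \<open>i\<close> to vertex \<open>j\<close>.
  So the signs of one simplex matter only up to a common factor.\<close>
locale sign_system =
  fixes X :: "'a sset" and sg :: "nat \<Rightarrow> 'a \<Rightarrow> nat \<Rightarrow> real"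
  assumes X: "simplicial_set X"
    and sg: "\<And>n x i. sg n x i = 1 \<or> sg n x i = -1"
    and sg_act: "\<And>m n \<alpha> x. \<alpha> \<in> simp_ops m n \<Longrightarrow> x \<in> Simp X n \<Longrightarrow>
      \<exists>s. (s = 1 \<or> s = -1) \<and> (\<forall>i\<le>m. sg m (Act X n \<alpha> x) i = s * sg n x (\<alpha> ! i))"
begin

definition pt_sign :: "nat \<times> 'a \<times> (nat \<Rightarrow> real) \<Rightarrow> real \<Rightarrow> real" where
  "pt_sign = (\<lambda>(n, x, t). sign_step (sg n x) t)"

lemma pt_sign_sign_fun: "sign_fun (pt_sign p)"
  unfolding pt_sign_def by (simp add: sign_step_sign_fun sg split: prod.split)

lemma step_agree:
  assumes "(p, q) \<in> real_step X"
  shows "p \<in> real_pts X \<and> q \<in> real_pts X \<and> agree_up_to_sign (pt_sign p) (pt_sign q)"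
proof -
  obtain m n \<alpha> x t where p: "p = (n, x, simplex_push \<alpha> t)" and q: "q = (m, Act X n \<alpha> x, t)"
    and a: "\<alpha> \<in> simp_ops m n" and x: "x \<in> Simp X n" and t: "t \<in> standard_simplex m"
    using assms unfolding real_step_def by blast
  obtain s where s: "s = 1 \<or> s = -1" "\<And>i. i \<le> m \<Longrightarrow> sg m (Act X n \<alpha> x) i = s * sg n x (\<alpha> ! i)"
    using sg_act[OF a x] by blast
  have "agree_up_to_sign (pt_sign q) (pt_sign p)"
    unfolding agree_up_to_sign_def
    by (intro exI[of _ s] conjI s(1) ballI)
      (simp add: p q pt_sign_def sign_step_def step_index_push[OF a t] s(2) step_index_simplex(1)[OF t] del: atLeastLessThan_iff)
  moreover have "Act X n \<alpha> x \<in> Simp X m" using X a x unfolding simplicial_set_def by blast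
  ultimately show ?thesis
    using x t simplex_push_simplex(1)[OF a t] agree_sym[of "pt_sign q" "pt_sign p"]
    unfolding p q real_pts_def by blast
qed

lemma eq_agree:
  assumes "(p, q) \<in> real_eq X" and p: "p \<in> real_pts X"
  shows "q \<in> real_pts X \<and> agree_up_to_sign (pt_sign p) (pt_sign q)"
  using assms(1) unfolding real_eq_def
proof (induction rule: rtrancl_induct)
  case base
  then show ?case using p agree_refl by blast
next
  case (step q r)
  from step.hyps(2) have "r \<in> real_pts X \<and> agree_up_to_sign (pt_sign q) (pt_sign r)"
    using step_agree[of q r] step_agree[of r q] by (auto intro: agree_sym)
  with step.IH show ?case using agree_trans[of "pt_sign p" "pt_sign q" "pt_sign r"] by simp
qed

definition rep :: "(nat \<times> 'a \<times> (nat \<Rightarrow> real)) set \<Rightarrow> real \<Rightarrow> real" where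
  "rep C = pt_sign (SOME p. p \<in> C)"

lemma rep_agree:
  assumes p: "p \<in> real_pts X"
  shows "agree_up_to_sign (rep (real_eq X `` {p})) (pt_sign p)"
proof -
  have "p \<in> real_eq X `` {p}" by (simp add: real_eq_def)
  then have "(SOME q. q \<in> real_eq X `` {p}) \<in> real_eq X `` {p}" by (rule someI)
  then have "(p, SOME q. q \<in> real_eq X `` {p}) \<in> real_eq X" by (rule ImageE) simp
  from eq_agree[OF this p] show ?thesis unfolding rep_def by (rule agree_sym[OF conjunct2])
qed

lemma rep_sign_fun: "sign_fun (rep C)"
  unfolding rep_def by (rule pt_sign_sign_fun)

lemma openin_rep_near: "openin (realization X) {D \<in> topspace (realization X). near (rep D) (rep C)}"
  unfolding openin_realization real_open_def topspace_realization
proof (intro conjI allI ballI)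
  fix n x assume x: "x \<in> Simp X n"
  have "near (rep (real_eq X `` {(n, x, t)})) (rep C) \<longleftrightarrow> near (sign_step (sg n x) t) (rep C)"
    if "t \<in> standard_simplex n" for t
  proof -
    have "(n, x, t) \<in> real_pts X" using x that by (auto simp: real_pts_def)
    from rep_agree[OF this] have "agree_up_to_sign (rep (real_eq X `` {(n, x, t)})) (sign_step (sg n x) t)"
      unfolding pt_sign_def prod.case .
    from near_agree[OF this] near_agree[OF agree_sym[OF this]] show ?thesis by blast
  qed
  moreover have "real_eq X `` {(n, x, t)} \<in> real_pts X // real_eq X" if "t \<in> standard_simplex n" for t
    by (rule quotientI) (use x that in \<open>auto simp: real_pts_def\<close>)
  ultimately have "{t \<in> standard_simplex n. real_eq X `` {(n, x, t)} \<in> {D \<in> real_pts X // real_eq X. near (rep D) (rep C)}} =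
      {t \<in> standard_simplex n. near (sign_step (sg n x) t) (rep C)}" by auto
  then show "openin (subtopology (powertop_real UNIV) (standard_simplex n))
      {t \<in> standard_simplex n. real_eq X `` {(n, x, t)} \<in> {D \<in> real_pts X // real_eq X. near (rep D) (rep C)}}"
    using openin_near_sign_step[OF sg rep_sign_fun] by simp
qed auto

end

text \<open>Only the coordinate \<open>0\<close> of a point of the unit cube of dimension \<open>1\<close> can be nonzero.\<close>
definition edge_loop :: "'a sset \<Rightarrow> 'a \<Rightarrow> (nat \<Rightarrow> real) \<Rightarrow> (nat \<times> 'a \<times> (nat \<Rightarrow> real)) set" where
  "edge_loop X e s = real_eq X `` {(1, e, edge_pt (s 0))}"

lemma edge_loop_ends:
  assumes e: "e \<in> Simp X 1" and v: "Act X 1 [0] e = v" "Act X 1 [1] e = v"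
  shows "s 0 = 0 \<Longrightarrow> edge_loop X e s = real_eq X `` {(0, v, edge_pt 0)}"
    and "s 0 = 1 \<Longrightarrow> edge_loop X e s = real_eq X `` {(0, v, edge_pt 0)}"
proof -
  have st: "((1, e, simplex_push [j] (edge_pt 0)), (0, Act X 1 [j] e, edge_pt 0)) \<in> real_step X" if "j \<le> 1" for j
    unfolding real_step_def using e that edge_pt_simplex(2)
    by (intro CollectI exI[of _ 0] exI[of _ "Suc 0"] exI[of _ "[j]"] exI[of _ e] exI[of _ "edge_pt 0"])
      (auto simp: simp_ops_def)
  have pu: "simplex_push [j] (edge_pt 0) = edge_pt (real j)" if "j \<le> 1" for j
  proof
    fix k
    have "{i. i < length [j] \<and> [j] ! i = k} = (if k = j then {0} else {})" by auto
    then show "simplex_push [j] (edge_pt 0) k = edge_pt (real j) k"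
      using that by (auto simp: simplex_push_def edge_pt_def)
  qed
  show "s 0 = 0 \<Longrightarrow> edge_loop X e s = real_eq X `` {(0, v, edge_pt 0)}"
    using real_eq_step_class[OF st[of 0]] pu[of 0] v by (simp add: edge_loop_def)
  show "s 0 = 1 \<Longrightarrow> edge_loop X e s = real_eq X `` {(0, v, edge_pt 0)}"
    using real_eq_step_class[OF st[of 1]] pu[of 1] v by (simp add: edge_loop_def)
qed

lemma edge_loop_spheroid:
  assumes e: "e \<in> Simp X 1" and v: "Act X 1 [0] e = v" "Act X 1 [1] e = v"
  shows "edge_loop X e \<in> spheroid 1 (realization X) (real_eq X `` {(0, v, edge_pt 0)})"
proof -
  have im: "edge_pt (s 0) \<in> standard_simplex 1" if "s \<in> cube 1" for s
    using that by (intro edge_pt_simplex) (auto simp: cube_def)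
  have "continuous_map (cube_top 1) (subtopology (powertop_real UNIV) (standard_simplex 1)) (\<lambda>s. edge_pt (s 0))"
    unfolding continuous_map_in_subtopology
  proof
    show "continuous_map (cube_top 1) (powertop_real UNIV) (\<lambda>s. edge_pt (s 0))"
      unfolding continuous_map_componentwise_UNIV cube_top_def
    proof
      fix k
      show "continuous_map (subtopology (powertop_real UNIV) (cube 1)) euclideanreal (\<lambda>s. edge_pt (s 0) k)"
        unfolding edge_pt_def
        by (cases "k = 0"; cases "k = 1")
          (auto intro!: continuous_map_from_subtopology continuous_map_diff continuous_map_product_projection)
    qed
    show "(\<lambda>s. edge_pt (s 0)) \<in> topspace (cube_top 1) \<rightarrow> standard_simplex 1"
      using im by (auto simp: cube_top_def)
  qed
  note c = this
  have "continuous_map (cube_top 1) (realization X) (edge_loop X e)"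
    unfolding continuous_map_def
  proof (intro conjI allI impI)
    have "edge_loop X e s \<in> real_pts X // real_eq X" if "s \<in> cube 1" for s
      unfolding edge_loop_def by (rule quotientI) (use e im[OF that] in \<open>auto simp: real_pts_def\<close>)
    then show "edge_loop X e \<in> topspace (cube_top 1) \<rightarrow> topspace (realization X)"
      by (auto simp: topspace_realization cube_top_def)
    fix U assume "openin (realization X) U"
    then have "openin (subtopology (powertop_real UNIV) (standard_simplex 1))
        {t \<in> standard_simplex 1. real_eq X `` {(1, e, t)} \<in> U}"
      using e by (simp add: openin_realization real_open_def)
    from openin_continuous_map_preimage[OF c this]
    have "openin (cube_top 1) {s \<in> topspace (cube_top 1).
        edge_pt (s 0) \<in> {t \<in> standard_simplex 1. real_eq X `` {(1, e, t)} \<in> U}}" .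
    moreover have "{s \<in> topspace (cube_top 1).
        edge_pt (s 0) \<in> {t \<in> standard_simplex 1. real_eq X `` {(1, e, t)} \<in> U}} =
        {s \<in> topspace (cube_top 1). edge_loop X e s \<in> U}"
      using im by (auto simp: edge_loop_def cube_top_def)
    ultimately show "openin (cube_top 1) {s \<in> topspace (cube_top 1). edge_loop X e s \<in> U}" by simp
  qed
  moreover have "edge_loop X e ` cube_bd 1 \<subseteq> {real_eq X `` {(0, v, edge_pt 0)}}"
    using edge_loop_ends[OF e v] by (auto simp: cube_bd_def)
  ultimately show ?thesis by (simp add: spheroid_def)
qed

lemma prod_telescope_signs:
  fixes \<delta> :: "nat \<Rightarrow> real"
  assumes "\<And>i. \<delta> i = 1 \<or> \<delta> i = -1"
  shows "(\<Prod>i<N. \<delta> i * \<delta> (Suc i)) = \<delta> 0 * \<delta> N"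
proof (induction N)
  case 0
  show ?case using assms[of 0] by auto
next
  case (Suc N)
  then show ?case using assms[of N] by auto
qed

context sign_system
begin

text \<open>Choose representing functions for the points of the loop. Consecutive points of a fine
  subdivision have nearby step functions, so the relative signs multiply to the sign that compares
  the first with the last step function. These are constant, with values \<open>sg 1 e 0\<close>
  and \<open>sg 1 e 1\<close>, although they belong to the same point. This contradicts
  \<open>sign_monodromy_trivial\<close>.\<close>
theorem edge_loop_essential:
  assumes e: "e \<in> Simp X 1" and v: "Act X 1 [0] e = v" "Act X 1 [1] e = v" and ne: "sg 1 e 0 \<noteq> sg 1 e 1"
  shows "\<not> spheroid_homotopic 1 (realization X) (real_eq X `` {(0, v, edge_pt 0)})
    (edge_loop X e) (\<lambda>_. real_eq X `` {(0, v, edge_pt 0)})"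
proof
  let ?x = "real_eq X `` {(0, v, edge_pt 0)}"
  assume "spheroid_homotopic 1 (realization X) ?x (edge_loop X e) (\<lambda>_. ?x)"
  then have "\<exists>h. continuous_map (prod_topology (top_of_set {0..1::real}) (cube_top 1)) (realization X) h \<and>
      (\<forall>s. h (0, s) = edge_loop X e s) \<and> (\<forall>s. h (1, s) = ?x) \<and>
      (\<forall>t\<in>{0..1}. (\<lambda>s. h (t, s)) ` cube_bd 1 \<subseteq> {?x})"
    unfolding spheroid_homotopic_def homotopic_with_def .
  then obtain h where H: "continuous_map (prod_topology (top_of_set {0..1::real}) (cube_top 1)) (realization X) h \<and>
      (\<forall>s. h (0, s) = edge_loop X e s) \<and> (\<forall>s. h (1, s) = ?x) \<and>
      (\<forall>t\<in>{0..1}. (\<lambda>s. h (t, s)) ` cube_bd 1 \<subseteq> {?x})" ..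
  note h = H[THEN conjunct1] and h0 = H[THEN conjunct2, THEN conjunct1, rule_format]
    and h1 = H[THEN conjunct2, THEN conjunct2, THEN conjunct1, rule_format]
    and hb = H[THEN conjunct2, THEN conjunct2, THEN conjunct2, THEN bspec]
  define pt :: "real \<Rightarrow> nat \<Rightarrow> real" where "pt a = (\<lambda>i. if i = 0 then a else 0)" for a
  have pt: "pt a \<in> cube 1" if "a \<in> {0..1}" for a using that by (auto simp: pt_def cube_def)
  have pb: "pt 0 \<in> cube_bd 1" "pt 1 \<in> cube_bd 1" by (auto simp: pt_def cube_def cube_bd_def)
  let ?S = "{0..1::real} \<times> {0..1::real}"
  have c: "continuous_map (top_of_set ?S) (prod_topology (top_of_set {0..1}) (cube_top 1)) (\<lambda>w. (snd w, pt (fst w)))"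
  proof (intro continuous_map_pairedI)
    show "continuous_map (top_of_set ?S) (top_of_set {0..1}) snd"
      by (auto simp: continuous_map_in_subtopology intro!: continuous_intros)
    show "continuous_map (top_of_set ?S) (cube_top 1) (\<lambda>w. pt (fst w))"
      unfolding cube_top_def continuous_map_in_subtopology continuous_map_componentwise_UNIV
    proof
      show "\<forall>k. continuous_map (top_of_set ?S) euclideanreal (\<lambda>w. pt (fst w) k)"
      proof
        fix k show "continuous_map (top_of_set ?S) euclideanreal (\<lambda>w. pt (fst w) k)"
          unfolding pt_def by (cases "k = 0") (auto intro!: continuous_intros)
      qed
      show "(\<lambda>w. pt (fst w)) \<in> topspace (top_of_set ?S) \<rightarrow> cube 1" using pt by auto
    qed
  qed
  \<comment> \<open>The two factors are exchanged, so that the given loop lies on the bottom side of the square.\<close>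
  define k where "k = h \<circ> (\<lambda>w. (snd w, pt (fst w)))"
  have kk: "k (a, b) = h (b, pt a)" for a b by (simp add: k_def)
  have "\<exists>N>4. (\<Prod>i<N. relative_sign (rep (k (real i / real N, 0))) (rep (k (real (Suc i) / real N, 0)))) = 1"
  proof (rule sign_monodromy_trivial[OF _ rep_sign_fun openin_rep_near])
    show "continuous_map (top_of_set ?S) (realization X) k"
      unfolding k_def by (rule continuous_map_compose[OF c h])
    show "k (0, b) = ?x" "k (1, b) = ?x" if "b \<in> {0..1}" for b
      unfolding kk using hb[OF that] pb by blast+
    show "k (a, 1) = ?x" for a unfolding kk by (rule h1)
  qed
  then obtain N :: nat where N: "N > 4"
    and prod: "(\<Prod>i<N. relative_sign (rep (k (real i / real N, 0))) (rep (k (real (Suc i) / real N, 0)))) = 1"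
    by blast
  define g where "g i = pt_sign (1, e, edge_pt (real i / real N))" for i
  define R where "R i = rep (k (real i / real N, 0))" for i
  have ept: "edge_pt (real i / real N) \<in> standard_simplex 1" if "i \<le> N" for i
    using that N by (intro edge_pt_simplex) (auto simp: divide_le_eq_1)
  have Rc: "k (real i / real N, 0) = real_eq X `` {(1, e, edge_pt (real i / real N))}" for i
    by (simp add: kk h0 edge_loop_def pt_def)
  have "agree_up_to_sign (R i) (g i)" if "i \<le> N" for i
    unfolding R_def Rc g_def by (rule rep_agree) (use e ept[OF that] in \<open>auto simp: real_pts_def\<close>)
  then have "\<forall>i. \<exists>d. (d = 1 \<or> d = -1) \<and> (i \<le> N \<longrightarrow> (\<forall>u\<in>{0..<1}. R i u = d * g i u))"
    unfolding agree_up_to_sign_def by blast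
  then obtain \<delta> where d: "\<And>i. \<delta> i = 1 \<or> \<delta> i = (-1 :: real)"
    "\<And>i u. i \<le> N \<Longrightarrow> u \<in> {0..<1} \<Longrightarrow> R i u = \<delta> i * g i u" by metis
  have cm: "relative_sign (R i) (R (Suc i)) = \<delta> i * \<delta> (Suc i)" if i: "i < N" for i
  proof (rule relative_sign_common[OF _ _ _ d(1) d(1)])
    show "sign_fun (R i)" "sign_fun (R (Suc i))" "sign_fun (g i)"
      by (simp_all add: R_def g_def rep_sign_fun pt_sign_sign_fun)
    have "disagreement (R i) (\<lambda>u. \<delta> i * g i u) = disagreement (R i) (R i)" by (rule disagreement_cong) (use d i in auto)
    then show "disagreement (R i) (\<lambda>u. \<delta> i * g i u) < 1/4" by (simp add: disagreement_self)
    have "disagreement (R (Suc i)) (\<lambda>u. \<delta> (Suc i) * g i u) = disagreement (g (Suc i)) (g i)"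
      unfolding disagreement_def
      by (rule arg_cong[where f = "measure lborel"]) (use d(1)[of "Suc i"] d(2)[of "Suc i"] i in auto)
    also have "\<dots> \<le> (\<Sum>j\<le>1. \<bar>(\<Sum>l\<le>j. edge_pt (real (Suc i) / real N) l) - (\<Sum>l\<le>j. edge_pt (real i / real N) l)\<bar>)"
      unfolding g_def pt_sign_def prod.case by (intro disagreement_sign_step ept sg) (use i in auto)
    also have "\<dots> = 1 / real N" using N by (simp add: edge_pt_def field_simps)
    also have "\<dots> < 1/4" using N by (simp add: field_simps)
    finally show "disagreement (R (Suc i)) (\<lambda>u. \<delta> (Suc i) * g i u) < 1/4" .
  qed
  have "(\<Prod>i<N. \<delta> i * \<delta> (Suc i)) = 1"
    using prod cm unfolding R_def[symmetric] by simp
  then have "\<delta> 0 * \<delta> N = 1" using prod_telescope_signs[of \<delta> N] d(1) by simp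
  moreover have "R 0 = R N"
    using h0 edge_loop_ends[OF e v] N unfolding R_def kk by (simp add: pt_def)
  moreover have "g 0 0 = sg 1 e 0"
  proof -
    have "step_index (edge_pt 0) 0 = 0"
      by (rule step_index_eqI[OF edge_pt_simplex(2)]) (auto simp: edge_pt_def)
    then show ?thesis by (simp add: g_def pt_sign_def sign_step_def)
  qed
  moreover have "g N 0 = sg 1 e 1"
  proof -
    have "step_index (edge_pt 1) 0 = 1"
      by (rule step_index_eqI[of _ 1, OF edge_pt_simplex(1)]) (auto simp: edge_pt_def)
    then show ?thesis using N by (simp add: g_def pt_sign_def sign_step_def)
  qed
  ultimately show False
    using d(2)[of 0 0] d(2)[of N 0] d(1)[of 0] d(1)[of N] ne sg[of 1 e 0] sg[of 1 e 1] by auto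
qed

end

section \<open>Weak equivalences reflect null-homotopic edges\<close>
lemma real_map_class:
  assumes p: "(n, x, t) \<in> real_pts X"
    and F: "\<And>m n \<alpha> x. \<alpha> \<in> simp_ops m n \<Longrightarrow> x \<in> Simp X n \<Longrightarrow> F m (Act X n \<alpha> x) = Act Y n \<alpha> (F n x)"
    and FS: "\<And>n x. x \<in> Simp X n \<Longrightarrow> F n x \<in> Simp Y n"
  shows "real_map Y F (real_eq X `` {(n, x, t)}) = real_eq Y `` {(n, F n x, t)}"
proof -
  let ?F = "\<lambda>(n, x, t). (n, F n x, t)"
  have step: "(?F p, ?F q) \<in> real_step Y" if "(p, q) \<in> real_step X" for p q
  proof -
    obtain m n \<alpha> x t where p: "p = (n, x, simplex_push \<alpha> t)" and q: "q = (m, Act X n \<alpha> x, t)"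
      and a: "\<alpha> \<in> simp_ops m n" and x: "x \<in> Simp X n" and t: "t \<in> standard_simplex m"
      using \<open>(p, q) \<in> real_step X\<close> unfolding real_step_def by blast
    show ?thesis
      unfolding p q prod.case F[OF a x] real_step_def using a FS[OF x] t by blast
  qed
  have eq: "(?F p, ?F q) \<in> real_eq Y" if "(p, q) \<in> real_eq X" for p q
    using that unfolding real_eq_def
  proof (induction rule: rtrancl_induct)
    case (step q r)
    then have "(?F q, ?F r) \<in> real_step Y \<union> (real_step Y)\<inverse>" using \<open>\<And>p q. (p, q) \<in> real_step X \<Longrightarrow> _\<close> by blast
    with step.IH show ?case by (rule rtrancl_into_rtrancl)
  qed simp
  have "real_eq Y `` (?F ` (real_eq X `` {(n, x, t)})) = real_eq Y `` {?F (n, x, t)}"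
  proof (intro equalityI subsetI)
    fix r assume "r \<in> real_eq Y `` (?F ` (real_eq X `` {(n, x, t)}))"
    then obtain q where "((n, x, t), q) \<in> real_eq X" "(?F q, r) \<in> real_eq Y" by blast
    then show "r \<in> real_eq Y `` {?F (n, x, t)}" using real_eq_trans[OF eq] by blast
  next
    fix r assume "r \<in> real_eq Y `` {?F (n, x, t)}"
    moreover have "((n, x, t), (n, x, t)) \<in> real_eq X" by (simp add: real_eq_def)
    ultimately show "r \<in> real_eq Y `` (?F ` (real_eq X `` {(n, x, t)}))" by blast
  qed
  then show ?thesis by (simp add: real_map_def)
qed

lemma degenerate_edge_class:
  assumes y: "y \<in> Simp Y 0" and r: "r \<in> {0..1}"
  shows "real_eq Y `` {(1, Act Y 0 [0, 0] y, edge_pt r)} = real_eq Y `` {(0, y, edge_pt 0)}"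
proof -
  have "simplex_push [0, 0] (edge_pt r) = edge_pt 0"
  proof
    fix k :: nat
    have "{i. i < length [0, 0 :: nat] \<and> [0, 0] ! i = k} = (if k = 0 then {0, 1} else {})"
      by (auto simp: less_Suc_eq nth_Cons')
    then show "simplex_push [0, 0] (edge_pt r) k = edge_pt 0 k"
      by (simp add: simplex_push_def edge_pt_def)
  qed
  then have "((0, y, edge_pt 0), (1, Act Y 0 [0, 0] y, edge_pt r)) \<in> real_step Y"
    unfolding real_step_def using y edge_pt_simplex(1)[OF r]
    by (intro CollectI exI[of _ "1"] exI[of _ "0"] exI[of _ "[0, 0]"] exI[of _ y] exI[of _ "edge_pt r"])
      (auto simp: simp_ops_def)
  from real_eq_step_class[OF this] show ?thesis by simp
qed

text \<open>The image of the loop is constant, hence homotopic to the constant loop, and a weak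
  equivalence is injective on fundamental groups.\<close>
theorem weak_equivalence_degenerate_edge:
  assumes w: "sset_weak_equivalence X Y F"
    and F: "\<And>m n \<alpha> x. \<alpha> \<in> simp_ops m n \<Longrightarrow> x \<in> Simp X n \<Longrightarrow> F m (Act X n \<alpha> x) = Act Y n \<alpha> (F n x)"
    and FS: "\<And>n x. x \<in> Simp X n \<Longrightarrow> F n x \<in> Simp Y n"
    and e: "e \<in> Simp X 1" and v: "Act X 1 [0] e = v" "Act X 1 [1] e = v" "v \<in> Simp X 0"
    and deg: "F 1 e = Act Y 0 [0, 0] (F 0 v)"
  shows "spheroid_homotopic 1 (realization X) (real_eq X `` {(0, v, edge_pt 0)})
    (edge_loop X e) (\<lambda>_. real_eq X `` {(0, v, edge_pt 0)})"
proof -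
  let ?x = "real_eq X `` {(0, v, edge_pt 0)}" and ?y = "real_eq Y `` {(0, F 0 v, edge_pt 0)}"
  let ?F = "real_map Y F"
  have v0: "(0, v, edge_pt 0) \<in> real_pts X" using v(3) edge_pt_simplex(2) by (simp add: real_pts_def)
  then have xs: "?x \<in> topspace (realization X)" unfolding topspace_realization by (rule quotientI)
  have Fx: "?F ?x = ?y" by (rule real_map_class[OF v0 F FS])
  have "(0, F 0 v, edge_pt 0) \<in> real_pts Y" using FS[OF v(3)] edge_pt_simplex(2) by (simp add: real_pts_def)
  then have ys: "?y \<in> topspace (realization Y)" unfolding topspace_realization by (rule quotientI)
  have Ff: "(?F \<circ> edge_loop X e) s = ?y" if s: "s \<in> cube 1" for s
  proof -
    have r: "s 0 \<in> {0..1}" using s by (auto simp: cube_def)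
    have "(1, e, edge_pt (s 0)) \<in> real_pts X" using e edge_pt_simplex(1)[OF r] by (simp add: real_pts_def)
    from real_map_class[OF this F FS] show ?thesis
      by (simp only: o_apply edge_loop_def deg degenerate_edge_class[OF FS[OF v(3)] r])
  qed
  have g: "(\<lambda>_. ?x) \<in> spheroid 1 (realization X) ?x" using xs by (auto simp: spheroid_def)
  have "homotopic_with (\<lambda>h. h ` cube_bd 1 \<subseteq> {?y}) (cube_top 1) (realization Y) (?F \<circ> (\<lambda>_. ?x)) (?F \<circ> edge_loop X e)"
  proof (rule homotopic_with_equal)
    show "continuous_map (cube_top 1) (realization Y) (?F \<circ> (\<lambda>_. ?x))"
      unfolding comp_def Fx using ys by simp
    show "(?F \<circ> edge_loop X e) ` cube_bd 1 \<subseteq> {?y}" using Ff by (auto simp: cube_bd_def simp del: o_apply)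
    show "(?F \<circ> (\<lambda>_. ?x)) s = (?F \<circ> edge_loop X e) s" if "s \<in> topspace (cube_top 1)" for s
      using that Fx by (simp only: Ff cube_top_def topspace_subtopology Int_iff) simp
  qed (auto simp: Fx)
  then have "spheroid_homotopic 1 (realization Y) (?F ?x) (?F \<circ> edge_loop X e) (?F \<circ> (\<lambda>_. ?x))"
    unfolding spheroid_homotopic_def Fx by (rule homotopic_with_symD)
  then show ?thesis
    using w edge_loop_spheroid[OF e v(1,2)] g xs
    unfolding sset_weak_equivalence_def weak_homotopy_equivalence_def by blast
qed

section \<open>Lawvere theories of clones\<close>

text \<open>The bits are used as the field with two elements; the standard simplification rules would
  rewrite its addition and multiplication to logical operations.\<close>
declare add_bit_eq_xor [simp del] mult_bit_eq_and [simp del]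

lemma bit_add_self [simp]: "a + a = 0" "a + (a + b) = b" for a b :: bit
proof -
  show "a + a = 0" for a :: bit by (cases a) (simp_all add: add_bit_eq_xor)
  then show "a + (a + b) = b" by (simp add: add.assoc[symmetric])
qed

text \<open>An abstract clone: \<open>B n\<close> are the operations of arity \<open>n\<close>, \<open>sub t fs\<close> substitutes the operations
  \<open>fs\<close> for the variables of \<open>t\<close>. In the Lawvere theory of a clone a morphism \<open>n \<rightarrow> k\<close> is a list of \<open>k\<close>
  operations, so that pairing is concatenation of lists.\<close>
locale clone =
  fixes B :: "nat \<Rightarrow> 'a set" and sub :: "'a \<Rightarrow> 'a list \<Rightarrow> 'a" and var :: "nat \<Rightarrow> 'a"
  assumes var_mem: "i < n \<Longrightarrow> var i \<in> B n"
    and sub_mem: "t \<in> B m \<Longrightarrow> length fs = m \<Longrightarrow> set fs \<subseteq> B n \<Longrightarrow> sub t fs \<in> B n"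
    and sub_var: "i < length fs \<Longrightarrow> sub (var i) fs = fs ! i"
    and sub_id: "t \<in> B n \<Longrightarrow> sub t (map var [0..<n]) = t"
    and sub_sub: "t \<in> B k \<Longrightarrow> length gs = k \<Longrightarrow> set gs \<subseteq> B m \<Longrightarrow> length fs = m \<Longrightarrow> set fs \<subseteq> B n \<Longrightarrow>
      sub (sub t gs) fs = sub t (map (\<lambda>g. sub g fs) gs)"
begin

definition law :: "'a list law" where
  "law = \<lparr>Hom = (\<lambda>n k. {xs. length xs = k \<and> set xs \<subseteq> B n}),
     Comp = (\<lambda>_ _ _ g f. map (\<lambda>t. sub t f) g),
     Idn = (\<lambda>n. map var [0..<n]), Fin = (\<lambda>_ _ xs. map var xs)\<rparr>"

lemma law_sel:
  "xs \<in> Hom law n k \<longleftrightarrow> length xs = k \<and> set xs \<subseteq> B n"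
  "Comp law n m k g f = map (\<lambda>t. sub t f) g"
  "Idn law n = map var [0..<n]"
  "Fin law n k ys = map var ys"
  by (simp_all add: law_def)

lemma map_var:
  assumes "length f = m" "set ys \<subseteq> {..<m}"
  shows "map (\<lambda>t. sub t f) (map var ys) = map ((!) f) ys"
  using assms by (auto simp: sub_var subset_iff)

lemma pair_iff:
  assumes f: "f \<in> Hom law n k" and g: "g \<in> Hom law n l"
  shows "h \<in> Hom law n (k + l) \<and> Comp law n (k + l) k (prj1 law k l) h = f \<and>
      Comp law n (k + l) l (prj2 law k l) h = g \<longleftrightarrow> h = f @ g"
proof -
  have "map ((!) h) [0..<k] = take k h" "map ((!) h) [k..<k + l] = drop k h" if "length h = k + l"
    using that by (auto simp: nth_equalityI list_eq_iff_nth_eq)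
  then have "Comp law n (k + l) k (prj1 law k l) h = take k h"
    "Comp law n (k + l) l (prj2 law k l) h = drop k h" if "length h = k + l"
    using that map_var[of h "k + l" "[0..<k]"] map_var[of h "k + l" "[k..<k + l]"]
    unfolding law_sel by (simp_all add: subset_eq del: map_map)
  note c = this
  show ?thesis
  proof
    assume h: "h \<in> Hom law n (k + l) \<and> Comp law n (k + l) k (prj1 law k l) h = f \<and>
      Comp law n (k + l) l (prj2 law k l) h = g"
    then have "length h = k + l" by (simp add: law_sel(1))
    from c[OF this] h show "h = f @ g" by (metis append_take_drop_id)
  next
    assume h: "h = f @ g"
    then have "length h = k + l" using f g by (simp add: law_sel(1))
    from c[OF this] show "h \<in> Hom law n (k + l) \<and> Comp law n (k + l) k (prj1 law k l) h = f \<and>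
      Comp law n (k + l) l (prj2 law k l) h = g"
      using f g by (simp add: law_sel(1) h)
  qed
qed

lemma is_law: "is_law law"
proof -
  have "is_cat law"
    unfolding is_cat_def law_sel
  proof (intro conjI allI ballI)
    fix n m k l f g h
    show "length (map var [0..<n]) = n" by simp
    show "set (map var [0..<n]) \<subseteq> B n" by (auto simp: var_mem)
    assume f: "f \<in> Hom law n m" and g: "g \<in> Hom law m k"
    show "length (map (\<lambda>t. sub t f) g) = k" "set (map (\<lambda>t. sub t f) g) \<subseteq> B n"
      using f g by (auto simp: law_sel subset_iff sub_mem)
    assume "h \<in> Hom law k l"
    then show "map (\<lambda>t. sub t (map (\<lambda>t. sub t f) g)) h = map (\<lambda>t. sub t f) (map (\<lambda>t. sub t g) h)"
      using f g by (auto simp: law_sel subset_iff sub_sub[of _ k g m f n])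
  next
    fix n k f assume f: "f \<in> Hom law n k"
    show "map (\<lambda>t. sub t (map var [0..<n])) f = f"
      using f by (auto simp: law_sel subset_iff sub_id intro!: map_idI)
    show "map (\<lambda>t. sub t f) (map var [0..<k]) = f"
      using f map_var[of f k "[0..<k]"] unfolding law_sel
      by (auto simp: map_nth atLeast_upt simp del: map_map)
  qed
  moreover have "map var xs \<in> Hom law n k" if "xs \<in> fin_hom n k" for n k xs
    using that by (auto simp: law_sel fin_hom_def var_mem subset_iff)
  moreover have "map (\<lambda>t. sub t (map var xs)) (map var ys) = map var (fin_comp ys xs)"
    if "xs \<in> fin_hom n m" "ys \<in> fin_hom m k" for n m k xs ys
    using that map_var[of "map var xs" m ys] by (auto simp: fin_hom_def fin_comp_def subset_iff)
  moreover have "\<exists>!h. h \<in> Hom law n (k + l) \<and>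
     Comp law n (k + l) k (prj1 law k l) h = f \<and> Comp law n (k + l) l (prj2 law k l) h = g"
    if "f \<in> Hom law n k" "g \<in> Hom law n l" for n k l f g
    unfolding pair_iff[OF that] by simp
  moreover have "\<exists>!h. h \<in> Hom law n 0" for n by (auto simp: law_sel)
  ultimately show ?thesis
    unfolding is_law_def by (simp add: law_sel(2-4))
qed

lemma pairing: "f \<in> Hom law n k \<Longrightarrow> g \<in> Hom law n l \<Longrightarrow> pairing law n k l f g = f @ g"
  unfolding pairing_def pair_iff by simp

lemma Tens:
  assumes f: "f \<in> Hom law n k" and g: "g \<in> Hom law n' k'"
  shows "Tens (law_pro law) n k n' k' f g =
    map (\<lambda>t. sub t (map var [0..<n])) f @ map (\<lambda>t. sub t (map var [n..<n + n'])) g"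
proof -
  note C = cat_Comp[OF is_law_cat[OF is_law]]
  have "Tens (law_pro law) n k n' k' f g = pairing law (n + n') k k'
      (Comp law (n + n') n k f (prj1 law n n')) (Comp law (n + n') n' k' g (prj2 law n n'))"
    by (simp add: law_pro_Tens)
  also have "\<dots> = Comp law (n + n') n k f (prj1 law n n') @ Comp law (n + n') n' k' g (prj2 law n n')"
    by (intro pairing C f g law_Fin[OF is_law] fin_hom_prj)
  finally show ?thesis by (simp add: law_sel)
qed

end

text \<open>The clone of the free monoids on \<open>{..<n}\<close>, which is that of the theory of monoids.\<close>
definition words :: "nat \<Rightarrow> nat list set" where
  "words n = {w. set w \<subseteq> {..<n}}"

definition word_sub :: "nat list \<Rightarrow> nat list list \<Rightarrow> nat list" where
  "word_sub w ws = concat (map ((!) ws) w)"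

interpretation W: clone words word_sub "\<lambda>i. [i]"
proof
  fix i n m k :: nat and w :: "nat list" and us vs :: "nat list list"
  show "[i] \<in> words n" if "i < n" using that by (simp add: words_def)
  show "word_sub w us \<in> words n" if "w \<in> words m" "length us = m" "set us \<subseteq> words n"
  proof -
    have "set (us ! p) \<subseteq> {..<n}" if "p \<in> set w" for p
      using that \<open>w \<in> words m\<close> \<open>length us = m\<close> \<open>set us \<subseteq> words n\<close> nth_mem[of p us] unfolding words_def by blast
    then show ?thesis unfolding words_def word_sub_def by auto
  qed
  show "word_sub [i] us = us ! i" by (simp add: word_sub_def)
  show "word_sub w (map (\<lambda>i. [i]) [0..<n]) = w" if "w \<in> words n"
    using that by (induction w) (auto simp: words_def word_sub_def)
  show "word_sub (word_sub w us) vs = word_sub w (map (\<lambda>u. word_sub u vs) us)"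
    if "w \<in> words k" "length us = k"
    using that by (induction w) (auto simp: words_def word_sub_def)
qed

abbreviation "word_theory \<equiv> W.law"

section \<open>The simplicial theory of operations on a Picard groupoid\<close>

text \<open>Consider the groupoid with objects \<open>\<int>/2\<close>, all automorphism groups \<open>\<int>/2\<close> and no other
  morphisms. An \<open>n\<close>-ary functor on it that is additive on objects, and acts on
  automorphisms by the same formula, is given by \<open>\<phi>\<close>. A chain of natural
  isomorphisms from this functor to itself is determined by its partial composites, the families
  \<open>\<eta> i a\<close> of automorphisms indexed by the objects \<open>a\<close>. A pair \<open>(\<phi>, \<eta>)\<close> is such a
  functor with such a chain; the type is independent of the arity and the length \<open>d\<close> of the chain, so
  membership in \<open>sops d n\<close> requires independence of unused variables, and that \<open>\<eta>\<close> vanishes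
  beyond \<open>d\<close>.\<close>
type_synonym sop = "((nat \<Rightarrow> bit) \<Rightarrow> bit) \<times> (nat \<Rightarrow> (nat \<Rightarrow> bit) \<Rightarrow> bit)"

text \<open>The tuple of the values \<open>h f\<close> for \<open>f\<close> in \<open>fs\<close>, extended by zero.\<close>
definition args :: "('s \<Rightarrow> bit) \<Rightarrow> 's list \<Rightarrow> nat \<Rightarrow> bit" where
  "args h fs p = (if p < length fs then h (fs ! p) else 0)"

definition sops :: "nat \<Rightarrow> nat \<Rightarrow> sop set" where
  "sops d n = {(\<phi>, \<eta>).
     (\<forall>x y. \<phi> (\<lambda>p. x p + y p) = \<phi> x + \<phi> y) \<and>
     (\<forall>x y. (\<forall>p<n. x p = y p) \<longrightarrow> \<phi> x = \<phi> y \<and> (\<forall>i. \<eta> i x = \<eta> i y)) \<and>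
     (\<forall>i x. i = 0 \<or> d < i \<longrightarrow> \<eta> i x = 0)}"

text \<open>Horizontal composition of natural transformations: the transformation of the outer functor at the
  transformed objects, plus the outer functor applied to the inner transformations.\<close>
definition sop_sub :: "sop \<Rightarrow> sop list \<Rightarrow> sop" where
  "sop_sub t fs = (\<lambda>a. fst t (args (\<lambda>f. fst f a) fs),
     \<lambda>i a. snd t i (args (\<lambda>f. fst f a) fs) + fst t (args (\<lambda>f. snd f i a) fs))"

definition sop_var :: "nat \<Rightarrow> sop" where
  "sop_var p = (\<lambda>a. a p, \<lambda>i a. 0)"

lemma sopsD:
  assumes "t \<in> sops d n"
  shows "fst t (\<lambda>p. x p + y p) = fst t x + fst t y"
    and "(\<And>p. p < n \<Longrightarrow> x p = y p) \<Longrightarrow> fst t x = fst t y"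
    and "(\<And>p. p < n \<Longrightarrow> x p = y p) \<Longrightarrow> snd t i x = snd t i y"
    and "snd t 0 x = 0" and "d < i \<Longrightarrow> snd t i x = 0"
  using assms unfolding sops_def by (auto simp: case_prod_beta)

lemma sops_zero: "t \<in> sops d n \<Longrightarrow> fst t (\<lambda>p. 0) = 0"
  using sopsD(1)[of t d n "\<lambda>p. 0" "\<lambda>p. 0"] by simp

lemma sopsI:
  assumes "\<And>x y. fst t (\<lambda>p. x p + y p) = fst t x + fst t y"
    and "\<And>x y. (\<And>p. p < n \<Longrightarrow> x p = y p) \<Longrightarrow> fst t x = fst t y"
    and "\<And>x y i. (\<And>p. p < n \<Longrightarrow> x p = y p) \<Longrightarrow> snd t i x = snd t i y"
    and "\<And>x. snd t 0 x = 0" and "\<And>x i. d < i \<Longrightarrow> snd t i x = 0"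
  shows "t \<in> sops d n"
  unfolding sops_def case_prod_beta mem_Collect_eq
  by (intro conjI allI impI; (elim disjE)?; (simp only:)?; (rule assms)?; blast?)

lemma clone_sops: "clone (sops d) sop_sub sop_var"
proof
  fix i n m k :: nat and t :: sop and fs gs :: "sop list"
  show "sop_var i \<in> sops d n" if "i < n" using that by (intro sopsI) (auto simp: sop_var_def)
  show "sop_sub t fs \<in> sops d n" if t: "t \<in> sops d m" and m: "length fs = m" and fs: "set fs \<subseteq> sops d n"
  proof -
    have f: "fs ! p \<in> sops d n" if "p < m" for p using fs nth_mem[of p fs] m that by blast
    show ?thesis
    proof (rule sopsI)
      fix x y :: "nat \<Rightarrow> bit"
      have "args (\<lambda>f. fst f (\<lambda>p. x p + y p)) fs = (\<lambda>p. args (\<lambda>f. fst f x) fs p + args (\<lambda>f. fst f y) fs p)"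
        by (rule ext) (auto simp: args_def m sopsD(1)[OF f])
      then show "fst (sop_sub t fs) (\<lambda>p. x p + y p) = fst (sop_sub t fs) x + fst (sop_sub t fs) y"
        by (simp add: sop_sub_def sopsD(1)[OF t])
    next
      fix x y :: "nat \<Rightarrow> bit" and i assume xy: "\<And>p. p < n \<Longrightarrow> x p = y p"
      have "args (\<lambda>f. fst f x) fs = args (\<lambda>f. fst f y) fs" "args (\<lambda>f. snd f i x) fs = args (\<lambda>f. snd f i y) fs"
        by (rule ext; auto simp: args_def m intro!: sopsD(2,3)[OF f] xy)+
      then show "fst (sop_sub t fs) x = fst (sop_sub t fs) y" "snd (sop_sub t fs) i x = snd (sop_sub t fs) i y"
        by (simp_all add: sop_sub_def)
    next
      have z: "snd (sop_sub t fs) i x = 0" if "i = 0 \<or> d < i" for i x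
      proof -
        have "args (\<lambda>f. snd f i x) fs = (\<lambda>p. 0)"
          by (rule ext) (use that in \<open>auto simp: args_def m sopsD(4,5)[OF f]\<close>)
        then show ?thesis using that by (auto simp: sop_sub_def sops_zero[OF t] sopsD(4,5)[OF t])
      qed
      show "snd (sop_sub t fs) 0 x = 0" for x by (rule z) simp
      show "snd (sop_sub t fs) i x = 0" if "d < i" for i x by (rule z) (simp add: that)
    qed
  qed
  show "sop_sub (sop_var i) fs = fs ! i" if "i < length fs"
    using that by (simp add: sop_sub_def sop_var_def args_def)
  show "sop_sub t (map sop_var [0..<n]) = t" if t: "t \<in> sops d n"
  proof -
    have "fst t (args (\<lambda>f. fst f a) (map sop_var [0..<n])) = fst t a" for a
      by (rule sopsD(2)[OF t]) (simp add: args_def sop_var_def)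
    moreover have "snd t i (args (\<lambda>f. fst f a) (map sop_var [0..<n])) = snd t i a" for a i
      by (rule sopsD(3)[OF t]) (simp add: args_def sop_var_def)
    moreover have "args (\<lambda>f. snd f i a) (map sop_var [0..<n]) = (\<lambda>p. 0)" for a i
      by (rule ext) (simp add: args_def sop_var_def)
    ultimately show ?thesis by (simp add: sop_sub_def sops_zero[OF t])
  qed
  show "sop_sub (sop_sub t gs) fs = sop_sub t (map (\<lambda>g. sop_sub g fs) gs)"
    if t: "t \<in> sops d k" and gs: "length gs = k" "set gs \<subseteq> sops d m"
  proof -
    have 1: "args (\<lambda>f. fst f a) (map (\<lambda>g. sop_sub g fs) gs) = args (\<lambda>g. fst g (args (\<lambda>f. fst f a) fs)) gs" for a
      by (rule ext) (simp add: args_def sop_sub_def)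
    have 2: "args (\<lambda>f. snd f i a) (map (\<lambda>g. sop_sub g fs) gs) =
        (\<lambda>p. args (\<lambda>g. snd g i (args (\<lambda>f. fst f a) fs)) gs p + args (\<lambda>g. fst g (args (\<lambda>f. snd f i a) fs)) gs p)" for i a
      by (rule ext) (simp add: args_def sop_sub_def)
    show ?thesis
      by (simp add: sop_sub_def[of t] sop_sub_def[of "sop_sub t gs"] 1 2 sopsD(1)[OF t])
        (simp add: sop_sub_def add.assoc)
  qed
qed

interpretation S: clone "sops d" sop_sub sop_var for d
  by (rule clone_sops)

abbreviation "sop_theory d \<equiv> clone.law (sops d) sop_sub sop_var"

text \<open>The chain is restricted along \<open>\<alpha>\<close> and renormalized to start with the identity; subtraction is
  addition in \<open>\<int>/2\<close>.\<close>
definition sop_act :: "nat list \<Rightarrow> sop \<Rightarrow> sop" where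
  "sop_act \<alpha> t = (fst t, \<lambda>i a. if i < length \<alpha> then snd t (\<alpha> ! i) a + snd t (\<alpha> ! 0) a else 0)"

definition sop_slaw :: "sop list slaw" where
  "sop_slaw = \<lparr>Lev = (\<lambda>d. sop_theory d), LAct = (\<lambda>d \<alpha> n k. map (sop_act \<alpha>))\<rparr>"

lemma sop_slaw_sel: "Lev sop_slaw d = sop_theory d" "LAct sop_slaw d \<alpha> n k = map (sop_act \<alpha>)"
  by (simp_all add: sop_slaw_def)

lemma sop_act_mem:
  assumes a: "\<alpha> \<in> simp_ops m d" and t: "t \<in> sops d n"
  shows "sop_act \<alpha> t \<in> sops m n"
proof (rule sopsI)
  fix x y :: "nat \<Rightarrow> bit" and i
  show "fst (sop_act \<alpha> t) (\<lambda>p. x p + y p) = fst (sop_act \<alpha> t) x + fst (sop_act \<alpha> t) y"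
    by (simp add: sop_act_def sopsD(1)[OF t])
  show "fst (sop_act \<alpha> t) x = fst (sop_act \<alpha> t) y" if "\<And>p. p < n \<Longrightarrow> x p = y p"
    using sopsD(2)[OF t that] by (simp add: sop_act_def)
  show "snd (sop_act \<alpha> t) i x = snd (sop_act \<alpha> t) i y" if "\<And>p. p < n \<Longrightarrow> x p = y p"
    using sopsD(3)[OF t that] by (simp add: sop_act_def)
  show "snd (sop_act \<alpha> t) 0 x = 0" by (simp add: sop_act_def)
  show "snd (sop_act \<alpha> t) i x = 0" if "m < i" using that by (simp add: sop_act_def simp_ops_length[OF a])
qed

text \<open>Renormalization commutes with substitution because functors are additive on automorphisms.\<close>
lemma sop_act_sub:
  assumes t: "t \<in> sops d k"
  shows "sop_act \<alpha> (sop_sub t fs) = sop_sub (sop_act \<alpha> t) (map (sop_act \<alpha>) fs)"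
proof -
  have 1: "args (\<lambda>f. fst f a) (map (sop_act \<alpha>) fs) = args (\<lambda>f. fst f a) fs" for a
    by (rule ext) (simp add: args_def sop_act_def)
  have 2: "args (\<lambda>f. snd f i a) (map (sop_act \<alpha>) fs) =
      (if i < length \<alpha> then (\<lambda>p. args (\<lambda>f. snd f (\<alpha> ! i) a) fs p + args (\<lambda>f. snd f (\<alpha> ! 0) a) fs p) else (\<lambda>p. 0))" for i a
    by (rule ext) (simp add: args_def sop_act_def)
  show ?thesis
    by (simp add: sop_act_def[of \<alpha> t] sop_sub_def[of _ "map (sop_act \<alpha>) fs"] 1 2)
      (auto simp: sop_act_def sop_sub_def sopsD(1)[OF t] sops_zero[OF t] fun_eq_iff ac_simps)
qed

lemma is_slaw_sop: "is_slaw sop_slaw"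
proof (rule slawI; unfold sop_slaw_sel)
  show "is_law (sop_theory d)" for d by (rule S.is_law)
  fix m d \<alpha> assume a: "\<alpha> \<in> simp_ops m d"
  show "law_map (sop_theory d) (sop_theory m) (\<lambda>n k. map (sop_act \<alpha>))"
    unfolding law_map_def S.law_sel
  proof (intro conjI allI ballI)
    fix n k l f g xs
    assume "f \<in> Hom (sop_theory d) n k"
    then show "length (map (sop_act \<alpha>) f) = k" "set (map (sop_act \<alpha>) f) \<subseteq> sops m n"
      using sop_act_mem[OF a] by (auto simp: S.law_sel)
    assume "g \<in> Hom (sop_theory d) k l"
    then show "map (sop_act \<alpha>) (map (\<lambda>t. sop_sub t f) g) = map (\<lambda>t. sop_sub t (map (sop_act \<alpha>) f)) (map (sop_act \<alpha>) g)"
      by (auto simp: S.law_sel sop_act_sub[of _ d k] subset_iff simp del: split_paired_All)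
  next
    fix xs :: "nat list"
    show "map (sop_act \<alpha>) (map sop_var xs) = map sop_var xs"
      by (simp add: sop_act_def sop_var_def cong: if_cong)
  qed
  show "map (sop_act \<beta>) (map (sop_act \<alpha>) x) = map (sop_act (map ((!) \<alpha>) \<beta>)) x"
    if b: "\<beta> \<in> simp_ops l m" for l \<beta> and x :: "sop list"
  proof -
    have "\<beta> ! i < length \<alpha>" if "i < length \<beta>" for i
      using simp_ops_nth[OF b, of i] that simp_ops_length[OF a] simp_ops_length[OF b] by simp
    moreover have "0 < length \<beta>" "0 < length \<alpha>" by (simp_all add: simp_ops_length[OF a] simp_ops_length[OF b])
    ultimately show ?thesis
      by (auto simp: sop_act_def fun_eq_iff ac_simps)
  qed
next
  fix d n k x assume "x \<in> Hom (sop_theory d) n k"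
  moreover have "sop_act [0..<Suc d] t = t" if t: "t \<in> sops d n" for t
    by (rule prod_eqI) (use sopsD(4,5)[OF t] in \<open>auto simp: sop_act_def fun_eq_iff less_Suc_eq_le not_le simp del: upt_Suc\<close>)
  ultimately show "map (sop_act [0..<Suc d]) x = x" by (auto simp: S.law_sel subset_iff simp del: upt_Suc intro!: map_idI)
qed

section \<open>Strict models\<close>
lemma (in clone) pairing_single:
  "s \<in> B n \<Longrightarrow> t \<in> B n \<Longrightarrow> pairing law n (Suc 0) (Suc 0) [s] [t] = [s, t]"
  by (subst pairing) (auto simp: law_sel)

definition splus :: "sop \<Rightarrow> sop \<Rightarrow> sop" where
  "splus s t = (\<lambda>a. fst s a + fst t a, \<lambda>i a. snd s i a + snd t i a)"

definition szero :: sop where "szero = (\<lambda>a. 0, \<lambda>i a. 0)"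

lemma splus_laws: "splus (splus r s) t = splus r (splus s t)" "splus s t = splus t s"
  "splus szero s = s" "splus s szero = s" "splus s s = szero"
  by (simp_all add: splus_def szero_def add.assoc) (simp add: add.commute)

lemma splus_mem: "s \<in> sops d n \<Longrightarrow> t \<in> sops d n \<Longrightarrow> splus s t \<in> sops d n"
  by (rule sopsI) (auto simp: splus_def sopsD(1,4,5) dest: sopsD(2,3) intro: arg_cong2[where f = "(+)"] simp: ac_simps)

lemma szero_mem: "szero \<in> sops d n"
  by (rule sopsI) (auto simp: szero_def)

text \<open>The groupoid is a strict abelian group, in which inversion is the identity.\<close>
fun sop_op :: "opsym \<Rightarrow> sop" where
  "sop_op UnitOp = szero"
| "sop_op MultOp = splus (sop_var 0) (sop_var 1)"
| "sop_op InvOp = sop_var 0"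

lemma sop_op_sub:
  "sop_sub szero fs = szero"
  "sop_sub (splus (sop_var 0) (sop_var (Suc 0))) [s, t] = splus s t"
  "sop_sub (sop_var 0) [s] = s"
  by (simp_all add: sop_sub_def szero_def splus_def sop_var_def args_def)

text \<open>Therefore every theory presented by group operations and some of the axioms of abelian
  groups acts strictly.\<close>
lemma sop_model:
  assumes "\<And>n. G n \<subseteq> grp_sig n" "R \<subseteq> mon_eqs \<union> inv_eqs \<union> comm_eqs"
  shows "pres_model (sig_gens G) R (sop_theory d) (\<lambda>n k g. [sop_op g])"
  unfolding pres_model_def
proof (intro conjI allI ballI impI)
  fix n k g assume "g \<in> sig_gens G n k"
  then have "k = 1" "g \<in> grp_sig n" using assms(1) by (auto simp: sig_gens_def split: if_splits)
  then show "[sop_op g] \<in> Hom (sop_theory d) n k"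
    by (auto simp: S.law_sel grp_sig_def szero_mem intro!: splus_mem S.var_mem split: if_splits)
next
  fix n k e e' assume "(n, k, e, e') \<in> R"
  then have "(n, k, e, e') \<in> mon_eqs \<union> inv_eqs \<union> comm_eqs" using assms(2) by blast
  then show "expr_eval (sop_theory d) (\<lambda>n k g. [sop_op g]) e = expr_eval (sop_theory d) (\<lambda>n k g. [sop_op g]) e'"
    unfolding mon_eqs_def inv_eqs_def comm_eqs_def
    by (auto simp: S.law_sel S.pairing_single S.var_mem splus_mem szero_mem sop_op_sub splus_laws(1,3-5) splus_laws(2)[of "sop_var (Suc 0)" "sop_var 0"])
qed

definition sop_of :: "nat \<Rightarrow> nat \<Rightarrow> nat \<Rightarrow> opsym expr set \<Rightarrow> sop list" where
  "sop_of d = pres_lift (sop_theory d) (\<lambda>n k g. [sop_op g])"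

lemma sop_of_map:
  assumes "\<And>n. G n \<subseteq> grp_sig n" "R \<subseteq> mon_eqs \<union> inv_eqs \<union> comm_eqs"
  shows "law_map (Th G R) (sop_theory d) (sop_of d)"
    and "g \<in> sig_gens G n k \<Longrightarrow> sop_of d n k (pres_gen (sig_gens G) R n k g) = [sop_op g]"
  unfolding sop_of_def Th_def
  using pres_lift_map[OF S.is_law sop_model[of G R d, OF assms]] by blast+

text \<open>Terms of the language of monoids are read as words. The value at the inversion symbol, which is
  not in this language, is arbitrary.\<close>
fun word_op :: "opsym \<Rightarrow> nat list" where
  "word_op UnitOp = []"
| "word_op MultOp = [0, 1]"
| "word_op InvOp = []"

lemma word_op_sub: "word_sub [] us = []" "word_sub [0, Suc 0] [v, w] = v @ w"
  by (simp_all add: word_sub_def)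

lemma word_model:
  assumes "R \<subseteq> mon_eqs"
  shows "pres_model (sig_gens mon_sig) R word_theory (\<lambda>n k g. [word_op g])"
  unfolding pres_model_def
proof (intro conjI allI ballI impI)
  fix n k g assume "g \<in> sig_gens mon_sig n k"
  then show "[word_op g] \<in> Hom word_theory n k"
    by (auto simp: W.law_sel sig_gens_def mon_sig_def words_def split: if_splits)
next
  fix n k e e' assume "(n, k, e, e') \<in> R"
  then have "(n, k, e, e') \<in> mon_eqs" using assms by blast
  then show "expr_eval word_theory (\<lambda>n k g. [word_op g]) e = expr_eval word_theory (\<lambda>n k g. [word_op g]) e'"
    unfolding mon_eqs_def
    by (auto simp: W.law_sel W.pairing_single words_def word_op_sub)
qed

definition words_of :: "nat \<Rightarrow> nat \<Rightarrow> opsym expr set \<Rightarrow> nat list list" where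
  "words_of = pres_lift word_theory (\<lambda>n k g. [word_op g])"

lemma words_of_map:
  assumes "R \<subseteq> mon_eqs"
  shows "law_map (Th mon_sig R) word_theory words_of"
    and "g \<in> sig_gens mon_sig n k \<Longrightarrow> words_of n k (pres_gen (sig_gens mon_sig) R n k g) = [word_op g]"
  unfolding words_of_def Th_def
  using pres_lift_map[OF W.is_law word_model[OF assms]] by blast+

text \<open>A word depends only on the class of a term in the theory of monoids.\<close>
lemma words_of_Th_map:
  assumes x: "x \<in> Hom (Th mon_sig {}) n k"
  shows "words_of n k (Th_map mon_sig mon_eqs n k x) = words_of n k x"
proof (rule Th_map_unique[OF W.is_law _ words_of_map(1) _ x])
  have m: "law_map (Th mon_sig {}) (Th mon_sig mon_eqs) (Th_map mon_sig mon_eqs)"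
    by (rule Th_map_law(1)) auto
  show "law_map (Th mon_sig {}) word_theory (\<lambda>n k x. words_of n k (Th_map mon_sig mon_eqs n k x))"
    by (rule law_map_compose[OF m words_of_map(1)]) simp
  fix n k g assume g: "g \<in> sig_gens mon_sig n k"
  have "Th_map mon_sig mon_eqs n k (pres_gen (sig_gens mon_sig) {} n k g) = pres_gen (sig_gens mon_sig) mon_eqs n k g"
    by (rule Th_map_law(2)) (use g in auto)
  then show "words_of n k (Th_map mon_sig mon_eqs n k (pres_gen (sig_gens mon_sig) {} n k g)) =
      words_of n k (pres_gen (sig_gens mon_sig) {} n k g)"
    by (simp add: words_of_map(2) g)
qed simp

lemma sop_of_Th_map:
  assumes x: "x \<in> Hom (Th G R) n k" and G: "\<And>n. G n \<subseteq> G' n" and R: "R \<subseteq> R'"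
    and G': "\<And>n. G' n \<subseteq> grp_sig n" and R': "R' \<subseteq> mon_eqs \<union> inv_eqs \<union> comm_eqs"
  shows "sop_of d n k (Th_map G' R' n k x) = sop_of d n k x"
proof (rule Th_map_unique[OF S.is_law _ sop_of_map(1) _ x])
  have GG: "\<And>n. G n \<subseteq> grp_sig n" and RR: "R \<subseteq> mon_eqs \<union> inv_eqs \<union> comm_eqs" using G G' R R' by blast+
  have m: "law_map (Th G R) (Th G' R') (Th_map G' R')"
    by (rule Th_map_law(1)[OF G R])
  show "law_map (Th G R) (sop_theory d) (\<lambda>n k x. sop_of d n k (Th_map G' R' n k x))"
    by (rule law_map_compose[OF m sop_of_map(1)[OF G' R']])
  show "G n \<subseteq> grp_sig n" "R \<subseteq> mon_eqs \<union> inv_eqs \<union> comm_eqs" for n by (rule GG RR)+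
  fix n k g assume g: "g \<in> sig_gens G n k"
  have g': "g \<in> sig_gens G' n k" by (rule subsetD[OF sig_gens_mono[OF G] g])
  have "Th_map G' R' n k (pres_gen (sig_gens G) R n k g) = pres_gen (sig_gens G') R' n k g"
    by (rule Th_map_law(2)[OF G R g])
  then show "sop_of d n k (Th_map G' R' n k (pres_gen (sig_gens G) R n k g)) =
      sop_of d n k (pres_gen (sig_gens G) R n k g)"
    by (simp add: sop_of_map(2)[OF G' R' g'] sop_of_map(2)[OF GG RR g])
qed

section \<open>Counting inversions of words\<close>

text \<open>The value of the word \<open>w\<close> in \<open>\<int>/2\<close> when the letters are evaluated by \<open>a\<close>.\<close>
definition wsum :: "(nat \<Rightarrow> bit) \<Rightarrow> nat list \<Rightarrow> bit" where
  "wsum a w = sum_list (map a w)"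

lemma wsum_simps [simp]: "wsum a [] = 0" "wsum a (p # w) = a p + wsum a w" "wsum a (v @ w) = wsum a v + wsum a w"
  by (simp_all add: wsum_def)

lemma wsum_zero: "wsum (\<lambda>p. 0) w = 0"
  by (induction w) auto

lemma wsum_add: "wsum (\<lambda>p. x p + y p) w = wsum x w + wsum y w"
  by (induction w) (auto simp: ac_simps)

lemma wsum_cong: "(\<And>p. p \<in> set w \<Longrightarrow> x p = y p) \<Longrightarrow> wsum x w = wsum y w"
  by (simp add: wsum_def cong: map_cong)

definition word_sop :: "nat list \<Rightarrow> sop" where
  "word_sop w = (\<lambda>a. wsum a w, \<lambda>i a. 0)"

lemma word_sop_mem: "w \<in> words n \<Longrightarrow> word_sop w \<in> sops d n"
  by (rule sopsI) (auto simp: word_sop_def wsum_add words_def intro!: wsum_cong)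

lemma wsum_sub:
  assumes "w \<in> words (length ws)"
  shows "wsum a (word_sub w ws) = wsum (args (wsum a) ws) w"
  using assms by (induction w) (auto simp: word_sub_def words_def args_def)

lemma word_sop_sub:
  assumes "w \<in> words (length ws)"
  shows "word_sop (word_sub w ws) = sop_sub (word_sop w) (map word_sop ws)"
proof -
  have "args (\<lambda>f. fst f a) (map word_sop ws) = args (wsum a) ws" "args (\<lambda>f. snd f i a) (map word_sop ws) = (\<lambda>p. 0)" for a i
    by (rule ext; simp add: args_def word_sop_def)+
  then show ?thesis
    by (simp add: sop_sub_def) (simp add: word_sop_def wsum_sub[OF assms] wsum_zero)
qed

lemma word_sop_map: "law_map word_theory (sop_theory d) (\<lambda>n k. map word_sop)"
  unfolding law_map_def S.law_sel
proof (intro conjI allI ballI)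
  fix n m k f g
  assume f: "f \<in> Hom word_theory n m"
  then show "length (map word_sop f) = m" "set (map word_sop f) \<subseteq> sops d n"
    using word_sop_mem by (auto simp: W.law_sel)
  assume "g \<in> Hom word_theory m k"
  then show "map word_sop (Comp word_theory n m k g f) = map (\<lambda>t. sop_sub t (map word_sop f)) (map word_sop g)"
    using f by (auto simp: W.law_sel word_sop_sub subset_iff)
next
  fix n k and xs :: "nat list"
  show "map word_sop (Fin word_theory n k xs) = map sop_var xs"
    by (simp add: W.law_sel word_sop_def sop_var_def)
qed

text \<open>The strict action of a monoid term is the evaluation of its word.\<close>
lemma sop_of_words:
  assumes x: "x \<in> Hom (Fr mon_sig) n k"
  shows "sop_of d n k x = map word_sop (words_of n k x)"
proof (rule Th_map_unique[OF S.is_law sop_of_map(1) law_map_compose[OF words_of_map(1) word_sop_map] _ x[unfolded Fr_Th]])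
  show "mon_sig n \<subseteq> grp_sig n" for n by (rule mon_grp_sig)
  fix n k g assume g: "g \<in> sig_gens mon_sig n k"
  then have "g = UnitOp \<or> g = MultOp" by (auto simp: sig_gens_def mon_sig_def split: if_splits)
  then show "sop_of d n k (pres_gen (sig_gens mon_sig) {} n k g) =
      map word_sop (words_of n k (pres_gen (sig_gens mon_sig) {} n k g))"
    by (auto simp: sop_of_map(2)[OF mon_grp_sig _ g] words_of_map(2)[OF _ g] word_sop_def szero_def splus_def sop_var_def)
qed auto

text \<open>The sum of \<open>C p r\<close> over all pairs of positions in a word, \<open>p\<close> to the left of \<open>r\<close>. If \<open>C\<close> is symmetric,
  the order of the letters does not matter (\<open>pair_sum_mset\<close>).\<close>
fun pair_sum :: "(nat \<Rightarrow> nat \<Rightarrow> bit) \<Rightarrow> nat list \<Rightarrow> bit" where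
  "pair_sum C [] = 0"
| "pair_sum C (p # w) = wsum (C p) w + pair_sum C w"

lemma pair_sum_move: "(\<And>r. r \<in> set v \<Longrightarrow> C p r = C r p) \<Longrightarrow> pair_sum C (v @ p # w) = pair_sum C (p # v @ w)"
  by (induction v) (simp_all add: ac_simps)

lemma wsum_mset: "mset v = mset w \<Longrightarrow> wsum a v = wsum a w"
  unfolding wsum_def by (metis mset_map sum_mset_sum_list)

lemma pair_sum_mset:
  assumes "mset v = mset w" and "\<And>p r. p \<in> set v \<Longrightarrow> r \<in> set v \<Longrightarrow> C p r = C r p"
  shows "pair_sum C v = pair_sum C w"
  using assms
proof (induction v arbitrary: w)
  case (Cons p v)
  have "p \<in> set w" using Cons.prems(1) by (metis list.set_intros(1) set_mset_mset)
  then obtain w1 w2 where w: "w = w1 @ p # w2" by (auto simp: in_set_conv_decomp)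
  have m: "mset v = mset (w1 @ w2)" using Cons.prems(1) by (simp add: w)
  then have s: "set v = set (w1 @ w2)" by (metis set_mset_mset)
  have "pair_sum C w = pair_sum C (p # w1 @ w2)"
    unfolding w by (rule pair_sum_move) (use Cons.prems(2) s in auto)
  also have "\<dots> = pair_sum C (p # v)"
    using Cons.IH[OF m] Cons.prems(2) wsum_mset[OF m] by simp
  finally show ?case by simp
qed simp

text \<open>Exchanging the objects \<open>a p\<close> and \<open>a r\<close> costs the sign \<open>(-1)\<^bsup>a p a r\<^esup>\<close>, here written additively.
  So \<open>inversions a w\<close> is the sign of the symmetry that sorts the word \<open>w\<close>.\<close>
definition inversion_term :: "(nat \<Rightarrow> bit) \<Rightarrow> nat \<Rightarrow> nat \<Rightarrow> bit" where
  "inversion_term a p r = (if r < p then a p * a r else 0)"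

definition inversions :: "(nat \<Rightarrow> bit) \<Rightarrow> nat list \<Rightarrow> bit" where
  "inversions a w = pair_sum (inversion_term a) w"

definition inversions_between :: "(nat \<Rightarrow> bit) \<Rightarrow> nat list \<Rightarrow> nat list \<Rightarrow> bit" where
  "inversions_between a v w = wsum (\<lambda>p. wsum (inversion_term a p) w) v"

lemma inversions_append: "inversions a (v @ w) = inversions a v + inversions a w + inversions_between a v w"
  by (induction v) (auto simp: inversions_def inversions_between_def ac_simps)

lemma inversions_between_concat: "inversions_between a v (concat ws) = sum_list (map (inversions_between a v) ws)"
proof (induction ws)
  case Nil
  then show ?case by (simp add: inversions_between_def wsum_zero)
next
  case (Cons w ws)
  then show ?case by (simp add: inversions_between_def wsum_add)
qed

lemma inversions_concat:
  "inversions a (concat (map f v)) = wsum (\<lambda>r. inversions a (f r)) v + pair_sum (\<lambda>r s. inversions_between a (f r) (f s)) v"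
proof (induction v)
  case Nil
  then show ?case by (simp add: inversions_def)
next
  case (Cons r v)
  then show ?case by (simp add: inversions_append inversions_between_concat wsum_def o_def ac_simps)
qed

lemma inversions_between_mset: "mset v = mset v' \<Longrightarrow> mset w = mset w' \<Longrightarrow> inversions_between a v w = inversions_between a v' w'"
  unfolding inversions_between_def using wsum_mset[of w w'] wsum_mset[of v v'] by simp

lemma pair_sum_cong: "(\<And>p r. p \<in> set v \<Longrightarrow> r \<in> set v \<Longrightarrow> C p r = C' p r) \<Longrightarrow> pair_sum C v = pair_sum C' v"
  by (induction v) (auto intro!: arg_cong2[where f = "(+)"] wsum_cong)

lemma pair_sum_add: "pair_sum (\<lambda>p r. C p r + C' p r) v = pair_sum C v + pair_sum C' v"
  by (induction v) (auto simp: wsum_add ac_simps)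

lemma wsum_mult: "wsum (\<lambda>p. c * x p) w = c * wsum x w" "wsum (\<lambda>p. x p * c) w = wsum x w * c"
  by (induction w) (auto simp: distrib_left distrib_right)

lemma wsum_swap: "wsum (\<lambda>p. wsum (\<lambda>r. x p r) w) v = wsum (\<lambda>r. wsum (\<lambda>p. x p r) v) w"
  by (induction v) (auto simp: wsum_zero wsum_add)

text \<open>A pair of different letters is inverted in exactly one of the two orders.\<close>
lemma inversions_between_symm:
  assumes "set v \<inter> set w = {}"
  shows "inversions_between a v w + inversions_between a w v = wsum a v * wsum a w"
proof -
  have "inversions_between a v w + inversions_between a w v = wsum (\<lambda>p. wsum (\<lambda>r. inversion_term a p r + inversion_term a r p) w) v"
    by (simp add: inversions_between_def wsum_add wsum_swap[of _ v w])
  also have "\<dots> = wsum (\<lambda>p. wsum (\<lambda>r. a p * a r) w) v"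
    by (intro wsum_cong) (use assms in \<open>auto simp: inversion_term_def mult.commute dest: linorder_neqE_nat\<close>)
  also have "\<dots> = wsum a v * wsum a w" by (simp add: wsum_mult)
  finally show ?thesis .
qed

text \<open>Interchange law for the sign of a rearrangement. Let the blocks \<open>f r\<close> be rearranged internally to
  \<open>f' r\<close>, and let the word \<open>v\<close> of blocks be rearranged to \<open>v'\<close>. The sign of the total rearrangement is
  that of the rearrangement of blocks, where the block \<open>r\<close> counts as one letter with value
  \<open>wsum a (f r)\<close>, times the signs of the rearrangements inside the blocks. For the inversions between
  letters of different blocks, one has to compare the sums over pairs of blocks of \<open>?B\<close>, which
  counts the actual inversions of letters, and of \<open>?X\<close>, which counts a block as one letter. Since
  the blocks are disjoint, both have the same symmetrization; so \<open>?B + ?X\<close> is symmetric and its sum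
  over the pairs is the same for \<open>v\<close> and \<open>v'\<close>.\<close>
lemma inversions_concat_mset:
  assumes m: "mset v = mset v'" "\<And>r. r \<in> set v \<Longrightarrow> mset (f r) = mset (f' r)"
    and disj: "\<And>r s. r \<in> set v \<Longrightarrow> s \<in> set v \<Longrightarrow> r \<noteq> s \<Longrightarrow> set (f r) \<inter> set (f s) = {}"
  shows "inversions a (concat (map f v)) + inversions a (concat (map f' v')) =
    inversions (\<lambda>r. wsum a (f r)) v + inversions (\<lambda>r. wsum a (f r)) v' +
    wsum (\<lambda>r. inversions a (f r) + inversions a (f' r)) v"
proof -
  have s: "set v' = set v" using m(1) by (metis set_mset_mset)
  let ?B = "\<lambda>r s. inversions_between a (f r) (f s)" and ?X = "inversion_term (\<lambda>r. wsum a (f r))"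
  \<comment> \<open>The numbers of inversions between two blocks do not see the order inside the blocks.\<close>
  have B': "pair_sum (\<lambda>r s. inversions_between a (f' r) (f' s)) v' = pair_sum ?B v'"
    by (rule pair_sum_cong) (use s m(2) inversions_between_mset in metis)
  have i': "wsum (\<lambda>r. inversions a (f' r)) v' = wsum (\<lambda>r. inversions a (f' r)) v"
    using wsum_mset[OF m(1)] by simp
  have "pair_sum (\<lambda>r s. ?B r s + ?X r s) v = pair_sum (\<lambda>r s. ?B r s + ?X r s) v'"
  proof (rule pair_sum_mset[OF m(1)])
    fix r s assume rs: "r \<in> set v" "s \<in> set v"
    show "?B r s + ?X r s = ?B s r + ?X s r"
    proof (cases "r = s")
      case False
      have x: "?X r s + ?X s r = wsum a (f r) * wsum a (f s)"
        using False by (auto simp: inversion_term_def mult.commute)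
      have "(?B r s + ?X r s) + (?B s r + ?X s r) = (?B r s + ?B s r) + (?X r s + ?X s r)" by (simp only: ac_simps)
      also have "\<dots> = 0" unfolding x inversions_between_symm[OF disj[OF rs False]] by simp
      finally have z: "(?B r s + ?X r s) + (?B s r + ?X s r) = 0" .
      have "(?B r s + ?X r s) + ((?B r s + ?X r s) + (?B s r + ?X s r)) = ?B r s + ?X r s" unfolding z by simp
      then show ?thesis by (simp only: bit_add_self)
    qed simp
  qed
  then have e: "pair_sum ?B v + pair_sum ?X v = pair_sum ?B v' + pair_sum ?X v'" by (simp only: pair_sum_add)
  have e': "pair_sum ?B v + pair_sum ?B v' = pair_sum ?X v + pair_sum ?X v'"
  proof -
    have "pair_sum ?B v + pair_sum ?B v' = (pair_sum ?B v + pair_sum ?X v) + (pair_sum ?B v' + pair_sum ?X v)" by (simp add: ac_simps)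
    also have "\<dots> = (pair_sum ?B v' + pair_sum ?X v') + (pair_sum ?B v' + pair_sum ?X v)" by (simp only: e)
    also have "\<dots> = pair_sum ?X v + pair_sum ?X v'" by (simp add: ac_simps)
    finally show ?thesis .
  qed
  have "inversions a (concat (map f v)) + inversions a (concat (map f' v')) =
      (pair_sum ?B v + pair_sum ?B v') + wsum (\<lambda>r. inversions a (f r) + inversions a (f' r)) v"
    unfolding inversions_concat B' i' wsum_add by (simp add: ac_simps)
  then show ?thesis unfolding e' by (simp add: inversions_def)
qed

section \<open>Linearity of the control pro of commutative monoids\<close>

text \<open>No letter occurs twice, neither in one word nor in two.\<close>
definition linear_words :: "nat list list \<Rightarrow> bool" where
  "linear_words ws \<longleftrightarrow> (\<forall>i<length ws. distinct (ws ! i)) \<and>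
     (\<forall>i<length ws. \<forall>j<length ws. i \<noteq> j \<longrightarrow> set (ws ! i) \<inter> set (ws ! j) = {})"

lemma word_sub_set: "set (word_sub w ws) = (\<Union>p\<in>set w. set (ws ! p))"
  by (simp add: word_sub_def)

lemma linear_words_sub:
  assumes vs: "linear_words vs" and ws: "linear_words ws" and w: "set vs \<subseteq> words (length ws)"
  shows "linear_words (map (\<lambda>v. word_sub v ws) vs)"
proof -
  have vw: "vs ! i \<in> words (length ws)" if "i < length vs" for i using w that by auto
  have d: "distinct (word_sub v ws)" if "distinct v" "v \<in> words (length ws)" for v
    using that
  proof (induction v)
    case (Cons p v)
    then have "distinct (word_sub v ws)" "p < length ws" "\<And>q. q \<in> set v \<Longrightarrow> q < length ws"
      by (auto simp: words_def)
    moreover have "set (ws ! p) \<inter> set (word_sub v ws) = {}"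
      using ws Cons.prems(1) calculation(2,3) unfolding word_sub_set linear_words_def by fastforce
    ultimately show ?case using ws by (auto simp: word_sub_def linear_words_def)
  qed (simp add: word_sub_def)
  have "set (word_sub (vs ! i) ws) \<inter> set (word_sub (vs ! j) ws) = {}"
    if ij: "i < length vs" "j < length vs" "i \<noteq> j" for i j
  proof -
    have "p \<noteq> q" "p < length ws" "q < length ws" if "p \<in> set (vs ! i)" "q \<in> set (vs ! j)" for p q
      using vs ij that vw[of i] vw[of j] unfolding linear_words_def words_def by (blast, auto)
    then show ?thesis using ws unfolding word_sub_set linear_words_def by blast
  qed
  then show ?thesis using vs d vw unfolding linear_words_def by simp
qed

lemma linear_words_append:
  assumes "linear_words vs" "linear_words ws" "\<And>v w. v \<in> set vs \<Longrightarrow> w \<in> set ws \<Longrightarrow> set v \<inter> set w = {}"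
  shows "linear_words (vs @ ws)"
proof -
  have "set ((vs @ ws) ! i) \<inter> set ((vs @ ws) ! j) = {}" if ij: "i < length (vs @ ws)" "j < length (vs @ ws)" "i \<noteq> j" for i j
  proof -
    consider "i < length vs" "j < length vs" | "i < length vs" "\<not> j < length vs"
      | "\<not> i < length vs" "j < length vs" | "\<not> i < length vs" "\<not> j < length vs" by blast
    then show ?thesis
    proof cases
      case 1 then show ?thesis using assms(1) ij by (simp add: nth_append linear_words_def)
    next
      case 2
      then have "vs ! i \<in> set vs" "ws ! (j - length vs) \<in> set ws" using ij by auto
      from assms(3)[OF this] show ?thesis using 2 by (simp add: nth_append)
    next
      case 3
      then have "vs ! j \<in> set vs" "ws ! (i - length vs) \<in> set ws" using ij by auto
      from assms(3)[OF this] show ?thesis using 3 by (simp add: nth_append Int_commute)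
    next
      case 4
      then have "i - length vs < length ws" "j - length vs < length ws" "i - length vs \<noteq> j - length vs" using ij by auto
      then show ?thesis using assms(2) 4 by (simp add: nth_append linear_words_def)
    qed
  qed
  moreover have "distinct ((vs @ ws) ! i)" if "i < length (vs @ ws)" for i
    using assms(1,2) that by (auto simp: nth_append linear_words_def)
  ultimately show ?thesis by (simp add: linear_words_def)
qed

lemma word_sub_vars:
  assumes "w \<in> words n"
  shows "word_sub w (map (\<lambda>i. [i]) [m..<m + n]) = map ((+) m) w"
  using assms by (induction w) (auto simp: words_def word_sub_def)

lemma linear_vars: "distinct xs \<Longrightarrow> linear_words (map (\<lambda>i. [i]) xs)"
  by (auto simp: linear_words_def nth_eq_iff_index_eq)

abbreviation "perm_terms \<equiv> sub_Fr perms mon_sig"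

lemma perm_terms_Hom: "x \<in> Hom perm_terms n k \<Longrightarrow> x \<in> Hom (Fr mon_sig) n k"
  using pro_map_Hom[OF sub_Fr_pro(2)[OF perms_sub]] by (simp add: law_pro_sel)

lemmas words_of_Fr = words_of_map(1)[of "{}", folded Fr_Th, simplified]

lemma words_of_pro: "pro_map (law_pro (Fr mon_sig)) (law_pro word_theory) words_of"
  by (rule law_map_pro_map[OF words_of_Fr is_law_Fr W.is_law])

text \<open>Linearity holds for permutations and generating operations and is preserved by composition and
  tensor product. It fails for the diagonal, which is not in this pro.\<close>
lemma perm_terms_linear:
  assumes "x \<in> Hom perm_terms n k"
  shows "linear_words (words_of n k x)"
proof -
  have P: "is_pro (law_pro (Fr mon_sig))" by (rule is_pro_law_pro[OF is_law_Fr])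
  have mem: "x \<in> Hom (Fr mon_sig) n k" if "(n, k, x) \<in> gen_hom (law_pro (Fr mon_sig))
      (\<lambda>n k. Fin (Fr mon_sig) n k ` perms n k \<union> Fr_gen mon_sig n k ` sig_gens mon_sig n k)" for n k x
    using gen_hom_Hom[OF P sub_Fr_gens[of perms, OF perms_sub] that] by (simp add: law_pro_sel)
  have W: "words_of n k x \<in> Hom word_theory n k" if "(n, k, x) \<in> gen_hom (law_pro (Fr mon_sig))
      (\<lambda>n k. Fin (Fr mon_sig) n k ` perms n k \<union> Fr_gen mon_sig n k ` sig_gens mon_sig n k)" for n k x
    by (rule law_map_Hom[OF words_of_Fr mem[OF that]])
  have "(n, k, x) \<in> gen_hom (law_pro (Fr mon_sig))
      (\<lambda>n k. Fin (Fr mon_sig) n k ` perms n k \<union> Fr_gen mon_sig n k ` sig_gens mon_sig n k)"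
    using assms by (simp add: sub_Fr_def gen_subpro_sel)
  then show ?thesis
  proof induction
    case (1 x n k)
    then show ?case
    proof
      assume "x \<in> Fin (Fr mon_sig) n k ` perms n k"
      then obtain xs where xs: "x = Fin (Fr mon_sig) n k xs" "xs \<in> perms n k" by blast
      then have "words_of n k x = map (\<lambda>i. [i]) xs"
        using law_map_Fin[OF words_of_Fr, of xs n k] perms_sub by (auto simp: W.law_sel)
      then show ?thesis using xs(2) by (auto simp: perms_def intro!: linear_vars)
    next
      assume "x \<in> Fr_gen mon_sig n k ` sig_gens mon_sig n k"
      then obtain g where g: "x = Fr_gen mon_sig n k g" "g \<in> sig_gens mon_sig n k" by blast
      then have "words_of n k x = [word_op g]" by (simp add: Fr_Th words_of_map(2))
      moreover have "distinct (word_op g)" by (cases g) auto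
      ultimately show ?thesis by (simp add: linear_words_def)
    qed
  next
    case (2 n)
    have "words_of n n (Idn (law_pro (Fr mon_sig)) n) = map (\<lambda>i. [i]) [0..<n]"
      using pro_map_Id[OF words_of_pro, of n] by (simp add: law_pro_sel W.law_sel)
    then show ?case by (simp add: linear_vars)
  next
    case (3 m k g n f)
    have "words_of n k (Comp (law_pro (Fr mon_sig)) n m k g f) = Comp word_theory n m k (words_of m k g) (words_of n m f)"
      using law_map_Comp[OF words_of_Fr mem[OF "3.hyps"(2)] mem[OF "3.hyps"(1)]] by (simp add: law_pro_sel)
    then show ?case
      using W[OF "3.hyps"(1)] W[OF "3.hyps"(2)] "3.IH" by (simp add: W.law_sel linear_words_sub)
  next
    case (4 n k f n' k' g)
    have "words_of (n + n') (k + k') (Tens (law_pro (Fr mon_sig)) n k n' k' f g) =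
        Tens (law_pro word_theory) n k n' k' (words_of n k f) (words_of n' k' g)"
      using pro_map_Tens[OF words_of_pro] mem[OF "4.hyps"(1)] mem[OF "4.hyps"(2)] by (simp add: law_pro_sel)
    also have "\<dots> = words_of n k f @ map (map ((+) n)) (words_of n' k' g)"
      unfolding W.Tens[OF W[OF "4.hyps"(1)] W[OF "4.hyps"(2)]]
      using W[OF "4.hyps"(1)] W[OF "4.hyps"(2)] W.sub_id by (auto simp: W.law_sel subset_iff word_sub_vars intro!: map_idI)
    also have "linear_words \<dots>"
    proof (rule linear_words_append[OF "4.IH"(1)])
      show "linear_words (map (map ((+) n)) (words_of n' k' g))"
        using "4.IH"(2) by (force simp: linear_words_def distinct_map)
      show "set v \<inter> set w = {}" if "v \<in> set (words_of n k f)" "w \<in> set (map (map ((+) n)) (words_of n' k' g))" for v w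
        using that W[OF "4.hyps"(1)] by (fastforce simp: W.law_sel words_def)
    qed
    finally show ?case .
  qed
qed

section \<open>The symmetry as an action of the control pro\<close>
interpretation CM: ctrl_data \<Omega>_cm by (rule cm_data)

lemma cm_sel: "CSig \<Omega>_cm = mon_sig" "CPro \<Omega>_cm = perm_terms" "CLaw \<Omega>_cm = Th_cm" "cinc \<Omega>_cm n k x = x"
  "cst \<Omega>_cm = Th_map mon_sig (mon_eqs \<union> comm_eqs)"
  by (simp_all add: \<Omega>_cm_def)

lemma mset_eq_of_wsum:
  assumes "distinct v" "distinct w" "\<And>a. wsum a v = wsum a w"
  shows "mset v = mset w"
proof -
  have *: "wsum (\<lambda>q. if q = p then 1 else 0) u = (if p \<in> set u then 1 else 0)" if "distinct u" for p u
    using that by (induction u) auto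
  have "set v = set w"
  proof (rule Set.set_eqI)
    fix p
    from assms(3)[of "\<lambda>q. if q = p then 1 else 0"] show "p \<in> set v \<longleftrightarrow> p \<in> set w"
      unfolding *[OF assms(1)] *[OF assms(2)] by (simp split: if_splits)
  qed
  then show ?thesis using assms(1,2) set_eq_iff_mset_eq_distinct by blast
qed

text \<open>The vertices of a simplex of the control pro agree in the theory of commutative monoids, so their
  words are rearrangements of each other: they have the same value for every evaluation of the
  letters in \<open>\<int>/2\<close>, which for linear words determines the set of letters.\<close>
lemma cm_simplex:
  assumes "xs \<in> Hom (Lev (ctrl_spro \<Omega>_cm) d) n k"
  shows "length xs = Suc d"
    and "\<And>x. x \<in> set xs \<Longrightarrow> x \<in> Hom perm_terms n k"
    and "\<And>x. x \<in> set xs \<Longrightarrow> words_of n k x \<in> Hom word_theory n k"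
    and "\<And>x y j. x \<in> set xs \<Longrightarrow> y \<in> set xs \<Longrightarrow> j < k \<Longrightarrow>
      mset (words_of n k x ! j) = mset (words_of n k y ! j)"
proof -
  obtain c where c: "length xs = Suc d" "\<forall>i\<le>d. xs ! i \<in> Hom perm_terms n k" "\<forall>i\<le>d. CM.sg n k (xs ! i) = c"
    using assms unfolding CM.Q_Hom cm_sel by blast
  have set: "set xs = {xs ! i | i. i \<le> d}" using c(1) by (auto simp: set_conv_nth less_Suc_eq_le)
  show "length xs = Suc d" by (rule c(1))
  show H: "x \<in> Hom perm_terms n k" if "x \<in> set xs" for x using that c(2) set by auto
  show W: "words_of n k x \<in> Hom word_theory n k" if "x \<in> set xs" for x
    by (rule law_map_Hom[OF words_of_Fr perm_terms_Hom[OF H[OF that]]])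
  have sop: "sop_of d n k c = map word_sop (words_of n k x)" if "x \<in> set xs" for x
  proof -
    have "c = Th_map mon_sig (mon_eqs \<union> comm_eqs) n k x"
      using that c(3) set by (auto simp: CM.sg_def cm_sel)
    moreover have "sop_of d n k (Th_map mon_sig (mon_eqs \<union> comm_eqs) n k x) = sop_of d n k x"
      by (rule sop_of_Th_map[OF perm_terms_Hom[OF H[OF that], unfolded Fr_Th]]) (use mon_grp_sig in auto)
    ultimately show ?thesis using sop_of_words[OF perm_terms_Hom[OF H[OF that]]] by simp
  qed
  show "mset (words_of n k x ! j) = mset (words_of n k y ! j)" if "x \<in> set xs" "y \<in> set xs" "j < k" for x y j
  proof (rule mset_eq_of_wsum)
    have l: "length (words_of n k x) = k" "length (words_of n k y) = k"
      using W[OF that(1)] W[OF that(2)] by (auto simp: W.law_sel)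
    show "distinct (words_of n k x ! j)" "distinct (words_of n k y ! j)"
      using perm_terms_linear[OF H[OF that(1)]] perm_terms_linear[OF H[OF that(2)]] l that(3) by (auto simp: linear_words_def)
    fix a
    have "map word_sop (words_of n k x) ! j = map word_sop (words_of n k y) ! j"
      using sop[OF that(1)] sop[OF that(2)] by simp
    then show "wsum a (words_of n k x ! j) = wsum a (words_of n k y ! j)"
      using l that(3) by (simp add: word_sop_def fun_eq_iff)
  qed
qed

text \<open>The chain of coherence isomorphisms between several rearrangements \<open>us\<close> of a word: the
  isomorphism from the first to the \<open>i\<close>-th one is the difference of the signs that sort them.\<close>
definition braid :: "nat list list \<Rightarrow> sop" where
  "braid us = (\<lambda>a. wsum a (us ! 0),
     \<lambda>i a. if i < length us then inversions a (us ! i) + inversions a (us ! 0) else 0)"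

definition braiding :: "nat \<Rightarrow> nat \<Rightarrow> nat \<Rightarrow> opsym expr set list \<Rightarrow> sop list" where
  "braiding d n k xs = map (\<lambda>j. braid (map (\<lambda>x. words_of n k x ! j) xs)) [0..<k]"

lemma inversion_term_cong: "a p = b p \<Longrightarrow> a r = b r \<Longrightarrow> inversion_term a p r = inversion_term b p r"
  by (simp add: inversion_term_def)

lemma inversions_cong: "(\<And>p. p \<in> set w \<Longrightarrow> a p = b p) \<Longrightarrow> inversions a w = inversions b w"
  unfolding inversions_def by (intro pair_sum_cong inversion_term_cong)

lemma braid_mem:
  assumes "length us = Suc d" "set us \<subseteq> words n"
  shows "braid us \<in> sops d n"
proof (rule sopsI)
  have p: "p < n" if "p \<in> set (us ! i)" "i \<le> d" for p i
  proof -
    have "us ! i \<in> set us" using assms(1) that(2) by simp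
    then show ?thesis using assms(2) that(1) unfolding words_def by blast
  qed
  fix x y :: "nat \<Rightarrow> bit" and i
  show "fst (braid us) (\<lambda>p. x p + y p) = fst (braid us) x + fst (braid us) y"
    by (simp add: braid_def wsum_add)
  show "fst (braid us) x = fst (braid us) y" if "\<And>p. p < n \<Longrightarrow> x p = y p"
    using that p[of _ 0] by (auto simp: braid_def intro!: wsum_cong)
  show "snd (braid us) i x = snd (braid us) i y" if "\<And>p. p < n \<Longrightarrow> x p = y p"
    using that p assms(1) by (auto simp: braid_def less_Suc_eq_le intro!: arg_cong2[where f = "(+)"] inversions_cong)
  show "snd (braid us) 0 x = 0" by (simp add: braid_def)
  show "snd (braid us) i x = 0" if "d < i" using that assms(1) by (simp add: braid_def)
qed

lemma braid_replicate: "braid (replicate (Suc d) w) = word_sop w"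
  by (auto simp: braid_def word_sop_def fun_eq_iff simp del: replicate_Suc)

text \<open>This is the interchange law \<open>inversions_concat_mset\<close> for each pair of vertices \<open>0, i\<close>.\<close>
lemma braid_sub:
  assumes len: "length vs = Suc d" "length wss = Suc d"
    and vs: "\<And>i. i \<le> d \<Longrightarrow> vs ! i \<in> words m" "\<And>i. i \<le> d \<Longrightarrow> mset (vs ! i) = mset (vs ! 0)"
    and ws: "\<And>i. i \<le> d \<Longrightarrow> length (wss ! i) = m"
      "\<And>i r. i \<le> d \<Longrightarrow> r < m \<Longrightarrow> mset (wss ! i ! r) = mset (wss ! 0 ! r)"
    and lin: "linear_words (wss ! 0)"
  shows "braid (map2 word_sub vs wss) = sop_sub (braid vs) (map (\<lambda>r. braid (map (\<lambda>ws. ws ! r) wss)) [0..<m])"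
proof -
  let ?F = "map (\<lambda>r. braid (map (\<lambda>ws. ws ! r) wss)) [0..<m]"
  have lenF: "length ?F = m" by simp
  have len2: "length (map2 word_sub vs wss) = Suc d" using len by simp
  have F1: "args (\<lambda>f. fst f a) ?F = args (wsum a) (wss ! 0)" for a
    by (rule ext) (use ws(1)[of 0] len(2) in \<open>auto simp: args_def braid_def\<close>)
  have v0: "r < m" if "r \<in> set (vs ! 0)" for r using vs(1)[of 0] that by (auto simp: words_def)
  have fst_eq: "wsum a (map2 word_sub vs wss ! 0) = wsum (args (wsum a) (wss ! 0)) (vs ! 0)" for a
    using len vs(1)[of 0] ws(1)[of 0] by (simp add: wsum_sub)
  have snd_eq: "inversions a (map2 word_sub vs wss ! i) + inversions a (map2 word_sub vs wss ! 0) =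
      (inversions (args (wsum a) (wss ! 0)) (vs ! i) + inversions (args (wsum a) (wss ! 0)) (vs ! 0)) +
      wsum (args (\<lambda>f. snd f i a) ?F) (vs ! 0)" if i: "i \<le> d" for a i
  proof -
    let ?f = "(!) (wss ! 0)" and ?g = "(!) (wss ! i)"
    have vi: "r < m" if "r \<in> set (vs ! i)" for r using vs(1)[OF i] that by (auto simp: words_def)
    have nth: "map2 word_sub vs wss ! i = concat (map ?g (vs ! i))" "map2 word_sub vs wss ! 0 = concat (map ?f (vs ! 0))"
      using len i by (simp_all add: word_sub_def)
    have "inversions a (concat (map ?f (vs ! 0))) + inversions a (concat (map ?g (vs ! i))) =
        inversions (\<lambda>r. wsum a (?f r)) (vs ! 0) + inversions (\<lambda>r. wsum a (?f r)) (vs ! i) +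
        wsum (\<lambda>r. inversions a (?f r) + inversions a (?g r)) (vs ! 0)"
    proof (rule inversions_concat_mset)
      show "mset (vs ! 0) = mset (vs ! i)" using vs(2)[OF i] by simp
      show "mset (?f r) = mset (?g r)" if "r \<in> set (vs ! 0)" for r using ws(2)[OF i v0[OF that]] by simp
      show "set (?f r) \<inter> set (?f s) = {}" if "r \<in> set (vs ! 0)" "s \<in> set (vs ! 0)" "r \<noteq> s" for r s
        using lin v0[OF that(1)] v0[OF that(2)] that(3) ws(1)[of 0] by (auto simp: linear_words_def)
    qed
    moreover have "inversions (\<lambda>r. wsum a (?f r)) (vs ! j) = inversions (args (wsum a) (wss ! 0)) (vs ! j)" if "j = 0 \<or> j = i" for j
      by (rule inversions_cong) (use that v0 vi ws(1)[of 0] in \<open>auto simp: args_def\<close>)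
    moreover have "wsum (\<lambda>r. inversions a (?f r) + inversions a (?g r)) (vs ! 0) = wsum (args (\<lambda>f. snd f i a) ?F) (vs ! 0)"
      by (rule wsum_cong) (use v0 len(2) i in \<open>auto simp: args_def braid_def ac_simps\<close>)
    ultimately show ?thesis unfolding nth by (simp add: ac_simps)
  qed
  have out: "args (\<lambda>f. snd f i a) ?F = (\<lambda>p. 0)" if "\<not> i \<le> d" for i a
    by (rule ext) (use that len(2) in \<open>simp add: args_def braid_def\<close>)
  show ?thesis
  proof (rule prod_eqI)
    show "fst (braid (map2 word_sub vs wss)) = fst (sop_sub (braid vs) ?F)"
      unfolding sop_sub_def fst_conv F1 by (simp add: braid_def fst_eq)
    show "snd (braid (map2 word_sub vs wss)) = snd (sop_sub (braid vs) ?F)"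
    proof (intro ext)
      fix i a
      show "snd (braid (map2 word_sub vs wss)) i a = snd (sop_sub (braid vs) ?F) i a"
      proof (cases "i \<le> d")
        case True
        then show ?thesis
          using snd_eq[OF True, of a] unfolding sop_sub_def snd_conv F1
          by (simp add: braid_def[of vs] braid_def[of "map2 word_sub vs wss"] len less_Suc_eq_le del: map_map)
      next
        case False
        then show ?thesis
          unfolding sop_sub_def snd_conv out[OF False]
          by (simp add: braid_def len less_Suc_eq_le wsum_zero)
      qed
    qed
  qed
qed

text \<open>Renaming of letters by an order preserving map does not change the inversions.\<close>
lemma braid_shift:
  assumes "us \<noteq> []" "\<And>u. u \<in> set us \<Longrightarrow> u \<in> words n'"
  shows "braid (map (map ((+) n)) us) = sop_sub (braid us) (map sop_var [n..<n + n'])"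
proof -
  have 1: "args (\<lambda>f. fst f a) (map sop_var [n..<n + n']) = (\<lambda>p. if p < n' then a (n + p) else 0)" for a
    by (rule ext) (auto simp: args_def sop_var_def)
  have 2: "args (\<lambda>f. snd f i a) (map sop_var [n..<n + n']) = (\<lambda>p. 0)" for i a
    by (rule ext) (auto simp: args_def sop_var_def)
  have w: "wsum a (map ((+) n) u) = wsum (\<lambda>p. if p < n' then a (n + p) else 0) u" if "u \<in> set us" for a u
    using assms(2)[OF that] by (induction u) (auto simp: words_def)
  have "wsum (inversion_term a (n + p)) (map ((+) n) u) = wsum (inversion_term (\<lambda>p. a (n + p)) p) u" for a p u
    by (induction u) (auto simp: inversion_term_def)
  then have "inversions a (map ((+) n) u) = inversions (\<lambda>p. a (n + p)) u" for a u
    by (induction u) (auto simp: inversions_def)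
  moreover have "inversions (\<lambda>p. a (n + p)) u = inversions (\<lambda>p. if p < n' then a (n + p) else 0) u" if "u \<in> set us" for a u
    by (rule inversions_cong) (use assms(2)[OF that] in \<open>auto simp: words_def\<close>)
  ultimately have q: "inversions a (map ((+) n) u) = inversions (\<lambda>p. if p < n' then a (n + p) else 0) u" if "u \<in> set us" for a u
    using that by simp
  have u0: "us ! 0 \<in> set us" using assms(1) by simp
  show ?thesis
    unfolding sop_sub_def 1 2
    using assms(1) by (auto simp: braid_def fun_eq_iff w[OF u0] q[OF u0] q[OF nth_mem] wsum_zero)
qed

lemma braiding_Hom:
  assumes "xs \<in> Hom (Lev (ctrl_spro \<Omega>_cm) d) n k"
  shows "braiding d n k xs \<in> Hom (sop_theory d) n k"
proof -
  note c = cm_simplex[OF assms]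
  have "words_of n k x ! j \<in> words n" if "x \<in> set xs" "j < k" for x j
    using c(3)[OF that(1)] that(2) nth_mem[of j "words_of n k x"] by (auto simp: W.law_sel)
  then show ?thesis
    using c(1) by (auto simp: S.law_sel braiding_def intro!: braid_mem)
qed

lemma braiding_constant:
  assumes "\<And>x. x \<in> set xs \<Longrightarrow> words_of n k x = ws" "length xs = Suc d" "length ws = k"
  shows "braiding d n k xs = map word_sop ws"
proof -
  have "map (\<lambda>x. words_of n k x ! j) xs = replicate (Suc d) (ws ! j)" for j
    using assms(1,2) by (intro replicate_eqI) auto
  then have "braiding d n k xs = map (\<lambda>j. word_sop (ws ! j)) [0..<k]"
    unfolding braiding_def by (simp only: braid_replicate)
  also have "\<dots> = map word_sop ws" by (rule nth_equalityI) (simp_all add: assms(3))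
  finally show ?thesis .
qed

lemma braiding_map: "pro_map (Lev (ctrl_spro \<Omega>_cm) d) (law_pro (sop_theory d)) (braiding d)"
  unfolding pro_map_def law_pro_sel
proof (intro conjI allI ballI)
  note ops = CM.Q_ops[unfolded cm_sel]
  have cops: "Comp perm_terms = Comp (Fr mon_sig)" "Idn perm_terms = Idn (Fr mon_sig)" "Tens perm_terms = Tens (law_pro (Fr mon_sig))"
    by (simp_all add: sub_Fr_def gen_subpro_sel law_pro_sel)
  show "braiding d n k f \<in> Hom (sop_theory d) n k" if "f \<in> Hom (Lev (ctrl_spro \<Omega>_cm) d) n k" for n k f
    by (rule braiding_Hom[OF that])
  show "braiding d n n (Idn (Lev (ctrl_spro \<Omega>_cm) d) n) = Idn (sop_theory d) n" for n
  proof -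
    have "words_of n n (Idn (Fr mon_sig) n) = map (\<lambda>i. [i]) [0..<n]"
      using pro_map_Id[OF words_of_pro, of n] by (simp add: law_pro_sel W.law_sel)
    then have "braiding d n n (replicate (Suc d) (Idn (Fr mon_sig) n)) = map word_sop (map (\<lambda>i. [i]) [0..<n])"
      by (intro braiding_constant) auto
    then show ?thesis by (simp add: ops cops S.law_sel word_sop_def sop_var_def)
  qed
  show "braiding d n k (Comp (Lev (ctrl_spro \<Omega>_cm) d) n m k g f) = Comp (sop_theory d) n m k (braiding d m k g) (braiding d n m f)"
    if f: "f \<in> Hom (Lev (ctrl_spro \<Omega>_cm) d) n m" and g: "g \<in> Hom (Lev (ctrl_spro \<Omega>_cm) d) m k" for n m k f g
  proof -
    note cf = cm_simplex[OF f] and cg = cm_simplex[OF g]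
    have fi: "f ! i \<in> set f" "g ! i \<in> set g" if "i \<le> d" for i using that cf(1) cg(1) by simp_all
    have w: "words_of n k (Comp (Fr mon_sig) n m k (g ! i) (f ! i)) =
        map (\<lambda>v. word_sub v (words_of n m (f ! i))) (words_of m k (g ! i))" if "i \<le> d" for i
      using law_map_Comp[OF words_of_Fr perm_terms_Hom[OF cf(2)[OF fi(1)[OF that]]] perm_terms_Hom[OF cg(2)[OF fi(2)[OF that]]]]
      by (simp add: W.law_sel)
    have lw: "length (words_of n m (f ! i)) = m" "length (words_of m k (g ! i)) = k" if "i \<le> d" for i
      using cf(3)[OF fi(1)[OF that]] cg(3)[OF fi(2)[OF that]] by (simp_all add: W.law_sel)
    have "braid (map (\<lambda>x. words_of n k x ! j) (map2 (Comp (Fr mon_sig) n m k) g f)) =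
        sop_sub (braid (map (\<lambda>x. words_of m k x ! j) g)) (braiding d n m f)" if j: "j < k" for j
    proof -
      have "map (\<lambda>x. words_of n k x ! j) (map2 (Comp (Fr mon_sig) n m k) g f) =
          map2 word_sub (map (\<lambda>x. words_of m k x ! j) g) (map (words_of n m) f)"
        using cf(1) cg(1) j by (intro nth_equalityI) (simp_all add: less_Suc_eq_le w lw)
      moreover have "braid (map2 word_sub (map (\<lambda>x. words_of m k x ! j) g) (map (words_of n m) f)) =
          sop_sub (braid (map (\<lambda>x. words_of m k x ! j) g))
            (map (\<lambda>r. braid (map (\<lambda>ws. ws ! r) (map (words_of n m) f))) [0..<m])"
      proof (rule braid_sub)
        show "length (map (\<lambda>x. words_of m k x ! j) g) = Suc d" "length (map (words_of n m) f) = Suc d"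
          using cf(1) cg(1) by simp_all
        show "linear_words (map (words_of n m) f ! 0)"
          using perm_terms_linear[OF cf(2)[OF fi(1)[of 0]]] cf(1) by simp
        fix i assume i: "i \<le> d"
        show "map (\<lambda>x. words_of m k x ! j) g ! i \<in> words m"
          using cg(3)[OF fi(2)[OF i]] i cg(1) j nth_mem[of j "words_of m k (g ! i)"] by (auto simp: W.law_sel)
        show "mset (map (\<lambda>x. words_of m k x ! j) g ! i) = mset (map (\<lambda>x. words_of m k x ! j) g ! 0)"
          using cg(4)[OF fi(2)[OF i] fi(2)[of 0] j] i cg(1) by simp
        show "length (map (words_of n m) f ! i) = m" using lw(1)[OF i] i cf(1) by simp
        show "mset (map (words_of n m) f ! i ! r) = mset (map (words_of n m) f ! 0 ! r)" if "r < m" for r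
          using cf(4)[OF fi(1)[OF i] fi(1)[of 0] that] i cf(1) by simp
      qed
      ultimately show ?thesis by (simp add: braiding_def o_def)
    qed
    then show ?thesis by (simp add: ops cops S.law_sel braiding_def[of d n k] braiding_def[of d m k])
  qed
  show "braiding d (n + n') (k + k') (Tens (Lev (ctrl_spro \<Omega>_cm) d) n k n' k' f g) =
      Tens (law_pro (sop_theory d)) n k n' k' (braiding d n k f) (braiding d n' k' g)"
    if f: "f \<in> Hom (Lev (ctrl_spro \<Omega>_cm) d) n k" and g: "g \<in> Hom (Lev (ctrl_spro \<Omega>_cm) d) n' k'" for n k n' k' f g
  proof -
    note cf = cm_simplex[OF f] and cg = cm_simplex[OF g]
    have fi: "f ! i \<in> set f" "g ! i \<in> set g" if "i \<le> d" for i using that cf(1) cg(1) by simp_all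
    have w: "words_of (n + n') (k + k') (Tens perm_terms n k n' k' (f ! i) (g ! i)) =
        words_of n k (f ! i) @ map (map ((+) n)) (words_of n' k' (g ! i))" if "i \<le> d" for i
    proof -
      note wf = cf(3)[OF fi(1)[OF that]] and wg = cg(3)[OF fi(2)[OF that]]
      have "words_of (n + n') (k + k') (Tens perm_terms n k n' k' (f ! i) (g ! i)) =
          Tens (law_pro word_theory) n k n' k' (words_of n k (f ! i)) (words_of n' k' (g ! i))"
        using pro_map_Tens[OF words_of_pro] perm_terms_Hom[OF cf(2)[OF fi(1)[OF that]]] perm_terms_Hom[OF cg(2)[OF fi(2)[OF that]]]
        by (simp add: law_pro_sel cops)
      also have "\<dots> = words_of n k (f ! i) @ map (map ((+) n)) (words_of n' k' (g ! i))"
        unfolding W.Tens[OF wf wg]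
        using wf wg W.sub_id by (auto simp: W.law_sel subset_iff word_sub_vars intro!: map_idI)
      finally show ?thesis .
    qed
    have lw: "length (words_of n k (f ! i)) = k" "length (words_of n' k' (g ! i)) = k'" if "i \<le> d" for i
      using cf(3)[OF fi(1)[OF that]] cg(3)[OF fi(2)[OF that]] by (simp_all add: W.law_sel)
    have T: "Tens (law_pro (sop_theory d)) n k n' k' (braiding d n k f) (braiding d n' k' g) =
        braiding d n k f @ map (\<lambda>t. sop_sub t (map sop_var [n..<n + n'])) (braiding d n' k' g)"
      unfolding S.Tens[OF braiding_Hom[OF f] braiding_Hom[OF g]]
      using braiding_Hom[OF f] S.sub_id by (auto simp: S.law_sel subset_iff intro!: map_idI simp del: split_paired_All)
    show ?thesis
      unfolding T
    proof (rule nth_equalityI)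
      show "length (braiding d (n + n') (k + k') (Tens (Lev (ctrl_spro \<Omega>_cm) d) n k n' k' f g)) =
          length (braiding d n k f @ map (\<lambda>t. sop_sub t (map sop_var [n..<n + n'])) (braiding d n' k' g))"
        by (simp add: braiding_def)
      fix j assume "j < length (braiding d (n + n') (k + k') (Tens (Lev (ctrl_spro \<Omega>_cm) d) n k n' k' f g))"
      then have j: "j < k + k'" by (simp add: braiding_def)
      have L: "braiding d (n + n') (k + k') (Tens (Lev (ctrl_spro \<Omega>_cm) d) n k n' k' f g) ! j =
          braid (map (\<lambda>x. words_of (n + n') (k + k') x ! j) (map2 (Tens perm_terms n k n' k') f g))"
        using j by (simp add: braiding_def ops)
      show "braiding d (n + n') (k + k') (Tens (Lev (ctrl_spro \<Omega>_cm) d) n k n' k' f g) ! j =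
          (braiding d n k f @ map (\<lambda>t. sop_sub t (map sop_var [n..<n + n'])) (braiding d n' k' g)) ! j"
      proof (cases "j < k")
        case True
        have "map (\<lambda>x. words_of (n + n') (k + k') x ! j) (map2 (Tens perm_terms n k n' k') f g) =
            map (\<lambda>x. words_of n k x ! j) f"
          using cf(1) cg(1) True by (intro nth_equalityI) (simp_all add: less_Suc_eq_le w lw nth_append)
        then show ?thesis unfolding L using True by (simp add: braiding_def nth_append)
      next
        case False
        then have jk: "j - k < k'" using j by simp
        have "map (\<lambda>x. words_of (n + n') (k + k') x ! j) (map2 (Tens perm_terms n k n' k') f g) =
            map (map ((+) n)) (map (\<lambda>x. words_of n' k' x ! (j - k)) g)"
          using cf(1) cg(1) False jk by (intro nth_equalityI) (simp_all add: less_Suc_eq_le w lw nth_append)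
        moreover have "braid (map (map ((+) n)) (map (\<lambda>x. words_of n' k' x ! (j - k)) g)) =
            sop_sub (braid (map (\<lambda>x. words_of n' k' x ! (j - k)) g)) (map sop_var [n..<n + n'])"
        proof (rule braid_shift)
          show "map (\<lambda>x. words_of n' k' x ! (j - k)) g \<noteq> []" using cg(1) by auto
          show "u \<in> words n'" if "u \<in> set (map (\<lambda>x. words_of n' k' x ! (j - k)) g)" for u
            using that cg(3) jk by (force simp: W.law_sel)
        qed
        ultimately show ?thesis unfolding L using False jk by (simp add: braiding_def nth_append)
      qed
    qed
  qed
qed

lemma braiding_spro_map: "spro_map (ctrl_spro \<Omega>_cm) (slaw_pro sop_slaw) braiding"
  unfolding spro_map_def
proof (intro conjI allI ballI)
  show "pro_map (Lev (ctrl_spro \<Omega>_cm) d) (Lev (slaw_pro sop_slaw) d) (braiding d)" for d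
    by (simp add: slaw_pro_def sop_slaw_sel braiding_map)
  fix m d \<alpha> n k xs assume a: "\<alpha> \<in> simp_ops m d" and xs: "xs \<in> Hom (Lev (ctrl_spro \<Omega>_cm) d) n k"
  note c = cm_simplex[OF xs]
  have la: "length \<alpha> = Suc m" and ai: "\<And>i. i \<le> m \<Longrightarrow> \<alpha> ! i < length xs"
    using simp_ops_length[OF a] simp_ops_nth[OF a] c(1) by (auto simp: less_Suc_eq_le)
  have "braid (map (\<lambda>x. words_of n k x ! j) (map ((!) xs) \<alpha>)) = sop_act \<alpha> (braid (map (\<lambda>x. words_of n k x ! j) xs))"
    if j: "j < k" for j
  proof -
    have "wsum b (words_of n k (xs ! (\<alpha> ! 0)) ! j) = wsum b (words_of n k (xs ! 0) ! j)" for b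
      by (rule wsum_mset, rule c(4)[OF nth_mem nth_mem j]) (use ai[of 0] c(1) in auto)
    then show ?thesis
      using la ai c(1) by (auto simp: braid_def sop_act_def fun_eq_iff less_Suc_eq_le ac_simps)
  qed
  then show "braiding m n k (LAct (ctrl_spro \<Omega>_cm) d \<alpha> n k xs) = LAct (slaw_pro sop_slaw) d \<alpha> n k (braiding d n k xs)"
    by (simp add: CM.Q_ops slaw_pro_def sop_slaw_sel braiding_def)
qed

section \<open>The action of the Picard nerve realization\<close>
interpretation GR: ctrl_data \<Omega>_grp by (rule grp_data)
interpretation MG: ctrl_morphism \<Omega>_mon \<Omega>_grp "\<lambda>n g. g" "free_pro_lift (law_pro (Fr grp_sig)) (Fr_gen grp_sig)"
  "Th_map grp_sig (mon_eqs \<union> inv_eqs)" by (rule mon_grp)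
interpretation MC: ctrl_morphism \<Omega>_mon \<Omega>_cm "\<lambda>n g. g" "free_pro_lift (law_pro (Fr mon_sig)) (Fr_gen mon_sig)"
  "Th_map mon_sig (mon_eqs \<union> comm_eqs)" by (rule mon_cm)

lemma sop_of_disc:
  assumes "\<And>n. G n \<subseteq> grp_sig n" "R \<subseteq> mon_eqs \<union> inv_eqs \<union> comm_eqs"
  shows "slaw_map (disc (Th G R)) sop_slaw sop_of"
proof (rule slaw_mapI; unfold disc_sel sop_slaw_sel)
  show m: "law_map (Th G R) (sop_theory d) (sop_of d)" for d by (rule sop_of_map(1)[OF assms])
  fix m d \<alpha> n k x assume a: "\<alpha> \<in> simp_ops m d" and x: "x \<in> Hom (Th G R) n k"
  show "sop_of m n k x = map (sop_act \<alpha>) (sop_of d n k x)"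
  proof (rule Th_map_unique[OF S.is_law sop_of_map(1)[OF assms] _ _ x])
    show "law_map (Th G R) (sop_theory m) (\<lambda>n k x. map (sop_act \<alpha>) (sop_of d n k x))"
      by (rule law_map_compose[OF m slaw_LAct[OF is_slaw_sop a, unfolded sop_slaw_sel[abs_def]]])
    fix n k g assume g: "g \<in> sig_gens G n k"
    have "sop_act \<alpha> (sop_op g) = sop_op g"
      by (cases g) (simp_all add: sop_act_def szero_def splus_def sop_var_def cong: if_cong)
    then show "sop_of m n k (pres_gen (sig_gens G) R n k g) = map (sop_act \<alpha>) (sop_of d n k (pres_gen (sig_gens G) R n k g))"
      by (simp add: sop_of_map(2)[OF assms g])
  qed
qed

text \<open>\<open>NR \<Omega>_grp\<close> acts through the theory of groups, with all coherence isomorphisms identities.\<close>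
definition grp_sop where "grp_sop = (\<lambda>d n k x. sop_of d n k (NR_st \<Omega>_grp d n k x))"

definition cm_sop where "cm_sop = po_lift sop_slaw sop_of (\<lambda>d. pres_lift (Lev sop_slaw d) (braiding d))"

lemma grp_sop_map: "slaw_map (NR \<Omega>_grp) sop_slaw grp_sop"
  unfolding grp_sop_def
proof (rule slaw_map_compose[OF GR.NR_st_map])
  show "slaw_map (disc (CLaw \<Omega>_grp)) sop_slaw sop_of"
    by (simp add: \<Omega>_grp_def) (rule sop_of_disc; auto)
qed

lemmas braiding_lift = sfree_lift[OF CM.is_spro_Q is_slaw_sop braiding_spro_map]

lemma Fr_sop_disc: "slaw_map (disc (Fr mon_sig)) sop_slaw sop_of"
  unfolding Fr_Th by (rule sop_of_disc) (use mon_grp_sig in auto)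

lemma cm_sop_square:
  assumes x: "x \<in> Hom (Lev (disc (free_law (CPro \<Omega>_cm))) d) n k"
  shows "sop_of d n k (NR_left \<Omega>_cm d n k x) = pres_lift (Lev sop_slaw d) (braiding d) n k (NR_right \<Omega>_cm d n k x)"
proof (rule CM.free_law_unique[OF slaw_Lev[OF is_slaw_sop] _ _ _ x[unfolded disc_sel]])
  show "law_map (free_law (CPro \<Omega>_cm)) (Lev sop_slaw d) (\<lambda>n k x. sop_of d n k (NR_left \<Omega>_cm d n k x))"
    using slaw_map_law[OF slaw_map_compose[OF CM.NR_left_map[unfolded cm_sel] Fr_sop_disc], of d] by (simp add: disc_sel cm_sel)
  show "law_map (free_law (CPro \<Omega>_cm)) (Lev sop_slaw d) (\<lambda>n k x. pres_lift (Lev sop_slaw d) (braiding d) n k (NR_right \<Omega>_cm d n k x))"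
    using slaw_map_law[OF slaw_map_compose[OF CM.NR_right_map braiding_lift(1)], of d] by (simp add: disc_sel)
  fix n k f assume f: "f \<in> Hom (CPro \<Omega>_cm) n k"
  have f': "f \<in> Hom (Fr mon_sig) n k" by (rule perm_terms_Hom) (use f in \<open>simp add: cm_sel\<close>)
  have "length (words_of n k f) = k"
    using law_map_Hom[OF words_of_Fr f'] by (simp add: W.law_sel)
  then have "braiding d n k (replicate (Suc d) f) = sop_of d n k f"
    unfolding sop_of_words[OF f'] by (intro braiding_constant) auto
  then show "sop_of d n k (NR_left \<Omega>_cm d n k (free_unit (CPro \<Omega>_cm) n k f)) =
      pres_lift (Lev sop_slaw d) (braiding d) n k (NR_right \<Omega>_cm d n k (free_unit (CPro \<Omega>_cm) n k f))"
    unfolding CM.NR_left_unit[OF f] CM.NR_right_unit[OF f] braiding_lift(2)[OF pro_map_Hom[OF CM.vertex_map f]]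
    unfolding cm_sel by (rule sym)
qed

lemma cm_sop_map: "slaw_map (NR \<Omega>_cm) sop_slaw cm_sop"
  and cm_sop_in1: "x \<in> Hom (Fr mon_sig) n k \<Longrightarrow> cm_sop d n k (NR_in1 \<Omega>_cm d n k x) = sop_of d n k x"
  and cm_sop_free: "y \<in> Hom (Lev (sfree_law (ctrl_spro \<Omega>_cm)) d) n k \<Longrightarrow>
    cm_sop d n k (NR_in2 \<Omega>_cm d n k y) = pres_lift (Lev sop_slaw d) (braiding d) n k y"
proof -
  note l = po_lift_map[OF CM.NR_po is_slaw_sop Fr_sop_disc[folded cm_sel(1)] braiding_lift(1) cm_sop_square,
    folded cm_sop_def NR_def]
  show "slaw_map (NR \<Omega>_cm) sop_slaw cm_sop" by (rule l(1))
  show "cm_sop d n k (NR_in1 \<Omega>_cm d n k x) = sop_of d n k x" if "x \<in> Hom (Fr mon_sig) n k"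
    by (rule l(2)) (simp_all add: disc_sel cm_sel that)
  show "cm_sop d n k (NR_in2 \<Omega>_cm d n k y) = pres_lift (Lev sop_slaw d) (braiding d) n k y"
    if "y \<in> Hom (Lev (sfree_law (ctrl_spro \<Omega>_cm)) d) n k"
    by (rule l(3)) (simp_all add: that)
qed

lemma cm_sop_in2:
  assumes xs: "xs \<in> Hom (Lev (ctrl_spro \<Omega>_cm) d) n k"
  shows "cm_sop d n k (NR_in2 \<Omega>_cm d n k (sfree_unit (ctrl_spro \<Omega>_cm) d n k xs)) = braiding d n k xs"
proof -
  have u: "sfree_unit (ctrl_spro \<Omega>_cm) d n k xs \<in> Hom (Lev (sfree_law (ctrl_spro \<Omega>_cm)) d) n k"
    using pro_map_Hom[OF free_unit_map[OF CM.Q_pro] xs] by (simp add: sfree_unit_def sfree_Lev law_pro_sel)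
  show ?thesis unfolding cm_sop_free[OF u] by (rule braiding_lift(2)[OF xs])
qed

text \<open>On the coherence isomorphisms of monoids both actions are trivial: terms that agree in the theory
  of monoids have equal words, and nothing is inverted.\<close>
lemma mon_sop_square:
  assumes x: "x \<in> Hom (Lev (NR \<Omega>_mon) d) n k"
  shows "grp_sop d n k (pic_left d n k x) = cm_sop d n k (pic_right d n k x)"
proof -
  let ?l = "\<lambda>d n k x. grp_sop d n k (pic_left d n k x)"
  let ?r = "\<lambda>d n k x. cm_sop d n k (pic_right d n k x)"
  have l: "slaw_map (NR \<Omega>_mon) sop_slaw ?l" by (rule slaw_map_compose[OF pic_po(4) grp_sop_map])
  have r: "slaw_map (NR \<Omega>_mon) sop_slaw ?r" by (rule slaw_map_compose[OF pic_po(5) cm_sop_map])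
  have sig: "CSig \<Omega>_mon = mon_sig" "CSig \<Omega>_grp = grp_sig" "CSig \<Omega>_cm = mon_sig"
    by (simp_all add: \<Omega>_mon_def \<Omega>_grp_def \<Omega>_cm_def)
  have grp: "sop_of d n k (cst \<Omega>_grp n k (Fr_map grp_sig (\<lambda>n g. g) n k y)) = sop_of d n k y"
    and cm: "sop_of d n k (Fr_map mon_sig (\<lambda>n g. g) n k y) = sop_of d n k y"
    if y: "y \<in> Hom (Fr mon_sig) n k" for d n k y
  proof -
    have y': "Fr_map grp_sig (\<lambda>n g. g) n k y \<in> Hom (Th grp_sig {}) n k"
      using law_map_Hom[OF Fr_map_law(1)[OF MG.sig] y[folded sig(1)]] by (simp add: sig Fr_Th)
    have "sop_of d n k (cst \<Omega>_grp n k (Fr_map grp_sig (\<lambda>n g. g) n k y)) = sop_of d n k (Fr_map grp_sig (\<lambda>n g. g) n k y)"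
      unfolding \<Omega>_grp_def ctrl.simps by (rule sop_of_Th_map[OF y']) auto
    also have "\<dots> = sop_of d n k y"
      unfolding Fr_map_eq_Th_map by (rule sop_of_Th_map[OF y[unfolded Fr_Th]]) (use mon_grp_sig in auto)
    finally show "sop_of d n k (cst \<Omega>_grp n k (Fr_map grp_sig (\<lambda>n g. g) n k y)) = sop_of d n k y" .
    show "sop_of d n k (Fr_map mon_sig (\<lambda>n g. g) n k y) = sop_of d n k y"
      unfolding Fr_map_eq_Th_map by (rule sop_of_Th_map[OF y[unfolded Fr_Th]]) (use mon_grp_sig in auto)
  qed
  have 1: "?l d n k (NR_in1 \<Omega>_mon d n k y) = ?r d n k (NR_in1 \<Omega>_mon d n k y)"
    if "y \<in> Hom (Lev (disc (Fr (CSig \<Omega>_mon))) d) n k" for d n k y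
  proof -
    have y: "y \<in> Hom (Fr (CSig \<Omega>_mon)) n k" using that by (simp add: disc_sel)
    have yg: "Fr_map grp_sig (\<lambda>n g. g) n k y \<in> Hom (Fr (CSig \<Omega>_grp)) n k"
      using law_map_Hom[OF Fr_map_law(1)[OF MG.sig] y] by (simp add: sig)
    have yc: "Fr_map mon_sig (\<lambda>n g. g) n k y \<in> Hom (Fr mon_sig) n k"
      using law_map_Hom[OF Fr_map_law(1)[OF MC.sig] y] by (simp add: sig)
    show ?thesis
      unfolding pic_left_def pic_right_def MG.NR_map_in1[OF y] MC.NR_map_in1[OF y] grp_sop_def
      unfolding sig GR.NR_st_in1[OF yg, unfolded sig] cm_sop_in1[OF yc, unfolded sig]
      using grp cm y by (simp add: sig)
  qed
  have 2: "?l d n k (NR_in2 \<Omega>_mon d n k y) = ?r d n k (NR_in2 \<Omega>_mon d n k y)"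
    if y: "y \<in> Hom (Lev (sfree_law (ctrl_spro \<Omega>_mon)) d) n k" for d n k y
  proof (rule sfree_unique[OF is_slaw_sop slaw_map_compose[OF MG.A.NR_in_map(2) l]
        slaw_map_compose[OF MG.A.NR_in_map(2) r] _ y])
    fix d n k xs assume xs: "xs \<in> Hom (Lev (ctrl_spro \<Omega>_mon) d) n k"
    have ne: "xs \<noteq> []" and len: "length xs = Suc d" and mem: "\<And>x. x \<in> set xs \<Longrightarrow> x \<in> Hom (CPro \<Omega>_mon) n k"
      and sgc: "\<exists>c. \<forall>x\<in>set xs. MG.A.sg n k x = c"
      using xs unfolding MG.A.Q_Hom by (auto simp: set_conv_nth less_Suc_eq_le)
    have hd: "hd xs \<in> Hom (CPro \<Omega>_mon) n k" using mem ne by simp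
    have u: "sfree_unit (ctrl_spro \<Omega>_mon) d n k xs \<in> Hom (Lev (sfree_law (ctrl_spro \<Omega>_mon)) d) n k"
      using pro_map_Hom[OF free_unit_map[OF MG.A.Q_pro] xs] by (simp add: sfree_unit_def sfree_Lev law_pro_sel)
    let ?pg = "free_pro_lift (law_pro (Fr grp_sig)) (Fr_gen grp_sig) n k"
    let ?pc = "free_pro_lift (law_pro (Fr mon_sig)) (Fr_gen mon_sig) n k"
    have mg: "map ?pg xs \<in> Hom (Lev (ctrl_spro \<Omega>_grp) d) n k"
      using MG.Q_p xs unfolding spro_map_def pro_map_def by blast
    have mc: "map ?pc xs \<in> Hom (Lev (ctrl_spro \<Omega>_cm) d) n k"
      using MC.Q_p xs unfolding spro_map_def pro_map_def by blast
    have ug: "sfree_unit (ctrl_spro \<Omega>_grp) d n k (map ?pg xs) \<in> Hom (Lev (sfree_law (ctrl_spro \<Omega>_grp)) d) n k"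
      using pro_map_Hom[OF free_unit_map[OF GR.Q_pro] mg] by (simp add: sfree_unit_def sfree_Lev law_pro_sel)
    have c: "cinc \<Omega>_mon n k x \<in> Hom (Fr mon_sig) n k" if "x \<in> set xs" for x
      using pro_map_Hom[OF MG.A.i mem[OF that]] by (simp add: law_pro_sel sig)
    have pc: "?pc x = cinc \<Omega>_mon n k x" for x by (simp add: \<Omega>_mon_def)
    have "words_of n k (?pc x) = words_of n k (cinc \<Omega>_mon n k (hd xs))" if x: "x \<in> set xs" for x
    proof -
      have st: "cst \<Omega>_mon = Th_map mon_sig mon_eqs" by (simp add: \<Omega>_mon_def)
      have e: "Th_map mon_sig mon_eqs n k (cinc \<Omega>_mon n k x) = Th_map mon_sig mon_eqs n k (cinc \<Omega>_mon n k (hd xs))"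
        using sgc x hd_in_set[OF ne] unfolding MG.A.sg_def st by metis
      show ?thesis
        using words_of_Th_map[OF c[OF x, unfolded Fr_Th]] words_of_Th_map[OF c[OF hd_in_set[OF ne], unfolded Fr_Th]]
        unfolding pc e by simp
    qed
    moreover have "length (words_of n k (cinc \<Omega>_mon n k (hd xs))) = k"
      using law_map_Hom[OF words_of_Fr c[OF hd_in_set[OF ne]]] by (simp add: W.law_sel)
    ultimately have "braiding d n k (map ?pc xs) = sop_of d n k (cinc \<Omega>_mon n k (hd xs))"
      unfolding sop_of_words[OF c[OF hd_in_set[OF ne]]] by (intro braiding_constant) (auto simp: len)
    then show "?l d n k (NR_in2 \<Omega>_mon d n k (sfree_unit (ctrl_spro \<Omega>_mon) d n k xs)) =
        ?r d n k (NR_in2 \<Omega>_mon d n k (sfree_unit (ctrl_spro \<Omega>_mon) d n k xs))"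
      unfolding pic_left_def pic_right_def MG.NR_map_in2[OF u] MC.NR_map_in2[OF u]
        MG.free_Q_p_unit[OF xs] MC.free_Q_p_unit[OF xs] cm_sop_in2[OF mc] grp_sop_def GR.NR_st_in2[OF ug]
        GR.st_Q_unit[OF mg] hd_map[OF ne] MG.sq1[OF hd, symmetric]
      using grp[OF c[OF hd_in_set[OF ne]]] by (simp add: sig)
  qed
  show ?thesis
    by (rule po_unique[OF MG.A.NR_po is_slaw_sop l[unfolded NR_def[of \<Omega>_mon]]
          r[unfolded NR_def[of \<Omega>_mon]] 1 2 x[unfolded NR_def]])
qed

definition pic_sop where "pic_sop = po_lift sop_slaw grp_sop cm_sop"

lemma pic_sop_map: "slaw_map NR_pic sop_slaw pic_sop"
  and pic_sop_in2: "y \<in> Hom (Lev (NR \<Omega>_cm) d) n k \<Longrightarrow>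
    pic_sop d n k (po_in2 (NR \<Omega>_mon) (NR \<Omega>_grp) (NR \<Omega>_cm) pic_left pic_right d n k y) = cm_sop d n k y"
proof -
  note l = po_lift_map[OF pic_po is_slaw_sop grp_sop_map cm_sop_map mon_sop_square, folded pic_sop_def NR_pic_def]
  show "slaw_map NR_pic sop_slaw pic_sop" by (rule l(1))
  show "pic_sop d n k (po_in2 (NR \<Omega>_mon) (NR \<Omega>_grp) (NR \<Omega>_cm) pic_left pic_right d n k y) = cm_sop d n k y"
    if "y \<in> Hom (Lev (NR \<Omega>_cm) d) n k"
    by (rule l(3)) (simp_all add: that)
qed

text \<open>The automorphisms at the object \<open>1\<close>, as numbers \<open>\<plusminus>1\<close>.\<close>
definition pic_sign :: "nat \<Rightarrow> _ \<Rightarrow> nat \<Rightarrow> real" where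
  "pic_sign d x i = (if snd (pic_sop d 1 1 x ! 0) i (\<lambda>_. 1) = 0 then 1 else -1)"

lemma pic_sign_system: "sign_system (shom NR_pic 1 1) pic_sign"
proof
  show "simplicial_set (shom NR_pic 1 1)" using is_slaw_NR_pic unfolding is_slaw_def by blast
  show "pic_sign n x i = 1 \<or> pic_sign n x i = -1" for n x i by (simp add: pic_sign_def)
  fix m n \<alpha> x assume a: "\<alpha> \<in> simp_ops m n" and "x \<in> Simp (shom NR_pic 1 1) n"
  then have x: "x \<in> Hom (Lev NR_pic n) 1 1" by (simp add: shom_def)
  have e: "pic_sop m 1 1 (LAct NR_pic n \<alpha> 1 1 x) = map (sop_act \<alpha>) (pic_sop n 1 1 x)"
    using slaw_map_act[OF pic_sop_map a x] by (simp add: sop_slaw_sel)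
  have l: "length (pic_sop n 1 1 x) = 1"
    using law_map_Hom[OF slaw_map_law[OF pic_sop_map] x] by (simp add: sop_slaw_sel S.law_sel)
  show "\<exists>s. (s = 1 \<or> s = -1) \<and> (\<forall>i\<le>m. pic_sign m (Act (shom NR_pic 1 1) n \<alpha> x) i = s * pic_sign n x (\<alpha> ! i))"
  proof (intro exI[of _ "pic_sign n x (\<alpha> ! 0)"] conjI allI impI)
    show "pic_sign n x (\<alpha> ! 0) = 1 \<or> pic_sign n x (\<alpha> ! 0) = -1" by (simp add: pic_sign_def)
    fix i assume "i \<le> m"
    then show "pic_sign m (Act (shom NR_pic 1 1) n \<alpha> x) i = pic_sign n x (\<alpha> ! 0) * pic_sign n x (\<alpha> ! i)"
      using l simp_ops_length[OF a]
      by (auto simp: pic_sign_def shom_def e[unfolded One_nat_def] sop_act_def less_Suc_eq_le)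
  qed
qed

section \<open>The loop of the self-symmetry\<close>
abbreviation "mult_op \<equiv> Fr_gen mon_sig 2 1 MultOp"
abbreviation "mult_op_swapped \<equiv> Comp (Fr mon_sig) 2 2 1 mult_op (Fin (Fr mon_sig) 2 2 [1, 0])"

lemma fin_hom_two: "[1, 0] \<in> fin_hom 2 2" "[0, 0] \<in> fin_hom 1 2"
  by (auto simp: fin_hom_def)

lemma law_pairing_two:
  assumes L: "is_law L" and ij: "i < 2" "j < 2"
  shows "pairing L 2 1 1 (Fin L 2 1 [i]) (Fin L 2 1 [j]) = Fin L 2 2 [i, j]"
proof -
  have h: "[i, j] \<in> fin_hom 2 (1 + 1)" using ij by (auto simp: fin_hom_def)
  have p: "fin_comp [0..<1] [i, j] = [i]" "fin_comp [1..<1 + 1] [i, j] = [j]"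
    by (simp_all add: fin_comp_def)
  have "pairing L 2 1 1 (Fin L 2 1 [i]) (Fin L 2 1 [j]) = Fin L 2 (1 + 1) [i, j]"
    by (rule law_pairing_unique[OF L law_Fin[OF L h]])
      (simp_all only: law_FinComp[OF L h fin_hom_prj(2)] law_FinComp[OF L h fin_hom_prj(3)] p)
  then show ?thesis by (simp only: one_add_one)
qed

lemma mult_op_mem: "mult_op \<in> Hom perm_terms 2 1" "mult_op_swapped \<in> Hom perm_terms 2 1"
proof -
  let ?X = "\<lambda>n k. Fin (Fr mon_sig) n k ` perms n k \<union> Fr_gen mon_sig n k ` sig_gens mon_sig n k"
  have "MultOp \<in> sig_gens mon_sig 2 1" by (simp add: sig_gens_def mon_sig_def)
  then have 1: "(2, 1, mult_op) \<in> gen_hom (law_pro (Fr mon_sig)) ?X" by (intro gen_hom.intros(1)) blast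
  have "[1, 0] \<in> perms 2 2" by (auto simp: perms_def fin_hom_def)
  then have "(2, 2, Fin (Fr mon_sig) 2 2 [1, 0]) \<in> gen_hom (law_pro (Fr mon_sig)) ?X"
    by (intro gen_hom.intros(1)) blast
  from gen_hom.intros(3)[OF 1 this]
  have 2: "(2, 1, mult_op_swapped) \<in> gen_hom (law_pro (Fr mon_sig)) ?X" by (simp add: law_pro_sel)
  show "mult_op \<in> Hom perm_terms 2 1" "mult_op_swapped \<in> Hom perm_terms 2 1"
    using 1 2 unfolding sub_Fr_def gen_subpro_sel by blast+
qed

lemma mult_op_words: "words_of 2 1 mult_op = [[0, 1]]" "words_of 2 1 mult_op_swapped = [[1, 0]]"
proof -
  have "MultOp \<in> sig_gens mon_sig 2 1" by (simp add: sig_gens_def mon_sig_def)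
  from words_of_map(2)[OF _ this, of "{}"] show 1: "words_of 2 1 mult_op = [[0, 1]]" by (simp add: Fr_Th)
  have "words_of 2 1 mult_op_swapped = Comp word_theory 2 2 1 (words_of 2 1 mult_op) (words_of 2 2 (Fin (Fr mon_sig) 2 2 [1, 0]))"
    by (rule law_map_Comp[OF words_of_Fr law_Fin[OF is_law_Fr fin_hom_two(1)] perm_terms_Hom[OF mult_op_mem(1)]])
  then show "words_of 2 1 mult_op_swapped = [[1, 0]]"
    unfolding 1 law_map_Fin[OF words_of_Fr fin_hom_two(1)] by (simp add: W.law_sel word_sub_def)
qed

text \<open>The commutativity axiom is stated with pairings of variables. Here it is transported to
  composites with the maps of finite sets \<open>[0, 1]\<close>, the identity, and \<open>[1, 0]\<close>.\<close>
lemma mult_op_commutes: "cst \<Omega>_cm 2 1 mult_op = cst \<Omega>_cm 2 1 mult_op_swapped"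
proof -
  let ?R = "mon_eqs \<union> comm_eqs" and ?G = "sig_gens mon_sig"
  let ?T = "pres ?G ?R"
  have L: "is_law ?T" by (rule is_law_pres)
  have m: "law_map (Fr mon_sig) ?T (Th_map mon_sig ?R)" using cst_Th by (simp add: Th_def)
  have g: "MultOp \<in> ?G 2 1" by (simp add: sig_gens_def mon_sig_def)
  have gen: "Th_map mon_sig ?R 2 1 mult_op = pres_gen ?G ?R 2 1 MultOp"
    unfolding Fr_Th by (rule Th_map_law(2)) (use g in auto)
  have ev: "expr_eq ?G ?R 2 1 (multE 2 (varE 2 i) (varE 2 j)) (multE 2 (varE 2 i) (varE 2 j))" if "i < 2" "j < 2" for i j
  proof -
    have "expr_eq ?G ?R 2 (1 + 1) (PairE 2 1 1 (varE 2 i) (varE 2 j)) (PairE 2 1 1 (varE 2 i) (varE 2 j))"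
      by (intro ePair eFin) (use that in \<open>auto simp: fin_hom_def\<close>)
    then have "expr_eq ?G ?R 2 2 (PairE 2 1 1 (varE 2 i) (varE 2 j)) (PairE 2 1 1 (varE 2 i) (varE 2 j))"
      by (simp only: one_add_one)
    then show ?thesis by (intro eComp eGen g)
  qed
  have "expr_eq ?G ?R 2 1 (multE 2 (varE 2 0) (varE 2 1)) (multE 2 (varE 2 1) (varE 2 0))"
    by (rule eRel[OF _ ev ev]) (simp_all add: comm_eqs_def)
  from expr_eval_pres[OF this] expr_class_eqI[OF this]
  have "Comp ?T 2 2 1 (pres_gen ?G ?R 2 1 MultOp) (pairing ?T 2 1 1 (Fin ?T 2 1 [0]) (Fin ?T 2 1 [1])) =
      Comp ?T 2 2 1 (pres_gen ?G ?R 2 1 MultOp) (pairing ?T 2 1 1 (Fin ?T 2 1 [1]) (Fin ?T 2 1 [0]))"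
    by (simp only: expr_eval.simps)
  moreover have z: "(0::nat) < 2" "(1::nat) < 2" by simp_all
  ultimately have c: "Comp ?T 2 2 1 (pres_gen ?G ?R 2 1 MultOp) (Fin ?T 2 2 [0, 1]) =
      Comp ?T 2 2 1 (pres_gen ?G ?R 2 1 MultOp) (Fin ?T 2 2 [1, 0])"
    by (simp only: law_pairing_two[OF L z(1,2)] law_pairing_two[OF L z(2,1)])
  have "[0..<2] = [0, 1::nat]" by (simp add: upt_rec)
  then have id: "Fin ?T 2 2 [0, 1] = Idn ?T 2" using law_Id[OF L, of 2] by simp
  have "Th_map mon_sig ?R 2 1 mult_op_swapped = Comp ?T 2 2 1 (pres_gen ?G ?R 2 1 MultOp) (Fin ?T 2 2 [1, 0])"
    using law_map_Comp[OF m law_Fin[OF is_law_Fr fin_hom_two(1)] perm_terms_Hom[OF mult_op_mem(1)]]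
    unfolding gen law_map_Fin[OF m fin_hom_two(1)] .
  also have "\<dots> = pres_gen ?G ?R 2 1 MultOp"
    unfolding c[symmetric] id by (rule cat_idR[OF is_law_cat[OF L] pres_gen_Hom[of MultOp ?G, OF g]])
  finally show ?thesis by (simp only: cm_sel gen)
qed

lemma swap_edge: "[mult_op, mult_op_swapped] \<in> Hom (Lev (ctrl_spro \<Omega>_cm) 1) 2 1"
proof (rule CM.Q_HomI[where c = "cst \<Omega>_cm 2 1 mult_op"])
  fix i :: nat assume "i \<le> 1"
  then consider "i = 0" | "i = 1" by linarith
  note i = this
  show "[mult_op, mult_op_swapped] ! i \<in> Hom (CPro \<Omega>_cm) 2 1"
    unfolding cm_sel(2) by (rule i) (simp_all only: nth_Cons_0 nth_Cons_Suc One_nat_def mult_op_mem[unfolded One_nat_def])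
  show "CM.sg 2 1 ([mult_op, mult_op_swapped] ! i) = cst \<Omega>_cm 2 1 mult_op"
    unfolding CM.sg_def cm_sel(4)
    by (rule i) (simp_all only: nth_Cons_0 nth_Cons_Suc One_nat_def mult_op_commutes[unfolded One_nat_def, symmetric])
qed simp

definition cm_pic where
  "cm_pic = (\<lambda>d n k y. po_in2 (NR \<Omega>_mon) (NR \<Omega>_grp) (NR \<Omega>_cm) pic_left pic_right d n k y)"

lemma cm_pic_map: "slaw_map (NR \<Omega>_cm) NR_pic cm_pic"
  unfolding NR_pic_def cm_pic_def by (rule po_in_slaw_map(2)[OF pic_po])

text \<open>The simplices of the control pro of \<open>\<Omega>_cm\<close>, and the terms in its signature, as simplices of
  \<open>NR_pic\<close>.\<close>
definition control_pic where
  "control_pic = (\<lambda>d n k xs. cm_pic d n k (NR_in2 \<Omega>_cm d n k (sfree_unit (ctrl_spro \<Omega>_cm) d n k xs)))"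

definition vertex_pic where
  "vertex_pic = (\<lambda>d n k x. cm_pic d n k (NR_in1 \<Omega>_cm d n k x))"

lemma vertex_pic_map: "slaw_map (disc (Fr mon_sig)) NR_pic vertex_pic"
  using slaw_map_compose[OF CM.NR_in_map(1) cm_pic_map] unfolding vertex_pic_def by (simp only: cm_sel)

lemma control_unit_Hom:
  assumes "xs \<in> Hom (Lev (ctrl_spro \<Omega>_cm) d) n k"
  shows "sfree_unit (ctrl_spro \<Omega>_cm) d n k xs \<in> Hom (Lev (sfree_law (ctrl_spro \<Omega>_cm)) d) n k"
  using pro_map_Hom[OF free_unit_map[OF CM.Q_pro] assms] by (simp add: sfree_unit_def sfree_Lev law_pro_sel)

lemma control_pic_Hom:
  assumes "xs \<in> Hom (Lev (ctrl_spro \<Omega>_cm) d) n k"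
  shows "control_pic d n k xs \<in> Hom (Lev NR_pic d) n k"
  unfolding control_pic_def
  by (intro law_map_Hom[OF slaw_map_law[OF cm_pic_map]] law_map_Hom[OF slaw_map_law[OF CM.NR_in_map(2)]]
      control_unit_Hom assms)

lemma control_pic_act:
  assumes a: "\<alpha> \<in> simp_ops m d" and xs: "xs \<in> Hom (Lev (ctrl_spro \<Omega>_cm) d) n k"
  shows "LAct NR_pic d \<alpha> n k (control_pic d n k xs) = control_pic m n k (map ((!) xs) \<alpha>)"
proof -
  note u = control_unit_Hom[OF xs]
  have "sfree_unit (ctrl_spro \<Omega>_cm) m n k (LAct (ctrl_spro \<Omega>_cm) d \<alpha> n k xs) =
      LAct (sfree_law (ctrl_spro \<Omega>_cm)) d \<alpha> n k (sfree_unit (ctrl_spro \<Omega>_cm) d n k xs)"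
    using sfree_unit_map[OF CM.is_spro_Q] a xs unfolding spro_map_def slaw_pro_def enr.select_convs by blast
  then show ?thesis
    unfolding control_pic_def CM.Q_ops
    by (simp add: slaw_map_act[OF CM.NR_in_map(2) a u] slaw_map_act[OF cm_pic_map a]
        law_map_Hom[OF slaw_map_law[OF CM.NR_in_map(2)] u])
qed

text \<open>The pushout that defines the nerve realization identifies vertices with terms.\<close>
lemma control_pic_vertex:
  assumes x: "x \<in> Hom perm_terms n k"
  shows "control_pic 0 n k [x] = vertex_pic 0 n k x"
proof -
  have x': "x \<in> Hom (CPro \<Omega>_cm) n k" using x by (simp only: cm_sel)
  have u: "free_unit (CPro \<Omega>_cm) n k x \<in> Hom (free_law (CPro \<Omega>_cm)) n k"
    using pro_map_Hom[OF free_unit_map[OF CM.P] x'] by (simp add: law_pro_sel)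
  have "NR_in1 \<Omega>_cm 0 n k x = NR_in2 \<Omega>_cm 0 n k (sfree_unit (ctrl_spro \<Omega>_cm) 0 n k [x])"
    using CM.NR_square[OF u, of 0] unfolding CM.NR_left_unit[OF x'] CM.NR_right_unit[OF x'] cm_sel(4) by simp
  then show ?thesis by (simp add: control_pic_def vertex_pic_def)
qed

lemma control_pic_sop:
  assumes xs: "xs \<in> Hom (Lev (ctrl_spro \<Omega>_cm) d) n k"
  shows "pic_sop d n k (control_pic d n k xs) = braiding d n k xs"
  unfolding control_pic_def cm_pic_def
    pic_sop_in2[OF law_map_Hom[OF slaw_map_law[OF CM.NR_in_map(2)] control_unit_Hom[OF xs]]]
  by (rule cm_sop_in2[OF xs])

text \<open>The edge from \<open>x y\<close> to \<open>y x\<close>, restricted along the diagonal \<open>x = y\<close>.\<close>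
definition symmetry_loop where
  "symmetry_loop = Comp (Lev NR_pic 1) 1 2 1 (control_pic 1 2 1 [mult_op, mult_op_swapped]) (Fin (Lev NR_pic 1) 1 2 [0, 0])"

definition square_vertex where
  "square_vertex = vertex_pic 0 1 1 (Comp (Fr mon_sig) 1 2 1 mult_op (Fin (Fr mon_sig) 1 2 [0, 0]))"

lemma NR_pic_law: "is_law (Lev NR_pic d)"
  by (rule slaw_Lev[OF is_slaw_NR_pic])

lemma symmetry_loop_Hom: "symmetry_loop \<in> Hom (Lev NR_pic 1) 1 1"
  unfolding symmetry_loop_def
  by (rule cat_Comp[OF is_law_cat[OF NR_pic_law] law_Fin[OF NR_pic_law fin_hom_two(2)] control_pic_Hom[OF swap_edge]])

text \<open>The transposition disappears when it is precomposed with the diagonal.\<close>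
lemma symmetry_loop_faces:
  assumes "j \<le> 1"
  shows "LAct NR_pic 1 [j] 1 1 symmetry_loop = square_vertex"
proof -
  have a: "[j] \<in> simp_ops 0 1" using assms by (simp add: simp_ops_def)
  let ?x = "[mult_op, mult_op_swapped] ! j"
  have j: "j = 0 \<or> j = 1" using assms by auto
  then have x: "?x \<in> Hom perm_terms 2 1" using mult_op_mem by auto
  note v = slaw_map_law[OF vertex_pic_map, of 0, unfolded disc_sel]
  have sq: "Comp (Fr mon_sig) 1 2 1 ?x (Fin (Fr mon_sig) 1 2 [0, 0]) = Comp (Fr mon_sig) 1 2 1 mult_op (Fin (Fr mon_sig) 1 2 [0, 0])"
    using j
  proof
    assume "j = 1"
    then have "Comp (Fr mon_sig) 1 2 1 ?x (Fin (Fr mon_sig) 1 2 [0, 0]) =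
        Comp (Fr mon_sig) 1 2 1 mult_op_swapped (Fin (Fr mon_sig) 1 2 [0, 0])" by simp
    also have "\<dots> = Comp (Fr mon_sig) 1 2 1 mult_op (Comp (Fr mon_sig) 1 2 2 (Fin (Fr mon_sig) 2 2 [1, 0]) (Fin (Fr mon_sig) 1 2 [0, 0]))"
      by (rule cat_assoc[OF is_law_cat[OF is_law_Fr] law_Fin[OF is_law_Fr fin_hom_two(2)]
            law_Fin[OF is_law_Fr fin_hom_two(1)] perm_terms_Hom[OF mult_op_mem(1)], symmetric])
    also have "Comp (Fr mon_sig) 1 2 2 (Fin (Fr mon_sig) 2 2 [1, 0]) (Fin (Fr mon_sig) 1 2 [0, 0]) = Fin (Fr mon_sig) 1 2 [0, 0]"
      unfolding law_FinComp[OF is_law_Fr fin_hom_two(2,1)] by (simp add: fin_comp_def)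
    finally show ?thesis .
  qed simp
  have "LAct NR_pic 1 [j] 1 1 symmetry_loop =
      Comp (Lev NR_pic 0) 1 2 1 (LAct NR_pic 1 [j] 2 1 (control_pic 1 2 1 [mult_op, mult_op_swapped]))
        (LAct NR_pic 1 [j] 1 2 (Fin (Lev NR_pic 1) 1 2 [0, 0]))"
    unfolding symmetry_loop_def
    by (rule law_map_Comp[OF slaw_LAct[OF is_slaw_NR_pic a] law_Fin[OF NR_pic_law fin_hom_two(2)] control_pic_Hom[OF swap_edge]])
  also have "LAct NR_pic 1 [j] 2 1 (control_pic 1 2 1 [mult_op, mult_op_swapped]) = vertex_pic 0 2 1 ?x"
    unfolding control_pic_act[OF a swap_edge] list.map by (rule control_pic_vertex[OF x])
  also have "LAct NR_pic 1 [j] 1 2 (Fin (Lev NR_pic 1) 1 2 [0, 0]) = vertex_pic 0 1 2 (Fin (Fr mon_sig) 1 2 [0, 0])"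
    unfolding law_map_Fin[OF slaw_LAct[OF is_slaw_NR_pic a] fin_hom_two(2)] law_map_Fin[OF v fin_hom_two(2)] ..
  also have "Comp (Lev NR_pic 0) 1 2 1 (vertex_pic 0 2 1 ?x) (vertex_pic 0 1 2 (Fin (Fr mon_sig) 1 2 [0, 0])) = square_vertex"
    unfolding law_map_Comp[OF v law_Fin[OF is_law_Fr fin_hom_two(2)] perm_terms_Hom[OF x], symmetric] sq square_vertex_def ..
  finally show ?thesis .
qed

text \<open>The words \<open>[0, 1]\<close> and \<open>[1, 0]\<close> differ by one inversion, which at \<open>a 0 = a 1 = 1\<close> has the
  sign \<open>-1\<close>.\<close>
lemma symmetry_loop_sign: "pic_sign 1 symmetry_loop 0 = 1" "pic_sign 1 symmetry_loop 1 = -1"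
proof -
  note m = slaw_map_law[OF pic_sop_map, of 1, unfolded sop_slaw_sel]
  have "pic_sop 1 1 1 symmetry_loop = Comp (sop_theory 1) 1 2 1 (braiding 1 2 1 [mult_op, mult_op_swapped]) (Fin (sop_theory 1) 1 2 [0, 0])"
    unfolding symmetry_loop_def
      law_map_Comp[OF m law_Fin[OF NR_pic_law fin_hom_two(2)] control_pic_Hom[OF swap_edge]]
      control_pic_sop[OF swap_edge] law_map_Fin[OF m fin_hom_two(2)] ..
  moreover have "braiding 1 2 1 [mult_op, mult_op_swapped] = [braid [[0, 1], [1, 0]]]"
    unfolding braiding_def list.map mult_op_words by simp
  ultimately have s: "pic_sop 1 1 1 symmetry_loop = [sop_sub (braid [[0, 1], [1, 0]]) [sop_var 0, sop_var 0]]"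
    by (simp add: S.law_sel)
  show "pic_sign 1 symmetry_loop 0 = 1" "pic_sign 1 symmetry_loop 1 = -1"
    unfolding pic_sign_def s
    by (simp_all add: sop_sub_def braid_def inversions_def inversion_term_def args_def sop_var_def)
qed

theorem theorem6p21:
  shows "\<not> slaw_weak_equivalence NR_pic (disc Th_ab) st_pic"
proof
  assume "slaw_weak_equivalence NR_pic (disc Th_ab) st_pic"
  then have w: "sset_weak_equivalence (shom NR_pic 1 1) (shom (disc Th_ab) 1 1) (\<lambda>d. st_pic d 1 1)"
    unfolding slaw_weak_equivalence_def by blast
  let ?X = "shom NR_pic 1 1" and ?Y = "shom (disc Th_ab) 1 1"
  interpret sign_system ?X pic_sign by (rule pic_sign_system)
  have e: "symmetry_loop \<in> Simp ?X 1" unfolding shom_def sset.simps by (rule symmetry_loop_Hom)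
  have v: "Act ?X 1 [0] symmetry_loop = square_vertex" "Act ?X 1 [1] symmetry_loop = square_vertex"
    unfolding shom_def sset.simps by (rule symmetry_loop_faces, simp)+
  have a: "[0] \<in> simp_ops 0 1" by (simp add: simp_ops_def)
  have v0: "square_vertex \<in> Simp ?X 0"
    unfolding shom_def sset.simps
    using law_map_Hom[OF slaw_LAct[OF is_slaw_NR_pic a] symmetry_loop_Hom] symmetry_loop_faces[of 0] by simp
  have "spheroid_homotopic 1 (realization ?X) (real_eq ?X `` {(0, square_vertex, edge_pt 0)})
      (edge_loop ?X symmetry_loop) (\<lambda>_. real_eq ?X `` {(0, square_vertex, edge_pt 0)})"
  proof (rule weak_equivalence_degenerate_edge[OF w _ _ e v v0])
    show "st_pic m 1 1 (Act ?X n \<alpha> x) = Act ?Y n \<alpha> (st_pic n 1 1 x)"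
      if "\<alpha> \<in> simp_ops m n" "x \<in> Simp ?X n" for m n \<alpha> x
      using slaw_map_act[OF st_pic_map that(1), of x 1 1] that(2) by (simp add: shom_def)
    show "st_pic n 1 1 x \<in> Simp ?Y n" if "x \<in> Simp ?X n" for n x
      using law_map_Hom[OF slaw_map_law[OF st_pic_map], of x n 1 1] that by (simp add: shom_def)
    have "st_pic 0 1 1 square_vertex = st_pic 1 1 1 symmetry_loop"
      using slaw_map_act[OF st_pic_map a symmetry_loop_Hom] symmetry_loop_faces[of 0] by (simp add: disc_sel)
    then show "st_pic 1 1 1 symmetry_loop = Act ?Y 0 [0, 0] (st_pic 0 1 1 square_vertex)"
      by (simp add: shom_def disc_sel)
  qed
  moreover have "pic_sign 1 symmetry_loop 0 \<noteq> pic_sign 1 symmetry_loop 1"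
    unfolding symmetry_loop_sign by simp
  ultimately show False using edge_loop_essential[OF e v] by blast
qed

end
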